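(* Let $b_1<0<b_2$, $B=\operatorname{diag}(b_1,b_2)$, let $$Q=\begin{pmatrix}Q_{11}&Q_{12}\\ Q_{21}&Q_{22}\end{pmatrix}\in L^1[0,1]\otimes\mathbb{C}^{2\times2}$$ be a summable potential matrix, and let $L_{C,D}(Q)$ be the operator associated in $L^2[0,1]\otimes\mathbb{C}^2$ with the boundary value problem $$-iB^{-1}y'+Q(x)y=\lambda y,\qquad y=\operatorname{col}(y_1,y_2),\ x\in[0,1],$$ $$U_j(y)=a_{j1}y_1(0)+a_{j2}y_2(0)+a_{j3}y_1(1)+a_{j4}y_2(1)=0,\qquad j\in\{1,2\},\ a_{jk}\in\mathbb{C}.$$ Assume that the boundary conditions are regular. Then the system of root vectors of the operator $L_{C,D}(Q)$ forms a Riesz basis with parentheses in $L^2[0,1]\otimes\mathbb{C}^2$.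
   Context: The operator $L_{C,D}(Q)$ acts by $y\mapsto -iB^{-1}y'+Qy$ on the domain of all $y\in W_1^1([0,1];\mathbb{C}^2)$ (absolutely continuous functions) with $-iB^{-1}y'+Qy\in L^2([0,1];\mathbb{C}^2)$ and $U_1(y)=U_2(y)=0$. The boundary conditions are regular if $J_{14}J_{32}\ne0$, where $J_{jk}=\det\begin{pmatrix}a_{1j}&a_{1k}\\ a_{2j}&a_{2k}\end{pmatrix}$. Root vectors are eigenvectors and associated (generalized eigen-) vectors; the root vectors system consists of a basis of each root subspace. A sequence of subspaces $\{\mathfrak{H}_k\}_{k=1}^\infty$ of a separable Hilbert space $\mathfrak{H}$ is a Riesz basis of subspaces if there exist a complete sequence of mutually orthogonal subspaces $\{\mathfrak{H}'_k\}_{k=1}^\infty$ and a bounded operator $T$ in $\mathfrak{H}$ with bounded inverse such that $\mathfrak{H}_k=T\mathfrak{H}'_k$, $k\in\mathbb{N}$. A sequence $\{f_k\}_{k=1}^\infty\subset\mathfrak{H}$ forms a Riesz basis with parentheses if each of its finite subsequences is linearly independent and there exists an increasing sequence $\{n_k\}_{k=0}^\infty\subset\mathbb{N}$ with $n_0=1$ such that the subspaces $\mathfrak{H}_k:=\operatorname{span}\{f_j\}_{j=n_{k-1}}^{n_k-1}$ constitute a Riesz basis of subspaces in $\mathfrak{H}$ (for a root vectors system: for a suitable enumeration of it as a sequence). *)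

theory Defs
  imports "HOL-Analysis.Analysis"
begin

section \<open>The Hilbert space of square-integrable functions from [0,1] to C^2\<close>

abbreviation unit_leb :: "real measure"
  where "unit_leb \<equiv> lebesgue_on {0..1}"

definition square_integrable :: "(real \<Rightarrow> complex^2) \<Rightarrow> bool"
  where "square_integrable f \<longleftrightarrow>
    f \<in> borel_measurable unit_leb \<and> integrable unit_leb (\<lambda>x. (norm (f x))\<^sup>2)"

text \<open>Linear in the first argument, conjugate-linear in the second.\<close>

definition cdot :: "complex^2 \<Rightarrow> complex^2 \<Rightarrow> complex"
  where "cdot v w = (\<Sum>i\<in>UNIV. v $ i * cnj (w $ i))"

lemma Re_cdot: "Re (cdot v w) = v \<bullet> w"
  by (simp add: cdot_def inner_vec_def inner_complex_def)

lemma cdot_self: "cdot v v = of_real ((norm v)\<^sup>2)"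
proof -
  have "Im (cdot v v) = 0"
    by (simp add: cdot_def)
  moreover have "Re (cdot v v) = (norm v)\<^sup>2"
    by (simp add: Re_cdot power2_norm_eq_inner)
  ultimately show ?thesis
    by (simp add: complex_eq_iff)
qed

lemma norm_cvec_scale: "norm (c *s (v :: complex^2)) = cmod c * norm v"
  by (simp add: norm_vec_def L2_set_def norm_mult power_mult_distrib
      sum_distrib_left[symmetric] real_sqrt_mult)

lemma norm_cdot_le: "cmod (cdot v w) \<le> norm v * norm w"
proof -
  have "cmod (cdot v w) \<le> (\<Sum>i\<in>UNIV. cmod (v $ i) * cmod (w $ i))"
    unfolding cdot_def by (rule order_trans[OF norm_sum]) (simp add: norm_mult)
  also have "\<dots> \<le> norm v * norm w"
    unfolding norm_vec_def
    using L2_set_mult_ineq[of "\<lambda>i. norm (v $ i)" "\<lambda>i. norm (w $ i)" UNIV] by simp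
  finally show ?thesis .
qed

lemma measurable_cdot:
  assumes "f \<in> borel_measurable M" "g \<in> borel_measurable M"
  shows "(\<lambda>x. cdot (f x) (g x)) \<in> borel_measurable M"
proof -
  have "continuous_on UNIV (\<lambda>p. cdot (fst p) (snd p))"
    unfolding cdot_def by (intro continuous_intros)
  then show ?thesis
    using borel_measurable_continuous_Pair[OF assms, of cdot] by (simp add: case_prod_beta)
qed

lemma measurable_cvec_scale:
  assumes "f \<in> borel_measurable M"
  shows "(\<lambda>x. c *s (f x :: complex^2)) \<in> borel_measurable M"
proof -
  have "continuous_on UNIV (\<lambda>v :: complex^2. c *s v)"
    unfolding vector_scalar_mult_def by (intro continuous_intros)
  then show ?thesis
    using borel_measurable_continuous_on[OF _ assms] by blast
qed

lemma square_integrable_zero: "square_integrable (\<lambda>_. 0)"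
  by (simp add: square_integrable_def)

lemma square_integrable_add:
  assumes "square_integrable f" "square_integrable g"
  shows "square_integrable (\<lambda>x. f x + g x)"
  unfolding square_integrable_def
proof
  show meas: "(\<lambda>x. f x + g x) \<in> borel_measurable unit_leb"
    using assms by (auto simp: square_integrable_def)
  show "integrable unit_leb (\<lambda>x. (norm (f x + g x))\<^sup>2)"
  proof (rule Bochner_Integration.integrable_bound)
    show "integrable unit_leb (\<lambda>x. 2 * (norm (f x))\<^sup>2 + 2 * (norm (g x))\<^sup>2)"
      using assms by (auto simp: square_integrable_def)
    show "(\<lambda>x. (norm (f x + g x))\<^sup>2) \<in> borel_measurable unit_leb"
      using meas by measurable
    have "(norm (f x + g x))\<^sup>2 \<le> 2 * (norm (f x))\<^sup>2 + 2 * (norm (g x))\<^sup>2" for x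
    proof -
      have "(norm (f x + g x))\<^sup>2 \<le> (norm (f x) + norm (g x))\<^sup>2"
        by (intro power_mono norm_triangle_ineq norm_ge_zero)
      also have "\<dots> \<le> 2 * (norm (f x))\<^sup>2 + 2 * (norm (g x))\<^sup>2"
        using sum_squares_bound[of "norm (f x)" "norm (g x)"]
        by (simp add: power2_sum)
      finally show ?thesis .
    qed
    then show "AE x in unit_leb. norm ((norm (f x + g x))\<^sup>2)
        \<le> norm (2 * (norm (f x))\<^sup>2 + 2 * (norm (g x))\<^sup>2)"
      by auto
  qed
qed

lemma square_integrable_cscale:
  assumes "square_integrable f"
  shows "square_integrable (\<lambda>x. c *s f x)"
  using assms
  by (auto simp: square_integrable_def measurable_cvec_scale norm_cvec_scale power_mult_distrib)

lemma square_integrable_uminus: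
  assumes "square_integrable f"
  shows "square_integrable (\<lambda>x. - f x)"
  using assms by (auto simp: square_integrable_def)

lemma square_integrable_diff:
  assumes "square_integrable f" "square_integrable g"
  shows "square_integrable (\<lambda>x. f x - g x)"
  using square_integrable_add[OF assms(1) square_integrable_uminus[OF assms(2)]] by simp

lemma square_integrable_scaleR:
  assumes "square_integrable f"
  shows "square_integrable (\<lambda>x. r *\<^sub>R f x)"
  using assms by (auto simp: square_integrable_def power_mult_distrib)

lemma integrable_cdot:
  assumes "square_integrable f" "square_integrable g"
  shows "integrable unit_leb (\<lambda>x. cdot (f x) (g x))"
proof (rule Bochner_Integration.integrable_bound)
  show "integrable unit_leb (\<lambda>x. (norm (f x))\<^sup>2 + (norm (g x))\<^sup>2)"
    using assms by (auto simp: square_integrable_def)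
  show "(\<lambda>x. cdot (f x) (g x)) \<in> borel_measurable unit_leb"
    using assms by (intro measurable_cdot) (auto simp: square_integrable_def)
  have "norm (cdot (f x) (g x)) \<le> norm ((norm (f x))\<^sup>2 + (norm (g x))\<^sup>2)" for x
  proof -
    have "2 * (norm (f x) * norm (g x)) \<le> (norm (f x))\<^sup>2 + (norm (g x))\<^sup>2"
      using sum_squares_bound[of "norm (f x)" "norm (g x)"] by simp
    moreover have "0 \<le> norm (f x) * norm (g x)"
      by simp
    ultimately have "cmod (cdot (f x) (g x)) \<le> (norm (f x))\<^sup>2 + (norm (g x))\<^sup>2"
      using norm_cdot_le[of "f x" "g x"] by linarith
    then show ?thesis
      by simp
  qed
  then show "AE x in unit_leb. norm (cdot (f x) (g x)) \<le> norm ((norm (f x))\<^sup>2 + (norm (g x))\<^sup>2)"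
    by blast
qed

definition L2_rel :: "(real \<Rightarrow> complex^2) \<Rightarrow> (real \<Rightarrow> complex^2) \<Rightarrow> bool"
  where "L2_rel f g \<longleftrightarrow> square_integrable f \<and> square_integrable g \<and> (AE x in unit_leb. f x = g x)"

lemma L2_rel_part_equivp: "part_equivp L2_rel"
proof (rule part_equivpI)
  show "\<exists>f. L2_rel f f"
    using square_integrable_zero by (auto simp: L2_rel_def)
  show "symp L2_rel"
    by (auto simp: L2_rel_def intro!: sympI)
  show "transp L2_rel"
    by (rule transpI) (auto simp: L2_rel_def)
qed

quotient_type L2 = "real \<Rightarrow> complex^2" / partial: L2_rel
  by (rule L2_rel_part_equivp)

lift_definition cinner :: "L2 \<Rightarrow> L2 \<Rightarrow> complex"
  is "\<lambda>f g. \<integral>x. cdot (f x) (g x) \<partial>unit_leb"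
  by (rule integral_cong_AE)
     (auto simp: L2_rel_def square_integrable_def intro!: measurable_cdot)

lift_definition cscale :: "complex \<Rightarrow> L2 \<Rightarrow> L2"
  is "\<lambda>c f x. c *s f x"
  by (auto simp: L2_rel_def square_integrable_cscale)

instantiation L2 :: real_vector
begin

lift_definition zero_L2 :: L2 is "\<lambda>_. 0"
  by (simp add: L2_rel_def square_integrable_zero)

lift_definition plus_L2 :: "L2 \<Rightarrow> L2 \<Rightarrow> L2" is "\<lambda>f g x. f x + g x"
  by (auto simp: L2_rel_def square_integrable_add)

lift_definition minus_L2 :: "L2 \<Rightarrow> L2 \<Rightarrow> L2" is "\<lambda>f g x. f x - g x"
  by (auto simp: L2_rel_def square_integrable_diff)

lift_definition uminus_L2 :: "L2 \<Rightarrow> L2" is "\<lambda>f x. - f x"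
  by (auto simp: L2_rel_def square_integrable_uminus)

lift_definition scaleR_L2 :: "real \<Rightarrow> L2 \<Rightarrow> L2" is "\<lambda>r f x. r *\<^sub>R f x"
  by (auto simp: L2_rel_def square_integrable_scaleR)

instance
proof
  fix u v w :: L2 and r s :: real
  show "u + v + w = u + (v + w)"
    by transfer (auto simp: L2_rel_def square_integrable_add add.assoc)
  show "u + v = v + u"
    by transfer (auto simp: L2_rel_def square_integrable_add add.commute)
  show "0 + u = u"
    by transfer (auto simp: L2_rel_def)
  show "- u + u = 0"
    by transfer (auto simp: L2_rel_def square_integrable_zero)
  show "u - v = u + - v"
    by transfer (auto simp: L2_rel_def square_integrable_diff)
  show "r *\<^sub>R (u + v) = r *\<^sub>R u + r *\<^sub>R v"
    by transfer
      (auto simp: L2_rel_def square_integrable_add square_integrable_scaleR scaleR_add_right)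
  show "(r + s) *\<^sub>R u = r *\<^sub>R u + s *\<^sub>R u"
    by transfer
      (auto simp: L2_rel_def square_integrable_add square_integrable_scaleR scaleR_add_left)
  show "r *\<^sub>R s *\<^sub>R u = (r * s) *\<^sub>R u"
    by transfer (auto simp: L2_rel_def square_integrable_scaleR)
  show "1 *\<^sub>R u = u"
    by transfer (auto simp: L2_rel_def)
qed

end

instantiation L2 :: real_inner
begin

definition inner_L2 :: "L2 \<Rightarrow> L2 \<Rightarrow> real"
  where "inner_L2 u v = Re (cinner u v)"

definition norm_L2 :: "L2 \<Rightarrow> real"
  where "norm_L2 u = sqrt (u \<bullet> u)"

definition dist_L2 :: "L2 \<Rightarrow> L2 \<Rightarrow> real"
  where "dist_L2 u v = norm (u - v)"

definition sgn_L2 :: "L2 \<Rightarrow> L2"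
  where "sgn_L2 u = u /\<^sub>R norm u"

definition uniformity_L2 :: "(L2 \<times> L2) filter"
  where "uniformity_L2 = (INF e\<in>{0 <..}. principal {(u, v). dist u v < e})"

definition open_L2 :: "L2 set \<Rightarrow> bool"
  where "open_L2 S \<longleftrightarrow> (\<forall>u\<in>S. \<forall>\<^sub>F (u', v) in uniformity. u' = u \<longrightarrow> v \<in> S)"

instance
proof
  fix u v w :: L2 and r :: real
  show "dist u v = norm (u - v)"
    by (rule dist_L2_def)
  show "sgn u = u /\<^sub>R norm u"
    by (rule sgn_L2_def)
  show "uniformity = (INF e\<in>{0 <..}. principal {(u, v :: L2). dist u v < e})"
    by (rule uniformity_L2_def)
  show "open S \<longleftrightarrow> (\<forall>u\<in>S. \<forall>\<^sub>F (u', v) in uniformity. u' = u \<longrightarrow> v \<in> S)" for S :: "L2 set"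
    by (rule open_L2_def)
  have Re_integral: "Re (\<integral>x. cdot (f x) (g x) \<partial>unit_leb) = (\<integral>x. f x \<bullet> g x \<partial>unit_leb)"
    and int: "integrable unit_leb (\<lambda>x. f x \<bullet> g x)"
    if "square_integrable f" "square_integrable g" for f g
    using integral_Re[OF integrable_cdot[OF that]] integrable_Re[OF integrable_cdot[OF that]]
    by (simp_all add: Re_cdot)
  show "u \<bullet> v = v \<bullet> u"
    unfolding inner_L2_def by transfer (simp add: L2_rel_def Re_integral inner_commute)
  show "(u + v) \<bullet> w = u \<bullet> w + v \<bullet> w"
    unfolding inner_L2_def
    by transfer (simp add: L2_rel_def Re_integral int square_integrable_add inner_add_left)
  show "(r *\<^sub>R u) \<bullet> v = r * (u \<bullet> v)"
    unfolding inner_L2_def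
    by transfer (simp add: L2_rel_def Re_integral square_integrable_scaleR)
  show "0 \<le> u \<bullet> u"
    unfolding inner_L2_def by transfer (simp add: L2_rel_def Re_integral)
  show "u \<bullet> u = 0 \<longleftrightarrow> u = 0"
    unfolding inner_L2_def
  proof transfer
    fix f assume "L2_rel f f"
    then have f: "square_integrable f" by (simp add: L2_rel_def)
    have "Re (\<integral>x. cdot (f x) (f x) \<partial>unit_leb) = 0 \<longleftrightarrow> (AE x in unit_leb. f x \<bullet> f x = 0)"
      unfolding Re_integral[OF f f]
      by (rule integral_nonneg_eq_0_iff_AE[OF int[OF f f]]) simp
    then show "Re (\<integral>x. cdot (f x) (f x) \<partial>unit_leb) = 0 \<longleftrightarrow> L2_rel f (\<lambda>_. 0)"
      using f by (simp add: L2_rel_def square_integrable_zero)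
  qed
  show "norm u = sqrt (u \<bullet> u)"
    by (rule norm_L2_def)
qed

end

interpretation L2: vector_space cscale
proof
  fix c d :: complex and u v :: L2
  show "cscale c (u + v) = cscale c u + cscale c v"
    by transfer
      (auto simp: L2_rel_def square_integrable_add square_integrable_cscale vector_add_ldistrib)
  show "cscale (c + d) u = cscale c u + cscale d u"
    by transfer
      (auto simp: L2_rel_def square_integrable_add square_integrable_cscale vector_sadd_rdistrib)
  show "cscale c (cscale d u) = cscale (c * d) u"
    by transfer (auto simp: L2_rel_def square_integrable_cscale vector_smult_assoc)
  show "cscale 1 u = u"
    by transfer (auto simp: L2_rel_def)
qed

lemma scaleR_L2_eq: "r *\<^sub>R u = cscale (of_real r) u"
  by transfer
    (auto simp: L2_rel_def square_integrable_scaleR square_integrable_cscale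
      vec_eq_iff scaleR_conv_of_real[where 'a = complex])

section \<open>Riesz bases\<close>

definition bounded_operator :: "(L2 \<Rightarrow> L2) \<Rightarrow> bool"
  where "bounded_operator T \<longleftrightarrow> Vector_Spaces.linear cscale cscale T \<and> bounded_linear T"

definition closed_subspace :: "L2 set \<Rightarrow> bool"
  where "closed_subspace H \<longleftrightarrow> L2.subspace H \<and> closed H"

definition Riesz_basis_of_subspaces :: "(nat \<Rightarrow> L2 set) \<Rightarrow> bool"
  where "Riesz_basis_of_subspaces H \<longleftrightarrow>
    (\<exists>H' T S.
      (\<forall>k. closed_subspace (H' k)) \<and>
      (\<forall>j k. j \<noteq> k \<longrightarrow> (\<forall>u\<in>H' j. \<forall>v\<in>H' k. cinner u v = 0)) \<and>
      closure (L2.span (\<Union>k. H' k)) = UNIV \<and>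
      bounded_operator T \<and> bounded_operator S \<and> S \<circ> T = id \<and> T \<circ> S = id \<and>
      (\<forall>k. H k = T ` H' k))"

text \<open>Sequences are indexed from 0, so the blocks start at \<open>n 0 = 0\<close>. Injectivity of \<open>f\<close> makes
  linear independence of the range the same as that of every finite subsequence.\<close>

definition Riesz_basis_with_parentheses :: "(nat \<Rightarrow> L2) \<Rightarrow> bool"
  where "Riesz_basis_with_parentheses f \<longleftrightarrow>
    inj f \<and> L2.independent (range f) \<and>
    (\<exists>n :: nat \<Rightarrow> nat. n 0 = 0 \<and> strict_mono n \<and>
      Riesz_basis_of_subspaces (\<lambda>k. L2.span (f ` {n k..<n (Suc k)})))"

section \<open>Root vectors\<close>

text \<open>An unbounded operator is given by its graph.\<close>

definition eigenvalues :: "(L2 \<times> L2) set \<Rightarrow> complex set"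
  where "eigenvalues L = {z. \<exists>u. u \<noteq> 0 \<and> (u, cscale z u) \<in> L}"

definition shifted_op :: "(L2 \<times> L2) set \<Rightarrow> complex \<Rightarrow> (L2 \<times> L2) set"
  where "shifted_op L z = {(u, v - cscale z u) | u v. (u, v) \<in> L}"

text \<open>The power is relational, so its domain is the natural one: \<open>(L - z)\<close> can be applied
  successively.\<close>

definition root_subspace :: "(L2 \<times> L2) set \<Rightarrow> complex \<Rightarrow> L2 set"
  where "root_subspace L z = {u. \<exists>n. (u, 0) \<in> shifted_op L z ^^ n}"

definition basis_of :: "L2 set \<Rightarrow> L2 set \<Rightarrow> bool"
  where "basis_of H E \<longleftrightarrow> L2.independent E \<and> L2.span E = H"

definition root_vectors_system :: "(L2 \<times> L2) set \<Rightarrow> L2 set \<Rightarrow> bool"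
  where "root_vectors_system L R \<longleftrightarrow>
    (\<exists>E. (\<forall>z\<in>eigenvalues L. basis_of (root_subspace L z) (E z)) \<and>
         R = (\<Union>z\<in>eigenvalues L. E z))"

section \<open>The boundary value problem\<close>

definition absolutely_continuous_on ::
    "real \<Rightarrow> real \<Rightarrow> (real \<Rightarrow> 'a::metric_space) \<Rightarrow> bool"
  where "absolutely_continuous_on s t f \<longleftrightarrow>
    (\<forall>e>0. \<exists>d>0. \<forall>P :: (real \<times> real) set.
      finite P \<longrightarrow>
      (\<forall>(p, q)\<in>P. s \<le> p \<and> p \<le> q \<and> q \<le> t) \<longrightarrow>
      pairwise (\<lambda>(p, q) (p', q'). {p<..<q} \<inter> {p'<..<q'} = {}) P \<longrightarrow>
      (\<Sum>(p, q)\<in>P. q - p) < d \<longrightarrow>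
      (\<Sum>(p, q)\<in>P. dist (f p) (f q)) < e)"

definition B_matrix :: "real \<Rightarrow> real \<Rightarrow> complex^2^2"
  where "B_matrix b1 b2 = vector [vector [of_real b1, 0], vector [0, of_real b2]]"

text \<open>An absolutely continuous function is differentiable almost everywhere on [0,1]; the values of
  the total function \<open>vector_derivative\<close> at the other points are irrelevant for the class in
  \<open>L2\<close>.\<close>

definition dirac_expr ::
    "real \<Rightarrow> real \<Rightarrow> (real \<Rightarrow> complex^2^2) \<Rightarrow> (real \<Rightarrow> complex^2) \<Rightarrow> real \<Rightarrow> complex^2"
  where "dirac_expr b1 b2 Q y x =
    (- \<i>) *s (matrix_inv (B_matrix b1 b2) *v vector_derivative y (at x within {0..1})) + Q x *v y x"

definition boundary_form :: "complex^4^2 \<Rightarrow> 2 \<Rightarrow> (real \<Rightarrow> complex^2) \<Rightarrow> complex"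
  where "boundary_form a j y =
    a $ j $ 1 * y 0 $ 1 + a $ j $ 2 * y 0 $ 2 + a $ j $ 3 * y 1 $ 1 + a $ j $ 4 * y 1 $ 2"

text \<open>The first component needs no integrability condition: \<open>y\<close> is continuous on [0,1], hence
  square-integrable there.\<close>

definition dirac_op ::
    "real \<Rightarrow> real \<Rightarrow> (real \<Rightarrow> complex^2^2) \<Rightarrow> complex^4^2 \<Rightarrow> (L2 \<times> L2) set"
  where "dirac_op b1 b2 Q a =
    {(abs_L2 y, abs_L2 (dirac_expr b1 b2 Q y)) | y.
      absolutely_continuous_on 0 1 y \<and>
      square_integrable (dirac_expr b1 b2 Q y) \<and>
      boundary_form a 1 y = 0 \<and> boundary_form a 2 y = 0}"

definition boundary_minor :: "complex^4^2 \<Rightarrow> 4 \<Rightarrow> 4 \<Rightarrow> complex"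
  where "boundary_minor a j k =
    det (vector [vector [a $ 1 $ j, a $ 1 $ k], vector [a $ 2 $ j, a $ 2 $ k]] :: complex^2^2)"

definition regular_bc :: "complex^4^2 \<Rightarrow> bool"
  where "regular_bc a \<longleftrightarrow> boundary_minor a 1 4 * boundary_minor a 3 2 \<noteq> 0"

end

theory Submission
  imports Defs "HOL-Complex_Analysis.Complex_Analysis"
begin

text \<open>The potential is only summable, so the proof avoids asymptotic formulas for solutions. Outside a strip
  \<open>\<bar>Im z\<bar> < h\<close>, regularity yields an a priori bound for the boundary value problem; the characteristic determinant \<open>\<Delta>\<close>
  is therefore bounded below there, and a normal families argument provides almost equidistant vertical segments across the
  strip on which \<open>\<bar>\<Delta>\<bar> \<ge> \<delta>\<close>. They cut the spectrum into cells.

  On the boundary of a cell the resolvent differs from the solution \<open>w\<close> of the Cauchy problem, which is entire in \<open>z\<close>,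
  by a solution of the homogeneous system whose initial value is controlled by \<open>w(1)\<close>. Hence the Riesz projection of a cell
  is controlled by \<open>w(1)\<close> and by the homogeneous solutions. Both are square-summable over the cells: variation of constants
  reduces this to Bessel's inequality for exponentials and to Gronwall's lemma. So the norm of a sum of
  root vectors is equivalent to the l2-norm of its cell components, and the cell subspaces are finite-dimensional. Completeness
  follows from Liouville's theorem for the resolvent paired with a function orthogonal to all root vectors.\<close>

text \<open>Nothing separates the eigenvalues inside a cell from each other; only their number is
  bounded, so whole cells have to serve as blocks. Summation over the cells rests on two choices. A
  contour integral is bounded by the length of the contour times the integrand at one point, and the
  Bessel inequalities hold with one constant for every choice of points \<open>z k\<close> within a
  fixed distance of \<open>c * k\<close>; the points may therefore depend on the cell, on the
  vectors and on the functional. And the Riesz projections are applied only to finite sums of root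
  functions, where the resolvent is an explicit finite Laurent sum; the passage to the whole space
  is a final extension by continuity. Regularity works together with \<open>b1 < 0 < b2\<close>: off
  the real axis one component of a solution is controlled from the left end and the other from the
  right end, and the minors J32 (for \<open>Im z > 0\<close>) and J14 (for \<open>Im z < 0\<close>)
  say that the boundary forms determine exactly these two end values. A summable potential is
  handled by cutting it at a high level: the bounded part is damped by
  \<open>\<bar>Im z\<bar>\<close>, and the rest is small in mean and absorbed.\<close>

abbreviation absint ("_ absint" [47] 46)
  where "f absint \<equiv> f absolutely_integrable_on {0..1::real}"

abbreviation norm_L1 where "norm_L1 f \<equiv> integral {0..1::real} (\<lambda>t. norm (f t))"
abbreviation norm_sq where "norm_sq f \<equiv> integral {0..1::real} (\<lambda>t. (norm (f t))\<^sup>2)"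
type_synonym curve = "real \<Rightarrow> complex^2"

lemmas absint_integrable = set_lebesgue_integral_eq_integral(1)
lemmas norm_entry_le = Finite_Cartesian_Product.norm_nth_le
lemmas hk_integral_add = Henstock_Kurzweil_Integration.integral_add
lemmas hk_integral_combine = Henstock_Kurzweil_Integration.integral_combine
lemmas hk_integral_cong = Henstock_Kurzweil_Integration.integral_cong
lemmas hk_integral_diff = Henstock_Kurzweil_Integration.integral_diff
lemmas hk_integral_nonneg = Henstock_Kurzweil_Integration.integral_nonneg
lemmas hk_integral_reflect_real = Henstock_Kurzweil_Integration.integral_reflect_real
lemmas hk_integral_sum = Henstock_Kurzweil_Integration.integral_sum

section \<open>Absolutely continuous functions\<close>

text \<open>Dominated convergence, with \<open>norm (f x)\<close> as majorant. It replaces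
  boundedness of an integrable function: up to a remainder that is small in mean, the function is
  bounded by \<open>N\<close>. The a priori estimate for the boundary value problem applies it to
  the potential and to the right-hand side.\<close>

lemma tail_integral_small:
  fixes f :: "real \<Rightarrow> 'b::euclidean_space"
  assumes f: "f absolutely_integrable_on S" and S: "S \<in> sets lebesgue" and "0 < e"
  shows "\<exists>N\<ge>0. (\<lambda>x. max 0 (norm (f x) - N)) absolutely_integrable_on S \<and>
    integral S (\<lambda>x. max 0 (norm (f x) - N)) < e"
proof -
  have nfi: "(\<lambda>x. norm (f x)) integrable_on S" using f by (simp add: absolutely_integrable_on_def)
  have fm: "f \<in> borel_measurable (lebesgue_on S)" using absolutely_integrable_imp_borel_measurable[OF f S] .
  have ai: "(\<lambda>x. max 0 (norm (f x) - real n)) absolutely_integrable_on S" for n :: nat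
  proof (rule measurable_bounded_by_integrable_imp_absolutely_integrable[OF _ S nfi])
    show "(\<lambda>x. max 0 (norm (f x) - real n)) \<in> borel_measurable (lebesgue_on S)" using fm by measurable
  qed auto
  have "(\<lambda>n. integral S (\<lambda>x. max 0 (norm (f x) - real n))) \<longlonglongrightarrow> integral S (\<lambda>x. 0)"
  proof (rule dominated_convergence(2)[OF _ nfi])
    show "(\<lambda>x. max 0 (norm (f x) - real n)) integrable_on S" for n using ai absint_integrable by blast
    fix x assume "x \<in> S"
    obtain k :: nat where "norm (f x) \<le> real k" using real_arch_simple by blast
    then have "\<forall>n\<ge>k. max 0 (norm (f x) - real n) = 0" by (smt (verit) of_nat_mono)
    then show "(\<lambda>n. max 0 (norm (f x) - real n)) \<longlonglongrightarrow> 0" by (metis (mono_tags, lifting) LIMSEQ_offset eventually_sequentially tendsto_eventually)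
  qed auto
  then have "(\<lambda>n. integral S (\<lambda>x. max 0 (norm (f x) - real n))) \<longlonglongrightarrow> 0" by simp
  then obtain n where "integral S (\<lambda>x. max 0 (norm (f x) - real n)) < e"
    using \<open>0 < e\<close> by (metis (no_types, lifting) eventually_sequentially order_refl order_tendstoD(2))
  then show ?thesis using ai[of n] by (intro exI[of _ "real n"]) auto
qed

definition interval_family :: "real \<Rightarrow> real \<Rightarrow> (real \<times> real) set \<Rightarrow> bool"
  where "interval_family s t P \<longleftrightarrow> finite P \<and> (\<forall>(p, q)\<in>P. s \<le> p \<and> p \<le> q \<and> q \<le> t) \<and>
    pairwise (\<lambda>(p, q) (p', q'). {p<..<q} \<inter> {p'<..<q'} = {}) P"

lemma absolutely_continuous_on_iff:
  "absolutely_continuous_on s t f \<longleftrightarrow> (\<forall>e>0. \<exists>d>0. \<forall>P. interval_family s t P \<longrightarrow> (\<Sum>(p, q)\<in>P. q - p) < d \<longrightarrow> (\<Sum>(p, q)\<in>P. dist (f p) (f q)) < e)"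
  unfolding absolutely_continuous_on_def interval_family_def by (simp only: imp_conjL)

lemma absolutely_continuous_onE:
  assumes "absolutely_continuous_on s t f" "0 < e"
  obtains d where "0 < d" "\<And>P. interval_family s t P \<Longrightarrow> (\<Sum>(p, q)\<in>P. q - p) < d \<Longrightarrow> (\<Sum>(p, q)\<in>P. dist (f p) (f q)) < e"
  using assms unfolding absolutely_continuous_on_iff by blast

text \<open>The indicators of the open intervals have sum at most 1. Open intervals are taken
  because the closed ones may share end points, which do not affect the integrals.\<close>

lemma sum_integral_nonoverlap_le:
  fixes g :: "real \<Rightarrow> real"
  assumes g: "g integrable_on {s..t}" and nn: "\<And>x. x \<in> {s..t} \<Longrightarrow> 0 \<le> g x"
    and PP: "interval_family s t P"
  shows "(\<Sum>(p, q)\<in>P. integral {p..q} g) \<le> integral {s..t} g"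
proof -
  note P = PP[unfolded interval_family_def, THEN conjunct1] PP[unfolded interval_family_def, THEN conjunct2, THEN conjunct1]
    PP[unfolded interval_family_def, THEN conjunct2, THEN conjunct2]
  let ?h = "\<lambda>(p,q) x. if x \<in> {p<..<q} then g x else 0"
  have 1: "integral {p..q} g = integral {s..t} (?h (p,q))" and 2: "?h (p,q) integrable_on {s..t}" if "(p,q) \<in> P" for p q
  proof -
    have sub: "{p<..<q} \<subseteq> {s..t}" "{p..q} \<subseteq> {s..t}" using P that by force+
    have "integral {p..q} g = integral {p<..<q} g" by (simp add: integral_open_interval_real)
    also have "\<dots> = integral {s..t} (?h (p,q))" using sub(1) by (simp only: prod.case integral_restrict_Int inf.absorb1)
    finally show "integral {p..q} g = integral {s..t} (?h (p,q))" .
    have "g integrable_on {p<..<q}" using integrable_on_subinterval[OF g sub(2)] by (simp add: integrable_on_open_interval_real)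
    then show "?h (p,q) integrable_on {s..t}" using sub(1) by (simp only: prod.case integrable_restrict_Int inf.absorb1)
  qed
  have "(\<Sum>(p, q)\<in>P. integral {p..q} g) = (\<Sum>i\<in>P. integral {s..t} (?h i))" by (rule sum.cong) (use 1 in auto)
  also have "\<dots> = integral {s..t} (\<lambda>x. \<Sum>i\<in>P. ?h i x)" by (rule integral_sum[symmetric]) (use P(1) 2 in auto)
  also have "\<dots> \<le> integral {s..t} g"
  proof (rule integral_le)
    show "(\<lambda>x. \<Sum>i\<in>P. ?h i x) integrable_on {s..t}" by (rule integrable_sum) (use P(1) 2 in auto)
    show "g integrable_on {s..t}" by fact
    fix x assume x: "x \<in> {s..t}"
    show "(\<Sum>i\<in>P. ?h i x) \<le> g x"
    proof (cases "\<exists>i\<in>P. x \<in> {fst i<..<snd i}")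
      case True
      then obtain i where i: "i \<in> P" "x \<in> {fst i<..<snd i}" by auto
      have "(\<Sum>j\<in>P. ?h j x) = (\<Sum>j\<in>{i}. ?h j x)"
      proof (rule sum.mono_neutral_right)
        show "\<forall>j\<in>P - {i}. ?h j x = 0"
        proof
          fix j assume j: "j \<in> P - {i}"
          then have "{fst i<..<snd i} \<inter> {fst j<..<snd j} = {}" using P(3) i(1) unfolding pairwise_def by (fastforce simp: case_prod_beta)
          then show "?h j x = 0" using i(2) by (auto simp: case_prod_beta)
        qed
      qed (use P(1) i in auto)
      then show ?thesis using i(2) by (simp add: case_prod_beta)
    next
      case False
      then have "(\<Sum>i\<in>P. ?h i x) = 0" by (intro sum.neutral) auto
      then show ?thesis using nn[OF x] by simp
    qed
  qed
  finally show ?thesis .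
qed

text \<open>Cutting \<open>f\<close> at the level \<open>N\<close> bounds each increment by the
  integral of the excess over the interval plus \<open>N\<close> times its length. The excess sums
  to less than \<open>e/2\<close>, and the rest to at most \<open>e/2\<close> once the total length
  is below \<open>e / (2 * (N + 1))\<close>, where the 1 covers \<open>N = 0\<close>.\<close>

lemma absolutely_continuous_on_integral:
  fixes f :: "real \<Rightarrow> 'b::euclidean_space"
  assumes f: "f absolutely_integrable_on {s..t}"
  shows "absolutely_continuous_on s t (\<lambda>x. c + integral {s..x} f)" unfolding absolutely_continuous_on_iff
proof (intro allI impI)
  fix e :: real assume "0 < e"
  then obtain N where N: "0 \<le> N" "(\<lambda>x. max 0 (norm (f x) - N)) absolutely_integrable_on {s..t}"
    "integral {s..t} (\<lambda>x. max 0 (norm (f x) - N)) < e/2" using tail_integral_small[OF f, of "e/2"] by auto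
  let ?g = "\<lambda>x. max 0 (norm (f x) - N)"
  have gi: "?g integrable_on {s..t}" using N(2) absint_integrable by blast
  have fi: "f integrable_on {s..t}" using f absint_integrable by blast
  show "\<exists>d>0. \<forall>P. interval_family s t P \<longrightarrow> (\<Sum>(p, q)\<in>P. q - p) < d \<longrightarrow> (\<Sum>(p, q)\<in>P. dist (c + integral {s..p} f) (c + integral {s..q} f)) < e"
  proof (intro exI conjI allI impI)
    show "0 < e / (2 * (N + 1))" using \<open>0 < e\<close> N(1) by simp
    fix P assume P: "interval_family s t P" and small: "(\<Sum>(p, q)\<in>P. q - p) < e / (2 * (N + 1))"
    have "(\<Sum>(p, q)\<in>P. dist (c + integral {s..p} f) (c + integral {s..q} f)) \<le> (\<Sum>(p, q)\<in>P. integral {p..q} ?g + N * (q - p))"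
    proof (rule sum_mono, clarify)
      fix p q assume "(p,q) \<in> P"
      then have pq: "s \<le> p" "p \<le> q" "q \<le> t" using P by (auto simp: interval_family_def)
      have "integral {s..q} f = integral {s..p} f + integral {p..q} f"
        using hk_integral_combine[of s p q f] pq integrable_on_subinterval[OF fi, of s q] by auto
      then have "dist (c + integral {s..p} f) (c + integral {s..q} f) = norm (integral {p..q} f)" by (simp add: dist_norm norm_minus_commute)
      also have "\<dots> \<le> integral {p..q} (\<lambda>x. ?g x + N)"
      proof (rule integral_norm_bound_integral)
        show "f integrable_on {p..q}" using integrable_on_subinterval[OF fi] pq by auto
        show "(\<lambda>x. ?g x + N) integrable_on {p..q}" by (intro integrable_add integrable_on_subinterval[OF gi]) (use pq in auto)
      qed auto
      also have "\<dots> = integral {p..q} ?g + N * (q - p)" using pq by (subst integral_add) (auto intro: integrable_on_subinterval[OF gi])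
      finally show "dist (c + integral {s..p} f) (c + integral {s..q} f) \<le> integral {p..q} ?g + N * (q - p)" .
    qed
    also have "\<dots> = (\<Sum>(p, q)\<in>P. integral {p..q} ?g) + N * (\<Sum>(p, q)\<in>P. q - p)" by (simp add: sum.distrib case_prod_beta sum_distrib_left)
    also have "\<dots> \<le> integral {s..t} ?g + N * (e / (2 * (N + 1)))"
      by (intro add_mono sum_integral_nonoverlap_le[OF gi _ P] mult_left_mono) (use small N(1) in auto)
    also have "\<dots> < e/2 + e/2"
    proof -
      have "N * (e / (2 * (N + 1))) \<le> e/2" using N(1) \<open>0 < e\<close> by (simp add: field_simps)
      then show ?thesis using N(3) by linarith
    qed
    finally show "(\<Sum>(p, q)\<in>P. dist (c + integral {s..p} f) (c + integral {s..q} f)) < e" by simp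
  qed
qed

text \<open>Lebesgue's differentiation theorem. \<open>integrable_ccontinuous_explicit\<close> gives
  the derivative from the right outside a null set; applied to the reflected function it gives the
  derivative from the left outside the reflection of a null set.\<close>

lemma AE_has_derivative_integral:
  fixes f :: "real \<Rightarrow> 'b::euclidean_space"
  assumes f: "f integrable_on {s..t}"
  shows "AE x in lebesgue_on {s..t}. ((\<lambda>x. c + integral {s..x} f) has_vector_derivative f x) (at x within {s..t})"
proof -
  define g where "g = (\<lambda>x. if x \<in> {s..t} then f x else 0)"
  have "g integrable_on UNIV" unfolding g_def using f by (simp only: integrable_restrict_UNIV)
  then have gi: "g integrable_on {a..b}" for a b by (rule integrable_on_subinterval) auto
  have gi': "(\<lambda>x. g (- x)) integrable_on {a..b}" for a b
    using gi[of "-b" "-a"] Henstock_Kurzweil_Integration.integrable_reflect_real[where f="g" and a="-b" and b="-a"] by (simp only: minus_minus)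
  obtain N1 where N1: "negligible N1" and d1: "\<And>x e. \<lbrakk>x \<notin> N1; 0 < e\<rbrakk> \<Longrightarrow>
      \<exists>d>0. \<forall>h. 0 < h \<and> h < d \<longrightarrow> norm (integral {x..x + h} g /\<^sub>R h - g x) < e" using integrable_ccontinuous_explicit[of g] gi by auto
  obtain N2 where N2: "negligible N2" and d2: "\<And>x e. \<lbrakk>x \<notin> N2; 0 < e\<rbrakk> \<Longrightarrow>
      \<exists>d>0. \<forall>h. 0 < h \<and> h < d \<longrightarrow> norm (integral {x..x + h} (\<lambda>x. g (-x)) /\<^sub>R h - g (-x)) < e"
    using integrable_ccontinuous_explicit[of "\<lambda>x. g (- x)"] gi' by auto
  have N2': "negligible (uminus ` N2)"
    using N2 by (intro negligible_differentiable_image_negligible) (auto intro!: derivative_intros simp: differentiable_on_def)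
  have main: "((\<lambda>x. c + integral {s..x} f) has_vector_derivative f x) (at x within {s..t})" if x: "x \<in> {s..t}" "x \<notin> N1" "x \<notin> uminus ` N2" for x
    unfolding has_vector_derivative_def has_derivative_within_alt
  proof (intro conjI allI impI)
    show "bounded_linear (\<lambda>h. h *\<^sub>R f x)" by (rule bounded_linear_scaleR_left)
    fix e :: real assume "0 < e"
    obtain da where da: "da > 0" "\<And>h. 0 < h \<Longrightarrow> h < da \<Longrightarrow> norm (integral {x..x + h} g /\<^sub>R h - g x) < e" using d1[OF x(2) \<open>0 < e\<close>] by auto
    have "- x \<notin> N2" using x(3) by (metis add.inverse_inverse imageI)
    then obtain db where db: "db > 0" "\<And>h. 0 < h \<Longrightarrow> h < db \<Longrightarrow>
        norm (integral {-x..-x + h} (\<lambda>x. g (-x)) /\<^sub>R h - g x) < e" using d2[of "-x", OF _ \<open>0 < e\<close>] by auto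
    have gf: "integral {a..b} g = integral {a..b} f" if "a \<ge> s" "b \<le> t" for a b using that by (intro hk_integral_cong) (auto simp: g_def)
    have gx: "g x = f x" using x by (simp add: g_def)
    have fi: "f integrable_on {a..b}" if "a \<ge> s" "b \<le> t" for a b using that by (intro integrable_on_subinterval[OF f]) auto
    have scale: "norm (I - r *\<^sub>R f x) \<le> e * r" if "norm (I /\<^sub>R r - g x) < e" "0 < r" for I r
    proof -
      have "I - r *\<^sub>R f x = r *\<^sub>R (I /\<^sub>R r - g x)" using that(2) gx by (simp add: scaleR_diff_right)
      then show ?thesis using that by (simp add: mult.commute)
    qed
    show "\<exists>d>0. \<forall>y\<in>{s..t}. norm (y - x) < d \<longrightarrow>
      norm (c + integral {s..y} f - (c + integral {s..x} f) - (y - x) *\<^sub>R f x) \<le> e * norm (y - x)"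
    proof (intro exI[of _ "min da db"] conjI ballI impI)
      show "0 < min da db" using da db by simp
      fix y assume y: "y \<in> {s..t}" and yx: "norm (y - x) < min da db"
      consider "y = x" | "x < y" | "y < x" by linarith
      then show "norm (c + integral {s..y} f - (c + integral {s..x} f) - (y - x) *\<^sub>R f x) \<le> e * norm (y - x)"
      proof cases
        case 2
        have eq: "integral {s..y} f - integral {s..x} f = integral {x..y} g"
          using hk_integral_combine[of s x y f] x y 2 fi gf by (auto simp: algebra_simps)
        have "norm (integral {x..y} g - (y - x) *\<^sub>R f x) \<le> e * (y - x)" by (rule scale) (use da(2)[of "y - x"] 2 yx in auto)
        then show ?thesis using eq 2 by (simp only: add_diff_cancel_left real_norm_def abs_of_pos diff_gt_0_iff_gt)
      next
        case 3
        have eq: "integral {s..x} f - integral {s..y} f = integral {y..x} g"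
          using hk_integral_combine[of s y x f] x y 3 fi gf by (auto simp: algebra_simps)
        have "integral {-x..-x + (x-y)} (\<lambda>x. g (-x)) = integral {y..x} g" using hk_integral_reflect_real[where f=g and a=y and b=x] by simp
        then have "norm (integral {y..x} g - (x - y) *\<^sub>R f x) \<le> e * (x - y)" by (intro scale) (use db(2)[of "x - y"] 3 yx in auto)
        moreover have "c + integral {s..y} f - (c + integral {s..x} f) - (y - x) *\<^sub>R f x = - (integral {y..x} g - (x-y) *\<^sub>R f x)"
          unfolding eq[symmetric] by (simp add: algebra_simps)
        moreover have "norm (y - x) = x - y" using 3 by simp
        ultimately show ?thesis by (simp only: norm_minus_cancel)
      qed simp
    qed
  qed
  have "negligible (N1 \<union> uminus ` N2)" using N1 N2' by (simp add: negligible_Un_eq)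
  then have "AE x in lebesgue. x \<notin> N1 \<union> uminus ` N2" by (intro AE_not_in) (simp only: negligible_iff_null_sets)
  then have "AE x in lebesgue_on {s..t}. x \<notin> N1 \<union> uminus ` N2" by (subst AE_restrict_space_iff) (auto elim: eventually_mono)
  moreover have "AE x in lebesgue_on {s..t}. x \<in> {s..t}" by (rule AE_I2) simp
  ultimately show ?thesis by eventually_elim (use main in auto)
qed

section \<open>Total variation of an absolutely continuous function\<close>

definition nonoverlapping :: "real \<Rightarrow> real \<Rightarrow> (real \<times> real) set \<Rightarrow> bool"
  where "nonoverlapping s t P \<longleftrightarrow> finite P \<and> (\<forall>(p, q)\<in>P. s \<le> p \<and> p < q \<and> q \<le> t) \<and>
    pairwise (\<lambda>(p, q) (p', q'). {p<..<q} \<inter> {p'<..<q'} = {}) P"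

text \<open>With \<open>p < q\<close> in every pair, disjointness of the open intervals turns into
  an order of the intervals. Degenerate pairs, which \<open>interval_family\<close> admits, would
  break this.\<close>

lemma nonoverlappingD:
  assumes "nonoverlapping s t P"
  shows "finite P" "\<And>p q. (p, q) \<in> P \<Longrightarrow> s \<le> p \<and> p < q \<and> q \<le> t"
    "\<And>p q p' q'. (p, q) \<in> P \<Longrightarrow> (p', q') \<in> P \<Longrightarrow> (p, q) \<noteq> (p', q') \<Longrightarrow> q \<le> p' \<or> q' \<le> p"
proof -
  fix p q p' q' assume a: "(p, q) \<in> P" "(p', q') \<in> P" "(p, q) \<noteq> (p', q')"
  then have "{p<..<q} \<inter> {p'<..<q'} = {}" using assms unfolding nonoverlapping_def pairwise_def by auto
  moreover have "p < q" "p' < q'" using a assms unfolding nonoverlapping_def by auto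
  ultimately show "q \<le> p' \<or> q' \<le> p"
  proof -
    have "(max p p' + min q q') / 2 \<in> {p<..<q} \<inter> {p'<..<q'}" if "\<not> (q \<le> p' \<or> q' \<le> p)" using that \<open>p < q\<close> \<open>p' < q'\<close> by (auto simp: max_def min_def)
    then show ?thesis using \<open>{p<..<q} \<inter> {p'<..<q'} = {}\<close> by blast
  qed
qed (use assms in \<open>auto simp: nonoverlapping_def\<close>)

lemma nonoverlappingI:
  assumes "finite P" "\<And>p q. (p, q) \<in> P \<Longrightarrow> s \<le> p \<and> p < q \<and> q \<le> t"
    "\<And>p q p' q'. (p, q) \<in> P \<Longrightarrow> (p', q') \<in> P \<Longrightarrow> (p, q) \<noteq> (p', q') \<Longrightarrow> q \<le> p' \<or> q' \<le> p"
  shows "nonoverlapping s t P" unfolding nonoverlapping_def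
proof (intro conjI pairwiseI)
  fix i j assume "i \<in> P" "j \<in> P" "i \<noteq> j"
  then show "(\<lambda>(p, q) (p', q'). {p<..<q} \<inter> {p'<..<q'} = {}) i j" using assms(3)[of "fst i" "snd i" "fst j" "snd j"] by (force simp: case_prod_beta)
qed (use assms in auto)

definition variation_sum :: "(real \<Rightarrow> real) \<Rightarrow> (real \<times> real) set \<Rightarrow> real"
  where "variation_sum F P = (\<Sum>(p, q)\<in>P. \<bar>F q - F p\<bar>)"

text \<open>Intervals that contain \<open>m\<close> in their interior are cut at \<open>m\<close>,
  and the triangle inequality bounds the increment by the two partial ones.\<close>

lemma variation_sum_split:
  assumes P: "nonoverlapping s t P" and m: "s \<le> m" "m \<le> t"
  obtains P1 P2 where "nonoverlapping s m P1" "nonoverlapping m t P2"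
    "variation_sum F P \<le> variation_sum F P1 + variation_sum F P2"
proof
  let ?A = "{i\<in>P. fst i < m}" and ?B = "{i\<in>P. m < snd i}"
  let ?f = "\<lambda>i. (fst i, min (snd i) m)" and ?g = "\<lambda>i. (max (fst i) m, snd i)"
  note D = nonoverlappingD[OF P]
  show "nonoverlapping s m (?f ` ?A)"
  proof (rule nonoverlappingI)
    show "finite (?f ` ?A)" using D(1) by auto
    show "s \<le> p \<and> p < q \<and> q \<le> m" if "(p, q) \<in> ?f ` ?A" for p q using that D(2) by auto
    fix p q p' q' assume a: "(p, q) \<in> ?f ` ?A" "(p', q') \<in> ?f ` ?A" "(p, q) \<noteq> (p', q')"
    then obtain i j where "i \<in> P" "j \<in> P" "(p,q) = ?f i" "(p',q') = ?f j" "i \<noteq> j" by blast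
    then show "q \<le> p' \<or> q' \<le> p" using D(3)[of "fst i" "snd i" "fst j" "snd j"] by (auto simp: min_def)
  qed
  show "nonoverlapping m t (?g ` ?B)"
  proof (rule nonoverlappingI)
    show "finite (?g ` ?B)" using D(1) by auto
    show "m \<le> p \<and> p < q \<and> q \<le> t" if "(p, q) \<in> ?g ` ?B" for p q using that D(2) by auto
    fix p q p' q' assume a: "(p, q) \<in> ?g ` ?B" "(p', q') \<in> ?g ` ?B" "(p, q) \<noteq> (p', q')"
    then obtain i j where "i \<in> P" "j \<in> P" "(p,q) = ?g i" "(p',q') = ?g j" "i \<noteq> j" by blast
    then show "q \<le> p' \<or> q' \<le> p" using D(3)[of "fst i" "snd i" "fst j" "snd j"] by (auto simp: max_def)
  qed
  \<comment> \<open>Distinct intervals do not overlap, so cutting sends different intervals to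
    different pieces and the sums can be reindexed.\<close>
  have "i = j" if "i \<in> P" "j \<in> P" "max (fst i) (fst j) < min (snd i) (snd j)" for i j
    using D(3)[of "fst i" "snd i" "fst j" "snd j"] that by (cases "i = j") auto
  note eq = this
  have "fst i < snd i" if "i \<in> P" for i using D(2)[of "fst i" "snd i"] that by simp
  note lt = this
  have injf: "inj_on ?f ?A" by (rule inj_onI, rule eq) (use lt in \<open>auto simp: min_def split: if_splits\<close>)
  have injg: "inj_on ?g ?B" by (rule inj_onI, rule eq) (use lt in \<open>auto simp: max_def split: if_splits\<close>)
  have "variation_sum F P \<le> (\<Sum>i\<in>P. (if fst i < m then \<bar>F (min (snd i) m) - F (fst i)\<bar> else 0)
      + (if m < snd i then \<bar>F (snd i) - F (max (fst i) m)\<bar> else 0))" unfolding variation_sum_def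
  proof (rule sum_mono)
    fix i assume "i \<in> P"
    then have "fst i < snd i" using D(2)[of "fst i" "snd i"] by simp
    then show "(case i of (p, q) \<Rightarrow> \<bar>F q - F p\<bar>) \<le> (if fst i < m then \<bar>F (min (snd i) m) - F (fst i)\<bar> else 0)
      + (if m < snd i then \<bar>F (snd i) - F (max (fst i) m)\<bar> else 0)" by (auto simp: case_prod_beta min_def max_def)
  qed
  also have "\<dots> = (\<Sum>i\<in>?A. \<bar>F (min (snd i) m) - F (fst i)\<bar>) + (\<Sum>i\<in>?B. \<bar>F (snd i) - F (max (fst i) m)\<bar>)"
    using D(1) by (simp add: sum.distrib sum.inter_filter[symmetric])
  also have "\<dots> = variation_sum F (?f ` ?A) + variation_sum F (?g ` ?B)"
    unfolding variation_sum_def by (simp add: sum.reindex[OF injf] sum.reindex[OF injg])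
  finally show "variation_sum F P \<le> variation_sum F (?f ` ?A) + variation_sum F (?g ` ?B)" .
qed

lemma absolutely_continuous_variation_sum:
  assumes "absolutely_continuous_on s t F" "0 < e"
  obtains d where "0 < d" "\<And>P. nonoverlapping s t P \<Longrightarrow> (\<Sum>(p, q)\<in>P. q - p) < d \<Longrightarrow> variation_sum F P < e"
proof -
  obtain d where d: "0 < d" "\<And>P. interval_family s t P \<Longrightarrow> (\<Sum>(p, q)\<in>P. q - p) < d \<Longrightarrow> (\<Sum>(p, q)\<in>P. dist (F p) (F q)) < e"
    by (rule absolutely_continuous_onE[OF assms]) blast
  show ?thesis
  proof (rule that[OF d(1)])
    fix P assume "nonoverlapping s t P" "(\<Sum>(p, q)\<in>P. q - p) < d"
    then show "variation_sum F P < e" using d(2)[of P] unfolding nonoverlapping_def interval_family_def variation_sum_def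
      by (force simp: dist_real_def abs_minus_commute case_prod_beta)
  qed
qed

lemma nonoverlapping_length_le:
  assumes "nonoverlapping s t P" "s \<le> t"
  shows "(\<Sum>(p, q)\<in>P. q - p) \<le> t - s"
proof -
  have "(\<Sum>(p, q)\<in>P. integral {p..q} (\<lambda>x. 1 :: real)) \<le> integral {s..t} (\<lambda>x. 1)"
    using assms by (intro sum_integral_nonoverlap_le) (auto simp: nonoverlapping_def interval_family_def)
  moreover have "(\<Sum>(p, q)\<in>P. integral {p..q} (\<lambda>x. 1 :: real)) = (\<Sum>(p, q)\<in>P. q - p)" by (rule sum.cong) (use nonoverlappingD[OF assms(1)] in force)+
  ultimately show ?thesis using assms(2) by simp
qed

lemma nonoverlapping_mono:
  "nonoverlapping s t P \<Longrightarrow> s' \<le> s \<Longrightarrow> t \<le> t' \<Longrightarrow> nonoverlapping s' t' P" unfolding nonoverlapping_def by force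

text \<open>With \<open>d\<close> belonging to \<open>e = 1\<close>, the interval is cut into
  \<open>n > 1/d\<close> pieces, and each of them contributes less than 1 to the variation.\<close>

lemma absolutely_continuous_bounded_variation:
  assumes F: "absolutely_continuous_on 0 1 F"
  obtains B where "\<And>P. nonoverlapping 0 1 P \<Longrightarrow> variation_sum F P \<le> B"
proof -
  obtain d where d: "0 < d" "\<And>P. nonoverlapping 0 1 P \<Longrightarrow> (\<Sum>(p, q)\<in>P. q - p) < d \<Longrightarrow> variation_sum F P < 1"
    using absolutely_continuous_variation_sum[OF F zero_less_one] by metis
  obtain n :: nat where n: "n > 0" "1 / real n < d" using reals_Archimedean[OF d(1)] by (metis inverse_eq_divide zero_less_Suc)
  have "\<forall>P. nonoverlapping 0 (real k / n) P \<longrightarrow> variation_sum F P \<le> real k" if "k \<le> n" for k using that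
  proof (induction k)
    case 0
    have "P = {}" if "nonoverlapping 0 0 P" for P using nonoverlappingD(2)[OF that] by fastforce
    then show ?case by (metis (no_types) div_0 of_nat_0 sum.empty variation_sum_def order_refl)
  next
    case (Suc k)
    show ?case
    proof (intro allI impI)
      fix P assume P: "nonoverlapping 0 (real (Suc k) / n) P"
      obtain P1 P2 where P12: "nonoverlapping 0 (real k / n) P1"
        "nonoverlapping (real k / n) (real (Suc k) / n) P2"
        "variation_sum F P \<le> variation_sum F P1 + variation_sum F P2"
        by (rule variation_sum_split[OF P, of "real k / n"]) (auto intro: divide_right_mono)
      have "(\<Sum>(p, q)\<in>P2. q - p) \<le> 1 / n" using nonoverlapping_length_le[OF P12(2)] n(1) by (simp add: add_divide_distrib)
      moreover have "nonoverlapping 0 1 P2" using P12(2) by (rule nonoverlapping_mono) (use Suc.prems n in auto)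
      ultimately have "variation_sum F P2 < 1" using d(2) n(2) by force
      then show "variation_sum F P \<le> real (Suc k)" using P12 Suc by force
    qed
  qed
  from this[of n] show ?thesis using n(1) by (intro that[of n]) auto
qed

definition total_variation :: "(real \<Rightarrow> real) \<Rightarrow> real \<Rightarrow> real \<Rightarrow> real"
  where "total_variation F s t = Sup (variation_sum F ` {P. nonoverlapping s t P})"

lemma nonoverlapping_empty: "nonoverlapping s t {}" by (simp add: nonoverlapping_def)

context
  fixes F :: "real \<Rightarrow> real"
  assumes F: "absolutely_continuous_on 0 1 F"
begin

lemma variation_bdd:
  assumes "0 \<le> s" "t \<le> 1"
  shows "bdd_above (variation_sum F ` {P. nonoverlapping s t P})"
proof -
  obtain B where "\<And>P. nonoverlapping 0 1 P \<Longrightarrow> variation_sum F P \<le> B" using absolutely_continuous_bounded_variation[OF F] by blast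
  then show ?thesis using assms by (intro bdd_aboveI[of _ B]) (auto intro: nonoverlapping_mono)
qed

lemma variation_sum_le_total:
  assumes "0 \<le> s" "t \<le> 1" "nonoverlapping s t P"
  shows "variation_sum F P \<le> total_variation F s t" unfolding total_variation_def using assms by (intro cSUP_upper variation_bdd) auto

lemma total_variation_le:
  assumes "\<And>P. nonoverlapping s t P \<Longrightarrow> variation_sum F P \<le> B"
  shows "total_variation F s t \<le> B" unfolding total_variation_def using assms nonoverlapping_empty by (intro cSUP_least) auto

lemma total_variation_triangle:
  assumes "0 \<le> s" "s \<le> m" "m \<le> t" "t \<le> 1"
  shows "total_variation F s t \<le> total_variation F s m + total_variation F m t"
proof (rule total_variation_le)
  fix P assume "nonoverlapping s t P"
  then obtain P1 P2 where "nonoverlapping s m P1" "nonoverlapping m t P2"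
    "variation_sum F P \<le> variation_sum F P1 + variation_sum F P2" using variation_sum_split assms by metis
  then show "variation_sum F P \<le> total_variation F s m + total_variation F m t"
    using variation_sum_le_total[of s m P1] variation_sum_le_total[of m t P2] assms by linarith
qed

text \<open>The interval from \<open>m\<close> to \<open>t\<close> is appended to a family in
  \<open>{0..m}\<close>. Hence the variation function stays monotone after \<open>F\<close> is added
  or subtracted.\<close>

lemma total_variation_ge:
  assumes "0 \<le> m" "m \<le> t" "t \<le> 1"
  shows "total_variation F 0 m + \<bar>F t - F m\<bar> \<le> total_variation F 0 t"
proof -
  have "total_variation F 0 m \<le> total_variation F 0 t - \<bar>F t - F m\<bar>"
  proof (rule total_variation_le)
    fix P assume P: "nonoverlapping 0 m P"
    show "variation_sum F P \<le> total_variation F 0 t - \<bar>F t - F m\<bar>"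
    proof (cases "m = t")
      case True
      then show ?thesis using variation_sum_le_total[OF _ _ P] assms by auto
    next
      case False
      have no: "nonoverlapping 0 t (insert (m, t) P)"
      proof (rule nonoverlappingI)
        show "finite (insert (m, t) P)" using nonoverlappingD(1)[OF P] by simp
        show "0 \<le> p \<and> p < q \<and> q \<le> t" if "(p, q) \<in> insert (m, t) P" for p q using that nonoverlappingD(2)[OF P, of p q] assms False by auto
        show "q \<le> p' \<or> q' \<le> p" if "(p, q) \<in> insert (m, t) P" "(p', q') \<in> insert (m, t) P" "(p, q) \<noteq> (p', q')" for p q p' q'
          using that nonoverlappingD(2)[OF P, of p q] nonoverlappingD(2)[OF P, of p' q'] nonoverlappingD(3)[OF P, of p q p' q'] by auto
      qed
      have "(m, t) \<notin> P" using nonoverlappingD(2)[OF P, of m t] False assms by auto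
      then have "variation_sum F (insert (m, t) P) = \<bar>F t - F m\<bar> + variation_sum F P" using nonoverlappingD(1)[OF P] by (simp add: variation_sum_def)
      then show ?thesis using variation_sum_le_total[OF _ assms(3) no] by simp
    qed
  qed
  then show ?thesis by simp
qed

text \<open>Each interval is replaced by a subfamily that nearly attains its variation. The union of
  these subfamilies is again nonoverlapping and not longer, so absolute continuity of
  \<open>F\<close> applies to it.\<close>

lemma total_variation_absolutely_continuous:
  assumes "0 < e"
  obtains d where "0 < d" "\<And>P. nonoverlapping 0 1 P \<Longrightarrow> (\<Sum>(p, q)\<in>P. q - p) < d \<Longrightarrow> (\<Sum>(p, q)\<in>P. total_variation F p q) < e"
proof -
  obtain d where d: "0 < d" "\<And>P. nonoverlapping 0 1 P \<Longrightarrow> (\<Sum>(p, q)\<in>P. q - p) < d \<Longrightarrow> variation_sum F P < e/3"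
    using absolutely_continuous_variation_sum[OF F, of "e/3"] assms by auto
  show ?thesis
  proof (rule that[OF d(1)])
    fix P assume P: "nonoverlapping 0 1 P" and len: "(\<Sum>(p, q)\<in>P. q - p) < d"
    note D = nonoverlappingD[OF P]
    \<comment> \<open>Each of the \<open>card P\<close> suprema is missed by less than
      \<open>e / (3 * n)\<close>, so the total loss is at most \<open>e/3\<close>; the 1 avoids
      division by zero.\<close>
    define n where "n = real (card P) + 1"
    have n: "n > 0" by (simp add: n_def add_nonneg_pos)
    have "\<exists>R. nonoverlapping (fst i) (snd i) R \<and> total_variation F (fst i) (snd i) - e/(3*n) < variation_sum F R" for i
    proof -
      have ne: "variation_sum F ` {P. nonoverlapping (fst i) (snd i) P} \<noteq> {}" using nonoverlapping_empty by auto
      have "total_variation F (fst i) (snd i) - e/(3*n) < total_variation F (fst i) (snd i)" using assms n by simp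
      then obtain x where "x \<in> variation_sum F ` {P. nonoverlapping (fst i) (snd i) P}" "total_variation F (fst i) (snd i) - e/(3*n) < x"
        unfolding total_variation_def using less_cSupD[OF ne] by meson
      then show ?thesis by auto
    qed
    then obtain R where R: "\<And>i. nonoverlapping (fst i) (snd i) (R i)"
      "\<And>i. total_variation F (fst i) (snd i) - e/(3*n) < variation_sum F (R i)" by metis
    have disj: "R i \<inter> R j = {}" if ij: "i \<in> P" "j \<in> P" "i \<noteq> j" for i j
    proof -
      have "snd i \<le> fst j \<or> snd j \<le> fst i" using D(3)[of "fst i" "snd i" "fst j" "snd j"] ij by auto
      then show ?thesis using nonoverlappingD(2)[OF R(1)[of i]] nonoverlappingD(2)[OF R(1)[of j]] by fastforce
    qed
    have sumU: "sum h (\<Union>(R ` P)) = (\<Sum>i\<in>P. sum h (R i))" for h :: "real \<times> real \<Rightarrow> real"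
      using disj D(1) nonoverlappingD(1)[OF R(1)] by (intro sum.UNION_disjoint) auto
    have no: "nonoverlapping 0 1 (\<Union>(R ` P))"
    proof (rule nonoverlappingI)
      show "finite (\<Union>(R ` P))" using D(1) nonoverlappingD(1)[OF R(1)] by auto
      show "0 \<le> p \<and> p < q \<and> q \<le> 1" if pq: "(p, q) \<in> \<Union>(R ` P)" for p q
      proof -
        obtain i where "i \<in> P" "(p,q) \<in> R i" using pq by blast
        then show ?thesis using D(2)[of "fst i" "snd i"] nonoverlappingD(2)[OF R(1)[of i], of p q] by auto
      qed
      fix p q p' q' assume a: "(p, q) \<in> \<Union>(R ` P)" "(p', q') \<in> \<Union>(R ` P)" "(p, q) \<noteq> (p', q')"
      then obtain i j where ij: "i \<in> P" "j \<in> P" "(p,q) \<in> R i" "(p',q') \<in> R j" by blast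
      show "q \<le> p' \<or> q' \<le> p"
      proof (cases "i = j")
        case True
        then show ?thesis using nonoverlappingD(3)[OF R(1)[of i]] ij a(3) by blast
      next
        case False
        then have "snd i \<le> fst j \<or> snd j \<le> fst i" using D(3)[of "fst i" "snd i" "fst j" "snd j"] ij by auto
        then show ?thesis using nonoverlappingD(2)[OF R(1)[of i] ij(3)] nonoverlappingD(2)[OF R(1)[of j] ij(4)] by linarith
      qed
    qed
    have "(\<Sum>(p, q)\<in>\<Union>(R ` P). q - p) = (\<Sum>i\<in>P. \<Sum>(p, q)\<in>R i. q - p)" by (rule sumU)
    also have "\<dots> \<le> (\<Sum>i\<in>P. snd i - fst i)" using D(2) by (intro sum_mono nonoverlapping_length_le R(1)) (metis less_imp_le prod.collapse)
    also have "\<dots> < d" using len by (simp add: case_prod_beta)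
    finally have "variation_sum F (\<Union>(R ` P)) < e/3" using d(2)[OF no] by simp
    then have 1: "(\<Sum>i\<in>P. variation_sum F (R i)) < e/3" unfolding variation_sum_def sumU .
    have "(\<Sum>(p, q)\<in>P. total_variation F p q) \<le> (\<Sum>i\<in>P. variation_sum F (R i) + e/(3*n))"
    proof (rule sum_mono)
      fix i
      show "(case i of (p, q) \<Rightarrow> total_variation F p q) \<le> variation_sum F (R i) + e/(3*n)" using R(2)[of i] by (simp add: case_prod_beta)
    qed
    also have "\<dots> = (\<Sum>i\<in>P. variation_sum F (R i)) + real (card P) * (e/(3*n))" by (simp add: sum.distrib)
    also have "\<dots> < e/3 + e/3"
    proof -
      have "real (card P) * (e/(3*n)) \<le> e/3" using n assms by (simp add: n_def field_simps)
      then show ?thesis using 1 by linarith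
    qed
    finally show "(\<Sum>(p, q)\<in>P. total_variation F p q) < e" using assms by linarith
  qed
qed

end

text \<open>The Lebesgue-Stieltjes measure of \<open>G\<close> is absolutely continuous with respect
  to Lebesgue measure, and its Radon-Nikodym density is the required \<open>g\<close>. Since
  \<open>G\<close> is constant outside the unit interval, the measure lives on
  \<open>{0<..1}\<close>.\<close>

lemma mono_absolutely_continuous_imp_integral:
  fixes G :: "real \<Rightarrow> real"
  assumes mono: "\<And>x y. x \<le> y \<Longrightarrow> G x \<le> G y"
    and left: "\<And>x. x \<le> 0 \<Longrightarrow> G x = G 0" and right: "\<And>x. 1 \<le> x \<Longrightarrow> G x = G 1"
    and ac: "\<And>e. 0 < e \<Longrightarrow> \<exists>d>0. \<forall>P. nonoverlapping 0 1 P \<longrightarrow> (\<Sum>(p, q)\<in>P. q - p) < d \<longrightarrow> (\<Sum>(p, q)\<in>P. G q - G p) < e"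
  obtains g where "g absint" "\<And>x. x \<in> {0..1} \<Longrightarrow> G x = G 0 + integral {0..x} g"
proof -
  have small: "\<exists>d>0. \<forall>x y. x \<le> y \<and> y < x + d \<longrightarrow> G y - G x < e" if e: "0 < e" for e
  proof -
    obtain d where d: "d > 0" "\<And>P. nonoverlapping 0 1 P \<Longrightarrow> (\<Sum>(p, q)\<in>P. q - p) < d \<Longrightarrow> (\<Sum>(p, q)\<in>P. G q - G p) < e" using ac[OF e] by blast
    have "G y - G x < e" if xy: "x \<le> y" "y < x + d" for x y
    proof -
      let ?c = "\<lambda>x. max 0 (min 1 x)"
      have cl: "G x = G (?c x)" for x using left[of x] right[of x] by (auto simp: max_def min_def)
      show ?thesis
      proof (cases "?c x < ?c y")
        case True
        have "nonoverlapping 0 1 {(?c x, ?c y)}" by (rule nonoverlappingI) (use True in auto)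
        then have "G (?c y) - G (?c x) < e" using d(2)[of "{(?c x, ?c y)}"] xy d(1) by (auto simp: max_def min_def split: if_splits)
        then show ?thesis using cl[of x] cl[of y] by linarith
      next
        case False
        then have "?c x = ?c y" using xy by auto
        then show ?thesis using cl[of x] cl[of y] \<open>0 < e\<close> by simp
      qed
    qed
    then show ?thesis using d(1) by blast
  qed
  have cont: "continuous_on UNIV G" unfolding continuous_on_iff
  proof (intro ballI allI impI)
    fix x e :: real assume "0 < e"
    obtain d where d: "d > 0" "\<And>x y. x \<le> y \<Longrightarrow> y < x + d \<Longrightarrow> G y - G x < e" using small[OF \<open>0 < e\<close>] by blast
    have "dist (G y) (G x) < e" if "dist y x < d" for y
    proof (cases "x \<le> y")
      case True
      then show ?thesis using d(2)[of x y] mono[of x y] that by (auto simp: dist_real_def)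
    next
      case False
      then show ?thesis using d(2)[of y x] mono[of y x] that by (auto simp: dist_real_def)
    qed
    then show "\<exists>d>0. \<forall>y\<in>UNIV. dist y x < d \<longrightarrow> dist (G y) (G x) < e" using d(1) by blast
  qed
  define M where "M = interval_measure G"
  have Icc: "emeasure M {a..b} = ennreal (G b - G a)" if "a \<le> b" for a b unfolding M_def by (rule emeasure_interval_measure_Icc[OF that mono cont])
  have rc: "continuous (at_right a) G" for a using cont by (simp add: continuous_on_eq_continuous_at continuous_at_imp_continuous_within)
  have Ioc: "emeasure M {a<..b} = ennreal (G b - G a)" if "a \<le> b" for a b unfolding M_def by (rule emeasure_interval_measure_Ioc[OF that mono rc])
  have sM[measurable_cong]: "sets M = sets borel" by (simp add: M_def)
  have outside: "emeasure M {..0} = 0" "emeasure M {1<..} = 0"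
  proof -
    have "{..0::real} = (\<Union>n. {- real n - 1<..0})"
    proof (intro equalityI subsetI)
      fix x :: real assume "x \<in> {..0}"
      obtain n :: nat where "- x \<le> real n" using real_arch_simple by blast
      then show "x \<in> (\<Union>n. {- real n - 1<..0})" using \<open>x \<in> {..0}\<close> by (auto intro!: exI[of _ n])
    qed auto
    moreover have "emeasure M (\<Union>n. {- real n - 1<..0}) = 0"
    proof (rule emeasure_UN_eq_0)
      show "emeasure M {- real i - 1<..0} = 0" for i using Ioc[of "- real i - 1" 0] left[of "- real i - 1"] by simp
    qed (auto simp: sM)
    ultimately show "emeasure M {..0} = 0" by simp
    have "{1::real<..} = (\<Union>n. {1<..1 + real n})"
    proof (intro equalityI subsetI)
      fix x :: real assume "x \<in> {1<..}"
      obtain n :: nat where "x - 1 \<le> real n" using real_arch_simple by blast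
      then show "x \<in> (\<Union>n. {1<..1 + real n})" using \<open>x \<in> {1<..}\<close> by (auto intro!: exI[of _ n])
    qed auto
    moreover have "emeasure M (\<Union>n. {1<..1 + real n}) = 0"
    proof (rule emeasure_UN_eq_0)
      show "emeasure M {1<..1 + real i} = 0" for i using Ioc[of 1 "1 + real i"] right[of "1 + real i"] by simp
    qed (auto simp: sM)
    ultimately show "emeasure M {1<..} = 0" by simp
  qed
  \<comment> \<open>A null set is covered by countably many nonoverlapping intervals of total length
    below \<open>d\<close>. Absolute continuity bounds the measure of any finitely many of them by
    \<open>e\<close>, and an increasing limit passes to the whole cover.\<close>
  have null: "emeasure M (S \<inter> {0..1}) \<le> ennreal e" if S: "S \<in> null_sets lborel" and e: "0 < e" for S e
  proof -
    obtain d where d: "d > 0" "\<And>P. nonoverlapping 0 1 P \<Longrightarrow> (\<Sum>(p, q)\<in>P. q - p) < d \<Longrightarrow> (\<Sum>(p, q)\<in>P. G q - G p) < e" using ac[OF e] by blast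
    have Sl: "S \<inter> {0..1} \<in> null_sets lebesgue" using S null_sets_completionI[of S lborel] by (intro null_set_Int2) auto
    then have lm: "S \<inter> {0..1} \<in> lmeasurable" and m0: "measure lebesgue (S \<inter> {0..1}) = 0" by (auto simp: fmeasurable_def null_sets_def measure_def)
    have sub: "S \<inter> {0..1} \<subseteq> cbox 0 1" by simp
    obtain \<D> where D: "countable \<D>" "\<And>K. K \<in> \<D> \<Longrightarrow> K \<subseteq> cbox 0 1 \<and> K \<noteq> {} \<and> (\<exists>c d. K = cbox c d)"
        "pairwise (\<lambda>A B. interior A \<inter> interior B = {}) \<D>"
        "\<And>K. \<lbrakk>K \<in> \<D>; box 0 (1::real) \<noteq> {}\<rbrakk> \<Longrightarrow> interior K \<noteq> {}"
        "S \<inter> {0..1} \<subseteq> \<Union>\<D>" "\<Union>\<D> \<in> lmeasurable" "measure lebesgue (\<Union>\<D>) \<le> measure lebesgue (S \<inter> {0..1}) + d/2"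
      by (rule measurable_outer_intervals_bounded[OF lm sub half_gt_zero[OF d(1)]]) (rule that; assumption)
    have Dk: "\<exists>a b. K = {a..b} \<and> 0 \<le> a \<and> a < b \<and> b \<le> 1" if KD: "K \<in> \<D>" for K
    proof -
      obtain a b where K: "K = {a..b}" using D(2)[OF KD] by auto
      have "interior K \<noteq> {}" using D(4)[OF KD] by simp
      then have "a < b" unfolding K by (simp add: interior_atLeastAtMost_real)
      then show ?thesis using D(2)[OF KD] K \<open>a < b\<close> by (intro exI[of _ a] exI[of _ b]) auto
    qed
    have fin: "emeasure M (\<Union>\<F>) \<le> ennreal e" if F: "finite \<F>" "\<F> \<subseteq> \<D>" for \<F>
    proof -
      let ?P = "(\<lambda>K. (Inf K, Sup K)) ` \<F>"
      have IS: "Inf {a..b} = a" "Sup {a..b} = b" if "a < b" for a b :: real using that by auto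
      have Kk: "K = {Inf K..Sup K} \<and> 0 \<le> Inf K \<and> Inf K < Sup K \<and> Sup K \<le> 1" if KF: "K \<in> \<F>" for K
      proof -
        obtain a b where "K = {a..b}" "0 \<le> a" "a < b" "b \<le> 1" using Dk[of K] KF F(2) by blast
        then show ?thesis by (simp add: IS)
      qed
      have inj: "inj_on (\<lambda>K. (Inf K, Sup K)) \<F>" by (rule inj_onI) (metis Kk prod.inject)
      have no: "nonoverlapping 0 1 ?P" unfolding nonoverlapping_def
      proof (intro conjI pairwiseI)
        show "finite ?P" using F by simp
        show "\<forall>(p, q)\<in>?P. 0 \<le> p \<and> p < q \<and> q \<le> 1" using Kk by auto
        fix i j assume ij: "i \<in> ?P" "j \<in> ?P" "i \<noteq> j"
        then obtain K L where KL: "K \<in> \<F>" "L \<in> \<F>" "K \<noteq> L" "i = (Inf K, Sup K)" "j = (Inf L, Sup L)" by auto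
        have "interior K \<inter> interior L = {}" using D(3) KL F(2) by (auto simp: pairwise_def)
        moreover have "interior K = {Inf K<..<Sup K}" "interior L = {Inf L<..<Sup L}"
          using Kk[OF KL(1)] Kk[OF KL(2)] by (metis interior_atLeastAtMost_real)+
        ultimately show "(\<lambda>(p, q) (p', q'). {p<..<q} \<inter> {p'<..<q'} = {}) i j" using KL by simp
      qed
      have "(\<Sum>(p, q)\<in>?P. q - p) = (\<Sum>K\<in>\<F>. Sup K - Inf K)" by (simp add: sum.reindex[OF inj])
      also have "\<dots> = (\<Sum>K\<in>\<F>. measure lebesgue (interior K))"
      proof (rule sum.cong)
        fix K assume "K \<in> \<F>"
        then have "interior K = {Inf K<..<Sup K}" "Inf K < Sup K" using Kk by (metis interior_atLeastAtMost_real)+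
        then show "Sup K - Inf K = measure lebesgue (interior K)" by simp
      qed simp
      also have "\<dots> = measure lebesgue (\<Union>K\<in>\<F>. interior K)"
      proof (rule measure_finite_Union[symmetric])
        show "disjoint_family_on interior \<F>" using D(3) F(2) by (auto simp: disjoint_family_on_def pairwise_def)
        fix K assume "K \<in> \<F>"
        then have "interior K = {Inf K<..<Sup K}" using Kk by (metis interior_atLeastAtMost_real)
        then show "emeasure lebesgue (interior K) \<noteq> \<infinity>" using Kk[OF \<open>K \<in> \<F>\<close>] by simp
      qed (use F in auto)
      also have "\<dots> \<le> measure lebesgue (\<Union>\<D>)"
      proof (rule measure_mono_fmeasurable)
        show "(\<Union>K\<in>\<F>. interior K) \<subseteq> \<Union>\<D>" using F(2) interior_subset by fastforce
        show "(\<Union>K\<in>\<F>. interior K) \<in> sets lebesgue" by (intro sets.finite_UN F) auto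
      qed (rule D)
      also have "\<dots> < d" using D(7) m0 d(1) by simp
      finally have "(\<Sum>(p, q)\<in>?P. G q - G p) < e" by (rule d(2)[OF no])
      then have s: "(\<Sum>K\<in>\<F>. G (Sup K) - G (Inf K)) < e" by (simp add: sum.reindex[OF inj])
      have "emeasure M (\<Union>\<F>) = emeasure M (\<Union>K\<in>\<F>. K)" by simp
      also have "\<dots> \<le> (\<Sum>K\<in>\<F>. emeasure M K)"
      proof (rule emeasure_subadditive_finite)
        show "(\<lambda>K. K) ` \<F> \<subseteq> sets M"
        proof clarify
          fix K assume "K \<in> \<F>"
          then have "K = {Inf K..Sup K}" using Kk by blast
          then show "K \<in> sets M" unfolding sM by (metis atLeastAtMost_borel)
        qed
      qed (rule F)
      also have "\<dots> = (\<Sum>K\<in>\<F>. ennreal (G (Sup K) - G (Inf K)))"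
      proof (rule sum.cong)
        fix K assume "K \<in> \<F>"
        then have "K = {Inf K..Sup K}" "Inf K \<le> Sup K" using Kk by (auto simp del: atLeastAtMost_iff intro: less_imp_le)
        then show "emeasure M K = ennreal (G (Sup K) - G (Inf K))" using Icc[of "Inf K" "Sup K"] by simp
      qed simp
      also have "\<dots> = ennreal (\<Sum>K\<in>\<F>. G (Sup K) - G (Inf K))" using Kk mono by (intro sum_ennreal) (meson diff_ge_0_iff_ge less_imp_le)
      also have "\<dots> \<le> ennreal e" using s by (intro ennreal_leI) simp
      finally show ?thesis .
    qed
    have sD: "\<Union>\<D> \<in> sets M"
    proof (intro sets.countable_Union D(1) subsetI)
      fix K assume "K \<in> \<D>" then show "K \<in> sets M" using Dk[of K] by (auto simp: sM)
    qed
    have "emeasure M (\<Union>\<D>) \<le> ennreal e"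
    proof (cases "\<D> = {}")
      case False
      define U where "U n = \<Union>(from_nat_into \<D> ` {..<n})" for n
      have U: "(\<Union>n. U n) = \<Union>\<D>"
      proof
        show "(\<Union>n. U n) \<subseteq> \<Union>\<D>" unfolding U_def using from_nat_into[OF False] by blast
        show "\<Union>\<D> \<subseteq> (\<Union>n. U n)"
        proof
          fix x assume "x \<in> \<Union>\<D>"
          then obtain K where K: "K \<in> \<D>" "x \<in> K" by blast
          then obtain i where "K = from_nat_into \<D> i" using D(1) by (metis from_nat_into_surj)
          then show "x \<in> (\<Union>n. U n)" unfolding U_def using K by (auto intro!: exI[of _ "Suc i"])
        qed
      qed
      have "(SUP n. emeasure M (U n)) = emeasure M (\<Union>n. U n)"
      proof (rule SUP_emeasure_incseq)
        show "incseq U" unfolding U_def incseq_def by fastforce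
        show "range U \<subseteq> sets M"
        proof clarify
          fix n show "U n \<in> sets M" unfolding U_def
          proof (intro sets.countable_Union subsetI)
            fix K assume "K \<in> from_nat_into \<D> ` {..<n}"
            then have "K \<in> \<D>" using from_nat_into[OF False] by blast
            then show "K \<in> sets M" using Dk[of K] by (auto simp: sM)
          qed auto
        qed
      qed
      moreover have "emeasure M (U n) \<le> ennreal e" for n unfolding U_def by (rule fin) (use from_nat_into[OF False] in auto)
      ultimately show ?thesis unfolding U by (metis SUP_least)
    qed simp
    then show ?thesis using emeasure_mono[OF D(5) sD] by (rule order_trans[rotated])
  qed
  have "absolutely_continuous lborel M" unfolding absolutely_continuous_def
  proof
    fix S :: "real set" assume S: "S \<in> null_sets lborel"
    then have Sb: "S \<in> sets M" by (auto simp: sM null_sets_def)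
    have "emeasure M (S \<inter> {0..1}) \<le> 0" by (rule ennreal_le_epsilon) (use null[OF S] in auto)
    then have "S \<inter> {0..1} \<in> null_sets M" using Sb by (auto simp: null_sets_def sM)
    moreover have "{..0} \<in> null_sets M" "{1<..} \<in> null_sets M" using outside by (auto simp: null_sets_def sM)
    ultimately have "S \<inter> {0..1} \<union> ({..0} \<union> {1<..}) \<in> null_sets M" by (intro null_sets.Un)
    then show "S \<in> null_sets M" by (rule null_sets_subset) (use Sb in auto)
  qed
  then obtain f where f: "f \<in> borel_measurable lborel" "density lborel f = M"
    using sigma_finite_measure.Radon_Nikodym[OF sigma_finite_lborel, of M] sM by auto
  have fM: "(\<integral>\<^sup>+t. f t * indicator {0<..x} t \<partial>lborel) = ennreal (G x - G 0)" if "0 \<le> x" for x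
    using Ioc[OF that] f emeasure_density[OF f(1), of "{0<..x}"] by simp
  define g where "g t = enn2real (f t)" for t
  have gb: "g \<in> borel_measurable borel" using f(1) by (simp add: g_def[abs_def])
  have "(\<integral>\<^sup>+t. f t * indicator {0<..1} t \<partial>lborel) \<noteq> \<infinity>" using fM[of 1] by simp
  then have fin: "AE t in lborel. f t * indicator {0<..1} t \<noteq> \<infinity>" using f(1) by (intro nn_integral_PInf_AE) auto
  have hi: "(g has_integral (G x - G 0)) {0<..x}" if x: "x \<in> {0..1}" for x
  proof -
    have "(\<integral>\<^sup>+t. ennreal (g t * indicator {0<..x} t) \<partial>lborel) = (\<integral>\<^sup>+t. f t * indicator {0<..x} t \<partial>lborel)"
    proof (rule nn_integral_cong_AE, use fin in eventually_elim)
      case (elim t)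
      then show "ennreal (g t * indicator {0<..x} t) = f t * indicator {0<..x} t" using x by (cases "t \<in> {0<..x}") (auto simp: g_def less_top)
    qed
    then have "(\<integral>\<^sup>+t. ennreal (g t * indicator {0<..x} t) \<partial>lborel) = ennreal (G x - G 0)" using fM[of x] x by simp
    then have "((\<lambda>t. g t * indicator {0<..x} t) has_integral (G x - G 0)) UNIV"
    proof (intro nn_integral_has_integral)
      show "(\<lambda>t. g t * indicator {0<..x} t) \<in> borel_measurable borel" using gb by measurable
      show "0 \<le> G x - G 0" using mono[of 0 x] x by simp
    qed (auto simp: g_def)
    moreover have "(\<lambda>t. g t * indicator {0<..x} t) = (\<lambda>t. if t \<in> {0<..x} then g t else 0)" by (auto simp: fun_eq_iff)
    ultimately show ?thesis by (simp only: has_integral_restrict_UNIV)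
  qed
  have hi': "(g has_integral (G x - G 0)) {0..x}" if x: "x \<in> {0..1}" for x
    by (rule has_integral_spike_set_eq[THEN iffD1, OF _ _ hi[OF x]]) (auto intro: negligible_subset[of "{0}"])
  show ?thesis
  proof (rule that)
    show "g absint" using hi'[of 1] by (intro nonnegative_absolutely_integrable_1) (auto simp: g_def)
    show "G x = G 0 + integral {0..x} g" if "x \<in> {0..1}" for x using integral_unique[OF hi'[OF that]] by simp
  qed
qed

lemma absint_sub:
  fixes f :: "real \<Rightarrow> 'b::euclidean_space"
  assumes "f absolutely_integrable_on {s..t}" "s \<le> a" "b \<le> t"
  shows "f integrable_on {a..b}" "f absolutely_integrable_on {a..b}" "(\<lambda>x. norm (f x)) integrable_on {a..b}"
proof -
  show *: "f absolutely_integrable_on {a..b}" by (rule absolutely_integrable_on_subinterval[OF assms(1)]) (use assms in auto)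
  then show "f integrable_on {a..b}" "(\<lambda>x. norm (f x)) integrable_on {a..b}" by (simp_all add: absolutely_integrable_on_def)
qed

lemma mult_le_abs:
  fixes s x :: real
  assumes "\<bar>s\<bar> \<le> 1"
  shows "s * x \<le> \<bar>x\<bar>" using mult_right_mono[OF assms abs_ge_zero[of x]] abs_ge_self[of "s * x"] by (simp add: abs_mult)

text \<open>Jordan decomposition: the variation function \<open>V\<close> and the sum
  \<open>V + F\<close> are both monotone and absolutely continuous, and \<open>F\<close> is their
  difference. The factor \<open>s\<close>, used with the values 0 and 1, treats both functions at
  once.\<close>

lemma real_absolutely_continuous_imp_integral:
  fixes F :: "real \<Rightarrow> real"
  assumes F: "absolutely_continuous_on 0 1 F"
  obtains f where "f absint" "\<And>x. x \<in> {0..1} \<Longrightarrow> F x = F 0 + integral {0..x} f"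
proof -
  \<comment> \<open>Clamping to the unit interval makes the functions constant outside it, as the
    Stieltjes measure requires.\<close>
  define c :: "real \<Rightarrow> real" where "c x = max 0 (min 1 x)" for x
  have c: "0 \<le> c x" "c x \<le> 1" "x \<le> y \<Longrightarrow> c x \<le> c y" for x y by (auto simp: c_def)
  have cid: "c x = x" if "x \<in> {0..1}" for x using that by (auto simp: c_def)
  have ends: "c x = c 0" if "x \<le> 0" for x using that by (auto simp: c_def)
  have ends': "c x = c 1" if "1 \<le> x" for x using that by (auto simp: c_def)
  define V where "V x = total_variation F 0 (c x)" for x
  have ge: "V x + \<bar>F (c y) - F (c x)\<bar> \<le> V y" if "x \<le> y" for x y unfolding V_def using total_variation_ge[OF F, of "c x" "c y"] c that by blast
  have acG: "\<exists>d>0. \<forall>P. nonoverlapping 0 1 P \<longrightarrow> (\<Sum>(p, q)\<in>P. q - p) < d \<longrightarrow>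
      (\<Sum>(p, q)\<in>P. (V q + s * F (c q)) - (V p + s * F (c p))) < e" if e: "0 < e" and s: "\<bar>s\<bar> \<le> 1" for e s
  proof -
    obtain d where d: "0 < d" "\<And>P. nonoverlapping 0 1 P \<Longrightarrow> (\<Sum>(p, q)\<in>P. q - p) < d \<Longrightarrow> (\<Sum>(p, q)\<in>P. total_variation F p q) < e/2"
      by (rule total_variation_absolutely_continuous[OF F half_gt_zero[OF e]]) (rule that; assumption)
    have "(\<Sum>(p, q)\<in>P. (V q + s * F (c q)) - (V p + s * F (c p))) < e" if P: "nonoverlapping 0 1 P" "(\<Sum>(p, q)\<in>P. q - p) < d" for P
    proof -
      have "(\<Sum>(p, q)\<in>P. (V q + s * F (c q)) - (V p + s * F (c p))) \<le> (\<Sum>(p, q)\<in>P. 2 * total_variation F p q)"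
      proof (rule sum_mono, clarify)
        fix p q assume "(p, q) \<in> P"
        then have pq: "0 \<le> p" "p < q" "q \<le> 1" using nonoverlappingD(2)[OF P(1)] by auto
        then have cc: "c p = p" "c q = q" using cid by auto
        have "V q - V p \<le> total_variation F p q" using total_variation_triangle[OF F, of 0 p q] pq unfolding V_def cc by simp
        moreover have "\<bar>F q - F p\<bar> \<le> V q - V p" using ge[of p q] pq cc by simp
        moreover have "s * (F q - F p) \<le> \<bar>F q - F p\<bar>" by (rule mult_le_abs[OF s])
        ultimately show "V q + s * F (c q) - (V p + s * F (c p)) \<le> 2 * total_variation F p q" unfolding cc by (simp add: algebra_simps)
      qed
      also have "\<dots> = 2 * (\<Sum>(p, q)\<in>P. total_variation F p q)" by (simp add: sum_distrib_left case_prod_beta)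
      finally show ?thesis using d(2)[OF P] by linarith
    qed
    then show ?thesis using d(1) by blast
  qed
  have G: "\<exists>g. g absint \<and> (\<forall>x\<in>{0..1}. V x + s * F (c x) = V 0 + s * F (c 0) + integral {0..x} g)" if s: "\<bar>s\<bar> \<le> 1" for s
  proof -
    define G where "G x = V x + s * F (c x)" for x
    have "\<exists>g. g absint \<and> (\<forall>x\<in>{0..1}. G x = G 0 + integral {0..x} g)"
    proof (rule mono_absolutely_continuous_imp_integral[of G])
      show "G x \<le> G y" if "x \<le> y" for x y
      proof -
        have "s * (F (c x) - F (c y)) \<le> \<bar>F (c x) - F (c y)\<bar>" by (rule mult_le_abs[OF s])
        then show ?thesis unfolding G_def using ge[OF that] by (simp add: algebra_simps abs_minus_commute)
      qed
      show "G x = G 0" if "x \<le> 0" for x unfolding G_def V_def using ends[OF that] by (simp only:)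
      show "G x = G 1" if "1 \<le> x" for x unfolding G_def V_def using ends'[OF that] by (simp only:)
      show "\<exists>d>0. \<forall>P. nonoverlapping 0 1 P \<longrightarrow> (\<Sum>(p, q)\<in>P. q - p) < d \<longrightarrow> (\<Sum>(p, q)\<in>P. G q - G p) < e" if "0 < e" for e
        unfolding G_def by (rule acG[OF that s])
    qed blast
    then show ?thesis unfolding G_def .
  qed
  obtain g0 where g0: "g0 absint" "\<forall>x\<in>{0..1}. V x = V 0 + integral {0..x} g0" using G[of 0] by auto
  obtain g1 where g1: "g1 absint" "\<forall>x\<in>{0..1}. V x + F (c x) = V 0 + F (c 0) + integral {0..x} g1" using G[of 1] by auto
  show ?thesis
  proof (rule that[of "\<lambda>x. g1 x - g0 x"])
    show "(\<lambda>x. g1 x - g0 x) absint" using g0 g1 by (intro set_integral_diff)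
    fix x :: real assume x: "x \<in> {0..1}"
    have i: "g0 integrable_on {0..x}" "g1 integrable_on {0..x}" using x by (auto intro!: absint_sub[OF g0(1)] absint_sub[OF g1(1)])
    have "F (c x) = F (c 0) + (integral {0..x} g1 - integral {0..x} g0)" using g0(2) g1(2) x by (smt (verit))
    then show "F x = F 0 + integral {0..x} (\<lambda>x. g1 x - g0 x)" using cid[OF x] cid[of 0] by (simp add: hk_integral_diff[OF i(2) i(1)])
  qed
qed

lemma absolutely_continuous_on_bound2:
  assumes F: "absolutely_continuous_on s t F" and G: "absolutely_continuous_on s t G"
    and h: "\<And>x y. x \<in> {s..t} \<Longrightarrow> y \<in> {s..t} \<Longrightarrow> dist (h x) (h y) \<le> L * (dist (F x) (F y) + dist (G x) (G y))"
  shows "absolutely_continuous_on s t h" unfolding absolutely_continuous_on_iff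
proof (intro allI impI)
  fix e :: real assume e: "0 < e"
  define K where "K = max L 1"
  have K: "K > 0" "L \<le> K" by (auto simp: K_def)
  have e': "0 < e / (2 * K)" using e K by simp
  obtain d1 where d1: "0 < d1" "\<And>P. interval_family s t P \<Longrightarrow> (\<Sum>(p, q)\<in>P. q - p) < d1 \<Longrightarrow> (\<Sum>(p, q)\<in>P. dist (F p) (F q)) < e / (2 * K)"
    by (rule absolutely_continuous_onE[OF F e']) blast
  obtain d2 where d2: "0 < d2" "\<And>P. interval_family s t P \<Longrightarrow> (\<Sum>(p, q)\<in>P. q - p) < d2 \<Longrightarrow> (\<Sum>(p, q)\<in>P. dist (G p) (G q)) < e / (2 * K)"
    by (rule absolutely_continuous_onE[OF G e']) blast
  have "(\<Sum>(p, q)\<in>P. dist (h p) (h q)) < e" if P: "interval_family s t P" "(\<Sum>(p, q)\<in>P. q - p) < min d1 d2" for P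
  proof -
    have "(\<Sum>(p, q)\<in>P. dist (h p) (h q)) \<le> (\<Sum>(p, q)\<in>P. K * (dist (F p) (F q) + dist (G p) (G q)))"
    proof (rule sum_mono, clarify)
      fix p q assume "(p, q) \<in> P"
      then have "dist (h p) (h q) \<le> L * (dist (F p) (F q) + dist (G p) (G q))" using P(1) by (intro h) (auto simp: interval_family_def)
      also have "\<dots> \<le> K * (dist (F p) (F q) + dist (G p) (G q))" using K by (intro mult_right_mono) auto
      finally show "dist (h p) (h q) \<le> K * (dist (F p) (F q) + dist (G p) (G q))" .
    qed
    also have "\<dots> = K * ((\<Sum>(p, q)\<in>P. dist (F p) (F q)) + (\<Sum>(p, q)\<in>P. dist (G p) (G q)))"
      by (simp add: sum_distrib_left sum.distrib case_prod_beta distrib_left)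
    also have "\<dots> < K * (e / (2 * K) + e / (2 * K))" using P K by (intro mult_strict_left_mono add_strict_mono d1(2) d2(2)) auto
    finally show ?thesis using K by simp
  qed
  then show "\<exists>d>0. \<forall>P. interval_family s t P \<longrightarrow> (\<Sum>(p, q)\<in>P. q - p) < d \<longrightarrow> (\<Sum>(p, q)\<in>P. dist (h p) (h q)) < e"
    using d1(1) d2(1) by (intro exI[of _ "min d1 d2"]) auto
qed

lemma absolutely_continuous_on_comp_Lipschitz:
  assumes F: "absolutely_continuous_on s t F"
    and h: "\<And>x y. x \<in> {s..t} \<Longrightarrow> y \<in> {s..t} \<Longrightarrow> dist (h x) (h y) \<le> L * dist (F x) (F y)"
  shows "absolutely_continuous_on s t h" by (rule absolutely_continuous_on_bound2[OF F F, of _ "L / 2"]) (use h in auto)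

text \<open>Coordinatewise. This is the step from the domain of the operator, described by epsilon
  and delta, to the integral equations in which the rest of the argument is carried out.\<close>

theorem absolutely_continuous_imp_integral:
  fixes F :: "real \<Rightarrow> 'b::euclidean_space"
  assumes F: "absolutely_continuous_on 0 1 F"
  obtains f where "f absint" "\<And>x. x \<in> {0..1} \<Longrightarrow> F x = F 0 + integral {0..x} f"
proof -
  have "\<exists>f. f absint \<and> (\<forall>x\<in>{0..1}. F x \<bullet> b = F 0 \<bullet> b + integral {0..x} f)" if b: "b \<in> Basis" for b
  proof -
    have "absolutely_continuous_on 0 1 (\<lambda>x. F x \<bullet> b)" by (rule absolutely_continuous_on_comp_Lipschitz[OF F, of _ 1])
        (use b in \<open>auto simp: dist_norm inner_diff_left[symmetric] Basis_le_norm\<close>)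
    then show ?thesis by (rule real_absolutely_continuous_imp_integral) blast
  qed
  then obtain f where f: "\<And>b. b \<in> Basis \<Longrightarrow> f b absint"
    "\<And>b x. b \<in> Basis \<Longrightarrow> x \<in> {0..1} \<Longrightarrow> F x \<bullet> b = F 0 \<bullet> b + integral {0..x} (f b)" by metis
  define g where "g x = (\<Sum>b\<in>Basis. f b x *\<^sub>R b)" for x
  have gb: "g x \<bullet> b = f b x" if "b \<in> Basis" for x b using that by (simp add: g_def inner_sum_left inner_Basis if_distrib sum.delta cong: if_cong)
  show ?thesis
  proof (rule that)
    show gi: "g absint" unfolding absolutely_integrable_componentwise_iff[where f=g]
    proof
      fix b :: 'b assume b: "b \<in> Basis"
      have "(\<lambda>x. g x \<bullet> b) = f b" by (rule ext) (rule gb[OF b])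
      then show "(\<lambda>x. g x \<bullet> b) absint" using f(1)[OF b] by (simp only:)
    qed
    fix x :: real assume x: "x \<in> {0..1}"
    have i: "g integrable_on {0..x}" using x by (auto intro!: absint_sub[OF gi])
    show "F x = F 0 + integral {0..x} g"
    proof (rule euclidean_eqI)
      fix b :: 'b assume b: "b \<in> Basis"
      have "integral {0..x} g \<bullet> b = integral {0..x} (\<lambda>x. g x \<bullet> b)" using integral_component_eq[OF i] by simp
      then show "F x \<bullet> b = (F 0 + integral {0..x} g) \<bullet> b" using f(2)[OF b x] gb[OF b] by (simp add: inner_add_left)
    qed
  qed
qed

section \<open>Indefinite integrals in place of pointwise derivatives\<close>

definition antiderivative :: "(real \<Rightarrow> 'b::euclidean_space) \<Rightarrow> (real \<Rightarrow> 'b) \<Rightarrow> bool"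
  where "antiderivative f F \<longleftrightarrow> f absint \<and> (\<forall>x\<in>{0..1}. F x = F 0 + integral {0..x} f)"

lemma absolutely_continuous_on_cong:
  assumes "\<And>x. x \<in> {s..t} \<Longrightarrow> F x = G x" "absolutely_continuous_on s t F"
  shows "absolutely_continuous_on s t G" by (rule absolutely_continuous_on_comp_Lipschitz[OF assms(2), of _ 1]) (use assms(1) in auto)

lemma antiderivative_absolutely_continuous:
  assumes "antiderivative f F" shows "absolutely_continuous_on 0 1 F"
proof -
  have f: "f absint" and F: "\<forall>x\<in>{0..1}. F x = F 0 + integral {0..x} f" using assms unfolding antiderivative_def by blast+
  show ?thesis by (rule absolutely_continuous_on_cong[OF _ absolutely_continuous_on_integral[OF f, of "F 0"]]) (rule F[rule_format, symmetric])
qed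

lemma antiderivative_AE:
  assumes "antiderivative f F"
  shows "AE x in lebesgue_on {0..1}. (F has_vector_derivative f x) (at x within {0..1})"
proof -
  have "f integrable_on {0..1}" using assms absint_integrable unfolding antiderivative_def by blast
  from AE_has_derivative_integral[OF this, of "F 0"]
  have "AE x in lebesgue_on {0..1}. ((\<lambda>x. F 0 + integral {0..x} f) has_vector_derivative f x) (at x within {0..1})" .
  moreover have "AE x in lebesgue_on {0..1}. x \<in> {0..1::real}" by (rule AE_I2) simp
  ultimately show ?thesis
  proof eventually_elim
    case (elim x)
    have F: "\<forall>x\<in>{0..1}. F x = F 0 + integral {0..x} f" using assms unfolding antiderivative_def by blast
    show ?case by (rule has_vector_derivative_transform[OF elim(2) _ elim(1)]) (rule F[rule_format])
  qed
qed

lemma absolutely_integrable_AE_cong: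
  fixes f g :: "real \<Rightarrow> 'b::euclidean_space"
  assumes f: "f absint" and ae: "AE x in lebesgue_on {0..1}. f x = g x"
  shows "g absint" "x \<le> 1 \<Longrightarrow> integral {0..x} g = integral {0..x} f"
proof -
  obtain N where N: "N \<in> null_sets (lebesgue_on {0..1})" "{x\<in>space (lebesgue_on {0..1}). f x \<noteq> g x} \<subseteq> N" using ae by (auto simp: eventually_ae_filter)
  then have n: "negligible N"
    by (metis negligible_iff_null_sets null_sets_restrict_space Int_iff atLeastAtMost_borel borel_closed closed_atLeastAtMost lborelD sets_completionI_sets)
  show "g absint" by (rule absolutely_integrable_spike[OF f n]) (use N in auto)
  show "integral {0..x} g = integral {0..x} f" if "x \<le> 1" by (rule integral_spike[OF n]) (use N that in auto)
qed

text \<open>The density provided by absolute continuity is the derivative almost everywhere, hence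
  agrees with \<open>f\<close> almost everywhere and can be replaced by it.\<close>

lemma antiderivativeI:
  fixes F :: "real \<Rightarrow> 'b::euclidean_space"
  assumes F: "absolutely_continuous_on 0 1 F"
    and ae: "AE x in lebesgue_on {0..1}. (F has_vector_derivative f x) (at x within {0..1})"
  shows "antiderivative f F"
proof -
  obtain g where g: "g absint" "\<And>x. x \<in> {0..1} \<Longrightarrow> F x = F 0 + integral {0..x} g" using absolutely_continuous_imp_integral[OF F] by blast
  then have "antiderivative g F" unfolding antiderivative_def by blast
  from antiderivative_AE[OF this]
  have "AE x in lebesgue_on {0..1}. (F has_vector_derivative g x) (at x within {0..1})" .
  moreover have "AE x in lebesgue_on {0..1}. x \<in> {0..1::real}" by (rule AE_I2) simp
  ultimately have "AE x in lebesgue_on {0..1}. g x = f x" using ae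
  proof eventually_elim
    case (elim x)
    show ?case by (rule vector_derivative_unique_within[OF _ elim(1) elim(3)]) (use elim(2) in \<open>simp add: trivial_limit_within islimpt_Icc\<close>)
  qed
  note fg = absolutely_integrable_AE_cong[OF g(1) this]
  have "F x = F 0 + integral {0..x} f" if x: "x \<in> {0..1}" for x using g(2)[OF x] fg(2)[of x] x by simp
  then show ?thesis using fg(1) unfolding antiderivative_def by blast
qed

lemma antiderivative_continuous:
  assumes "antiderivative f F" shows "continuous_on {0..1} F"
proof -
  have "f integrable_on {0..1}" using assms absint_integrable unfolding antiderivative_def by blast
  then have "continuous_on {0..1} (\<lambda>x. F 0 + integral {0..x} f)" by (intro continuous_intros indefinite_integral_continuous_1)
  then show ?thesis by (rule continuous_on_eq) (use assms in \<open>unfold antiderivative_def, metis\<close>)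
qed

text \<open>Both factors are bounded, which makes the product absolutely continuous, and the product
  rule holds almost everywhere. Read at the end points this is integration by parts; it underlies
  Gronwall's lemma, variation of constants and the duality arguments.\<close>

lemma antiderivative_bilinear:
  fixes h :: "'a::euclidean_space \<Rightarrow> 'b::euclidean_space \<Rightarrow> 'c::euclidean_space"
  assumes h: "bounded_bilinear h" and F: "antiderivative f F" and G: "antiderivative g G"
  shows "antiderivative (\<lambda>x. h (F x) (g x) + h (f x) (G x)) (\<lambda>x. h (F x) (G x))"
proof (rule antiderivativeI)
  interpret bounded_bilinear h by fact
  obtain K where K: "\<And>a b. norm (h a b) \<le> norm a * norm b * K" "K \<ge> 0" using nonneg_bounded by blast
  have "bounded (F ` {0..1})" "bounded (G ` {0..1})"
    using antiderivative_continuous[OF F] antiderivative_continuous[OF G] compact_continuous_image compact_imp_bounded by blast+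
  then obtain A B where AB: "\<And>x. x \<in> {0..1} \<Longrightarrow> norm (F x) \<le> A" "\<And>x. x \<in> {0..1} \<Longrightarrow> norm (G x) \<le> B" unfolding bounded_iff by (metis imageI)
  have A0: "A \<ge> 0" "B \<ge> 0" using AB[of 0] norm_ge_zero order_trans by (auto intro: order_trans[OF norm_ge_zero])
  show "absolutely_continuous_on 0 1 (\<lambda>x. h (F x) (G x))"
  proof (rule absolutely_continuous_on_bound2[OF antiderivative_absolutely_continuous[OF F] antiderivative_absolutely_continuous[OF G]])
    fix x y :: real assume xy: "x \<in> {0..1}" "y \<in> {0..1}"
    have "h (F x) (G x) - h (F y) (G y) = h (F x - F y) (G x) + h (F y) (G x - G y)" by (simp add: diff_left diff_right)
    then have "norm (h (F x) (G x) - h (F y) (G y)) \<le> norm (F x - F y) * norm (G x) * K + norm (F y) * norm (G x - G y) * K"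
      by (metis (no_types, lifting) K(1) add_mono norm_triangle_le)
    also have "\<dots> \<le> norm (F x - F y) * B * K + A * norm (G x - G y) * K" using AB xy K(2) by (intro add_mono mult_right_mono mult_left_mono) auto
    also have "\<dots> \<le> (A + B) * K * (norm (F x - F y) + norm (G x - G y))" using A0 K(2) by (simp add: algebra_simps)
    finally show "dist (h (F x) (G x)) (h (F y) (G y)) \<le> (A + B) * K * (dist (F x) (F y) + dist (G x) (G y))" by (simp add: dist_norm)
  qed
  show "AE x in lebesgue_on {0..1}. ((\<lambda>x. h (F x) (G x)) has_vector_derivative h (F x) (g x) + h (f x) (G x)) (at x within {0..1})"
    using antiderivative_AE[OF F] antiderivative_AE[OF G] by eventually_elim (rule has_vector_derivative)
qed

section \<open>Linear differential equations with summable coefficients\<close>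

lemma antiderivativeD:
  assumes "antiderivative f F"
  shows "f absint" "\<And>x. x \<in> {0..1} \<Longrightarrow> F x = F 0 + integral {0..x} f" using assms unfolding antiderivative_def by blast+

lemma antiderivativeI2:
  assumes "f absint" "\<And>x. x \<in> {0..1} \<Longrightarrow> F x = F 0 + integral {0..x} f"
  shows "antiderivative f F" using assms unfolding antiderivative_def by blast

lemma antiderivative_integral:
  fixes f :: "real \<Rightarrow> 'b::euclidean_space"
  assumes "f absint"
  shows "antiderivative f (\<lambda>x. c + integral {0..x} f)" by (rule antiderivativeI2[OF assms]) simp

lemma antiderivative_cong:
  assumes "antiderivative f F" "\<And>x. x \<in> {0..1} \<Longrightarrow> f x = g x" "\<And>x. x \<in> {0..1} \<Longrightarrow> F x = G x"
  shows "antiderivative g G"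
proof (rule antiderivativeI2)
  show "g absint" by (rule absolutely_integrable_spike[OF antiderivativeD(1)[OF assms(1)] negligible_empty]) (use assms(2) in auto)
  fix x :: real assume x: "x \<in> {0..1}"
  have "integral {0..x} f = integral {0..x} g" by (rule hk_integral_cong) (use assms(2) x in auto)
  then show "G x = G 0 + integral {0..x} g" using antiderivativeD(2)[OF assms(1) x] assms(3)[OF x] assms(3)[of 0] by simp
qed

lemma antiderivative_linear:
  fixes h :: "'a::euclidean_space \<Rightarrow> 'b::euclidean_space"
  assumes h: "bounded_linear h" and F: "antiderivative f F"
  shows "antiderivative (\<lambda>x. h (f x)) (\<lambda>x. h (F x))"
proof (rule antiderivativeI2)
  show "(\<lambda>x. h (f x)) absint" using absolutely_integrable_linear[OF antiderivativeD(1)[OF F] h] by (simp add: o_def)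
  fix x :: real assume x: "x \<in> {0..1}"
  have "f integrable_on {0..x}" using x by (auto intro!: absint_sub[OF antiderivativeD(1)[OF F]])
  then have "integral {0..x} (\<lambda>x. h (f x)) = h (integral {0..x} f)" using integral_linear[OF _ h, of f "{0..x}"] by (simp add: o_def)
  then show "h (F x) = h (F 0) + integral {0..x} (\<lambda>x. h (f x))"
    by (subst antiderivativeD(2)[OF F x]) (simp add: linear_add bounded_linear.linear[OF h])
qed

lemma antiderivative_add:
  assumes F: "antiderivative f F" and G: "antiderivative g G"
  shows "antiderivative (\<lambda>x. f x + g x) (\<lambda>x. F x + G x)"
proof (rule antiderivativeI2)
  show "(\<lambda>x. f x + g x) absint" by (intro set_integral_add antiderivativeD(1)[OF F] antiderivativeD(1)[OF G])
  fix x :: real assume x: "x \<in> {0..1}"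
  have "f integrable_on {0..x}" "g integrable_on {0..x}"
    using x by (auto intro!: absint_sub[OF antiderivativeD(1)[OF F]] absint_sub[OF antiderivativeD(1)[OF G]])
  then have "integral {0..x} (\<lambda>x. f x + g x) = integral {0..x} f + integral {0..x} g" by (rule hk_integral_add)
  then show "F x + G x = F 0 + G 0 + integral {0..x} (\<lambda>x. f x + g x)" by (subst antiderivativeD(2)[OF F x], subst antiderivativeD(2)[OF G x]) simp
qed

lemma antiderivative_C1:
  fixes f :: "real \<Rightarrow> 'b::euclidean_space"
  assumes "\<And>x. x \<in> {0..1} \<Longrightarrow> (F has_vector_derivative f x) (at x within {0..1})" "continuous_on {0..1} f"
  shows "antiderivative f F"
proof (rule antiderivativeI2)
  show "f absint" by (rule absolutely_integrable_continuous_real[OF assms(2)])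
  fix x :: real assume x: "x \<in> {0..1}"
  have "(f has_integral (F x - F 0)) {0..x}"
    by (rule fundamental_theorem_of_calculus) (use x in \<open>auto intro!: has_vector_derivative_within_subset[OF assms(1)]\<close>)
  then show "F x = F 0 + integral {0..x} f" by (simp add: integral_unique)
qed

lemma antiderivative_diff_integral:
  assumes F: "antiderivative f F" and xy: "0 \<le> x" "x \<le> y" "y \<le> 1"
  shows "F y = F x + integral {x..y} f"
proof -
  have "f integrable_on {0..y}" using xy by (auto intro!: absint_sub[OF antiderivativeD(1)[OF F]])
  then have "integral {0..x} f + integral {x..y} f = integral {0..y} f" using xy by (intro hk_integral_combine) auto
  then show ?thesis
    by (subst antiderivativeD(2)[OF F, of y], use xy in simp, subst antiderivativeD(2)[OF F, of x], use xy in simp, simp add: algebra_simps)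
qed

lemma antiderivative_const_left: "antiderivative f F \<Longrightarrow> antiderivative (\<lambda>x. c * f x) (\<lambda>x. c * F x)"
  for f :: "real \<Rightarrow> real" by (rule antiderivative_linear) (rule bounded_linear_mult_right)

text \<open>Needed for the absolute continuity of the integrating factor in
  \<open>Gronwall\<close>.\<close>

lemma exp_neg_diff_le:
  fixes a b :: real
  assumes "0 \<le> a" "0 \<le> b"
  shows "\<bar>exp (- a) - exp (- b)\<bar> \<le> \<bar>a - b\<bar>"
proof -
  have *: "exp (- a) - exp (- b) \<le> b - a" if "0 \<le> a" "a \<le> b" for a b :: real
  proof -
    have "exp (- a) - exp (- b) = exp (- a) * (1 - exp (- (b - a)))" by (simp add: algebra_simps exp_add[symmetric])
    also have "\<dots> \<le> 1 * (b - a)"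
    proof (rule mult_mono)
      show "1 - exp (- (b - a)) \<le> b - a" using exp_ge_add_one_self[of "- (b - a)"] by linarith
    qed (use that in auto)
    finally show ?thesis by simp
  qed
  have "0 \<le> exp (- a) - exp (- b) \<longleftrightarrow> a \<le> b" by simp
  then show ?thesis using *[of a b] *[of b a] assms by (cases "a \<le> b") auto
qed

text \<open>The product of the right-hand side \<open>G\<close> with the integrating factor
  \<open>exp (- E)\<close> has the derivative \<open>exp (- E) * q * (u - G)\<close>, which is
  nowhere positive, so the product does not increase. As \<open>q\<close> is only integrable,
  derivatives are understood in the sense of \<open>antiderivative\<close>.\<close>

lemma Gronwall:
  fixes q u :: "real \<Rightarrow> real"
  assumes q: "q absint" "\<And>x. x \<in> {0..1} \<Longrightarrow> 0 \<le> q x"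
    and u: "continuous_on {0..1} u"
    and le: "\<And>x. x \<in> {0..1} \<Longrightarrow> u x \<le> K + integral {0..x} (\<lambda>t. q t * u t)"
    and x: "x \<in> {0..1}"
  shows "u x \<le> K * exp (integral {0..x} q)"
proof -
  define E where "E x = integral {0..x} q" for x
  define G where "G x = K + integral {0..x} (\<lambda>t. q t * u t)" for x
  have E: "antiderivative q E" using antiderivative_integral[OF q(1), of 0] by (simp add: E_def[abs_def])
  have qu: "(\<lambda>t. q t * u t) absint"
  proof -
    have "(\<lambda>t. u t * q t) absint"
      using u q(1) by (intro absolutely_integrable_bounded_measurable_product_real continuous_imp_measurable_on_sets_lebesgue compact_imp_bounded compact_continuous_image) auto
    then show ?thesis by (simp add: mult.commute)
  qed
  have G: "antiderivative (\<lambda>t. q t * u t) G" unfolding G_def by (rule antiderivative_integral[OF qu])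
  have E0: "0 \<le> E x" if "x \<in> {0..1}" for x unfolding E_def using that q by (intro hk_integral_nonneg absint_sub[OF q(1)]) auto
  have X: "antiderivative (\<lambda>t. - q t * exp (- E t)) (\<lambda>t. exp (- E t))"
  proof (rule antiderivativeI)
    show "absolutely_continuous_on 0 1 (\<lambda>t. exp (- E t))"
      by (rule absolutely_continuous_on_comp_Lipschitz[OF antiderivative_absolutely_continuous[OF E], of _ 1])
        (use E0 exp_neg_diff_le in \<open>auto simp: dist_real_def\<close>)
    show "AE x in lebesgue_on {0..1}. ((\<lambda>t. exp (- E t)) has_vector_derivative - q x * exp (- E x)) (at x within {0..1})"
      using antiderivative_AE[OF E]
    proof eventually_elim
      case (elim x)
      then have "(E has_real_derivative q x) (at x within {0..1})" by (simp add: has_real_derivative_iff_has_vector_derivative)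
      then have "((\<lambda>t. exp (- E t)) has_real_derivative exp (- E x) * - q x) (at x within {0..1})" by (auto intro!: derivative_eq_intros)
      then show ?case by (simp add: has_real_derivative_iff_has_vector_derivative mult.commute)
    qed
  qed
  have H: "antiderivative (\<lambda>t. exp (- E t) * (q t * u t) + - q t * exp (- E t) * G t) (\<lambda>t. exp (- E t) * G t)"
    by (rule antiderivative_bilinear[OF bounded_bilinear_mult X G])
  have "integral {0..x} (\<lambda>t. exp (- E t) * (q t * u t) + - q t * exp (- E t) * G t) \<le> 0"
  proof -
    have "integral {0..x} (\<lambda>t. exp (- E t) * (q t * u t) + - q t * exp (- E t) * G t) \<le> integral {0..x} (\<lambda>t. 0)"
    proof (rule integral_le)
      show "(\<lambda>t. exp (- E t) * (q t * u t) + - q t * exp (- E t) * G t) integrable_on {0..x}"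
        by (rule absint_sub(1)[OF antiderivativeD(1)[OF H]]) (use x in auto)
      fix t assume t: "t \<in> {0..x}"
      then have "exp (- E t) * (q t * u t) + - q t * exp (- E t) * G t = exp (- E t) * q t * (u t - G t)" by (simp add: algebra_simps)
      also have "\<dots> \<le> 0" using le[of t] q(2)[of t] t x by (intro mult_nonneg_nonpos) (auto simp: G_def)
      finally show "exp (- E t) * (q t * u t) + - q t * exp (- E t) * G t \<le> 0" .
    qed auto
    then show ?thesis by simp
  qed
  then have "exp (- E x) * G x \<le> exp (- E 0) * G 0" using antiderivativeD(2)[OF H x] by linarith
  then have "exp (- E x) * G x \<le> K" by (simp add: E_def G_def)
  then have "G x \<le> K * exp (E x)" by (simp add: exp_minus field_simps)
  then show ?thesis using le[OF x] unfolding G_def E_def by linarith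
qed

section \<open>Linear systems with an integrable coefficient matrix\<close>

lemma norm_matrix_vector_le: "norm (A *v v) \<le> norm A * norm v" for A :: "complex^'n^'m"
proof -
  have "norm (A *v v) = L2_set (\<lambda>i. norm (\<Sum>j\<in>UNIV. A $ i $ j * v $ j)) UNIV" by (simp add: norm_vec_def matrix_vector_mult_def)
  also have "\<dots> \<le> L2_set (\<lambda>i. norm (A $ i) * norm v) UNIV"
  proof (rule L2_set_mono)
    fix i
    have "norm (\<Sum>j\<in>UNIV. A $ i $ j * v $ j) \<le> (\<Sum>j\<in>UNIV. norm (A $ i $ j) * norm (v $ j))" by (rule order_trans[OF norm_sum]) (simp add: norm_mult)
    also have "\<dots> \<le> norm (A $ i) * norm v" unfolding norm_vec_def using L2_set_mult_ineq[of "\<lambda>j. norm (A $ i $ j)" "\<lambda>j. norm (v $ j)" UNIV] by simp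
    finally show "norm (\<Sum>j\<in>UNIV. A $ i $ j * v $ j) \<le> norm (A $ i) * norm v" .
  qed auto
  also have "\<dots> = norm A * norm v" by (simp add: norm_vec_def[of A] L2_set_left_distrib)
  finally show ?thesis .
qed

lemma bounded_bilinear_matrix_vector: "bounded_bilinear ((*v) :: complex^'n^'m \<Rightarrow> complex^'n \<Rightarrow> complex^'m)"
proof
  fix A B :: "complex^'n^'m" and v w :: "complex^'n" and r :: real
  show "(A + B) *v v = A *v v + B *v v" by (simp add: matrix_vector_mult_add_rdistrib)
  show "A *v (v + w) = A *v v + A *v w" by (simp add: matrix_vector_right_distrib)
  show "(r *\<^sub>R A) *v v = r *\<^sub>R (A *v v)" by (simp add: matrix_vector_mult_def vec_eq_iff scaleR_sum_right)
  show "A *v (r *\<^sub>R v) = r *\<^sub>R (A *v v)" by (simp add: matrix_vector_mult_def vec_eq_iff scaleR_sum_right)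
  show "\<exists>K. \<forall>(A::complex^'n^'m) v. norm (A *v v) \<le> norm A * norm v * K" by (intro exI[of _ 1]) (simp add: norm_matrix_vector_le)
qed

lemma absint_bilinear_continuous:
  fixes h :: "'a::euclidean_space \<Rightarrow> 'b::euclidean_space \<Rightarrow> 'c::euclidean_space"
    and A :: "real \<Rightarrow> 'a"
  assumes h: "bounded_bilinear h" and A: "A absolutely_integrable_on {s..t}" and y: "continuous_on {s..t} y"
  shows "(\<lambda>t. h (A t) (y t)) absolutely_integrable_on {s..t}"
proof -
  have "(\<lambda>x. (\<lambda>a b. h b a) (y x) (A x)) absolutely_integrable_on {s..t}"
  proof (rule absolutely_integrable_bounded_measurable_product[of "\<lambda>a b. h b a"])
    have "bounded_bilinear (\<lambda>a b. h b a)" by (rule bounded_bilinear.flip[OF h])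
    then show "bilinear (\<lambda>a b. h b a)" by (simp add: bilinear_conv_bounded_bilinear)
  qed (use y A in \<open>auto intro!: continuous_imp_measurable_on_sets_lebesgue compact_imp_bounded compact_continuous_image\<close>)
  then show ?thesis .
qed

lemmas absint_matrix_vector = absint_bilinear_continuous[OF bounded_bilinear_matrix_vector]

definition linear_ode :: "(real \<Rightarrow> complex^2^2) \<Rightarrow> curve \<Rightarrow> curve \<Rightarrow> bool"
  where "linear_ode A g y \<longleftrightarrow> antiderivative (\<lambda>t. A t *v y t + g t) y"

text \<open>Gronwall's lemma for \<open>norm (y x)\<close>. The constant contains the integral of
  \<open>norm A\<close> and is therefore not uniform when \<open>A\<close> contains a large spectral
  parameter; \<open>strip_bound\<close> repairs this in horizontal strips.\<close>

lemma linear_ode_bound: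
  assumes A: "A absint" and g: "g absint"
    and y: "linear_ode A g y" and x: "x \<in> {0..1}"
  shows "norm (y x) \<le> (norm (y 0) + norm_L1 g) * exp (norm_L1 A)"
proof -
  let ?K = "norm (y 0) + norm_L1 g"
  have nA: "(\<lambda>t. norm (A t)) absint" by (rule absolutely_integrable_norm[OF A, unfolded o_def])
  have cy: "continuous_on {0..1} y" using y unfolding linear_ode_def by (rule antiderivative_continuous)
  have nAy: "(\<lambda>t. norm (A t) * norm (y t)) absint" by (rule absint_bilinear_continuous[OF bounded_bilinear_mult nA]) (intro continuous_intros cy)
  have K0: "0 \<le> ?K" by (intro add_nonneg_nonneg hk_integral_nonneg absint_sub(3)[OF g]) auto
  have "norm (y x) \<le> ?K * exp (integral {0..x} (\<lambda>t. norm (A t)))"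
  proof (rule Gronwall[OF nA _ _ _ x])
    show "continuous_on {0..1} (\<lambda>x. norm (y x))" by (intro continuous_intros cy)
    fix x :: real assume x: "x \<in> {0..1}"
    have "y x = y 0 + integral {0..x} (\<lambda>t. A t *v y t + g t)" using y x unfolding linear_ode_def by (rule antiderivativeD(2))
    then have "norm (y x) \<le> norm (y 0) + norm (integral {0..x} (\<lambda>t. A t *v y t + g t))" by (metis norm_triangle_ineq)
    also have "norm (integral {0..x} (\<lambda>t. A t *v y t + g t)) \<le> integral {0..x} (\<lambda>t. norm (A t) * norm (y t) + norm (g t))"
    proof (rule integral_norm_bound_integral)
      show "(\<lambda>t. A t *v y t + g t) integrable_on {0..x}" by (rule absint_sub(1)[OF antiderivativeD(1)[OF y[unfolded linear_ode_def]]]) (use x in auto)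
      show "(\<lambda>t. norm (A t) * norm (y t) + norm (g t)) integrable_on {0..x}"
        using x by (intro integrable_add absint_sub(3)[OF g] absint_sub(1)[OF nAy]) auto
      show "norm (A t *v y t + g t) \<le> norm (A t) * norm (y t) + norm (g t)" for t
        using norm_triangle_ineq[of "A t *v y t" "g t"] norm_matrix_vector_le[of "A t" "y t"] by linarith
    qed
    also have "\<dots> = integral {0..x} (\<lambda>t. norm (A t) * norm (y t)) + integral {0..x} (\<lambda>t. norm (g t))"
      using x by (intro hk_integral_add absint_sub(3)[OF g] absint_sub(1)[OF nAy]) auto
    also have "integral {0..x} (\<lambda>t. norm (g t)) \<le> norm_L1 g" using x by (intro integral_subset_le absint_sub(3)[OF g]) auto
    finally show "norm (y x) \<le> ?K + integral {0..x} (\<lambda>t. norm (A t) * norm (y t))" by simp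
  qed auto
  also have "\<dots> \<le> ?K * exp (norm_L1 A)" using x by (intro mult_left_mono K0) (auto intro!: integral_subset_le absint_sub(3)[OF A])
  finally show ?thesis .
qed

lemma antiderivative_power:
  fixes q :: "real \<Rightarrow> real"
  assumes "antiderivative q E"
  shows "antiderivative (\<lambda>t. real (Suc n) * (q t * E t ^ n)) (\<lambda>t. E t ^ Suc n)"
proof (induction n)
  case 0 then show ?case using assms by simp
next
  case (Suc n)
  show ?case by (rule antiderivative_cong[OF antiderivative_bilinear[OF bounded_bilinear_mult assms Suc]]) (auto simp: algebra_simps)
qed

text \<open>Picard iteration. \<open>v n\<close> is the increment from one iterate to the next and
  is bounded by \<open>K * E x ^ n / fact n\<close>; the integral \<open>E\<close> of
  \<open>norm A\<close> takes the place of a Lipschitz constant times \<open>x\<close>, because the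
  coefficient is not bounded.\<close>

theorem linear_ode_exists:
  assumes A: "A absint" and g: "g absint"
  obtains y where "linear_ode A g y" "y 0 = c"
proof -
  define E where "E x = integral {0..x} (\<lambda>t. norm (A t))" for x
  define F where "F x = c + integral {0..x} g" for x
  have nA: "(\<lambda>t. norm (A t)) absint" by (rule absolutely_integrable_norm[OF A, unfolded o_def])
  have E: "antiderivative (\<lambda>t. norm (A t)) E" using antiderivative_integral[OF nA, of 0] by (simp add: E_def[abs_def])
  have F: "antiderivative g F" unfolding F_def[abs_def] by (rule antiderivative_integral[OF g])
  have E0: "0 \<le> E x" "E x \<le> E 1" if "x \<in> {0..1}" for x unfolding E_def using that
    by (auto intro!: hk_integral_nonneg integral_subset_le absint_sub(3)[OF A])
  define v where "v = rec_nat F (\<lambda>n v x. integral {0..x} (\<lambda>t. A t *v v t))"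
  have v0: "v 0 = F" and vS: "v (Suc n) = (\<lambda>x. integral {0..x} (\<lambda>t. A t *v v n t))" for n by (simp_all add: v_def)
  have cF: "continuous_on {0..1} F" by (rule antiderivative_continuous[OF F])
  have cv: "continuous_on {0..1} (v n)" for n
  proof (induction n)
    case (Suc n)
    have "antiderivative (\<lambda>t. A t *v v n t) (v (Suc n))" using antiderivative_integral[OF absint_matrix_vector[OF A Suc], of 0] by (simp add: vS)
    then show ?case by (rule antiderivative_continuous)
  qed (simp add: v0 cF)
  have Av: "(\<lambda>t. A t *v v n t) absint" for n by (rule absint_matrix_vector[OF A cv])
  have "bounded (F ` {0..1})" by (intro compact_imp_bounded compact_continuous_image cF) auto
  then obtain K where K: "K > 0" "\<And>x. x \<in> {0..1} \<Longrightarrow> norm (F x) \<le> K" unfolding bounded_pos by auto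
  have vb: "norm (v n x) \<le> K * E x ^ n / fact n" if "x \<in> {0..1}" for n x using that
  proof (induction n arbitrary: x)
    case (Suc n)
    have P: "antiderivative (\<lambda>t. real (Suc n) * (norm (A t) * E t ^ n)) (\<lambda>t. E t ^ Suc n)" by (rule antiderivative_power[OF E])
    have P': "antiderivative (\<lambda>t. K / fact (Suc n) * (real (Suc n) * (norm (A t) * E t ^ n))) (\<lambda>t. K / fact (Suc n) * E t ^ Suc n)"
      by (rule antiderivative_const_left[OF P])
    have "norm (v (Suc n) x) \<le> integral {0..x} (\<lambda>t. K / fact (Suc n) * (real (Suc n) * (norm (A t) * E t ^ n)))" unfolding vS
    proof (rule integral_norm_bound_integral)
      show "(\<lambda>t. A t *v v n t) integrable_on {0..x}" using Suc.prems by (intro absint_sub(1)[OF Av]) auto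
      show "(\<lambda>t. K / fact (Suc n) * (real (Suc n) * (norm (A t) * E t ^ n))) integrable_on {0..x}"
        using Suc.prems by (intro absint_sub(1)[OF antiderivativeD(1)[OF P']]) auto
      fix t assume t: "t \<in> {0..x}"
      have "norm (A t *v v n t) \<le> norm (A t) * norm (v n t)" by (rule norm_matrix_vector_le)
      also have "\<dots> \<le> norm (A t) * (K * E t ^ n / fact n)" using t Suc.prems by (intro mult_left_mono Suc.IH) auto
      also have "\<dots> = K / fact (Suc n) * (real (Suc n) * (norm (A t) * E t ^ n))" by (simp add: field_simps del: of_nat_Suc)
      finally show "norm (A t *v v n t) \<le> K / fact (Suc n) * (real (Suc n) * (norm (A t) * E t ^ n))" .
    qed
    also have "\<dots> = K / fact (Suc n) * E x ^ Suc n" using antiderivativeD(2)[OF P' Suc.prems] by (simp add: E_def)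
    finally show ?case by simp
  qed (use K in \<open>simp add: v0\<close>)
  define y where "y x = (\<Sum>n. v n x)" for x
  have ul: "uniform_limit {0..1} (\<lambda>n x. \<Sum>i<n. v i x) y sequentially" unfolding y_def
  proof (rule Weierstrass_m_test)
    show "norm (v n x) \<le> K * (E 1 ^ n / fact n)" if "x \<in> {0..1}" for n x
    proof -
      have "norm (v n x) \<le> K * E x ^ n / fact n" by (rule vb[OF that])
      also have "\<dots> \<le> K * E 1 ^ n / fact n" using E0[OF that] K by (intro divide_right_mono mult_left_mono power_mono) auto
      finally show ?thesis by simp
    qed
    show "summable (\<lambda>n. K * (E 1 ^ n / fact n))" using summable_exp[of "E 1"] by (intro summable_mult) (simp add: field_simps)
  qed
  have cy: "continuous_on {0..1} y" by (rule uniform_limit_theorem[OF _ ul]) (auto intro!: always_eventually continuous_intros cv)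
  have Ay: "(\<lambda>t. A t *v y t) absint" by (rule absint_matrix_vector[OF A cy])
  have yeq: "y x = F x + integral {0..x} (\<lambda>t. A t *v y t)" if x: "x \<in> {0..1}" for x
  proof -
    have S: "(\<Sum>i<Suc n. v i x) = F x + integral {0..x} (\<lambda>t. A t *v (\<Sum>i<n. v i t))" for n
    proof -
      have "(\<Sum>i<Suc n. v i x) = F x + (\<Sum>i<n. integral {0..x} (\<lambda>t. A t *v v i t))" by (simp add: sum.lessThan_Suc_shift v0 vS del: sum.lessThan_Suc)
      also have "(\<Sum>i<n. integral {0..x} (\<lambda>t. A t *v v i t)) = integral {0..x} (\<lambda>t. \<Sum>i<n. A t *v v i t)"
        using x by (intro integral_sum[symmetric] absint_sub(1)[OF Av]) auto
      also have "(\<lambda>t. \<Sum>i<n. A t *v v i t) = (\<lambda>t. A t *v (\<Sum>i<n. v i t))" by (simp add: bounded_bilinear.sum_right[OF bounded_bilinear_matrix_vector])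
      finally show ?thesis .
    qed
    have "(\<lambda>n. integral {0..x} (\<lambda>t. A t *v (\<Sum>i<n. v i t))) \<longlonglongrightarrow> integral {0..x} (\<lambda>t. A t *v y t)"
    proof (rule LIMSEQ_I)
      fix e :: real assume e: "0 < e"
      let ?d = "e / (E 1 + 1)"
      have d: "0 < ?d" using e E0[of 1] by auto
      then obtain N where N: "\<And>n t. n \<ge> N \<Longrightarrow> t \<in> {0..1} \<Longrightarrow> dist (\<Sum>i<n. v i t) (y t) < ?d" using ul unfolding uniform_limit_sequentially_iff by meson
      show "\<exists>N. \<forall>n\<ge>N. norm (integral {0..x} (\<lambda>t. A t *v (\<Sum>i<n. v i t)) - integral {0..x} (\<lambda>t. A t *v y t)) < e"
      proof (intro exI allI impI)
        fix n assume n: "n \<ge> N"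
        have cs: "continuous_on {0..1} (\<lambda>t. \<Sum>i<n. v i t)" by (intro continuous_intros cv)
        have As: "(\<lambda>t. A t *v (\<Sum>i<n. v i t)) absint" by (rule absint_matrix_vector[OF A cs])
        have "integral {0..x} (\<lambda>t. A t *v (\<Sum>i<n. v i t)) - integral {0..x} (\<lambda>t. A t *v y t) = integral {0..x} (\<lambda>t. A t *v (\<Sum>i<n. v i t) - A t *v y t)"
          using x by (intro hk_integral_diff[symmetric] absint_sub(1)[OF As] absint_sub(1)[OF Ay]) auto
        also have "norm \<dots> \<le> integral {0..x} (\<lambda>t. norm (A t) * ?d)"
        proof (rule integral_norm_bound_integral)
          show "(\<lambda>t. A t *v (\<Sum>i<n. v i t) - A t *v y t) integrable_on {0..x}"
            using x by (intro integrable_diff absint_sub(1)[OF As] absint_sub(1)[OF Ay]) auto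
          show "(\<lambda>t. norm (A t) * ?d) integrable_on {0..x}" using x by (intro integrable_on_mult_left absint_sub(3)[OF A]) auto
          fix t assume t: "t \<in> {0..x}"
          have "A t *v (\<Sum>i<n. v i t) - A t *v y t = A t *v ((\<Sum>i<n. v i t) - y t)" by (simp add: matrix_vector_mult_diff_distrib)
          also have "norm \<dots> \<le> norm (A t) * norm ((\<Sum>i<n. v i t) - y t)" by (rule norm_matrix_vector_le)
          also have "\<dots> \<le> norm (A t) * ?d" using N[OF n, of t] t x by (intro mult_left_mono) (auto simp: dist_norm intro: less_imp_le)
          finally show "norm (A t *v (\<Sum>i<n. v i t) - A t *v y t) \<le> norm (A t) * ?d" .
        qed
        also have "\<dots> = E x * ?d" unfolding E_def by (rule integral_mult_left)
        also have "\<dots> \<le> E 1 * ?d" using E0[OF x] d by (intro mult_right_mono) auto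
        also have "\<dots> < e" using e E0[of 1] by (auto simp: field_simps)
        finally show "norm (integral {0..x} (\<lambda>t. A t *v (\<Sum>i<n. v i t)) - integral {0..x} (\<lambda>t. A t *v y t)) < e" .
      qed
    qed
    then have "(\<lambda>n. \<Sum>i<Suc n. v i x) \<longlonglongrightarrow> F x + integral {0..x} (\<lambda>t. A t *v y t)" unfolding S by (intro tendsto_intros)
    moreover have "(\<lambda>n. \<Sum>i<Suc n. v i x) \<longlonglongrightarrow> y x" using tendsto_uniform_limitI[OF ul x] by (rule LIMSEQ_Suc)
    ultimately show ?thesis by (rule LIMSEQ_unique[symmetric])
  qed
  show ?thesis
  proof (rule that[of y])
    show "linear_ode A g y" unfolding linear_ode_def
    proof (rule antiderivativeI2)
      show "(\<lambda>t. A t *v y t + g t) absint" by (intro set_integral_add Ay g)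
      fix x :: real assume x: "x \<in> {0..1}"
      have "integral {0..x} (\<lambda>t. A t *v y t + g t) = integral {0..x} (\<lambda>t. A t *v y t) + integral {0..x} g"
        using x by (intro hk_integral_add absint_sub(1)[OF Ay] absint_sub(1)[OF g]) auto
      then show "y x = y 0 + integral {0..x} (\<lambda>t. A t *v y t + g t)" using yeq[OF x] yeq[of 0] by (simp add: F_def)
    qed
    show "y 0 = c" using yeq[of 0] by (simp add: F_def)
  qed
qed

section \<open>Bessel inequalities\<close>

lemma integrable_unit_leb_iff: "integrable unit_leb f \<longleftrightarrow> f absint" for f :: "real \<Rightarrow> 'b::euclidean_space"
  by (simp add: set_integrable_def integrable_restrict_space)

lemma integral_unit_leb: "f absint \<Longrightarrow> integral\<^sup>L unit_leb f = integral {0..1} f" for f :: "real \<Rightarrow> 'b::euclidean_space"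
  using lebesgue_integral_eq_integral[of "{0..1}" f] integrable_unit_leb_iff[of f] by simp

lemma square_integrable_norm2:
  assumes "square_integrable f"
  shows "(\<lambda>x. (norm (f x))\<^sup>2) absint" using assms unfolding square_integrable_def integrable_unit_leb_iff by blast

lemma square_integrable_imp_absint:
  assumes "square_integrable f"
  shows "f absint"
proof (rule measurable_bounded_by_integrable_imp_absolutely_integrable)
  show "f \<in> borel_measurable unit_leb" using assms by (simp add: square_integrable_def)
  show "(\<lambda>x. 1 + (norm (f x))\<^sup>2) integrable_on {0..1}" using square_integrable_norm2[OF assms] by (intro integrable_add absint_integrable) auto
  show "norm (f x) \<le> 1 + (norm (f x))\<^sup>2" for x using sum_squares_bound[of "norm (f x)" 1] by (simp add: power2_eq_square) (smt (verit) zero_le_square)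
qed auto

lemma continuous_imp_square_integrable:
  assumes "continuous_on {0..1} f"
  shows "square_integrable f" unfolding square_integrable_def integrable_unit_leb_iff
proof
  show "f \<in> borel_measurable unit_leb" using assms by (intro continuous_imp_measurable_on_sets_lebesgue) auto
  show "(\<lambda>x. (norm (f x))\<^sup>2) absint" by (intro absolutely_integrable_continuous_real continuous_intros assms)
qed

text \<open>The function \<open>exp (- \<mu> * t) * u t\<close> has the derivative
  \<open>exp (- \<mu> * t) * G t\<close>.\<close>

lemma variation_of_constants:
  fixes u :: "real \<Rightarrow> complex"
  assumes u: "antiderivative (\<lambda>t. \<mu> * u t + G t) u" and x: "x \<in> {0..1}"
  shows "u x = exp (\<mu> * x) * u 0 + integral {0..x} (\<lambda>t. exp (\<mu> * (x - t)) * G t)"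
    and "(\<lambda>t. exp (\<mu> * (x - t)) * G t) absint"
proof -
  have E: "antiderivative (\<lambda>t. - \<mu> * exp (- \<mu> * of_real t)) (\<lambda>t. exp (- \<mu> * of_real t))"
  proof (rule antiderivative_C1)
    fix x :: real
    have "((\<lambda>z. exp (- \<mu> * z)) has_field_derivative - \<mu> * exp (- \<mu> * of_real x)) (at (of_real x))" by (auto intro!: derivative_eq_intros)
    then show "((\<lambda>t. exp (- \<mu> * of_real t)) has_vector_derivative - \<mu> * exp (- \<mu> * of_real x)) (at x within {0..1})"
      by (intro has_vector_derivative_real_field has_vector_derivative_at_within)
  qed (intro continuous_intros)
  have H: "antiderivative (\<lambda>t. exp (- \<mu> * of_real t) * G t) (\<lambda>t. exp (- \<mu> * of_real t) * u t)"
    by (rule antiderivative_cong[OF antiderivative_bilinear[OF bounded_bilinear_mult E u]]) (auto simp: algebra_simps)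
  have "exp (\<mu> * x) * (exp (- \<mu> * of_real x) * u x) = exp (\<mu> * x) * (u 0 + integral {0..x} (\<lambda>t. exp (- \<mu> * of_real t) * G t))"
    using antiderivativeD(2)[OF H x] by simp
  moreover have "exp (\<mu> * x) * (exp (- \<mu> * of_real x) * u x) = u x" using exp_minus_inverse[of "\<mu> * x"] by (simp add: mult.assoc[symmetric])
  moreover have eq: "exp (\<mu> * x) * (exp (- \<mu> * of_real t) * G t) = exp (\<mu> * (x - t)) * G t" for t
  proof -
    have "exp (\<mu> * x) * exp (- \<mu> * of_real t) = exp (\<mu> * (x - t))" unfolding exp_add[symmetric] by (simp add: algebra_simps)
    then show ?thesis by (simp only: mult.assoc[symmetric])
  qed
  moreover have "exp (\<mu> * x) * integral {0..x} (\<lambda>t. exp (- \<mu> * of_real t) * G t) = integral {0..x} (\<lambda>t. exp (\<mu> * (x - t)) * G t)"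
    unfolding eq[symmetric] by simp
  ultimately show "u x = exp (\<mu> * x) * u 0 + integral {0..x} (\<lambda>t. exp (\<mu> * (x - t)) * G t)" by (simp only: distrib_left)
  have "(\<lambda>t. exp (\<mu> * x) * (exp (- \<mu> * of_real t) * G t)) absint" using antiderivativeD(1)[OF H] by (rule set_integrable_mult_right)
  then show "(\<lambda>t. exp (\<mu> * (x - t)) * G t) absint" unfolding eq .
qed

lemma integral_exp_periodic:
  fixes w :: real and n :: int
  assumes "w \<noteq> 0"
  shows "((\<lambda>t. exp (\<i> * of_real (w * n * t))) has_integral (if n = 0 then of_real (2 * pi / \<bar>w\<bar>) else 0)) {0..2 * pi / \<bar>w\<bar>}"
proof (cases "n = 0")
  case True
  then show ?thesis using has_integral_const_real[of "1::complex" 0 "2 * pi / \<bar>w\<bar>"] by (simp add: scaleR_conv_of_real)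
next
  case False
  let ?a = "\<i> * of_real (w * n)"
  have a: "?a \<noteq> 0" using assms False by simp
  have "((\<lambda>t. exp (\<i> * of_real (w * n * t))) has_integral (exp (?a * of_real (2 * pi / \<bar>w\<bar>)) / ?a - exp (?a * of_real 0) / ?a)) {0..2 * pi / \<bar>w\<bar>}"
  proof (rule fundamental_theorem_of_calculus)
    fix x :: real
    have "((\<lambda>z. exp (?a * z) / ?a) has_field_derivative exp (\<i> * of_real (w * n * x))) (at (of_real x))"
      using a by (auto intro!: derivative_eq_intros simp: mult_ac)
    then show "((\<lambda>t. exp (?a * of_real t) / ?a) has_vector_derivative exp (\<i> * of_real (w * n * x))) (at x within {0..2 * pi / \<bar>w\<bar>})"
      by (intro has_vector_derivative_real_field has_vector_derivative_at_within)
  qed simp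
  moreover have "exp (?a * of_real (2 * pi / \<bar>w\<bar>)) = 1"
  proof -
    define m where "m = (if w > 0 then n else - n)"
    have "w * of_int n * (2 * pi / \<bar>w\<bar>) = 2 * of_int m * pi" using assms unfolding m_def by (cases "w > 0") simp_all
    then have "?a * of_real (2 * pi / \<bar>w\<bar>) = \<i> * of_real (2 * of_int m * pi)" by (simp only: mult.assoc of_real_mult[symmetric])
    also have "\<dots> = 2 * of_int m * of_real pi * \<i>" by simp
    finally have "?a * of_real (2 * pi / \<bar>w\<bar>) = 2 * of_int m * of_real pi * \<i>" .
    then show ?thesis using exp_integer_2pi[OF Ints_of_int[of m]] by (simp add: mult.assoc)
  qed
  ultimately show ?thesis using False by simp
qed

text \<open>The exponentials are orthogonal on an interval of length
  \<open>T = 2 * pi / \<bar>w\<bar>\<close>, which contains \<open>{0..1}\<close> by the hypothesis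
  on \<open>w\<close>. The constant is the same for every upper limit \<open>x\<close>, since only
  the part of the period up to \<open>x\<close> meets \<open>g\<close>.\<close>

lemma bessel_exponentials:
  fixes g :: "real \<Rightarrow> complex" and w x :: real
  assumes w: "w \<noteq> 0" "\<bar>w\<bar> \<le> 2 * pi" and K: "finite (K :: int set)" and x: "x \<in> {0..1}"
    and g: "g absint" "(\<lambda>t. (norm (g t))\<^sup>2) absint"
  shows "(\<Sum>k\<in>K. (norm (integral {0..x} (\<lambda>t. exp (- (\<i> * of_real (w * k * t))) * g t)))\<^sup>2) \<le> 2 * pi / \<bar>w\<bar> * norm_sq g"
proof -
  define T where "T = 2 * pi / \<bar>w\<bar>"
  have T: "1 \<le> T" "T > 0" using w by (auto simp: T_def field_simps)
  define e where "e k t = exp (- (\<i> * of_real (w * of_int k * t)))" for k :: int and t :: real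
  define a where "a k = integral {0..x} (\<lambda>t. e k t * g t)" for k
  \<comment> \<open>Duality: pairing \<open>g\<close> with the exponential polynomial whose
    coefficients are the conjugates of the \<open>a k\<close> gives the sum \<open>s\<close> of
    squares, while the square integral of \<open>P\<close> over a full period is
    \<open>T * s\<close>.\<close>
  define P where "P t = (\<Sum>k\<in>K. cnj (a k) * e k t)" for t
  have ce: "continuous_on S (e k)" for k S unfolding e_def by (intro continuous_intros)
  have cP: "continuous_on S P" for S unfolding P_def by (intro continuous_intros ce)
  have eg: "(\<lambda>t. e k t * g t) absint" for k using absint_bilinear_continuous[OF bounded_bilinear_mult g(1) ce, of k] by (simp add: mult.commute)
  have Pg: "(\<lambda>t. P t * g t) absint" using absint_bilinear_continuous[OF bounded_bilinear_mult g(1) cP] by (simp add: mult.commute)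
  have PP: "((\<lambda>t. (norm (P t))\<^sup>2) has_integral (T * (\<Sum>k\<in>K. (norm (a k))\<^sup>2))) {0..T}"
  proof -
    have eq: "of_real ((norm (P t))\<^sup>2) = (\<Sum>j\<in>K. \<Sum>k\<in>K. cnj (a j) * a k * exp (\<i> * of_real (w * of_int (k - j) * t)))" for t
    proof -
      have "of_real ((norm (P t))\<^sup>2) = P t * cnj (P t)" by (rule complex_norm_square)
      also have "cnj (P t) = (\<Sum>k\<in>K. a k * exp (\<i> * of_real (w * of_int k * t)))" by (simp add: P_def e_def exp_cnj)
      finally show ?thesis unfolding P_def sum_product
      proof (simp only:, intro sum.cong refl)
        fix j k
        have "e j t * exp (\<i> * of_real (w * of_int k * t)) = exp (\<i> * of_real (w * of_int (k - j) * t))"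
          unfolding e_def exp_add[symmetric] by (simp add: algebra_simps)
        then show "cnj (a j) * e j t * (a k * exp (\<i> * of_real (w * of_int k * t))) = cnj (a j) * a k * exp (\<i> * of_real (w * of_int (k - j) * t))"
          by (metis (no_types, lifting) mult.assoc mult.left_commute)
      qed
    qed
    have "((\<lambda>t. of_real ((norm (P t))\<^sup>2) :: complex) has_integral (\<Sum>j\<in>K. \<Sum>k\<in>K. cnj (a j) * a k * (if k - j = 0 then of_real T else 0))) {0..T}"
      unfolding eq T_def by (intro has_integral_sum K has_integral_mult_right integral_exp_periodic w)
    moreover have "(\<Sum>j\<in>K. \<Sum>k\<in>K. cnj (a j) * a k * (if k - j = 0 then of_real T else 0)) = of_real (T * (\<Sum>k\<in>K. (norm (a k))\<^sup>2))"
    proof -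
      have "(\<Sum>k\<in>K. cnj (a j) * a k * (if k - j = 0 then of_real T else 0)) = of_real (T * (norm (a j))\<^sup>2)" if "j \<in> K" for j
      proof -
        have "(\<Sum>k\<in>K. cnj (a j) * a k * (if k - j = 0 then of_real T else 0)) = (\<Sum>k\<in>K. if k = j then cnj (a j) * a j * of_real T else 0)"
          by (rule sum.cong) auto
        also have "\<dots> = cnj (a j) * a j * of_real T" using K that by simp
        also have "\<dots> = of_real (T * (norm (a j))\<^sup>2)" by (simp only: of_real_mult complex_norm_square mult_ac)
        finally show ?thesis .
      qed
      then show ?thesis by (simp add: sum_distrib_left)
    qed
    ultimately have "((\<lambda>t. of_real ((norm (P t))\<^sup>2) :: complex) has_integral of_real (T * (\<Sum>k\<in>K. (norm (a k))\<^sup>2))) {0..T}" by simp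
    from has_integral_linear[OF this bounded_linear_Re] show ?thesis by (simp add: o_def del: of_real_mult of_real_sum of_real_power)
  qed
  define s where "s = (\<Sum>k\<in>K. (norm (a k))\<^sup>2)"
  have "of_real s = (\<Sum>k\<in>K. cnj (a k) * a k)" by (simp only: s_def of_real_sum complex_norm_square mult.commute)
  also have "\<dots> = (\<Sum>k\<in>K. integral {0..x} (\<lambda>t. cnj (a k) * (e k t * g t)))" by (simp add: a_def)
  also have "\<dots> = integral {0..x} (\<lambda>t. \<Sum>k\<in>K. cnj (a k) * (e k t * g t))"
    using x by (intro integral_sum[symmetric] K integrable_on_mult_right absint_sub(1)[OF eg]) auto
  also have "(\<lambda>t. \<Sum>k\<in>K. cnj (a k) * (e k t * g t)) = (\<lambda>t. P t * g t)" by (simp add: P_def sum_distrib_right mult.assoc)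
  finally have "norm (of_real s :: complex) = norm (integral {0..x} (\<lambda>t. P t * g t))" by simp
  \<comment> \<open>The weights \<open>1/(2*T)\<close> and \<open>T/2\<close> make the contribution
    of \<open>P\<close> at most \<open>s/2\<close>, which is absorbed on the left.\<close>
  also have "\<dots> \<le> integral {0..x} (\<lambda>t. 1/(2*T) * (norm (P t))\<^sup>2 + T/2 * (norm (g t))\<^sup>2)"
  proof (rule integral_norm_bound_integral)
    show "(\<lambda>t. P t * g t) integrable_on {0..x}" using x by (intro absint_sub(1)[OF Pg]) auto
    show "(\<lambda>t. 1/(2*T) * (norm (P t))\<^sup>2 + T/2 * (norm (g t))\<^sup>2) integrable_on {0..x}"
      using x by (intro integrable_add integrable_on_mult_right absint_sub(1)[OF g(2)] integrable_continuous_real continuous_intros cP) auto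
    show "norm (P t * g t) \<le> 1/(2*T) * (norm (P t))\<^sup>2 + T/2 * (norm (g t))\<^sup>2" for t
    proof -
      have "0 \<le> (norm (P t) - T * norm (g t))\<^sup>2" by simp
      then have "2 * T * (norm (P t) * norm (g t)) \<le> (norm (P t))\<^sup>2 + T\<^sup>2 * (norm (g t))\<^sup>2"
        by (simp add: power2_diff power_mult_distrib algebra_simps)
      then show ?thesis using T by (simp add: norm_mult field_simps power2_eq_square)
    qed
  qed
  also have "\<dots> = 1/(2*T) * integral {0..x} (\<lambda>t. (norm (P t))\<^sup>2) + T/2 * integral {0..x} (\<lambda>t. (norm (g t))\<^sup>2)"
  proof -
    have "(\<lambda>t. (norm (P t))\<^sup>2) integrable_on {0..x}" by (intro integrable_continuous_real continuous_intros cP)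
    moreover have "(\<lambda>t. (norm (g t))\<^sup>2) integrable_on {0..x}" using x by (intro absint_sub(1)[OF g(2)]) auto
    ultimately show ?thesis by (subst hk_integral_add) (intro integrable_on_mult_right; assumption | simp)+
  qed
  also have "\<dots> \<le> 1/(2*T) * (T * s) + T/2 * norm_sq g"
  proof (intro add_mono mult_left_mono)
    have "integral {0..x} (\<lambda>t. (norm (P t))\<^sup>2) \<le> integral {0..T} (\<lambda>t. (norm (P t))\<^sup>2)"
      using x T by (intro integral_subset_le integrable_continuous_real continuous_intros cP) auto
    then show "integral {0..x} (\<lambda>t. (norm (P t))\<^sup>2) \<le> T * s" using integral_unique[OF PP] by (simp add: s_def)
    show "integral {0..x} (\<lambda>t. (norm (g t))\<^sup>2) \<le> norm_sq g" using x by (intro integral_subset_le absint_sub(1)[OF g(2)]) auto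
  qed (use T in auto)
  finally have "s \<le> s/2 + T/2 * norm_sq g" using T by simp
  then have "s \<le> T * norm_sq g" by (simp add: field_simps)
  then show ?thesis unfolding s_def a_def e_def T_def .
qed

lemma has_integral_reverse:
  fixes f :: "real \<Rightarrow> 'b::euclidean_space"
  assumes "(f has_integral I) {p..q}"
  shows "((\<lambda>t. f (1 - t)) has_integral I) {1 - q..1 - p}" using has_integral_affinity[of f I p q "- 1" 1] assms
    image_affinity_atLeastAtMost_diff[of "- 1" "- 1" p q] by (cases "p \<le> q") (simp_all add: image_uminus_atLeastAtMost)

lemma antiderivative_reverse:
  fixes f :: "real \<Rightarrow> 'b::euclidean_space"
  assumes F: "antiderivative f F"
  shows "antiderivative (\<lambda>t. - f (1 - t)) (\<lambda>t. F (1 - t))"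
proof (rule antiderivativeI2)
  note f = antiderivativeD(1)[OF F]
  have "(\<lambda>t. f (1 - t)) absint" using f has_integral_reverse[of f _ 0 1] has_integral_reverse[of "\<lambda>t. norm (f t)" _ 0 1]
    by (auto simp: absolutely_integrable_on_def integrable_on_def)
  then show "(\<lambda>t. - f (1 - t)) absint" by (simp add: absolutely_integrable_on_def integrable_neg)
  fix x :: real assume x: "x \<in> {0..1}"
  have "(f has_integral integral {1 - x..1} f) {1 - x..1}" by (rule integrable_integral[OF absint_sub(1)[OF f]]) (use x in auto)
  from has_integral_reverse[OF this] have "integral {0..x} (\<lambda>t. f (1 - t)) = integral {1 - x..1} f" by (intro integral_unique) simp
  then show "F (1 - x) = F (1 - 0) + integral {0..x} (\<lambda>t. - f (1 - t))" using antiderivative_diff_integral[OF F, of "1 - x" 1] x by simp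
qed

no_notation fps_nth (infixl "$" 75)

section \<open>Square sums of solutions at sampled spectral parameters\<close>

definition coef :: "real \<Rightarrow> real \<Rightarrow> 2 \<Rightarrow> real"
  where "coef b1 b2 i = (if i = 1 then b1 else b2)"

text \<open>This is \<open>i z B\<close>. Solving \<open>- i B^{-1} y' + Q y = z y + f\<close> for
  \<open>y'\<close> gives \<open>i z B y - i B Q y + i B f\<close>.\<close>

definition diagA :: "real \<Rightarrow> real \<Rightarrow> complex \<Rightarrow> complex^2^2"
  where "diagA b1 b2 z = (\<chi> i j. if i = j then \<i> * of_real (coef b1 b2 i) * z else 0)"

lemma diagA_nth [simp]: "(diagA b1 b2 z *v v) $ i = \<i> * of_real (coef b1 b2 i) * z * v $ i"
  by (simp add: diagA_def matrix_vector_mult_def if_distrib[of "\<lambda>x. x * _"] sum.delta cong: if_cong)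

lemma norm_C2_le: "norm (v :: complex^2) \<le> norm (v $ 1) + norm (v $ 2)"
  using L2_set_le_sum[of UNIV "\<lambda>i. norm (v $ i)"] by (simp add: norm_vec_def sum_2)

lemma norm_le_of_eq_add: "a = b + c \<Longrightarrow> norm a \<le> norm b + norm c" for a :: "'a::real_normed_vector" by (simp add: norm_triangle_ineq)

text \<open>The integral of \<open>q * (s - u)^2\<close> is nonnegative for every real
  \<open>s\<close>; the value \<open>?J / ?P\<close> of \<open>s\<close> gives the inequality. If
  \<open>q\<close> has integral 0, the condition becomes linear in \<open>s\<close> and forces the
  mixed term to vanish.\<close>

lemma Cauchy_Schwarz_weighted:
  fixes q u :: "real \<Rightarrow> real"
  assumes q: "q integrable_on S" and qu: "(\<lambda>t. q t * u t) integrable_on S" and qu2: "(\<lambda>t. q t * (u t)\<^sup>2) integrable_on S"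
    and nn: "\<And>t. t \<in> S \<Longrightarrow> 0 \<le> q t"
  shows "(integral S (\<lambda>t. q t * u t))\<^sup>2 \<le> integral S q * integral S (\<lambda>t. q t * (u t)\<^sup>2)"
proof -
  let ?P = "integral S q" and ?J = "integral S (\<lambda>t. q t * u t)" and ?R = "integral S (\<lambda>t. q t * (u t)\<^sup>2)"
  have P0: "0 \<le> ?P" by (rule hk_integral_nonneg[OF q nn])
  have R0: "0 \<le> ?R" by (rule hk_integral_nonneg[OF qu2]) (use nn in auto)
  have key: "2 * s * ?J \<le> s\<^sup>2 * ?P + ?R" for s
  proof -
    have "2 * s * ?J = integral S (\<lambda>t. 2 * s * (q t * u t))" by simp
    also have "\<dots> \<le> integral S (\<lambda>t. s\<^sup>2 * q t + q t * (u t)\<^sup>2)"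
    proof (rule integral_le)
      show "(\<lambda>t. 2 * s * (q t * u t)) integrable_on S" by (intro integrable_on_mult_right qu)
      show "(\<lambda>t. s\<^sup>2 * q t + q t * (u t)\<^sup>2) integrable_on S" by (intro integrable_add integrable_on_mult_right q qu2)
      fix t assume "t \<in> S"
      then have "0 \<le> q t * (s - u t)\<^sup>2" using nn by auto
      then show "2 * s * (q t * u t) \<le> s\<^sup>2 * q t + q t * (u t)\<^sup>2" by (simp add: power2_eq_square algebra_simps)
    qed
    also have "\<dots> = s\<^sup>2 * ?P + ?R" by (subst hk_integral_add) (auto intro: integrable_on_mult_right q qu2)
    finally show ?thesis .
  qed
  show ?thesis
  proof (cases "?P = 0")
    case True
    have "?J = 0"
    proof (rule ccontr)
      assume "?J \<noteq> 0"
      then have "2 * ((?R + 1) / ?J) * ?J = 2 * (?R + 1)" by simp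
      then show False using key[of "(?R + 1) / ?J"] True R0 by simp
    qed
    then show ?thesis using True by simp
  next
    case False
    then have "?P > 0" using P0 by simp
    then show ?thesis using key[of "?J / ?P"] by (simp add: field_simps power2_eq_square)
  qed
qed

lemma absint_comp:
  fixes f :: curve
  assumes "f absolutely_integrable_on S" shows "(\<lambda>t. f t $ i) absolutely_integrable_on S"
  using absolutely_integrable_linear[OF assms bounded_linear_vec_nth[of i]] by (simp add: o_def)

lemma absint_norm: "f absolutely_integrable_on S \<Longrightarrow> (\<lambda>t. norm (f t)) absolutely_integrable_on S" for f :: "real \<Rightarrow> 'b::euclidean_space"
  using absolutely_integrable_norm[where f=f and S=S] by (simp add: o_def)

lemma square_integrable_comp:
  assumes "square_integrable F"
  shows "(\<lambda>t. F t $ i) absint" "(\<lambda>t. (norm (F t $ i))\<^sup>2) absint"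
    "integral {0..1} (\<lambda>t. (norm (F t $ i))\<^sup>2) \<le> norm_sq F"
proof -
  show 1: "(\<lambda>t. F t $ i) absint" by (rule absint_comp[OF square_integrable_imp_absint[OF assms]])
  have i2: "(\<lambda>t. (norm (F t))\<^sup>2) integrable_on {0..1}" using square_integrable_norm2[OF assms] absint_integrable by blast
  have le: "(norm (F t $ i))\<^sup>2 \<le> (norm (F t))\<^sup>2" for t by (intro power_mono norm_entry_le) auto
  have m: "(\<lambda>t. F t $ i) \<in> borel_measurable unit_leb" using 1 by (rule absolutely_integrable_imp_borel_measurable) auto
  show 2: "(\<lambda>t. (norm (F t $ i))\<^sup>2) absint" by (rule measurable_bounded_by_integrable_imp_absolutely_integrable[OF _ _ i2]) (use m le in auto)
  show "integral {0..1} (\<lambda>t. (norm (F t $ i))\<^sup>2) \<le> norm_sq F" by (rule integral_le[OF _ i2]) (use 2 absint_integrable le in blast)+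
qed

text \<open>The part \<open>z - m\<close> of the spectral parameter is moved to the right-hand side,
  so that variation of constants can be carried out with a prescribed frequency
  \<open>m\<close>.\<close>

lemma linear_ode_component:
  assumes "linear_ode (\<lambda>t. diagA b1 b2 z + V t) F w"
  shows "antiderivative (\<lambda>t. \<i> * of_real (coef b1 b2 i) * m * w t $ i +
      (\<i> * of_real (coef b1 b2 i) * (z - m) * w t $ i + (V t *v w t) $ i + F t $ i)) (\<lambda>t. w t $ i)"
  using antiderivative_linear[OF bounded_linear_vec_nth[of i] assms[unfolded linear_ode_def]]
  by (rule antiderivative_cong) (simp_all add: matrix_vector_mult_add_rdistrib algebra_simps)

text \<open>Variation of constants at the real frequency \<open>c * k\<close> represents each
  component of \<open>w k x\<close> by a Fourier coefficient of \<open>F\<close> on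
  \<open>{0..x}\<close> plus an error bounded by the integral of \<open>q * norm (w k)\<close>, with
  \<open>q\<close> independent of \<open>k\<close>. The squares can therefore be summed over
  \<open>k\<close> first, by Bessel's inequality, and Gronwall's lemma is applied once to the sum.
  The bounds on \<open>c\<close> make the common period of the exponentials at least 1. The constant
  is the same for all \<open>K\<close>, \<open>z\<close> and \<open>x\<close>.\<close>

theorem bessel_gronwall:
  assumes b: "b1 \<noteq> 0" "b2 \<noteq> 0" and c: "c > 0" "\<bar>b1\<bar> * c \<le> 2 * pi" "\<bar>b2\<bar> * c \<le> 2 * pi"
    and V: "V absint" and M: "0 \<le> M"
  obtains C where "0 \<le> C" "\<And>F K z w x. square_integrable F \<Longrightarrow> finite (K :: int set) \<Longrightarrow> (\<And>k. k \<in> K \<Longrightarrow> norm (z k - of_real (c * of_int k)) \<le> M) \<Longrightarrow>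
    (\<And>k. k \<in> K \<Longrightarrow> linear_ode (\<lambda>t. diagA b1 b2 (z k) + V t) F (w k)) \<Longrightarrow> (\<And>k. k \<in> K \<Longrightarrow> w k 0 = 0) \<Longrightarrow> x \<in> {0..1} \<Longrightarrow> (\<Sum>k\<in>K. (norm (w k x))\<^sup>2) \<le> C * norm_sq F"
proof -
  define \<beta> where "\<beta> = \<bar>b1\<bar> + \<bar>b2\<bar>"
  define q where "q t = \<beta> * M + norm (V t)" for t
  have b0: "\<beta> \<ge> 0" "\<bar>coef b1 b2 i\<bar> \<le> \<beta>" for i by (auto simp: \<beta>_def coef_def)
  have nV: "(\<lambda>t. norm (V t)) absint" by (rule absint_norm[OF V])
  have q: "q absint" unfolding q_def[abs_def] by (intro set_integral_add nV) simp
  have q0: "0 \<le> q t" for t using b0 M by (simp add: q_def)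
  define P where "P = integral {0..1} q"
  have P0: "0 \<le> P" unfolding P_def by (intro hk_integral_nonneg absint_sub(1)[OF q]) (auto simp: q0)
  define T where "T i = 2 * pi / \<bar>coef b1 b2 i * c\<bar>" for i
  have T0: "0 \<le> T i" for i by (simp add: T_def)
  \<comment> \<open>The 3 comes from squaring a sum of three terms, and 12 is 3 times the square of
    2, as the error occurs in both components. One factor \<open>P\<close> stems from the
    Cauchy-Schwarz inequality, the other from Gronwall's lemma.\<close>
  define C where "C = 3 * (T 1 + T 2) * exp (12 * P * P)"
  show ?thesis
  proof (rule that[of C])
    show "0 \<le> C" by (simp add: C_def T0)
    fix F K z w x
    assume F: "square_integrable F" and K: "finite (K :: int set)"
      and z: "\<And>k. k \<in> K \<Longrightarrow> norm (z k - of_real (c * of_int k)) \<le> M"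
      and w: "\<And>k. k \<in> K \<Longrightarrow> linear_ode (\<lambda>t. diagA b1 b2 (z k) + V t) F (w k)"
      and w0: "\<And>k. k \<in> K \<Longrightarrow> w k 0 = 0" and x: "x \<in> {0..1 :: real}"
    define L where "L = norm_sq F"
    define a where "a k i x = norm (integral {0..x} (\<lambda>t. exp (- (\<i> * of_real (coef b1 b2 i * c * of_int k * t))) * F t $ i))" for k :: int and i x
    have cw: "continuous_on {0..1} (w k)" if "k \<in> K" for k using w[OF that] unfolding linear_ode_def by (rule antiderivative_continuous)
    have qw: "(\<lambda>t. q t * norm (w k t)) absint" if "k \<in> K" for k
      by (rule absint_bilinear_continuous[OF bounded_bilinear_mult q]) (intro continuous_intros cw that)
    have qw2: "(\<lambda>t. q t * (norm (w k t))\<^sup>2) absint" if "k \<in> K" for k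
      by (rule absint_bilinear_continuous[OF bounded_bilinear_mult q]) (intro continuous_intros cw that)
    have bes: "(\<Sum>k\<in>K. (a k i x)\<^sup>2) \<le> T i * L" if x: "x \<in> {0..1}" for i x
    proof -
      have "(\<Sum>k\<in>K. (a k i x)\<^sup>2) \<le> T i * integral {0..1} (\<lambda>t. (norm (F t $ i))\<^sup>2)" unfolding a_def T_def
      proof (rule bessel_exponentials[OF _ _ K x square_integrable_comp(1,2)[OF F]])
        show "coef b1 b2 i * c \<noteq> 0" using b c by (simp add: coef_def)
        show "\<bar>coef b1 b2 i * c\<bar> \<le> 2 * pi" using c by (simp add: coef_def abs_mult)
      qed
      also have "\<dots> \<le> T i * L" unfolding L_def by (intro mult_left_mono square_integrable_comp(3)[OF F] T0)
      finally show ?thesis .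
    qed
    have comp: "norm (w k x $ i) \<le> a k i x + integral {0..x} (\<lambda>t. q t * norm (w k t))" if k: "k \<in> K" and x: "x \<in> {0..1}" for k i x
    proof -
      let ?m = "of_real (c * of_int k) :: complex"
      let ?\<mu> = "\<i> * of_real (coef b1 b2 i) * ?m"
      let ?E = "\<lambda>t. exp (?\<mu> * (of_real x - of_real t))" and ?H = "\<lambda>t. \<i> * of_real (coef b1 b2 i) * (z k - ?m) * w k t $ i + (V t *v w k t) $ i"
      have A: "antiderivative (\<lambda>t. ?\<mu> * w k t $ i + (?H t + F t $ i)) (\<lambda>t. w k t $ i)" by (rule linear_ode_component[OF w[OF k]])
      note voc = variation_of_constants[OF A x, unfolded of_real_diff]
      have n1: "norm (?E t) = 1" for t by (simp add: norm_exp_eq_Re)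
      have eF: "(\<lambda>t. ?E t * F t $ i) absint" using absint_bilinear_continuous[OF bounded_bilinear_mult square_integrable_comp(1)[OF F], of ?E i]
        by (simp add: mult.commute continuous_intros)
      have eH: "(\<lambda>t. ?E t * ?H t) absint" using set_integral_diff(1)[OF voc(2) eF] by (simp add: distrib_left)
      have "w k x $ i = integral {0..x} (\<lambda>t. ?E t * (?H t + F t $ i))" using voc(1) w0[OF k] by simp
      also have "\<dots> = integral {0..x} (\<lambda>t. ?E t * ?H t) + integral {0..x} (\<lambda>t. ?E t * F t $ i)"
      proof -
        have "(\<lambda>t. ?E t * ?H t) integrable_on {0..x}" by (rule absint_sub(1)[OF eH]) (use x in auto)
        moreover have "(\<lambda>t. ?E t * F t $ i) integrable_on {0..x}" by (rule absint_sub(1)[OF eF]) (use x in auto)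
        ultimately show ?thesis using hk_integral_add by (simp only: distrib_left)
      qed
      finally have "norm (w k x $ i) \<le> norm (integral {0..x} (\<lambda>t. ?E t * ?H t)) + norm (integral {0..x} (\<lambda>t. ?E t * F t $ i))"
        by (rule norm_le_of_eq_add)
      also have "norm (integral {0..x} (\<lambda>t. ?E t * F t $ i)) = a k i x"
      proof -
        have "?E t * F t $ i = exp (?\<mu> * of_real x) * (exp (- (\<i> * of_real (coef b1 b2 i * c * of_int k * t))) * F t $ i)" for t
        proof -
          have "?E t = exp (?\<mu> * of_real x) * exp (- (\<i> * of_real (coef b1 b2 i * c * of_int k * t)))"
            unfolding exp_add[symmetric] by (simp add: algebra_simps)
          then show ?thesis by (simp only: mult.assoc)
        qed
        then have "integral {0..x} (\<lambda>t. ?E t * F t $ i) =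
          exp (?\<mu> * of_real x) * integral {0..x} (\<lambda>t. exp (- (\<i> * of_real (coef b1 b2 i * c * of_int k * t))) * F t $ i)"
          by (simp only: integral_mult_right)
        then show ?thesis using n1[of 0] by (simp add: a_def norm_mult)
      qed
      also have "norm (integral {0..x} (\<lambda>t. ?E t * ?H t)) \<le> integral {0..x} (\<lambda>t. q t * norm (w k t))"
      proof (rule integral_norm_bound_integral)
        show "(\<lambda>t. ?E t * ?H t) integrable_on {0..x}" by (rule absint_sub(1)[OF eH]) (use x in auto)
        show "(\<lambda>t. q t * norm (w k t)) integrable_on {0..x}" by (rule absint_sub(1)[OF qw[OF k]]) (use x in auto)
        fix t
        have "norm (?E t * ?H t) = norm (?H t)" by (simp only: norm_mult n1)
        also have "\<dots> \<le> norm (\<i> * of_real (coef b1 b2 i) * (z k - ?m) * w k t $ i) + norm ((V t *v w k t) $ i)" by (rule norm_triangle_ineq)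
        also have "\<dots> \<le> \<beta> * M * norm (w k t) + norm (V t) * norm (w k t)"
        proof (rule add_mono)
          have "norm (\<i> * of_real (coef b1 b2 i) * (z k - ?m) * w k t $ i) = \<bar>coef b1 b2 i\<bar> * norm (z k - ?m) * norm (w k t $ i)"
            by (simp add: norm_mult)
          also have "\<dots> \<le> \<beta> * M * norm (w k t)" using b0 M z[OF k] by (intro mult_mono norm_entry_le) auto
          finally show "norm (\<i> * of_real (coef b1 b2 i) * (z k - ?m) * w k t $ i) \<le> \<beta> * M * norm (w k t)" .
          show "norm ((V t *v w k t) $ i) \<le> norm (V t) * norm (w k t)" by (rule order_trans[OF norm_entry_le norm_matrix_vector_le])
        qed
        finally show "norm (?E t * ?H t) \<le> q t * norm (w k t)" by (simp add: q_def algebra_simps)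
      qed
      finally show ?thesis by simp
    qed
    have sq: "(norm (w k x))\<^sup>2 \<le> 3 * (a k 1 x)\<^sup>2 + 3 * (a k 2 x)\<^sup>2 + 12 * P * integral {0..x} (\<lambda>t. q t * (norm (w k t))\<^sup>2)"
      if k: "k \<in> K" and x: "x \<in> {0..1}" for k x
    proof -
      let ?J = "integral {0..x} (\<lambda>t. q t * norm (w k t))"
      have "norm (w k x) \<le> a k 1 x + a k 2 x + 2 * ?J" using norm_C2_le[of "w k x"] comp[OF k x, of 1] comp[OF k x, of 2] by linarith
      then have "(norm (w k x))\<^sup>2 \<le> (a k 1 x + a k 2 x + 2 * ?J)\<^sup>2" by (intro power_mono) auto
      also have "\<dots> \<le> 3 * (a k 1 x)\<^sup>2 + 3 * (a k 2 x)\<^sup>2 + 3 * (2 * ?J)\<^sup>2"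
      proof -
        have "0 \<le> (u - v)\<^sup>2 + (u - s)\<^sup>2 + (v - s)\<^sup>2" for u v s :: real by simp
        then have "(u + v + s)\<^sup>2 \<le> 3 * u\<^sup>2 + 3 * v\<^sup>2 + 3 * s\<^sup>2" for u v s :: real by (simp add: power2_eq_square algebra_simps)
        then show ?thesis .
      qed
      also have "3 * (2 * ?J)\<^sup>2 = 12 * ?J\<^sup>2" by (simp add: power_mult_distrib)
      also have "?J\<^sup>2 \<le> integral {0..x} q * integral {0..x} (\<lambda>t. q t * (norm (w k t))\<^sup>2)"
        by (rule Cauchy_Schwarz_weighted) (use x q0 in \<open>auto intro!: absint_sub(1)[OF q] absint_sub(1)[OF qw[OF k]] absint_sub(1)[OF qw2[OF k]]\<close>)
      also have "\<dots> \<le> P * integral {0..x} (\<lambda>t. q t * (norm (w k t))\<^sup>2)" unfolding P_def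
      proof (rule mult_right_mono)
        show "integral {0..x} q \<le> integral {0..1} q" by (rule integral_subset_le) (use x q0 in \<open>auto intro!: absint_sub(1)[OF q]\<close>)
        show "0 \<le> integral {0..x} (\<lambda>t. q t * (norm (w k t))\<^sup>2)" by (rule hk_integral_nonneg) (use x q0 in \<open>auto intro!: absint_sub(1)[OF qw2[OF k]]\<close>)
      qed
      finally show ?thesis by (simp add: mult.assoc)
    qed
    define S where "S x = (\<Sum>k\<in>K. (norm (w k x))\<^sup>2)" for x
    have "S x \<le> (3 * (T 1 + T 2) * L) * exp (integral {0..x} (\<lambda>t. 12 * P * q t))"
    proof (rule Gronwall[OF _ _ _ _ x])
      show "(\<lambda>t. 12 * P * q t) absint" using q by (rule set_integrable_mult_right)
      show "0 \<le> 12 * P * q t" for t using P0 q0 by simp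
      show "continuous_on {0..1} S" unfolding S_def by (intro continuous_intros cw)
      fix x :: real assume x: "x \<in> {0..1}"
      have "S x \<le> (\<Sum>k\<in>K. 3 * (a k 1 x)\<^sup>2 + 3 * (a k 2 x)\<^sup>2 + 12 * P * integral {0..x} (\<lambda>t. q t * (norm (w k t))\<^sup>2))"
        unfolding S_def by (intro sum_mono sq x)
      also have "\<dots> = 3 * (\<Sum>k\<in>K. (a k 1 x)\<^sup>2) + 3 * (\<Sum>k\<in>K. (a k 2 x)\<^sup>2) + 12 * P * (\<Sum>k\<in>K. integral {0..x} (\<lambda>t. q t * (norm (w k t))\<^sup>2))"
        by (simp add: sum.distrib sum_distrib_left)
      also have "(\<Sum>k\<in>K. integral {0..x} (\<lambda>t. q t * (norm (w k t))\<^sup>2)) = integral {0..x} (\<lambda>t. q t * S t)" unfolding S_def sum_distrib_left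
        by (rule integral_sum[symmetric]) (use x K in \<open>auto intro!: absint_sub(1)[OF qw2]\<close>)
      also have "12 * P * integral {0..x} (\<lambda>t. q t * S t) = integral {0..x} (\<lambda>t. 12 * P * q t * S t)"
        by (simp only: mult.assoc[of "12 * P"] integral_mult_right)
      also have "3 * (\<Sum>k\<in>K. (a k 1 x)\<^sup>2) + 3 * (\<Sum>k\<in>K. (a k 2 x)\<^sup>2) \<le> 3 * (T 1 + T 2) * L"
        using bes[OF x, of 1] bes[OF x, of 2] by (simp add: algebra_simps)
      finally show "S x \<le> 3 * (T 1 + T 2) * L + integral {0..x} (\<lambda>t. 12 * P * q t * S t)" by simp
    qed
    also have "\<dots> \<le> (3 * (T 1 + T 2) * L) * exp (12 * P * P)"
    proof (rule mult_left_mono)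
      have "integral {0..x} (\<lambda>t. 12 * P * q t) = 12 * P * integral {0..x} q" by simp
      also have "\<dots> \<le> 12 * P * P" unfolding P_def
        by (rule mult_left_mono[OF integral_subset_le]) (use x q0 P0 in \<open>auto simp: P_def intro!: absint_sub(1)[OF q]\<close>)
      finally show "exp (integral {0..x} (\<lambda>t. 12 * P * q t)) \<le> exp (12 * P * P)" by simp
      have "0 \<le> L" unfolding L_def by (rule hk_integral_nonneg) (use square_integrable_norm2[OF F] absint_integrable in auto)
      then show "0 \<le> 3 * (T 1 + T 2) * L" by (simp add: T0)
    qed
    finally show "(\<Sum>k\<in>K. (norm (w k x))\<^sup>2) \<le> C * norm_sq F" by (simp add: S_def C_def L_def mult_ac)
  qed
qed

text \<open>In the strip the exponentials of the diagonal part have modulus at most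
  \<open>exp (\<beta> * h)\<close>, whatever the real part of \<open>z\<close>. After variation of
  constants, Gronwall's lemma sees only \<open>V\<close>, so the constant is uniform in the
  strip.\<close>

theorem strip_bound:
  assumes V: "V absint" and h: "0 \<le> h"
  obtains C where "0 \<le> C" "\<And>F z w x. F absint \<Longrightarrow> \<bar>Im z\<bar> \<le> h \<Longrightarrow>
    linear_ode (\<lambda>t. diagA b1 b2 z + V t) F w \<Longrightarrow> x \<in> {0..1} \<Longrightarrow>
    norm (w x) \<le> C * (norm (w 0) + norm_L1 F)"
proof -
  define \<beta> where "\<beta> = \<bar>b1\<bar> + \<bar>b2\<bar>"
  have b0: "\<beta> \<ge> 0" "\<bar>coef b1 b2 i\<bar> \<le> \<beta>" for i by (auto simp: \<beta>_def coef_def)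
  define D where "D = 2 * exp (\<beta> * h)"
  have D0: "D \<ge> 0" by (simp add: D_def)
  have nV: "(\<lambda>t. norm (V t)) absint" by (rule absint_norm[OF V])
  define C where "C = D * exp (integral {0..1} (\<lambda>t. D * norm (V t)))"
  show ?thesis
  proof (rule that[of C])
    show "0 \<le> C" by (simp add: C_def D0)
    fix F z w x
    assume F: "F absint" and z: "\<bar>Im z\<bar> \<le> h"
      and w: "linear_ode (\<lambda>t. diagA b1 b2 z + V t) F w" and x: "x \<in> {0..1 :: real}"
    define L where "L = norm_L1 F"
    have L0: "0 \<le> L" unfolding L_def by (intro hk_integral_nonneg absint_sub(3)[OF F]) auto
    have cw: "continuous_on {0..1} w" using w unfolding linear_ode_def by (rule antiderivative_continuous)
    have Vw: "(\<lambda>t. norm (V t) * norm (w t)) absint" by (rule absint_bilinear_continuous[OF bounded_bilinear_mult nV]) (intro continuous_intros cw)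
    have "norm (w x) \<le> (D * (norm (w 0) + L)) * exp (integral {0..x} (\<lambda>t. D * norm (V t)))"
    proof (rule Gronwall[OF _ _ _ _ x])
      show "(\<lambda>t. D * norm (V t)) absint" using nV by (rule set_integrable_mult_right)
      show "0 \<le> D * norm (V t)" for t using D0 by simp
      show "continuous_on {0..1} (\<lambda>x. norm (w x))" by (intro continuous_intros cw)
      fix x :: real assume x: "x \<in> {0..1}"
      let ?I = "integral {0..x} (\<lambda>t. norm (V t) * norm (w t))"
      have comp: "norm (w x $ i) \<le> exp (\<beta> * h) * (norm (w 0) + L + ?I)" for i
      proof -
        let ?\<mu> = "\<i> * of_real (coef b1 b2 i) * z"
        let ?E = "\<lambda>t. exp (?\<mu> * (of_real x - of_real t))"
        have A: "antiderivative (\<lambda>t. ?\<mu> * w t $ i + ((V t *v w t) $ i + F t $ i)) (\<lambda>t. w t $ i)" using linear_ode_component[OF w, of i z] by simp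
        note voc = variation_of_constants[OF A x, unfolded of_real_diff]
        have ne: "norm (exp (?\<mu> * of_real s)) \<le> exp (\<beta> * h)" if "0 \<le> s" "s \<le> 1" for s
        proof -
          have "norm (exp (?\<mu> * of_real s)) = exp (- (coef b1 b2 i * Im z * s))" by (simp add: norm_exp_eq_Re)
          also have "\<dots> \<le> exp (\<beta> * h)"
          proof -
            have "- (coef b1 b2 i * Im z * s) \<le> \<bar>coef b1 b2 i\<bar> * \<bar>Im z\<bar> * \<bar>s\<bar>" using abs_ge_minus_self[of "coef b1 b2 i * Im z * s"] by (simp add: abs_mult)
            also have "\<dots> \<le> \<beta> * h * 1" using that b0 z h by (intro mult_mono) auto
            finally show ?thesis by simp
          qed
          finally show ?thesis .
        qed
        have "norm (w x $ i) \<le> norm (exp (?\<mu> * of_real x) * w 0 $ i) + norm (integral {0..x} (\<lambda>t. ?E t * ((V t *v w t) $ i + F t $ i)))"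
          by (rule norm_le_of_eq_add[OF voc(1)])
        also have "norm (exp (?\<mu> * of_real x) * w 0 $ i) \<le> exp (\<beta> * h) * norm (w 0)"
          unfolding norm_mult using x by (intro mult_mono ne norm_entry_le) auto
        also have "norm (integral {0..x} (\<lambda>t. ?E t * ((V t *v w t) $ i + F t $ i)))
            \<le> integral {0..x} (\<lambda>t. exp (\<beta> * h) * (norm (V t) * norm (w t) + norm (F t)))"
        proof (rule integral_norm_bound_integral)
          show "(\<lambda>t. ?E t * ((V t *v w t) $ i + F t $ i)) integrable_on {0..x}" by (rule absint_sub(1)[OF voc(2)]) (use x in auto)
          show "(\<lambda>t. exp (\<beta> * h) * (norm (V t) * norm (w t) + norm (F t))) integrable_on {0..x}"
            using x by (intro integrable_on_mult_right integrable_add absint_sub(1)[OF Vw] absint_sub(3)[OF F]) auto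
          fix t assume t: "t \<in> {0..x}"
          have "norm ((V t *v w t) $ i + F t $ i) \<le> norm (V t) * norm (w t) + norm (F t)"
            by (intro norm_triangle_le add_mono order_trans[OF norm_entry_le norm_matrix_vector_le] norm_entry_le)
          then show "norm (?E t * ((V t *v w t) $ i + F t $ i)) \<le> exp (\<beta> * h) * (norm (V t) * norm (w t) + norm (F t))"
            unfolding norm_mult using ne[of "x - t"] t x by (intro mult_mono) auto
        qed
        also have "\<dots> = exp (\<beta> * h) * (?I + integral {0..x} (\<lambda>t. norm (F t)))" unfolding integral_mult_right using x
          by (subst hk_integral_add) (auto intro!: absint_sub(1)[OF Vw] absint_sub(3)[OF F])
        also have "\<dots> \<le> exp (\<beta> * h) * (?I + L)"
          unfolding L_def by (intro mult_left_mono add_left_mono integral_subset_le) (use x in \<open>auto intro!: absint_sub(3)[OF F]\<close>)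
        finally show ?thesis by (simp add: algebra_simps)
      qed
      have "norm (w x) \<le> D * (norm (w 0) + L + ?I)" using norm_C2_le[of "w x"] comp[of 1] comp[of 2] by (simp add: D_def)
      also have "\<dots> = D * (norm (w 0) + L) + integral {0..x} (\<lambda>t. D * norm (V t) * norm (w t))"
        by (simp only: mult.assoc integral_mult_right distrib_left)
      finally show "norm (w x) \<le> D * (norm (w 0) + L) + integral {0..x} (\<lambda>t. D * norm (V t) * norm (w t))" .
    qed
    also have "\<dots> \<le> (D * (norm (w 0) + L)) * exp (integral {0..1} (\<lambda>t. D * norm (V t)))"
    proof (rule mult_left_mono)
      have "integral {0..x} (\<lambda>t. D * norm (V t)) \<le> integral {0..1} (\<lambda>t. D * norm (V t))"
        by (rule integral_subset_le) (use x D0 in \<open>auto intro!: integrable_on_mult_right absint_sub(3)[OF V]\<close>)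
      then show "exp (integral {0..x} (\<lambda>t. D * norm (V t))) \<le> exp (integral {0..1} (\<lambda>t. D * norm (V t)))" by simp
    qed (simp add: D0 L0)
    finally show "norm (w x) \<le> C * (norm (w 0) + norm_L1 F)" by (simp add: C_def L_def mult_ac)
  qed
qed

section \<open>The boundary value problem\<close>

lemma reverse_integral:
  fixes f :: "real \<Rightarrow> 'b::euclidean_space"
  assumes f: "f absint"
  shows "(\<lambda>t. f (1 - t)) absint" "integral {0..1} (\<lambda>t. f (1 - t)) = integral {0..1} f"
proof -
  have A: "antiderivative (\<lambda>t. - f (1 - t)) (\<lambda>t. integral {0..1 - t} f)" using antiderivative_reverse[OF antiderivative_integral[OF f, of 0]] by simp
  have "(\<lambda>t. - (- f (1 - t))) absint"
    using absolutely_integrable_linear[OF antiderivativeD(1)[OF A] bounded_linear_minus[OF bounded_linear_ident]] by (simp add: o_def)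
  then show "(\<lambda>t. f (1 - t)) absint" by simp
  show "integral {0..1} (\<lambda>t. f (1 - t)) = integral {0..1} f" using antiderivativeD(2)[OF A, of 1] by simp
qed

text \<open>The part of \<open>v\<close> above the level \<open>K\<close> is small in mean, and the
  part below it is damped by the exponential, whose integral is at most \<open>1 / \<eta>\<close>.
  In this way a coefficient that is only summable becomes small for large spectral
  parameters.\<close>

lemma decay_forward:
  fixes u G :: "real \<Rightarrow> complex" and v g :: "real \<Rightarrow> real"
  assumes u: "antiderivative (\<lambda>t. \<mu> * u t + G t) u" and \<mu>: "Re \<mu> \<le> - \<eta>" and \<eta>: "\<eta> > 0"
    and G: "\<And>t. t \<in> {0..1} \<Longrightarrow> norm (G t) \<le> N * v t + g t" and N: "0 \<le> N"
    and v: "v absint" and g: "g absint" "\<And>t. t \<in> {0..1} \<Longrightarrow> 0 \<le> g t"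
    and K: "0 \<le> K" "(\<lambda>t. max 0 (v t - K)) absint" "integral {0..1} (\<lambda>t. max 0 (v t - K)) \<le> \<epsilon>"
    and x: "x \<in> {0..1}"
  shows "norm (u x) \<le> exp (- \<eta> * x) * norm (u 0) + N * (\<epsilon> + K / \<eta>) + integral {0..1} g"
proof -
  note voc = variation_of_constants[OF u x, unfolded of_real_diff]
  let ?m = "\<lambda>t. max 0 (v t - K)"
  have ne: "norm (exp (\<mu> * of_real s)) \<le> exp (- \<eta> * s)" if "0 \<le> s" for s
  proof -
    have "Re \<mu> * s \<le> - \<eta> * s" using that \<mu> by (intro mult_right_mono) auto
    then show ?thesis by (simp add: norm_exp_eq_Re)
  qed
  have ei: "((\<lambda>t. exp (- \<eta> * (x - t))) has_integral (exp (- \<eta> * (x - x)) / \<eta> - exp (- \<eta> * (x - 0)) / \<eta>)) {0..x}"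
    by (rule fundamental_theorem_of_calculus)
      (use x \<eta> in \<open>auto intro!: derivative_eq_intros simp: has_real_derivative_iff_has_vector_derivative[symmetric]\<close>)
  have ei2: "integral {0..x} (\<lambda>t. exp (- \<eta> * (x - t))) \<le> 1 / \<eta>"
  proof -
    have "integral {0..x} (\<lambda>t. exp (- \<eta> * (x - t))) = 1 / \<eta> - exp (- \<eta> * (x - 0)) / \<eta>" using integral_unique[OF ei] by simp
    moreover have "0 \<le> exp (- \<eta> * (x - 0)) / \<eta>" using \<eta> by simp
    ultimately show ?thesis by linarith
  qed
  have int1: "?m integrable_on {0..x}" "g integrable_on {0..x}" "(\<lambda>t. exp (- \<eta> * (x - t))) integrable_on {0..x}"
    using x absint_sub(1)[OF K(2)] absint_sub(1)[OF g(1)] has_integral_integrable[OF ei] by auto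
  have "norm (u x) \<le> norm (exp (\<mu> * of_real x) * u 0) + norm (integral {0..x} (\<lambda>t. exp (\<mu> * (of_real x - of_real t)) * G t))"
    by (rule norm_le_of_eq_add[OF voc(1)])
  also have "norm (exp (\<mu> * of_real x) * u 0) \<le> exp (- \<eta> * x) * norm (u 0)" unfolding norm_mult using x by (intro mult_right_mono ne) auto
  also have "norm (integral {0..x} (\<lambda>t. exp (\<mu> * (of_real x - of_real t)) * G t))
    \<le> integral {0..x} (\<lambda>t. N * ?m t + N * K * exp (- \<eta> * (x - t)) + g t)"
  proof (rule integral_norm_bound_integral)
    show "(\<lambda>t. exp (\<mu> * (of_real x - of_real t)) * G t) integrable_on {0..x}" by (rule absint_sub(1)[OF voc(2)]) (use x in auto)
    show "(\<lambda>t. N * ?m t + N * K * exp (- \<eta> * (x - t)) + g t) integrable_on {0..x}" by (intro integrable_add integrable_on_mult_right int1)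
    fix t assume t: "t \<in> {0..x}"
    let ?e = "exp (- \<eta> * (x - t))"
    have e: "0 \<le> ?e" "?e \<le> 1" using t \<eta> by auto
    have "norm (exp (\<mu> * (of_real x - of_real t))) \<le> ?e" using ne[of "x - t"] t by simp
    then have "norm (exp (\<mu> * (of_real x - of_real t)) * G t) \<le> ?e * (N * v t + g t)" unfolding norm_mult using G[of t] t x by (intro mult_mono) auto
    also have "\<dots> \<le> ?e * (N * (?m t + K) + g t)" using e N by (intro mult_left_mono add_right_mono) auto
    also have "\<dots> = ?e * (N * ?m t) + N * K * ?e + ?e * g t" by (simp add: algebra_simps)
    also have "\<dots> \<le> 1 * (N * ?m t) + N * K * ?e + 1 * g t" using e N K(1) g(2)[of t] t x by (intro add_mono mult_right_mono) auto
    finally show "norm (exp (\<mu> * (of_real x - of_real t)) * G t) \<le> N * ?m t + N * K * ?e + g t" by simp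
  qed
  also have "\<dots> = N * integral {0..x} ?m + N * K * integral {0..x} (\<lambda>t. exp (- \<eta> * (x - t))) + integral {0..x} g"
  proof -
    have "integral {0..x} (\<lambda>t. N * ?m t + N * K * exp (- \<eta> * (x - t)) + g t)
      = integral {0..x} (\<lambda>t. N * ?m t + N * K * exp (- \<eta> * (x - t))) + integral {0..x} g"
      by (intro hk_integral_add integrable_add integrable_on_mult_right int1)
    also have "integral {0..x} (\<lambda>t. N * ?m t + N * K * exp (- \<eta> * (x - t)))
      = integral {0..x} (\<lambda>t. N * ?m t) + integral {0..x} (\<lambda>t. N * K * exp (- \<eta> * (x - t)))" by (intro hk_integral_add integrable_on_mult_right int1)
    finally show ?thesis by (simp only: integral_mult_right)
  qed
  also have "\<dots> \<le> N * \<epsilon> + N * K * (1 / \<eta>) + integral {0..1} g"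
  proof (intro add_mono mult_left_mono)
    have "integral {0..x} ?m \<le> integral {0..1} ?m" by (rule integral_subset_le) (use x in \<open>auto intro!: int1 absint_sub(1)[OF K(2)]\<close>)
    then show "integral {0..x} ?m \<le> \<epsilon>" using K(3) by linarith
    show "integral {0..x} g \<le> integral {0..1} g" by (rule integral_subset_le) (use x g(2) in \<open>auto intro!: int1 absint_sub(1)[OF g(1)]\<close>)
  qed (use ei2 N K in auto)
  finally show ?thesis by (simp add: algebra_simps)
qed

lemma decay_backward:
  fixes u G :: "real \<Rightarrow> complex" and v g :: "real \<Rightarrow> real"
  assumes u: "antiderivative (\<lambda>t. \<mu> * u t + G t) u" and \<mu>: "Re \<mu> \<ge> \<eta>" and \<eta>: "\<eta> > 0"
    and G: "\<And>t. t \<in> {0..1} \<Longrightarrow> norm (G t) \<le> N * v t + g t" and N: "0 \<le> N"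
    and v: "v absint" and g: "g absint" "\<And>t. t \<in> {0..1} \<Longrightarrow> 0 \<le> g t"
    and K: "0 \<le> K" "(\<lambda>t. max 0 (v t - K)) absint" "integral {0..1} (\<lambda>t. max 0 (v t - K)) \<le> \<epsilon>"
    and x: "x \<in> {0..1}"
  shows "norm (u x) \<le> exp (- \<eta> * (1 - x)) * norm (u 1) + N * (\<epsilon> + K / \<eta>) + integral {0..1} g"
proof -
  have R: "antiderivative (\<lambda>t. (- \<mu>) * u (1 - t) + - G (1 - t)) (\<lambda>t. u (1 - t))" using antiderivative_reverse[OF u] by simp
  have "norm (u (1 - (1 - x))) \<le> exp (- \<eta> * (1 - x)) * norm (u (1 - 0)) + N * (\<epsilon> + K / \<eta>) + integral {0..1} (\<lambda>t. g (1 - t))"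
    by (rule decay_forward[OF R _ \<eta> _ N reverse_integral(1)[OF v] reverse_integral(1)[OF g(1)] _ K(1) reverse_integral(1)[OF K(2)]])
      (use \<mu> G g(2) x K(3) reverse_integral(2)[OF K(2)] in auto)
  then show ?thesis using reverse_integral(2)[OF g(1)] by simp
qed

lemma solve_2x2_bound:
  fixes \<alpha>1 \<alpha>2 \<gamma>1 \<gamma>2 X Y :: complex
  assumes "\<alpha>1 * \<gamma>2 - \<alpha>2 * \<gamma>1 \<noteq> 0"
  shows "norm X + norm Y \<le> (norm \<alpha>1 + norm \<alpha>2 + norm \<gamma>1 + norm \<gamma>2) / norm (\<alpha>1 * \<gamma>2 - \<alpha>2 * \<gamma>1)
    * (norm (\<alpha>1 * X + \<gamma>1 * Y) + norm (\<alpha>2 * X + \<gamma>2 * Y))"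
proof -
  let ?D = "\<alpha>1 * \<gamma>2 - \<alpha>2 * \<gamma>1" and ?r = "\<alpha>1 * X + \<gamma>1 * Y" and ?s = "\<alpha>2 * X + \<gamma>2 * Y"
  have "?D * X = \<gamma>2 * ?r - \<gamma>1 * ?s" "?D * Y = \<alpha>1 * ?s - \<alpha>2 * ?r" by (simp_all add: algebra_simps)
  then have "norm ?D * norm X \<le> norm \<gamma>2 * norm ?r + norm \<gamma>1 * norm ?s"
    "norm ?D * norm Y \<le> norm \<alpha>1 * norm ?s + norm \<alpha>2 * norm ?r" by (metis norm_mult norm_triangle_ineq4)+
  then have "norm ?D * (norm X + norm Y) \<le> norm \<gamma>2 * norm ?r + norm \<gamma>1 * norm ?s + norm \<alpha>1 * norm ?s + norm \<alpha>2 * norm ?r" by (simp add: algebra_simps)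
  also have "\<dots> \<le> (norm \<alpha>1 + norm \<alpha>2 + norm \<gamma>1 + norm \<gamma>2) * (norm ?r + norm ?s)" by (simp add: algebra_simps)
  finally show ?thesis using assms by (simp add: field_simps)
qed

text \<open>Here \<open>N\<close> is the maximum of the solution, \<open>p\<close> the sum of the
  two end values from which the components decay, and \<open>w\<close> the sum of the two opposite
  end values. Smallness of \<open>\<kappa> * E\<close> and of \<open>\<delta>\<close> allows first
  \<open>p\<close> and then \<open>N\<close> to be absorbed on the left.\<close>

lemma a_priori_arithmetic:
  fixes N :: real
  assumes "N \<le> p + 2 * N * \<delta> + 2 * L" "p \<le> \<kappa> * (B + w)" "w \<le> E * p + 2 * N * \<delta> + 2 * L"
    "\<kappa> * E \<le> 1/2" "(4 * \<kappa> + 2) * \<delta> \<le> 1/2" "0 \<le> N" "0 \<le> p" "0 \<le> \<kappa>"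
  shows "N \<le> 4 * \<kappa> * B + (8 * \<kappa> + 4) * L"
proof -
  have "p \<le> \<kappa> * (B + (E * p + 2 * N * \<delta> + 2 * L))" using assms(2) mult_left_mono[OF assms(3,8)] by (simp add: algebra_simps)
  also have "\<dots> = \<kappa> * B + (\<kappa> * E) * p + \<kappa> * 2 * N * \<delta> + \<kappa> * 2 * L" by (simp add: algebra_simps)
  also have "(\<kappa> * E) * p \<le> 1/2 * p" using assms by (intro mult_right_mono)
  finally have p: "p \<le> 2 * \<kappa> * B + 4 * \<kappa> * N * \<delta> + 4 * \<kappa> * L" by simp
  have "N \<le> 2 * \<kappa> * B + ((4 * \<kappa> + 2) * \<delta>) * N + (4 * \<kappa> + 2) * L" using assms(1) p by (simp add: algebra_simps)
  also have "((4 * \<kappa> + 2) * \<delta>) * N \<le> 1/2 * N" using assms by (intro mult_right_mono)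
  finally show ?thesis by (simp add: algebra_simps)
qed

section \<open>A priori estimates far from the real axis\<close>

locale dirac_problem =
  fixes b1 b2 :: real and Q :: "real \<Rightarrow> complex^2^2" and a :: "complex^4^2"
  assumes b1: "b1 < 0" and b2: "0 < b2"
    and Q: "Q absint"
    and regular: "regular_bc a"
begin

text \<open>The matrix \<open>- i B Q\<close>, which is the potential term once the equation has
  been solved for \<open>y'\<close>.\<close>

definition V :: "real \<Rightarrow> complex^2^2" where "V t = (\<chi> i j. - (\<i> * of_real (coef b1 b2 i)) * Q t $ i $ j)"

lemma V_nth [simp]: "(V t *v v) $ i = - (\<i> * of_real (coef b1 b2 i)) * (Q t *v v) $ i"
  by (simp add: V_def matrix_vector_mult_def sum_distrib_left mult.assoc sum_negf)

lemma V_absint: "V absint"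
proof -
  have "linear (\<lambda>A :: complex^2^2. (\<chi> i j. - (\<i> * of_real (coef b1 b2 i)) * A $ i $ j) :: complex^2^2)"
    by (rule linearI) (simp_all add: vec_eq_iff algebra_simps)
  then have "bounded_linear (\<lambda>A :: complex^2^2. (\<chi> i j. - (\<i> * of_real (coef b1 b2 i)) * A $ i $ j) :: complex^2^2)"
    by (simp add: linear_conv_bounded_linear)
  from absolutely_integrable_linear[OF Q this] show ?thesis by (simp add: o_def V_def[abs_def])
qed

abbreviation D :: "complex \<Rightarrow> complex^2^2" where "D \<equiv> diagA b1 b2"

text \<open>The equation \<open>- i B\<inverse> y' + Q y - z y = f\<close>, solved for \<open>y'\<close>.\<close>

definition dsol :: "complex \<Rightarrow> curve \<Rightarrow> curve \<Rightarrow> bool"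
  where "dsol z f y \<longleftrightarrow> f absint \<and> linear_ode (\<lambda>t. D z + V t) (\<lambda>t. D 1 *v f t) y"

definition \<beta> where "\<beta> = \<bar>b1\<bar> + \<bar>b2\<bar>"

lemma \<beta>: "\<beta> > 0" "\<bar>coef b1 b2 i\<bar> \<le> \<beta>" using b1 b2 by (auto simp: \<beta>_def coef_def)

lemma D1_absint: "f absolutely_integrable_on S \<Longrightarrow> (\<lambda>t. D 1 *v f t) absolutely_integrable_on S"
  by (drule absolutely_integrable_linear[OF _ bounded_bilinear.bounded_linear_right[OF bounded_bilinear_matrix_vector, of "D 1"]]) (simp add: o_def)

lemma dsol_component:
  assumes "dsol z f y"
  shows "antiderivative (\<lambda>t. \<i> * of_real (coef b1 b2 i) * z * y t $ i + ((V t *v y t) $ i + \<i> * of_real (coef b1 b2 i) * f t $ i)) (\<lambda>t. y t $ i)"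
  using linear_ode_component[of b1 b2 z V _ y i z] assms unfolding dsol_def by fastforce

lemma dsol_continuous: "dsol z f y \<Longrightarrow> continuous_on {0..1} y" unfolding dsol_def linear_ode_def by (blast intro: antiderivative_continuous)

lemma coef_simps [simp]: "coef b1 b2 1 = b1" "coef b1 b2 2 = b2" by (simp_all add: coef_def)

text \<open>Since \<open>b1\<close> and \<open>b2\<close> have opposite signs, one component is
  damped from left to right and the other from right to left. Each is bounded by its value at the
  end where the damping starts, and regularity expresses these two values by the boundary forms and
  by the values at the opposite ends, which are exponentially smaller up to absorbable errors. The
  right-hand side is cut at a free level \<open>k\<close>, from which \<open>a_priori\<close>
  extracts both a uniform bound and decay.\<close>

theorem a_priori_split:
  obtains h C where "h > 0" "C > 0" "\<And>z f y x k \<epsilon>. h \<le> \<bar>Im z\<bar> \<Longrightarrow> dsol z f y \<Longrightarrow> x \<in> {0..1} \<Longrightarrow>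
    0 \<le> k \<Longrightarrow> (\<lambda>t. max 0 (norm (f t) - k)) absint \<Longrightarrow>
    integral {0..1} (\<lambda>t. max 0 (norm (f t) - k)) \<le> \<epsilon> \<Longrightarrow>
    norm (y x) \<le> C * (norm (boundary_form a 1 y) + norm (boundary_form a 2 y) + \<epsilon> + k / \<bar>Im z\<bar>)"
proof -
  have reg: "a $ 1 $ 1 * a $ 2 $ 4 - a $ 2 $ 1 * a $ 1 $ 4 \<noteq> 0" "a $ 1 $ 3 * a $ 2 $ 2 - a $ 2 $ 3 * a $ 1 $ 2 \<noteq> 0"
    using regular by (auto simp: regular_bc_def boundary_minor_def det_2)
  define A where "A = (\<Sum>j\<in>UNIV. \<Sum>k\<in>UNIV. norm (a $ j $ k))"
  have A: "norm (a $ j $ k) \<le> A" for j k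
  proof -
    have "norm (a $ j $ k) \<le> (\<Sum>k\<in>UNIV. norm (a $ j $ k))" by (rule member_le_sum) auto
    also have "\<dots> \<le> A" unfolding A_def by (rule member_le_sum) (auto intro: sum_nonneg)
    finally show ?thesis .
  qed
  have A0: "0 \<le> A" using A[of 1 1] norm_ge_zero order_trans by blast
  define \<kappa>1 where "\<kappa>1 = (norm (a $ 1 $ 1) + norm (a $ 2 $ 1) + norm (a $ 1 $ 4) + norm (a $ 2 $ 4)) / norm (a $ 1 $ 1 * a $ 2 $ 4 - a $ 2 $ 1 * a $ 1 $ 4)"
  define \<kappa>2 where "\<kappa>2 = (norm (a $ 1 $ 3) + norm (a $ 2 $ 3) + norm (a $ 1 $ 2) + norm (a $ 2 $ 2)) / norm (a $ 1 $ 3 * a $ 2 $ 2 - a $ 2 $ 3 * a $ 1 $ 2)"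
  define \<kappa> where "\<kappa> = (\<kappa>1 + \<kappa>2) * (1 + 2 * A) + 1"
  have \<kappa>12: "0 \<le> \<kappa>1" "0 \<le> \<kappa>2" by (auto simp: \<kappa>1_def \<kappa>2_def)
  have \<kappa>: "\<kappa> > 0" using \<kappa>12 A0 by (simp add: \<kappa>_def add_nonneg_pos)
  have \<kappa>m: "(\<kappa>1 + \<kappa>2) * s \<le> \<kappa> * s" "(\<kappa>1 + \<kappa>2) * (2 * A * s) \<le> \<kappa> * s" if "0 \<le> s" for s
  proof -
    have "(\<kappa>1 + \<kappa>2) \<le> \<kappa>" "(\<kappa>1 + \<kappa>2) * (2 * A) \<le> \<kappa>" using \<kappa>12 A0 by (auto simp: \<kappa>_def algebra_simps intro!: add_nonneg_nonneg)
    from this[THEN mult_right_mono, OF that] show "(\<kappa>1 + \<kappa>2) * s \<le> \<kappa> * s" "(\<kappa>1 + \<kappa>2) * (2 * A * s) \<le> \<kappa> * s" by (simp_all add: mult.assoc)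
  qed
  \<comment> \<open>The largest value for which \<open>a_priori_arithmetic\<close> can absorb the
    contribution of the potential.\<close>
  define \<delta> where "\<delta> = 1 / (2 * (4 * \<kappa> + 2))"
  have \<delta>: "\<delta> > 0" "(4 * \<kappa> + 2) * \<delta> \<le> 1/2" using \<kappa> by (auto simp: \<delta>_def)
  have vi: "(\<lambda>t. norm (V t)) absint" by (rule absint_norm[OF V_absint])
  obtain K where K: "0 \<le> K" "(\<lambda>x. max 0 (norm (V x) - K)) absint"
    "integral {0..1} (\<lambda>x. max 0 (norm (V x) - K)) \<le> \<delta>/2" using tail_integral_small[OF V_absint, of "\<delta>/2"] \<delta>(1) by auto
  define m where "m = min (- b1) b2"
  have m: "m > 0" using b1 b2 by (simp add: m_def)
  \<comment> \<open>Chosen so that \<open>\<eta> = m * \<bar>Im z\<bar>\<close> satisfies both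
    \<open>K / \<eta> \<le> \<delta>/2\<close> and
    \<open>\<kappa> * exp (- \<eta>) \<le> 1/2\<close>.\<close>
  define h where "h = (2 * K / \<delta> + 2 * \<kappa> + 1) / m"
  have h: "h > 0" using K(1) \<delta> \<kappa> m by (simp add: h_def add_nonneg_pos)
  define C where "C = 4 * \<kappa> + (8 * \<kappa> + 4) * (\<beta> * (1 + 1 / m))"
  show ?thesis
  proof (rule that[OF h, of C])
    show "C > 0" using \<kappa> \<beta>(1) m by (simp add: C_def add_pos_nonneg)
    fix z f y x k \<epsilon> assume z: "h \<le> \<bar>Im z\<bar>" and y: "dsol z f y" and x: "x \<in> {0..1 :: real}"
      and k: "0 \<le> k" "(\<lambda>t. max 0 (norm (f t) - k)) absint" "integral {0..1} (\<lambda>t. max 0 (norm (f t) - k)) \<le> \<epsilon>"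
    define \<eta> where "\<eta> = m * \<bar>Im z\<bar>"
    have \<eta>e: "\<eta> \<ge> 2 * K / \<delta> + 2 * \<kappa> + 1"
    proof -
      have "m * h \<le> \<eta>" unfolding \<eta>_def using z m by (intro mult_left_mono) auto
      moreover have "m * h = 2 * K / \<delta> + 2 * \<kappa> + 1" using m by (simp add: h_def)
      ultimately show ?thesis by simp
    qed
    have \<eta>0: "\<eta> > 0" using m h z by (simp add: \<eta>_def)
    have K\<eta>: "K / \<eta> \<le> \<delta>/2"
    proof -
      have "2 * K / \<delta> \<le> \<eta>" using \<kappa> \<eta>e by linarith
      then show ?thesis using \<eta>0 \<delta>(1) by (simp add: field_simps)
    qed
    have E: "\<kappa> * exp (- \<eta>) \<le> 1/2"
    proof -
      have "0 \<le> 2 * K / \<delta>" using K(1) \<delta>(1) by simp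
      then have "2 * \<kappa> \<le> \<eta>" using \<eta>e by linarith
      also have "\<dots> \<le> exp \<eta>" using exp_ge_add_one_self[of \<eta>] by linarith
      finally show ?thesis by (simp add: exp_minus field_simps)
    qed
    have \<epsilon>0: "0 \<le> \<epsilon>"
    proof -
      have "0 \<le> integral {0..1} (\<lambda>t. max 0 (norm (f t) - k))" by (rule hk_integral_nonneg) (use k(2) absint_integrable in auto)
      then show ?thesis using k(3) by linarith
    qed
    have f: "f absint" using y by (simp add: dsol_def)
    have cy: "continuous_on {0..1} y" by (rule dsol_continuous[OF y])
    have "\<exists>x\<in>{0..1}. \<forall>y'\<in>{0..1}. norm (y y') \<le> norm (y x)" by (rule continuous_attains_sup) (auto intro!: continuous_intros cy)
    then obtain x0 where x0: "x0 \<in> {0..1}" "\<And>x. x \<in> {0..1} \<Longrightarrow> norm (y x) \<le> norm (y x0)" by auto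
    define N where "N = norm (y x0)"
    have N0: "0 \<le> N" by (simp add: N_def)
    define g where "g t = \<beta> * norm (f t)" for t
    have g: "g absint" unfolding g_def[abs_def] by (rule set_integrable_mult_right[OF absint_norm[OF f]])
    define L where "L = \<beta> * (\<epsilon> + k / \<eta>)"
    \<comment> \<open>The potential acts on a solution of size at most \<open>N\<close>. Cutting
      \<open>v\<close> at the level \<open>N * K + \<beta> * k\<close> amounts to cutting
      \<open>V\<close> at \<open>K\<close> and \<open>f\<close> at \<open>k\<close>.\<close>
    define v where "v t = N * norm (V t) + g t" for t
    have v: "v absint" unfolding v_def[abs_def] by (intro set_integral_add set_integrable_mult_right vi g)
    let ?vm = "\<lambda>t. max 0 (v t - (N * K + \<beta> * k))"
    let ?bd = "\<lambda>t. N * max 0 (norm (V t) - K) + \<beta> * max 0 (norm (f t) - k)"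
    have bd: "?bd integrable_on {0..1}" using K(2) k(2) by (intro integrable_add integrable_on_mult_right) (use absint_integrable in auto)
    have vmle: "?vm t \<le> ?bd t" for t
    proof -
      have "N * norm (V t) - N * K \<le> N * max 0 (norm (V t) - K)" using N0 by (simp add: right_diff_distrib[symmetric] mult_left_mono)
      moreover have "\<beta> * norm (f t) - \<beta> * k \<le> \<beta> * max 0 (norm (f t) - k)" using \<beta>(1) by (simp add: right_diff_distrib[symmetric] mult_left_mono)
      moreover have "0 \<le> N * max 0 (norm (V t) - K)" "0 \<le> \<beta> * max 0 (norm (f t) - k)" using N0 \<beta>(1) by auto
      ultimately show ?thesis unfolding v_def g_def by linarith
    qed
    have vm: "?vm absint"
    proof (rule measurable_bounded_by_integrable_imp_absolutely_integrable[OF _ _ bd])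
      have "v \<in> borel_measurable (lebesgue_on {0..1})" by (rule absolutely_integrable_imp_borel_measurable[OF v]) simp
      then show "?vm \<in> borel_measurable (lebesgue_on {0..1})" by measurable
      show "norm (?vm t) \<le> ?bd t" for t using vmle[of t] by simp
    qed simp
    have vmi: "integral {0..1} ?vm \<le> N * (\<delta>/2) + \<beta> * \<epsilon>"
    proof -
      have "integral {0..1} ?vm \<le> integral {0..1} ?bd" by (rule integral_le[OF _ bd vmle]) (use vm absint_integrable in blast)
      also have "\<dots> = N * integral {0..1} (\<lambda>t. max 0 (norm (V t) - K)) + \<beta> * integral {0..1} (\<lambda>t. max 0 (norm (f t) - k))"
      proof -
        have "(\<lambda>t. N * max 0 (norm (V t) - K)) integrable_on {0..1}" "(\<lambda>t. \<beta> * max 0 (norm (f t) - k)) integrable_on {0..1}"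
          using K(2) k(2) absint_integrable by (auto intro!: integrable_on_mult_right)
        then show ?thesis by (subst hk_integral_add) simp_all
      qed
      also have "\<dots> \<le> N * (\<delta>/2) + \<beta> * \<epsilon>" using K(3) k(3) N0 \<beta>(1) by (intro add_mono mult_left_mono) auto
      finally show ?thesis .
    qed
    have NK: "0 \<le> N * K + \<beta> * k" using N0 K(1) \<beta>(1) k(1) by simp
    have z0: "(\<lambda>t. 0 :: real) absint" by simp
    define G where "G i t = (V t *v y t) $ i + \<i> * of_real (coef b1 b2 i) * f t $ i" for i t
    have comp: "antiderivative (\<lambda>t. (\<i> * of_real (coef b1 b2 i) * z) * y t $ i + G i t) (\<lambda>t. y t $ i)" for i
      unfolding G_def by (rule dsol_component[OF y])
    have Gb: "norm (G i t) \<le> 1 * v t + 0" if "t \<in> {0..1}" for i t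
    proof -
      have "norm (G i t) \<le> norm ((V t *v y t) $ i) + norm (\<i> * of_real (coef b1 b2 i) * f t $ i)" unfolding G_def by (rule norm_triangle_ineq)
      also have "norm ((V t *v y t) $ i) \<le> norm (V t) * norm (y t)" by (rule order_trans[OF norm_entry_le norm_matrix_vector_le])
      also have "\<dots> \<le> norm (V t) * N" unfolding N_def by (intro mult_left_mono x0 that) auto
      also have "norm (\<i> * of_real (coef b1 b2 i) * f t $ i) \<le> g t" unfolding g_def norm_mult using \<beta> by (intro mult_mono norm_entry_le) auto
      finally show ?thesis by (simp add: v_def mult.commute)
    qed
    have eps: "1 * ((N * (\<delta>/2) + \<beta> * \<epsilon>) + (N * K + \<beta> * k) / \<eta>) \<le> N * \<delta> + L"
    proof -
      have "N * (K / \<eta>) \<le> N * (\<delta>/2)" using K\<eta> N0 by (intro mult_left_mono) linarith+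
      moreover have "1 * ((N * (\<delta>/2) + \<beta> * \<epsilon>) + (N * K + \<beta> * k) / \<eta>) = N * (\<delta>/2) + N * (K / \<eta>) + L"
        by (simp add: L_def distrib_left add_divide_distrib)
      ultimately show ?thesis by simp
    qed
    have e1: "exp (- \<eta> * s) * r \<le> r" if "0 \<le> s" "0 \<le> r" for s r using that \<eta>0 by (intro mult_left_le_one_le) auto
    have fwd: "norm (y x $ i) \<le> exp (- \<eta> * x) * norm (y 0 $ i) + N * \<delta> + L" if "coef b1 b2 i * Im z \<ge> \<eta>" "x \<in> {0..1}" for i x
    proof -
      have "Re (\<i> * of_real (coef b1 b2 i) * z) \<le> - \<eta>" using that by simp
      from decay_forward[OF comp this \<eta>0 Gb zero_le_one v z0 order_refl NK vm vmi that(2)] show ?thesis using eps by simp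
    qed
    have bwd: "norm (y x $ i) \<le> exp (- \<eta> * (1 - x)) * norm (y 1 $ i) + N * \<delta> + L" if "coef b1 b2 i * Im z \<le> - \<eta>" "x \<in> {0..1}" for i x
    proof -
      have "\<eta> \<le> Re (\<i> * of_real (coef b1 b2 i) * z)" using that by simp
      from decay_backward[OF comp this \<eta>0 Gb zero_le_one v z0 order_refl NK vm vmi that(2)] show ?thesis using eps by simp
    qed
    define B where "B = norm (boundary_form a 1 y) + norm (boundary_form a 2 y)"
    have B0: "0 \<le> B" by (simp add: B_def)
    have Nb: "N \<le> norm (y x0 $ 1) + norm (y x0 $ 2)" unfolding N_def by (rule norm_C2_le)
    \<comment> \<open>\<open>i\<close> is the component damped from the right end and
      \<open>i'\<close> the one damped from the left end. \<open>c1\<close> and \<open>c2\<close>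
      are the columns of the boundary matrix that multiply their starting values, and
      \<open>\<kappa>0\<close> bounds the inverse of the matrix formed by these columns. The two
      signs of \<open>Im z\<close> exchange the roles of the components.\<close>
    have core: "N \<le> 4 * \<kappa> * B + (8 * \<kappa> + 4) * L"
      if i1: "coef b1 b2 i * Im z \<le> - \<eta>" and i2: "coef b1 b2 i' * Im z \<ge> \<eta>" and n: "N \<le> norm (y x0 $ i) + norm (y x0 $ i')"
        and bc: "\<And>j. boundary_form a j y = c1 j * y 1 $ i + c2 j * y 0 $ i' + (c3 j * y 0 $ i + c4 j * y 1 $ i')"
        and cA: "\<And>j. norm (c3 j) \<le> A" "\<And>j. norm (c4 j) \<le> A"
        and sb: "\<And>X Y. norm X + norm Y \<le> \<kappa>0 * (norm (c1 1 * X + c2 1 * Y) + norm (c1 2 * X + c2 2 * Y))"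
        and \<kappa>0: "0 \<le> \<kappa>0" "\<kappa>0 \<le> \<kappa>1 + \<kappa>2" for i i' :: 2 and c1 c2 c3 c4 :: "2 \<Rightarrow> complex" and \<kappa>0
    proof -
      define p where "p = norm (y 1 $ i) + norm (y 0 $ i')"
      define w where "w = norm (y 0 $ i) + norm (y 1 $ i')"
      have p0: "0 \<le> p" "0 \<le> w" by (simp_all add: p_def w_def)
      show ?thesis
      proof (rule a_priori_arithmetic[where p=p and w=w and \<delta>=\<delta> and E="exp (- \<eta>)"])
        show "N \<le> p + 2 * N * \<delta> + 2 * L" using n bwd[OF i1 x0(1)] fwd[OF i2 x0(1)] e1[of x0 "norm (y 0 $ i')"] e1[of "1 - x0" "norm (y 1 $ i)"] x0(1)
          by (auto simp: p_def)
        show "w \<le> exp (- \<eta>) * p + 2 * N * \<delta> + 2 * L" using bwd[OF i1, of 0] fwd[OF i2, of 1] by (simp add: p_def w_def algebra_simps)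
        have r: "norm (c1 j * y 1 $ i + c2 j * y 0 $ i') \<le> norm (boundary_form a j y) + A * w" for j
        proof -
          have "norm (c1 j * y 1 $ i + c2 j * y 0 $ i') \<le> norm (boundary_form a j y) + norm (c3 j * y 0 $ i + c4 j * y 1 $ i')"
            unfolding bc using norm_triangle_ineq4[of "c1 j * y 1 $ i + c2 j * y 0 $ i' + (c3 j * y 0 $ i + c4 j * y 1 $ i')" "c3 j * y 0 $ i + c4 j * y 1 $ i'"] by simp
          also have "norm (c3 j * y 0 $ i + c4 j * y 1 $ i') \<le> A * norm (y 0 $ i) + A * norm (y 1 $ i')"
            by (intro norm_triangle_le add_mono) (auto simp: norm_mult intro!: mult_right_mono cA)
          finally show ?thesis by (simp add: w_def algebra_simps)
        qed
        have "p \<le> \<kappa>0 * (norm (c1 1 * y 1 $ i + c2 1 * y 0 $ i') + norm (c1 2 * y 1 $ i + c2 2 * y 0 $ i'))" unfolding p_def by (rule sb)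
        also have "\<dots> \<le> \<kappa>0 * (B + 2 * A * w)" using r[of 1] r[of 2] by (intro mult_left_mono \<kappa>0) (simp add: B_def)
        also have "\<dots> \<le> (\<kappa>1 + \<kappa>2) * (B + 2 * A * w)" using \<kappa>0 B0 A0 p0 by (intro mult_right_mono) auto
        also have "\<dots> \<le> \<kappa> * (B + w)" using \<kappa>m(1)[OF B0] \<kappa>m(2)[OF p0(2)] by (simp add: algebra_simps)
        finally show "p \<le> \<kappa> * (B + w)" .
      qed (use E \<delta> N0 p0 \<kappa> in auto)
    qed
    have mz: "\<eta> \<le> (- b1) * \<bar>Im z\<bar>" "\<eta> \<le> b2 * \<bar>Im z\<bar>" unfolding \<eta>_def by (intro mult_right_mono; simp add: m_def)+
    have main: "N \<le> 4 * \<kappa> * B + (8 * \<kappa> + 4) * L"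
    proof (cases "Im z \<ge> 0")
      case True
      show ?thesis by (rule core[of 1 2 "\<lambda>j. a $ j $ 3" "\<lambda>j. a $ j $ 2" "\<lambda>j. a $ j $ 1" "\<lambda>j. a $ j $ 4" \<kappa>2])
          (use mz True Nb A \<kappa>12 solve_2x2_bound[OF reg(2)] in \<open>auto simp: boundary_form_def \<kappa>2_def\<close>)
    next
      case False
      have "norm X + norm Y \<le> \<kappa>1 * (norm (a $ 1 $ 4 * X + a $ 1 $ 1 * Y) + norm (a $ 2 $ 4 * X + a $ 2 $ 1 * Y))" for X Y
        using solve_2x2_bound[OF reg(1), of Y X] unfolding \<kappa>1_def by (simp only: add.commute)
      then show ?thesis by (intro core[of 2 1 "\<lambda>j. a $ j $ 4" "\<lambda>j. a $ j $ 1" "\<lambda>j. a $ j $ 2" "\<lambda>j. a $ j $ 3" \<kappa>1])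
          (use mz False Nb A \<kappa>12 in \<open>auto simp: boundary_form_def add.commute\<close>)
    qed
    have "norm (y x) \<le> N" unfolding N_def by (rule x0(2)[OF x])
    also have "\<dots> \<le> C * B + C * (\<epsilon> + k / \<bar>Im z\<bar>)"
    proof -
      have Iz: "\<bar>Im z\<bar> > 0" using z h by linarith
      have "\<epsilon> + k / \<eta> \<le> (1 + 1 / m) * (\<epsilon> + k / \<bar>Im z\<bar>)"
      proof -
        have "k / \<eta> = (1 / m) * (k / \<bar>Im z\<bar>)" by (simp add: \<eta>_def)
        moreover have "0 \<le> (1 / m) * \<epsilon>" "0 \<le> k / \<bar>Im z\<bar>" using m \<epsilon>0 k(1) by auto
        moreover have "(1 + 1 / m) * (\<epsilon> + k / \<bar>Im z\<bar>) = \<epsilon> + k / \<bar>Im z\<bar> + (1 / m) * \<epsilon> + (1 / m) * (k / \<bar>Im z\<bar>)"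
          by (simp add: distrib_right distrib_left add_divide_distrib)
        ultimately show ?thesis by linarith
      qed
      then have "(8 * \<kappa> + 4) * L \<le> (8 * \<kappa> + 4) * (\<beta> * ((1 + 1 / m) * (\<epsilon> + k / \<bar>Im z\<bar>)))" unfolding L_def using \<kappa> \<beta>(1) by (intro mult_left_mono) auto
      also have "\<dots> \<le> C * (\<epsilon> + k / \<bar>Im z\<bar>)"
      proof -
        have "0 \<le> \<kappa> * (\<epsilon> + k / \<bar>Im z\<bar>)" using \<kappa> \<epsilon>0 k(1) by simp
        then show ?thesis unfolding C_def by (simp add: distrib_right mult.assoc)
      qed
      finally have 1: "(8 * \<kappa> + 4) * L \<le> C * (\<epsilon> + k / \<bar>Im z\<bar>)" .
      have "4 * \<kappa> \<le> C" unfolding C_def using \<kappa> \<beta>(1) m by simp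
      from mult_right_mono[OF this B0] 1 main show ?thesis by linarith
    qed
    finally show "norm (y x) \<le> C * (norm (boundary_form a 1 y) + norm (boundary_form a 2 y) + \<epsilon> + k / \<bar>Im z\<bar>)" by (simp add: B_def algebra_simps)
  qed
qed

text \<open>The level \<open>k = 0\<close> gives the first bound. For the second, the level is
  chosen so that the excess of \<open>f\<close> over it is small in mean; with \<open>k\<close>
  fixed, \<open>k / \<bar>Im z\<bar>\<close> tends to 0.\<close>

theorem a_priori:
  obtains h C where "h > 0" "C > 0" "\<And>z f y x. h \<le> \<bar>Im z\<bar> \<Longrightarrow> dsol z f y \<Longrightarrow> x \<in> {0..1} \<Longrightarrow>
    norm (y x) \<le> C * (norm (boundary_form a 1 y) + norm (boundary_form a 2 y) + norm_L1 f)"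
    "\<And>f e. f absint \<Longrightarrow> 0 < e \<Longrightarrow> \<exists>\<tau>. \<forall>z y x. \<tau> \<le> \<bar>Im z\<bar> \<longrightarrow> dsol z f y \<longrightarrow>
      boundary_form a 1 y = 0 \<longrightarrow> boundary_form a 2 y = 0 \<longrightarrow> x \<in> {0..1} \<longrightarrow> norm (y x) \<le> e"
proof -
  obtain h C where h: "h > 0" "C > 0" and ap: "\<And>z f y x k \<epsilon>. h \<le> \<bar>Im z\<bar> \<Longrightarrow> dsol z f y \<Longrightarrow> x \<in> {0..1} \<Longrightarrow>
    0 \<le> k \<Longrightarrow> (\<lambda>t. max 0 (norm (f t) - k)) absint \<Longrightarrow>
    integral {0..1} (\<lambda>t. max 0 (norm (f t) - k)) \<le> \<epsilon> \<Longrightarrow>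
    norm (y x) \<le> C * (norm (boundary_form a 1 y) + norm (boundary_form a 2 y) + \<epsilon> + k / \<bar>Im z\<bar>)" by (rule a_priori_split) blast
  show ?thesis
  proof (rule that[OF h])
    fix z f y x assume "h \<le> \<bar>Im z\<bar>" and y: "dsol z f y" and "x \<in> {0..1::real}"
    then show "norm (y x) \<le> C * (norm (boundary_form a 1 y) + norm (boundary_form a 2 y) + norm_L1 f)"
      using ap[of z f y x 0 "norm_L1 f"] absint_norm[where f=f] by (simp add: dsol_def)
  next
    fix f :: curve and e :: real assume f: "f absint" and e: "0 < e"
    obtain k where k: "0 \<le> k" "(\<lambda>t. max 0 (norm (f t) - k)) absint"
      "integral {0..1} (\<lambda>t. max 0 (norm (f t) - k)) \<le> e / (2 * C)" using tail_integral_small[OF f, of "e / (2 * C)"] e h by auto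
    have "norm (y x) \<le> e" if z: "h + 2 * C * k / e \<le> \<bar>Im z\<bar>" and y: "dsol z f y"
      "boundary_form a 1 y = 0" "boundary_form a 2 y = 0" "x \<in> {0..1}" for z y x
    proof -
      have ck: "0 \<le> 2 * C * k / e" using h k(1) e by simp
      then have hz: "h \<le> \<bar>Im z\<bar>" using z by linarith
      have kz: "C * (k / \<bar>Im z\<bar>) \<le> e / 2"
      proof -
        have "2 * C * k / e \<le> \<bar>Im z\<bar>" "0 < \<bar>Im z\<bar>" using z h hz by linarith+
        then show ?thesis using e by (simp add: field_simps)
      qed
      have "norm (y x) \<le> C * (e / (2 * C) + k / \<bar>Im z\<bar>)" using ap[OF hz y(1,4) k] y(2,3) by simp
      also have "\<dots> = e / 2 + C * (k / \<bar>Im z\<bar>)" using h by (simp add: distrib_left)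
      finally show ?thesis using kz by linarith
    qed
    then show "\<exists>\<tau>. \<forall>z y x. \<tau> \<le> \<bar>Im z\<bar> \<longrightarrow> dsol z f y \<longrightarrow>
      boundary_form a 1 y = 0 \<longrightarrow> boundary_form a 2 y = 0 \<longrightarrow> x \<in> {0..1} \<longrightarrow> norm (y x) \<le> e" by blast
  qed
qed

end

text \<open>Common form of point evaluations, boundary forms and pairings with integrable functions.
  Linearity is required only for functions continuous on \<open>{0..1}\<close>, for which all the
  integrals exist.\<close>

definition sup_functional :: "(curve \<Rightarrow> complex) \<Rightarrow> bool"
  where "sup_functional \<psi> \<longleftrightarrow> (\<forall>y w. continuous_on {0..1} y \<longrightarrow> continuous_on {0..1} w \<longrightarrow> \<psi> (\<lambda>x. y x + w x) = \<psi> y + \<psi> w) \<and>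
    (\<forall>c y. continuous_on {0..1} y \<longrightarrow> \<psi> (\<lambda>x. c *s y x) = c * \<psi> y) \<and>
    (\<exists>B. \<forall>y s. continuous_on {0..1} y \<longrightarrow> (\<forall>x\<in>{0..1}. norm (y x) \<le> s) \<longrightarrow> norm (\<psi> y) \<le> B * s)"

lemma continuous_on_cscale [continuous_intros]:
  "continuous_on S y \<Longrightarrow> continuous_on S (\<lambda>x. c *s (y x :: complex^2))" unfolding vector_scalar_mult_def by (intro continuous_intros)

lemma sup_functional_add:
  "sup_functional \<psi> \<Longrightarrow> continuous_on {0..1} y \<Longrightarrow> continuous_on {0..1} w \<Longrightarrow> \<psi> (\<lambda>x. y x + w x) = \<psi> y + \<psi> w"
  and sup_functional_scale: "sup_functional \<psi> \<Longrightarrow> continuous_on {0..1} y \<Longrightarrow> \<psi> (\<lambda>x. c *s y x) = c * \<psi> y" unfolding sup_functional_def by blast+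

lemma sup_functional_zero: "sup_functional \<psi> \<Longrightarrow> \<psi> (\<lambda>x. 0) = 0" using sup_functional_scale[of \<psi> "\<lambda>x. 0" 0] by simp

lemma sup_functional_sum:
  assumes "sup_functional \<psi>" "\<And>i. i \<in> I \<Longrightarrow> continuous_on {0..1} (y i)"
  shows "\<psi> (\<lambda>x. \<Sum>i\<in>I. c i *s y i x) = (\<Sum>i\<in>I. c i * \<psi> (y i))" using assms(2)
proof (induction I rule: infinite_finite_induct)
  case (insert i I)
  have "\<psi> (\<lambda>x. c i *s y i x + (\<Sum>i\<in>I. c i *s y i x)) = \<psi> (\<lambda>x. c i *s y i x) + \<psi> (\<lambda>x. \<Sum>i\<in>I. c i *s y i x)"
    using insert.prems by (intro sup_functional_add[OF assms(1)] continuous_intros) auto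
  then show ?case using insert by (simp add: sup_functional_scale[OF assms(1)])
qed (simp_all add: sup_functional_zero[OF assms(1)])

text \<open>The difference of the two functions is bounded by \<open>s = 0\<close> on the interval,
  so the bound in \<open>sup_functional\<close> annihilates its image.\<close>

lemma sup_functional_cong:
  assumes "sup_functional \<psi>" "continuous_on {0..1} y" "\<And>x. x \<in> {0..1} \<Longrightarrow> y x = w x"
  shows "\<psi> y = \<psi> w"
proof -
  have cw: "continuous_on {0..1} w" using assms(2) by (rule continuous_on_eq) (use assms(3) in auto)
  obtain B where B: "\<And>y s. continuous_on {0..1} y \<Longrightarrow> (\<forall>x\<in>{0..1}. norm (y x) \<le> s) \<Longrightarrow> norm (\<psi> y) \<le> B * s"
    using assms(1) unfolding sup_functional_def by blast
  have "norm (\<psi> (\<lambda>x. y x + (-1) *s w x)) \<le> B * 0" using assms(3) by (intro B continuous_intros assms(2) cw) auto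
  then have "\<psi> (\<lambda>x. y x + (-1) *s w x) = 0" by simp
  moreover have "\<psi> (\<lambda>x. y x + (-1) *s w x) = \<psi> y + (-1) * \<psi> w"
    using sup_functional_add[OF assms(1,2) continuous_on_cscale[OF cw, of "-1"]] sup_functional_scale[OF assms(1) cw, of "-1"] by simp
  ultimately show ?thesis by simp
qed

lemma sup_functional_eval: "x \<in> {0..1} \<Longrightarrow> sup_functional (\<lambda>y. y x $ i)" unfolding sup_functional_def
  by (auto intro!: exI[of _ 1] order_trans[OF norm_entry_le])

lemma sup_functional_boundary: "sup_functional (boundary_form a j)" unfolding sup_functional_def
proof (intro conjI allI impI exI)
  fix y :: curve and s assume "\<forall>x\<in>{0..1}. norm (y x) \<le> s"
  then have s: "norm (y 0 $ i) \<le> s" "norm (y 1 $ i) \<le> s" for i by (auto intro: order_trans[OF norm_entry_le])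
  show "norm (boundary_form a j y) \<le> (norm (a $ j $ 1) + norm (a $ j $ 2) + norm (a $ j $ 3) + norm (a $ j $ 4)) * s"
    unfolding boundary_form_def distrib_right by (intro norm_triangle_le add_mono) (auto simp: norm_mult intro!: mult_left_mono s)
qed (auto simp: boundary_form_def algebra_simps)

lemma cdot_add_left: "cdot (u + v) w = cdot u w + cdot v w"
  and cdot_scale_left: "cdot (c *s u) w = c * cdot u w" by (simp_all add: cdot_def sum.distrib distrib_right sum_distrib_left mult.assoc)

lemma bounded_bilinear_cdot: "bounded_bilinear cdot"
proof
  fix u v w :: "complex^2" and r :: real
  show "cdot (u + v) w = cdot u w + cdot v w" by (rule cdot_add_left)
  show "cdot u (v + w) = cdot u v + cdot u w" by (simp add: cdot_def sum.distrib distrib_left)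
  show "cdot (r *\<^sub>R u) v = r *\<^sub>R cdot u v" by (simp add: cdot_def scaleR_sum_right)
  show "cdot u (r *\<^sub>R v) = r *\<^sub>R cdot u v" by (simp add: cdot_def scaleR_sum_right)
  show "\<exists>K. \<forall>u v. norm (cdot u v) \<le> norm u * norm v * K" by (intro exI[of _ 1]) (simp add: norm_cdot_le)
qed

lemma absint_cdot:
  fixes g y :: curve
  assumes "g absint" "continuous_on {0..1} y"
  shows "(\<lambda>x. cdot (y x) (g x)) absint" using absint_bilinear_continuous[OF bounded_bilinear.flip[OF bounded_bilinear_cdot] assms] .

definition pairing :: "curve \<Rightarrow> curve \<Rightarrow> complex"
  where "pairing g y = integral {0..1} (\<lambda>x. cdot (y x) (g x))"

lemma norm_pairing_le:
  assumes g: "g absint" and y: "continuous_on {0..1} y" "\<And>x. x \<in> {0..1} \<Longrightarrow> norm (y x) \<le> s"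
  shows "norm (pairing g y) \<le> norm_L1 g * s"
proof -
  have "norm (pairing g y) \<le> integral {0..1} (\<lambda>x. norm (g x) * s)" unfolding pairing_def
  proof (rule integral_norm_bound_integral)
    show "(\<lambda>x. cdot (y x) (g x)) integrable_on {0..1}" using absint_cdot[OF g y(1)] absint_integrable by blast
    show "(\<lambda>x. norm (g x) * s) integrable_on {0..1}" by (intro integrable_on_mult_left absint_sub(3)[OF g]) auto
    show "norm (cdot (y x) (g x)) \<le> norm (g x) * s" if "x \<in> {0..1}" for x
    proof -
      have "norm (y x) * norm (g x) \<le> s * norm (g x)" by (rule mult_right_mono[OF y(2)[OF that]]) simp
      then show ?thesis using norm_cdot_le[of "y x" "g x"] by (simp add: mult.commute)
    qed
  qed
  then show ?thesis by (simp only: integral_mult_left)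
qed

lemma sup_functional_pairing:
  assumes g: "g absint"
  shows "sup_functional (pairing g)" unfolding sup_functional_def
proof (intro conjI allI impI)
  have i: "(\<lambda>x. cdot (y x) (g x)) integrable_on {0..1}" if "continuous_on {0..1} y" for y using absint_cdot[OF g that] absint_integrable by blast
  fix y w :: curve assume "continuous_on {0..1} y" "continuous_on {0..1} w"
  then show "pairing g (\<lambda>x. y x + w x) = pairing g y + pairing g w" unfolding pairing_def cdot_add_left by (intro hk_integral_add i)
next
  show "pairing g (\<lambda>x. c *s y x) = c * pairing g y" for c y unfolding pairing_def cdot_scale_left by (rule integral_mult_right)
  show "\<exists>B. \<forall>y s. continuous_on {0..1} y \<longrightarrow> (\<forall>x\<in>{0..1}. norm (y x) \<le> s) \<longrightarrow> norm (pairing g y) \<le> B * s" using norm_pairing_le[OF g] by blast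
qed

text \<open>The factor 1/2 makes the initial error disappear geometrically while the perturbations
  tend to 0. It serves for the partial sums of the Taylor series in the spectral parameter.\<close>

lemma tendsto_zero_of_contraction:
  fixes e \<eta> :: "nat \<Rightarrow> real"
  assumes e: "\<And>n. 0 \<le> e n" "\<And>n. e (Suc n) \<le> \<eta> n + e n / 2" and \<eta>: "\<eta> \<longlonglongrightarrow> 0"
  shows "e \<longlonglongrightarrow> 0"
proof (rule LIMSEQ_I)
  fix \<epsilon> :: real assume \<epsilon>: "0 < \<epsilon>"
  obtain N where N: "\<And>n. n \<ge> N \<Longrightarrow> \<eta> n < \<epsilon>/4" using order_tendstoD(2)[OF \<eta>, of "\<epsilon>/4"] \<epsilon> unfolding eventually_sequentially by auto
  have k: "e (N + k) \<le> \<epsilon>/2 + e N * (1/2)^k" for k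
  proof (induction k)
    case (Suc k)
    have "e (N + Suc k) \<le> \<eta> (N + k) + e (N + k) / 2" using e(2)[of "N + k"] by simp
    then show ?case using N[of "N + k"] Suc by simp
  qed (use \<epsilon> in simp)
  have "(\<lambda>k. e N * (1/2)^k) \<longlonglongrightarrow> e N * 0" by (intro tendsto_intros LIMSEQ_power_zero) simp
  then obtain K where K: "\<And>k. k \<ge> K \<Longrightarrow> e N * (1/2)^k < \<epsilon>/2"
    using order_tendstoD(2)[of _ 0 sequentially "\<epsilon>/2"] \<epsilon> unfolding eventually_sequentially by fastforce
  show "\<exists>no. \<forall>n\<ge>no. norm (e n - 0) < \<epsilon>"
  proof (intro exI allI impI)
    fix n assume "n \<ge> N + K"
    then obtain k where "n = N + k" "k \<ge> K" by (metis add_leD1 le_add_diff_inverse nat_add_left_cancel_le)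
    then show "norm (e n - 0) < \<epsilon>" using k[of k] K[of k] e(1)[of n] by simp
  qed
qed

section \<open>The inhomogeneous system and its holomorphic dependence on the spectral
  parameter\<close>

context dirac_problem
begin

lemma DV_absint: "(\<lambda>t. D z + V t) absint" by (intro set_integral_add V_absint) simp

lemma dsol_exists:
  assumes "f absint"
  shows "\<exists>y. dsol z f y \<and> y 0 = c" using linear_ode_exists[OF DV_absint D1_absint[OF assms]] assms unfolding dsol_def by metis

lemma dsol_cong:
  assumes "dsol z f y" "\<And>x. x \<in> {0..1} \<Longrightarrow> f x = g x" "\<And>x. x \<in> {0..1} \<Longrightarrow> y x = w x"
  shows "dsol z g w" unfolding dsol_def linear_ode_def
proof
  show "g absint" by (rule absolutely_integrable_spike[OF _ negligible_empty, where f=f]) (use assms in \<open>auto simp: dsol_def\<close>)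
  show "antiderivative (\<lambda>t. (D z + V t) *v w t + D 1 *v g t) w"
    by (rule antiderivative_cong[OF assms(1)[unfolded dsol_def linear_ode_def, THEN conjunct2]]) (use assms(2,3) in auto)
qed

lemma dsol_add:
  assumes "dsol z f y" "dsol z g w"
  shows "dsol z (\<lambda>x. f x + g x) (\<lambda>x. y x + w x)" unfolding dsol_def linear_ode_def
proof
  show "(\<lambda>x. f x + g x) absint" using assms unfolding dsol_def by (intro set_integral_add) auto
  have "antiderivative (\<lambda>t. ((D z + V t) *v y t + D 1 *v f t) + ((D z + V t) *v w t + D 1 *v g t)) (\<lambda>x. y x + w x)"
    using assms unfolding dsol_def linear_ode_def by (intro antiderivative_add) auto
  then show "antiderivative (\<lambda>t. (D z + V t) *v (y t + w t) + D 1 *v (f t + g t)) (\<lambda>x. y x + w x)"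
    by (rule antiderivative_cong) (simp_all add: matrix_vector_right_distrib)
qed

lemma bounded_linear_cscale: "bounded_linear (\<lambda>v :: complex^2. c *s v)" by (rule bounded_linear_intro[of _ "cmod c"])
    (auto simp: vector_add_ldistrib norm_cvec_scale mult.commute vec_eq_iff)

lemma absint_cscale: "f absolutely_integrable_on S \<Longrightarrow> (\<lambda>x. c *s (f x :: complex^2)) absolutely_integrable_on S"
  by (drule absolutely_integrable_linear[OF _ bounded_linear_cscale]) (simp add: o_def)

lemma matrix_vector_cscale: "A *v (c *s v) = c *s (A *v v)" for A :: "complex^2^2"
  by (simp add: matrix_vector_mult_def vec_eq_iff sum_distrib_left mult_ac)

lemma dsol_scale:
  assumes "dsol z f y"
  shows "dsol z (\<lambda>x. c *s f x) (\<lambda>x. c *s y x)" unfolding dsol_def linear_ode_def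
proof
  show "(\<lambda>x. c *s f x) absint" using assms unfolding dsol_def by (intro absint_cscale) auto
  have "antiderivative (\<lambda>t. c *s ((D z + V t) *v y t + D 1 *v f t)) (\<lambda>x. c *s y x)"
    using assms unfolding dsol_def linear_ode_def by (intro antiderivative_linear[OF bounded_linear_cscale]) auto
  then show "antiderivative (\<lambda>t. (D z + V t) *v (c *s y t) + D 1 *v (c *s f t)) (\<lambda>x. c *s y x)"
    by (rule antiderivative_cong) (simp_all add: matrix_vector_cscale vector_add_ldistrib)
qed

lemma dsol_zero: "dsol z (\<lambda>x. 0) (\<lambda>x. 0)" unfolding dsol_def linear_ode_def by (simp add: antiderivative_def)

lemma dsol_diff:
  assumes "dsol z f y" "dsol z g w"
  shows "dsol z (\<lambda>x. f x - g x) (\<lambda>x. y x - w x)"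
proof -
  have e: "u + (-1) *s v = u - v" for u v :: "complex^2" by (simp add: vec_eq_iff)
  show ?thesis using dsol_add[OF assms(1) dsol_scale[OF assms(2), of "-1"]] unfolding e .
qed

lemma dsol_sum:
  assumes "\<And>i. i \<in> I \<Longrightarrow> dsol z (f i) (y i)"
  shows "dsol z (\<lambda>x. \<Sum>i\<in>I. c i *s f i x) (\<lambda>x. \<Sum>i\<in>I. c i *s y i x)" using assms
proof (induction I rule: infinite_finite_induct)
  case (insert i I)
  have "dsol z (\<lambda>x. c i *s f i x + (\<Sum>i\<in>I. c i *s f i x)) (\<lambda>x. c i *s y i x + (\<Sum>i\<in>I. c i *s y i x))"
    by (intro dsol_add dsol_scale insert.prems insert.IH) auto
  then show ?case using insert by simp
qed (simp_all add: dsol_zero)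

text \<open>The local form of the resolvent identity: a change of the spectral parameter is moved
  into the right-hand side.\<close>

lemma dsol_shift:
  assumes "dsol z f y"
  shows "dsol z' (\<lambda>x. f x + (z - z') *s y x) y" unfolding dsol_def linear_ode_def
proof
  have y: "continuous_on {0..1} y" by (rule dsol_continuous[OF assms])
  show "(\<lambda>x. f x + (z - z') *s y x) absint"
  proof (rule set_integral_add(1))
    show "f absint" using assms by (simp add: dsol_def)
    show "(\<lambda>x. (z - z') *s y x) absint" by (intro absolutely_integrable_continuous_real continuous_on_cscale y)
  qed
  have "(D z + V t) *v y t + D 1 *v f t = (D z' + V t) *v y t + D 1 *v (f t + (z - z') *s y t)" for t
    by (simp add: vec_eq_iff matrix_vector_mult_add_rdistrib algebra_simps)
  then show "antiderivative (\<lambda>t. (D z' + V t) *v y t + D 1 *v (f t + (z - z') *s y t)) y" using assms unfolding dsol_def linear_ode_def by simp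
qed

lemma dsol_bound:
  obtains C where "0 < C" "\<And>f y x. dsol z f y \<Longrightarrow> x \<in> {0..1} \<Longrightarrow>
    norm (y x) \<le> C * (norm (y 0) + norm_L1 f)"
proof -
  define C where "C = (1 + norm (D 1)) * exp (integral {0..1} (\<lambda>t. norm (D z + V t)))"
  show ?thesis
  proof (rule that[of C])
    show "0 < C" by (simp add: C_def add_pos_nonneg)
    fix f y x assume y: "dsol z f y" and x: "x \<in> {0..1::real}"
    have f: "f absint" using y by (simp add: dsol_def)
    let ?I = "norm_L1 f"
    have I0: "0 \<le> ?I" by (rule hk_integral_nonneg) (use absint_sub(3)[OF f] in auto)
    have "norm (y x) \<le> (norm (y 0) + integral {0..1} (\<lambda>t. norm (D 1 *v f t))) * exp (integral {0..1} (\<lambda>t. norm (D z + V t)))"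
      using y by (intro linear_ode_bound[OF DV_absint D1_absint[OF f] _ x]) (simp add: dsol_def)
    also have "\<dots> \<le> ((1 + norm (D 1)) * (norm (y 0) + ?I)) * exp (integral {0..1} (\<lambda>t. norm (D z + V t)))"
    proof (rule mult_right_mono)
      have "integral {0..1} (\<lambda>t. norm (D 1 *v f t)) \<le> integral {0..1} (\<lambda>t. norm (D 1) * norm (f t))"
        by (rule integral_le) (auto intro!: absint_sub(3)[OF D1_absint[OF f]] integrable_on_mult_right absint_sub(3)[OF f] norm_matrix_vector_le)
      also have "\<dots> = norm (D 1) * ?I" by simp
      finally have *: "integral {0..1} (\<lambda>t. norm (D 1 *v f t)) \<le> norm (D 1) * ?I" .
      then show "norm (y 0) + integral {0..1} (\<lambda>t. norm (D 1 *v f t)) \<le> (1 + norm (D 1)) * (norm (y 0) + ?I)"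
      proof -
        have "0 \<le> norm (y 0) * norm (D 1)" by simp
        moreover have "(1 + norm (D 1)) * (norm (y 0) + ?I) = norm (y 0) + ?I + norm (y 0) * norm (D 1) + norm (D 1) * ?I"
          by (simp add: algebra_simps)
        ultimately show ?thesis using I0 * by linarith
      qed
    qed simp
    finally show "norm (y x) \<le> C * (norm (y 0) + ?I)" by (simp add: C_def mult_ac)
  qed
qed

lemma dsol_unique:
  assumes "dsol z f y" "dsol z f w" "y 0 = w 0" "x \<in> {0..1}"
  shows "y x = w x"
proof -
  obtain C where "0 < C" and C: "\<And>f y x. dsol z f y \<Longrightarrow> x \<in> {0..1} \<Longrightarrow>
    norm (y x) \<le> C * (norm (y 0) + norm_L1 f)" using dsol_bound by blast
  show ?thesis using C[OF dsol_diff[OF assms(1,2)] assms(4)] assms(3) by simp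
qed

text \<open>A choice, because the equation and the initial value determine the function only on
  \<open>{0..1}\<close>.\<close>

definition sol :: "complex \<Rightarrow> complex^2 \<Rightarrow> curve \<Rightarrow> curve"
  where "sol z c f = (SOME y. dsol z f y \<and> y 0 = c)"

lemma sol:
  assumes "f absint"
  shows "dsol z f (sol z c f)" "sol z c f 0 = c" using someI_ex[OF dsol_exists[OF assms], of z c] unfolding sol_def by auto

lemma sol_continuous: "f absint \<Longrightarrow> continuous_on {0..1} (sol z c f)" by (rule dsol_continuous[OF sol(1)])

text \<open>Taylor coefficients at \<open>z\<close> of the solution whose initial value and whose
  factor of \<open>f\<close> are power series in the spectral parameter with coefficients
  \<open>c\<close> and \<open>d\<close>. The coefficient matrix is affine in the spectral parameter,
  so its expansion puts the preceding coefficient on the right-hand side.\<close>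

fun taylor_sol :: "complex \<Rightarrow> (nat \<Rightarrow> complex^2) \<Rightarrow> (nat \<Rightarrow> complex) \<Rightarrow> curve \<Rightarrow> nat \<Rightarrow> curve"
  where "taylor_sol z c d f 0 = sol z (c 0) (\<lambda>x. d 0 *s f x)"
  | "taylor_sol z c d f (Suc n) = sol z (c (Suc n)) (\<lambda>x. d (Suc n) *s f x + taylor_sol z c d f n x)"

context
  fixes f :: curve
  assumes f: "f absint"
begin

lemma taylor_sol_dsol:
  "dsol z (\<lambda>x. d n *s f x + (if n = 0 then 0 else taylor_sol z c d f (n - 1) x)) (taylor_sol z c d f n) \<and>
   taylor_sol z c d f n 0 = c n"
proof (induction n)
  case 0
  then show ?case using sol[OF absint_cscale[OF f, of "d 0"], of z "c 0"] by simp
next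
  case (Suc n)
  have "(\<lambda>x. d (Suc n) *s f x + taylor_sol z c d f n x) absint"
    using Suc by (intro set_integral_add absint_cscale f absolutely_integrable_continuous_real dsol_continuous[of z]) auto
  from sol[OF this, of z "c (Suc n)"] show ?case by simp
qed

lemma taylor_sol_continuous: "continuous_on {0..1} (taylor_sol z c d f n)" using taylor_sol_dsol[of z d n c] by (blast intro: dsol_continuous)

text \<open>The error of the partial sum of length \<open>N + 1\<close> solves the system at the
  fixed point \<open>z0\<close> with \<open>z - z0\<close> times the error of length
  \<open>N\<close> on the right, up to the errors of the series for \<open>C\<close> and
  \<open>D'\<close>. For \<open>norm (z - z0) < 1 / (2 * K)\<close>, with \<open>K\<close> from
  \<open>dsol_bound\<close> at \<open>z0\<close>, this recursion contracts by the factor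
  1/2.\<close>

lemma taylor_sol_uniform_limit:
  obtains r where "r > 0" "\<And>z c d C D'. norm (z - z0) < r \<Longrightarrow> (\<And>i. (\<lambda>n. c n $ i * (z - z0) ^ n) sums (C $ i)) \<Longrightarrow> (\<lambda>n. d n * (z - z0) ^ n) sums D' \<Longrightarrow>
    uniform_limit {0..1} (\<lambda>N x. \<Sum>n<N. (z - z0) ^ n *s taylor_sol z0 c d f n x) (sol z C (\<lambda>x. D' *s f x)) sequentially"
proof -
  obtain K where K: "0 < K" "\<And>f y x. dsol z0 f y \<Longrightarrow> x \<in> {0..1} \<Longrightarrow>
    norm (y x) \<le> K * (norm (y 0) + norm_L1 f)" using dsol_bound by blast
  show ?thesis
  proof (rule that[of "1 / (2 * K)"])
    show "0 < 1 / (2 * K)" using K by simp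
    fix z :: complex and c :: "nat \<Rightarrow> complex^2" and d and C :: "complex^2" and D' assume zr: "norm (z - z0) < 1 / (2 * K)"
      and c: "\<And>i. (\<lambda>n. c n $ i * (z - z0) ^ n) sums (C $ i)" and d: "(\<lambda>n. d n * (z - z0) ^ n) sums D'"
    let ?h = "z - z0"
    define T where "T n = taylor_sol z0 c d f n" for n
    define s where "s N x = (\<Sum>n<N. ?h ^ n *s T n x)" for N x
    define Y where "Y = sol z C (\<lambda>x. D' *s f x)"
    have Y: "dsol z (\<lambda>x. D' *s f x) Y" "Y 0 = C" unfolding Y_def by (rule sol[OF absint_cscale[OF f]])+
    have cY: "continuous_on {0..1} Y" by (rule dsol_continuous[OF Y(1)])
    have cT: "continuous_on {0..1} (T n)" for n unfolding T_def by (rule taylor_sol_continuous)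
    have cs: "continuous_on {0..1} (s N)" for N unfolding s_def by (intro continuous_intros cT)
    define dN where "dN N = (\<Sum>n<N. d n * ?h ^ n)" for N
    have sd: "dsol z0 (\<lambda>x. dN (Suc N) *s f x + ?h *s s N x) (s (Suc N))" for N
    proof -
      have "dsol z0 (\<lambda>x. \<Sum>n<Suc N. ?h ^ n *s (d n *s f x + (if n = 0 then 0 else T (n - 1) x))) (\<lambda>x. \<Sum>n<Suc N. ?h ^ n *s T n x)"
        unfolding T_def by (rule dsol_sum) (use taylor_sol_dsol in blast)
      then show ?thesis
      proof (rule dsol_cong)
        fix x
        have "(\<Sum>n<Suc N. ?h ^ n *s (d n *s f x + (if n = 0 then 0 else T (n - 1) x)))
          = (\<Sum>n<Suc N. (d n * ?h ^ n) *s f x) + (\<Sum>n<Suc N. ?h ^ n *s (if n = 0 then 0 else T (n - 1) x))"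
          by (simp add: vector_add_ldistrib sum.distrib vector_smult_assoc mult.commute del: sum.lessThan_Suc)
        also have "(\<Sum>n<Suc N. (d n * ?h ^ n) *s f x) = dN (Suc N) *s f x" by (simp add: dN_def vec_eq_iff sum_distrib_right del: sum.lessThan_Suc)
        also have "(\<Sum>n<Suc N. ?h ^ n *s (if n = 0 then 0 else T (n - 1) x)) = ?h *s s N x"
        proof -
          have "(\<Sum>n<Suc N. ?h ^ n *s (if n = 0 then 0 else T (n - 1) x)) = (\<Sum>n<N. ?h ^ Suc n *s T n x)"
            by (simp add: sum.lessThan_Suc_shift del: sum.lessThan_Suc power_Suc)
          also have "\<dots> = (\<Sum>n<N. ?h *s (?h ^ n *s T n x))" by (simp only: vector_smult_assoc power_Suc)
          also have "\<dots> = ?h *s s N x" unfolding s_def by (simp only: vec.scale_sum_right)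
          finally show ?thesis .
        qed
        finally show "(\<Sum>n<Suc N. ?h ^ n *s (d n *s f x + (if n = 0 then 0 else T (n - 1) x))) = dN (Suc N) *s f x + ?h *s s N x" .
      qed (simp add: s_def)
    qed
    have s0: "s N 0 $ i = (\<Sum>n<N. c n $ i * ?h ^ n)" for N i unfolding s_def T_def using taylor_sol_dsol by (simp add: mult.commute)
    define If where "If = norm_L1 f"
    have "\<exists>x\<in>{0..1}. \<forall>x'\<in>{0..1}. norm (Y x' - s N x') \<le> norm (Y x - s N x)" for N
      by (rule continuous_attains_sup) (auto intro!: continuous_intros cY cs)
    then obtain xm where xm: "\<And>N. xm N \<in> {0..1}" "\<And>N x. x \<in> {0..1} \<Longrightarrow> norm (Y x - s N x) \<le> norm (Y (xm N) - s N (xm N))" by metis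
    define e where "e N = norm (Y (xm N) - s N (xm N))" for N
    define \<eta> where "\<eta> N = K * (norm (C - s (Suc N) 0) + norm (D' - dN (Suc N)) * If)" for N
    have "e \<longlonglongrightarrow> 0"
    proof (rule tendsto_zero_of_contraction)
      show "0 \<le> e n" for n by (simp add: e_def)
      show "e (Suc N) \<le> \<eta> N + e N / 2" for N
      proof -
        let ?r = "\<lambda>x. (D' *s f x + ?h *s Y x) - (dN (Suc N) *s f x + ?h *s s N x)" and ?n = "norm (D' - dN (Suc N))"
        have "dsol z0 ?r (\<lambda>x. Y x - s (Suc N) x)" by (rule dsol_diff[OF dsol_shift[OF Y(1)] sd])
        from K(2)[OF this xm(1)[of "Suc N"]]
        have "e (Suc N) \<le> K * (norm (C - s (Suc N) 0) + integral {0..1} (\<lambda>x. norm (?r x)))" unfolding e_def Y(2) .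
        also have "\<dots> \<le> K * (norm (C - s (Suc N) 0) + (?n * If + norm ?h * e N))"
        proof (intro mult_left_mono add_left_mono)
          have "integral {0..1} (\<lambda>x. norm (?r x)) \<le> integral {0..1} (\<lambda>x. ?n * norm (f x) + norm ?h * e N)"
          proof (rule integral_le)
            have "?r absint" by (intro set_integral_add set_integral_diff absint_cscale f absolutely_integrable_continuous_real cY cs)
            then show "(\<lambda>x. norm (?r x)) integrable_on {0..1}" by (rule absint_sub(3)) auto
            show "(\<lambda>x. ?n * norm (f x) + norm ?h * e N) integrable_on {0..1}"
              by (intro integrable_add integrable_on_mult_right absint_sub(3)[OF f]) auto
            fix x :: real assume x: "x \<in> {0..1}"
            have "?r x = (D' - dN (Suc N)) *s f x + ?h *s (Y x - s N x)" by (simp add: vec_eq_iff algebra_simps)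
            then have "norm (?r x) \<le> ?n * norm (f x) + norm ?h * norm (Y x - s N x)" by (metis norm_triangle_ineq norm_cvec_scale)
            also have "\<dots> \<le> ?n * norm (f x) + norm ?h * e N" unfolding e_def by (intro add_left_mono mult_left_mono xm(2)[OF x]) auto
            finally show "norm (?r x) \<le> ?n * norm (f x) + norm ?h * e N" .
          qed
          also have "\<dots> = ?n * If + norm ?h * e N"
          proof -
            have "(\<lambda>x. ?n * norm (f x)) integrable_on {0..1}" by (intro integrable_on_mult_right absint_sub(3)[OF f]) auto
            then show ?thesis by (subst hk_integral_add) (auto simp: If_def)
          qed
          finally show "integral {0..1} (\<lambda>x. norm (?r x)) \<le> ?n * If + norm ?h * e N" .
        qed (use K in auto)
        also have "\<dots> = \<eta> N + (K * norm ?h) * e N" by (simp add: \<eta>_def algebra_simps)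
        also have "(K * norm ?h) * e N \<le> (1/2) * e N"
        proof (rule mult_right_mono)
          show "K * norm ?h \<le> 1/2" using zr K(1) by (simp add: field_simps)
        qed (simp add: e_def)
        finally show ?thesis by simp
      qed
      have "(\<lambda>N. s N 0) \<longlonglongrightarrow> C"
      proof (rule vec_tendstoI)
        show "(\<lambda>N. s N 0 $ i) \<longlonglongrightarrow> C $ i" for i unfolding s0 using c[of i] by (simp add: sums_def)
      qed
      then have 1: "(\<lambda>N. s (Suc N) 0) \<longlonglongrightarrow> C" by (rule LIMSEQ_Suc)
      have "dN \<longlonglongrightarrow> D'" using d unfolding dN_def sums_def .
      then have 2: "(\<lambda>N. dN (Suc N)) \<longlonglongrightarrow> D'" by (rule LIMSEQ_Suc)
      have "\<eta> \<longlonglongrightarrow> K * (norm (C - C) + norm (D' - D') * If)" unfolding \<eta>_def by (intro tendsto_intros 1 2)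
      then show "\<eta> \<longlonglongrightarrow> 0" by simp
    qed
    show "uniform_limit {0..1} (\<lambda>N x. \<Sum>n<N. ?h ^ n *s taylor_sol z0 c d f n x) (sol z C (\<lambda>x. D' *s f x)) sequentially" unfolding uniform_limit_iff
    proof (intro allI impI)
      fix \<epsilon> :: real assume "0 < \<epsilon>"
      then have "\<forall>\<^sub>F N in sequentially. e N < \<epsilon>" by (rule order_tendstoD(2)[OF \<open>e \<longlonglongrightarrow> 0\<close>])
      then show "\<forall>\<^sub>F N in sequentially. \<forall>x\<in>{0..1}. dist (\<Sum>n<N. ?h ^ n *s taylor_sol z0 c d f n x) (sol z C (\<lambda>x. D' *s f x) x) < \<epsilon>"
      proof eventually_elim
        case (elim N)
        show ?case
        proof
          fix x :: real assume "x \<in> {0..1}"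
          then have "norm (Y x - s N x) \<le> e N" unfolding e_def by (rule xm(2))
          then show "dist (\<Sum>n<N. ?h ^ n *s taylor_sol z0 c d f n x) (sol z C (\<lambda>x. D' *s f x) x) < \<epsilon>"
            using elim by (simp add: dist_norm norm_minus_commute s_def T_def Y_def)
        qed
      qed
    qed
  qed
qed

lemma taylor_sol_sums:
  obtains r where "r > 0" "\<And>z c d C D' \<psi>. norm (z - z0) < r \<Longrightarrow> (\<And>i. (\<lambda>n. c n $ i * (z - z0) ^ n) sums (C $ i)) \<Longrightarrow>
    (\<lambda>n. d n * (z - z0) ^ n) sums D' \<Longrightarrow> sup_functional \<psi> \<Longrightarrow> (\<lambda>n. \<psi> (taylor_sol z0 c d f n) * (z - z0) ^ n) sums \<psi> (sol z C (\<lambda>x. D' *s f x))"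
proof -
  obtain r where r: "r > 0" "\<And>z c d C D'. norm (z - z0) < r \<Longrightarrow> (\<And>i. (\<lambda>n. c n $ i * (z - z0) ^ n) sums (C $ i)) \<Longrightarrow> (\<lambda>n. d n * (z - z0) ^ n) sums D' \<Longrightarrow>
    uniform_limit {0..1} (\<lambda>N x. \<Sum>n<N. (z - z0) ^ n *s taylor_sol z0 c d f n x) (sol z C (\<lambda>x. D' *s f x)) sequentially"
    using taylor_sol_uniform_limit[of z0] by blast
  show ?thesis
  proof (rule that[OF r(1)])
    fix z :: complex and c :: "nat \<Rightarrow> complex^2" and d and C :: "complex^2" and D' \<psi> assume h: "norm (z - z0) < r" "\<And>i. (\<lambda>n. c n $ i * (z - z0) ^ n) sums (C $ i)"
      "(\<lambda>n. d n * (z - z0) ^ n) sums D'" and \<psi>: "sup_functional \<psi>"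
    let ?Y = "sol z C (\<lambda>x. D' *s f x)" and ?s = "\<lambda>N x. \<Sum>n<N. (z - z0) ^ n *s taylor_sol z0 c d f n x"
    have cY: "continuous_on {0..1} ?Y" by (rule sol_continuous[OF absint_cscale[OF f]])
    have cs: "continuous_on {0..1} (?s N)" for N by (intro continuous_intros taylor_sol_continuous)
    obtain B where B: "\<And>y s. continuous_on {0..1} y \<Longrightarrow> (\<forall>x\<in>{0..1}. norm (y x) \<le> s) \<Longrightarrow> norm (\<psi> y) \<le> B * s" using \<psi> unfolding sup_functional_def by blast
    have "(\<lambda>N. \<psi> (?s N)) \<longlonglongrightarrow> \<psi> ?Y"
    proof (rule LIMSEQ_I)
      fix \<epsilon> :: real assume \<epsilon>: "0 < \<epsilon>"
      let ?d = "\<epsilon> / (2 * (\<bar>B\<bar> + 1))"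
      have d: "?d > 0" using \<epsilon> by simp
      obtain N where N: "\<And>n x. n \<ge> N \<Longrightarrow> x \<in> {0..1} \<Longrightarrow> dist (?s n x) (?Y x) < ?d" using r(2)[OF h] d unfolding uniform_limit_sequentially_iff by meson
      have "norm (\<psi> (?s n) - \<psi> ?Y) < \<epsilon>" if n: "n \<ge> N" for n
      proof -
        have e1: "\<psi> (\<lambda>x. ?s n x + (-1) *s ?Y x) = \<psi> (?s n) + (-1) * \<psi> ?Y"
          using sup_functional_add[OF \<psi> cs[of n] continuous_on_cscale[OF cY, of "-1"]] sup_functional_scale[OF \<psi> cY, of "-1"] by simp
        have e2: "norm (\<psi> (\<lambda>x. ?s n x + (-1) *s ?Y x)) \<le> B * ?d"
        proof (rule B)
          show "continuous_on {0..1} (\<lambda>x. ?s n x + (-1) *s ?Y x)" by (intro continuous_intros cs cY)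
          show "\<forall>x\<in>{0..1}. norm (?s n x + (-1) *s ?Y x) \<le> ?d"
          proof
            fix x :: real assume "x \<in> {0..1}"
            have "?s n x + (-1) *s ?Y x = ?s n x - ?Y x" by (simp add: vec_eq_iff)
            then show "norm (?s n x + (-1) *s ?Y x) \<le> ?d" using N[OF n \<open>x \<in> {0..1}\<close>] by (simp add: dist_norm)
          qed
        qed
        have e3: "B * ?d \<le> \<epsilon>/2"
        proof -
          have "B * ?d \<le> (\<bar>B\<bar> + 1) * ?d" using d by (intro mult_right_mono) auto
          also have "\<dots> = \<epsilon>/2" by (simp add: field_simps)
          finally show ?thesis .
        qed
        have "norm (\<psi> (?s n) + (-1) * \<psi> ?Y) \<le> \<epsilon>/2" by (rule order_trans[OF e2[unfolded e1] e3])
        then show ?thesis using \<epsilon> by simp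
      qed
      then show "\<exists>no. \<forall>n\<ge>no. norm (\<psi> (?s n) - \<psi> ?Y) < \<epsilon>" by blast
    qed
    moreover have "\<psi> (?s N) = (\<Sum>n<N. \<psi> (taylor_sol z0 c d f n) * (z - z0) ^ n)" for N
      by (subst sup_functional_sum[OF \<psi> taylor_sol_continuous]) (simp add: mult.commute)
    ultimately show "(\<lambda>n. \<psi> (taylor_sol z0 c d f n) * (z - z0) ^ n) sums \<psi> ?Y" unfolding sums_def by simp
  qed
qed

end

text \<open>Every functional of the solution has a convergent power series around each point. The
  radius \<open>min r 1\<close> keeps \<open>z\<close> also in the unit ball on which
  \<open>c\<close> and \<open>d\<close> are expanded.\<close>

lemma holomorphic_sol:
  assumes f: "f absint" and c: "\<And>i. (\<lambda>z. c z $ i) holomorphic_on UNIV"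
    and d: "d holomorphic_on UNIV" and \<psi>: "sup_functional \<psi>"
  shows "(\<lambda>z. \<psi> (sol z (c z) (\<lambda>x. d z *s f x))) holomorphic_on UNIV"
proof -
  have "(\<lambda>z. \<psi> (sol z (c z) (\<lambda>x. d z *s f x))) analytic_on UNIV" unfolding analytic_on_def
  proof
    fix z0 :: complex
    define cn where "cn n = (\<chi> i. (deriv ^^ n) (\<lambda>z. c z $ i) z0 / fact n)" for n
    define dn where "dn n = (deriv ^^ n) d z0 / fact n" for n
    have cs: "(\<lambda>n. cn n $ i * (z - z0) ^ n) sums (c z $ i)" if "z \<in> ball z0 1" for i z
      using holomorphic_power_series[OF holomorphic_on_subset[OF c] that] by (simp add: cn_def)
    have ds: "(\<lambda>n. dn n * (z - z0) ^ n) sums d z" if "z \<in> ball z0 1" for z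
      using holomorphic_power_series[OF holomorphic_on_subset[OF d] that] by (simp add: dn_def)
    obtain r where r: "r > 0" "\<And>z c d C D' \<psi>. norm (z - z0) < r \<Longrightarrow> (\<And>i. (\<lambda>n. c n $ i * (z - z0) ^ n) sums (C $ i)) \<Longrightarrow>
    (\<lambda>n. d n * (z - z0) ^ n) sums D' \<Longrightarrow> sup_functional \<psi> \<Longrightarrow> (\<lambda>n. \<psi> (taylor_sol z0 c d f n) * (z - z0) ^ n) sums \<psi> (sol z C (\<lambda>x. D' *s f x))"
      using taylor_sol_sums[OF f, of z0] by blast
    show "\<exists>e>0. (\<lambda>z. \<psi> (sol z (c z) (\<lambda>x. d z *s f x))) holomorphic_on ball z0 e"
    proof (intro exI conjI)
      show "0 < min r 1" using r(1) by simp
      show "(\<lambda>z. \<psi> (sol z (c z) (\<lambda>x. d z *s f x))) holomorphic_on ball z0 (min r 1)"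
      proof (rule power_series_holomorphic)
        fix z assume "z \<in> ball z0 (min r 1)"
        then show "(\<lambda>n. \<psi> (taylor_sol z0 cn dn f n) * (z - z0) ^ n) sums \<psi> (sol z (c z) (\<lambda>x. d z *s f x))"
          by (intro r(2) cs ds \<psi>) (auto simp: dist_norm norm_minus_commute)
      qed
    qed
  qed
  then show ?thesis by (simp add: analytic_imp_holomorphic)
qed

end

section \<open>The characteristic determinant\<close>

lemma abs_L2_eq_iff:
  assumes "square_integrable f" "square_integrable g"
  shows "abs_L2 f = abs_L2 g \<longleftrightarrow> (AE x in unit_leb. f x = g x)" using Quotient_rel[OF Quotient_L2, of f g] assms by (simp add: L2_rel_def)

lemma abs_L2_eqI:
  assumes "square_integrable f" "\<And>x. x \<in> {0..1} \<Longrightarrow> f x = g x"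
  shows "square_integrable g" "abs_L2 f = abs_L2 g"
proof -
  have m: "g \<in> borel_measurable unit_leb \<longleftrightarrow> f \<in> borel_measurable unit_leb" by (rule measurable_cong) (use assms(2) in auto)
  have i: "integrable unit_leb (\<lambda>x. (norm (g x))\<^sup>2) \<longleftrightarrow> integrable unit_leb (\<lambda>x. (norm (f x))\<^sup>2)"
    by (rule Bochner_Integration.integrable_cong) (use assms(2) in auto)
  show g: "square_integrable g" using assms(1) m i by (simp add: square_integrable_def)
  show "abs_L2 f = abs_L2 g" unfolding abs_L2_eq_iff[OF assms(1) g] by (rule AE_I2) (use assms(2) in auto)
qed

lemma L2_rep: obtains f where "square_integrable f" "u = abs_L2 f"
proof -
  have "abs_L2 (rep_L2 u) = u" by (rule Quotient_abs_rep[OF Quotient_L2])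
  moreover have "L2_rel (rep_L2 u) (rep_L2 u)" by (rule Quotient_rep_reflp[OF Quotient_L2])
  ultimately show ?thesis using that[of "rep_L2 u"] by (simp add: L2_rel_def)
qed

lemma abs_L2_add: "square_integrable f \<Longrightarrow> square_integrable g \<Longrightarrow> abs_L2 f + abs_L2 g = abs_L2 (\<lambda>x. f x + g x)"
  by (rule plus_L2.abs_eq) (simp_all add: L2_rel_def)

lemma abs_L2_diff: "square_integrable f \<Longrightarrow> square_integrable g \<Longrightarrow> abs_L2 f - abs_L2 g = abs_L2 (\<lambda>x. f x - g x)"
  by (rule minus_L2.abs_eq) (simp_all add: L2_rel_def)

lemma abs_L2_scale: "square_integrable f \<Longrightarrow> cscale c (abs_L2 f) = abs_L2 (\<lambda>x. c *s f x)" by (rule cscale.abs_eq) (simp add: L2_rel_def)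

lemma abs_L2_zero: "abs_L2 (\<lambda>x. 0) = 0" by (rule zero_L2.abs_eq[symmetric])

lemma square_integrable_cdot_absint:
  "square_integrable f \<Longrightarrow> square_integrable g \<Longrightarrow> (\<lambda>x. cdot (f x) (g x)) absint" using integrable_cdot integrable_unit_leb_iff by blast

lemma cinner_abs_L2: "square_integrable f \<Longrightarrow> square_integrable g \<Longrightarrow> cinner (abs_L2 f) (abs_L2 g) = pairing g f"
  by (subst cinner.abs_eq) (simp_all add: L2_rel_def pairing_def integral_unit_leb[OF square_integrable_cdot_absint])

lemma norm_abs_L2: "square_integrable f \<Longrightarrow> (norm (abs_L2 f))\<^sup>2 = norm_sq f"
proof -
  assume f: "square_integrable f"
  have i: "(\<lambda>x. cdot (f x) (f x)) integrable_on {0..1}" using square_integrable_cdot_absint[OF f f] absint_integrable by blast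
  have "(norm (abs_L2 f))\<^sup>2 = Re (pairing f f)" by (simp add: power2_norm_eq_inner inner_L2_def cinner_abs_L2[OF f f])
  also have "\<dots> = integral {0..1} (\<lambda>x. Re (cdot (f x) (f x)))" unfolding pairing_def using integral_linear[OF i bounded_linear_Re] by (simp add: o_def)
  finally show ?thesis by (simp add: cdot_self)
qed

lemma matrix_inv_B:
  assumes "b1 \<noteq> 0" "b2 \<noteq> 0"
  shows "(matrix_inv (B_matrix b1 b2) *v v) $ i = v $ i / of_real (coef b1 b2 i)"
proof -
  define C :: "complex^2^2" where "C = vector [vector [1 / of_real b1, 0], vector [0, 1 / of_real b2]]"
  have BC: "B_matrix b1 b2 ** C = mat 1" "C ** B_matrix b1 b2 = mat 1"
    using assms by (simp_all add: B_matrix_def C_def matrix_matrix_mult_def mat_def vec_eq_iff forall_2 sum_2)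
  have "B_matrix b1 b2 ** matrix_inv (B_matrix b1 b2) = mat 1 \<and> matrix_inv (B_matrix b1 b2) ** B_matrix b1 b2 = mat 1"
    unfolding matrix_inv_def by (rule someI[of _ C]) (use BC in auto)
  then have "matrix_inv (B_matrix b1 b2) = C" by (metis BC(1) matrix_mul_assoc matrix_mul_lid matrix_mul_rid)
  then show ?thesis using exhaust_2[of i] by (auto simp: C_def matrix_vector_mult_def sum_2 coef_def)
qed

lemma boundary_form_diff: "boundary_form a l (\<lambda>x. y x - w x) = boundary_form a l y - boundary_form a l w"
  by (simp add: boundary_form_def algebra_simps)

section \<open>Fundamental solutions, Cramer's rule, and the operator as an integral
  equation\<close>

context dirac_problem
begin

lemma absint_0: "(\<lambda>_. 0 :: complex^2) absint" by simp

definition U :: "complex \<Rightarrow> 2 \<Rightarrow> curve"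
  where "U z i = sol z (axis i 1) (\<lambda>_. 0)"

definition M :: "complex \<Rightarrow> 2 \<Rightarrow> 2 \<Rightarrow> complex"
  where "M z l i = boundary_form a l (U z i)"

definition \<Delta> :: "complex \<Rightarrow> complex"
  where "\<Delta> z = M z 1 1 * M z 2 2 - M z 1 2 * M z 2 1"

lemma U_dsol: "dsol z (\<lambda>_. 0) (U z i)" "U z i 0 = axis i 1" unfolding U_def by (rule sol[OF absint_0])+

lemma U_continuous: "continuous_on {0..1} (U z i)" by (rule dsol_continuous[OF U_dsol(1)])

lemma dsol_decompose:
  assumes y: "dsol z f y" and x: "x \<in> {0..1}"
  shows "y x = sol z 0 f x + (y 0 $ 1 *s U z 1 x + y 0 $ 2 *s U z 2 x)"
proof -
  have f: "f absint" using y by (simp add: dsol_def)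
  have d: "dsol z (\<lambda>x. f x + ((y 0 $ 1) *s (0 :: complex^2) + (y 0 $ 2) *s 0)) (\<lambda>x. sol z 0 f x + (y 0 $ 1 *s U z 1 x + y 0 $ 2 *s U z 2 x))"
    by (intro dsol_add dsol_scale U_dsol sol f)
  have "dsol z f (\<lambda>x. sol z 0 f x + (y 0 $ 1 *s U z 1 x + y 0 $ 2 *s U z 2 x))" by (rule dsol_cong[OF d]) auto
  then show ?thesis
  proof (rule dsol_unique[OF y _ _ x])
    show "y 0 = sol z 0 f 0 + (y 0 $ 1 *s U z 1 0 + y 0 $ 2 *s U z 2 0)" by (simp add: sol(2)[OF f] U_dsol(2) vec_eq_iff forall_2 axis_def)
  qed
qed

lemma functional_decompose:
  assumes \<psi>: "sup_functional \<psi>" and y: "dsol z f y"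
  shows "\<psi> y = \<psi> (sol z 0 f) + (y 0 $ 1 * \<psi> (U z 1) + y 0 $ 2 * \<psi> (U z 2))"
proof -
  have f: "f absint" using y by (simp add: dsol_def)
  note c = sol_continuous[OF f] U_continuous continuous_on_cscale continuous_on_add
  have "\<psi> y = \<psi> (\<lambda>x. sol z 0 f x + (y 0 $ 1 *s U z 1 x + y 0 $ 2 *s U z 2 x))"
    by (rule sup_functional_cong[OF \<psi> dsol_continuous[OF y] dsol_decompose[OF y]])
  also have "\<dots> = \<psi> (sol z 0 f) + \<psi> (\<lambda>x. y 0 $ 1 *s U z 1 x + y 0 $ 2 *s U z 2 x)" by (rule sup_functional_add[OF \<psi>]) (intro c)+
  also have "\<psi> (\<lambda>x. y 0 $ 1 *s U z 1 x + y 0 $ 2 *s U z 2 x) = \<psi> (\<lambda>x. y 0 $ 1 *s U z 1 x) + \<psi> (\<lambda>x. y 0 $ 2 *s U z 2 x)"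
    by (rule sup_functional_add[OF \<psi>]) (intro c)+
  finally show ?thesis by (simp add: sup_functional_scale[OF \<psi> U_continuous])
qed

lemma boundary_decompose:
  "dsol z f y \<Longrightarrow> boundary_form a l y = boundary_form a l (sol z 0 f) + (M z l 1 * y 0 $ 1 + M z l 2 * y 0 $ 2)"
  using functional_decompose[OF sup_functional_boundary] by (simp add: M_def mult.commute)

lemma holomorphic_U:
  assumes "sup_functional \<psi>" shows "(\<lambda>z. \<psi> (U z i)) holomorphic_on UNIV"
  using holomorphic_sol[OF absint_0 _ _ assms, of "\<lambda>_. axis i 1" "\<lambda>_. 0"] by (simp add: U_def)

lemma holomorphic_M: "(\<lambda>z. M z l i) holomorphic_on UNIV" unfolding M_def by (rule holomorphic_U[OF sup_functional_boundary])

lemma holomorphic_\<Delta>: "\<Delta> holomorphic_on UNIV" unfolding \<Delta>_def[abs_def] by (intro holomorphic_intros holomorphic_M)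

lemma holomorphic_w:
  assumes "f absint" "sup_functional \<psi>"
  shows "(\<lambda>z. \<psi> (sol z 0 f)) holomorphic_on UNIV" using holomorphic_sol[OF assms(1) _ _ assms(2), of "\<lambda>_. 0" "\<lambda>_. 1"] by simp

definition homogeneous_bc :: "curve \<Rightarrow> bool"
  where "homogeneous_bc y \<longleftrightarrow> boundary_form a 1 y = 0 \<and> boundary_form a 2 y = 0"

text \<open>The factor \<open>\<Delta> z\<close> on the right-hand side clears the denominators of Cramer's rule, so that \<open>resol z f\<close>
  depends holomorphically on \<open>z\<close>.\<close>

definition cramer :: "complex \<Rightarrow> curve \<Rightarrow> complex^2"
  where "cramer z f = (\<chi> i. if i = 1 then - (M z 2 2 * boundary_form a 1 (sol z 0 f) - M z 1 2 * boundary_form a 2 (sol z 0 f))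
    else - (M z 1 1 * boundary_form a 2 (sol z 0 f) - M z 2 1 * boundary_form a 1 (sol z 0 f)))"

definition resol :: "complex \<Rightarrow> curve \<Rightarrow> curve"
  where "resol z f = sol z (cramer z f) (\<lambda>x. \<Delta> z *s f x)"

lemma resol:
  assumes f: "f absint"
  shows "dsol z (\<lambda>x. \<Delta> z *s f x) (resol z f)" "homogeneous_bc (resol z f)"
proof -
  show d: "dsol z (\<lambda>x. \<Delta> z *s f x) (resol z f)" unfolding resol_def by (rule sol[OF absint_cscale[OF f]])
  have c: "resol z f 0 = cramer z f" unfolding resol_def by (rule sol[OF absint_cscale[OF f]])
  have b: "boundary_form a l (sol z 0 (\<lambda>x. \<Delta> z *s f x)) = \<Delta> z * boundary_form a l (sol z 0 f)" for l
  proof -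
    have "dsol z (\<lambda>x. \<Delta> z *s f x) (\<lambda>x. \<Delta> z *s sol z 0 f x)" by (intro dsol_scale sol f)
    from boundary_decompose[OF this, of l] sol(2)[OF f, of z 0]
    show ?thesis using sup_functional_scale[OF sup_functional_boundary sol_continuous[OF f], of a l "\<Delta> z" z 0] by simp
  qed
  show "homogeneous_bc (resol z f)" unfolding homogeneous_bc_def boundary_decompose[OF d] b c by (simp add: cramer_def \<Delta>_def algebra_simps)
qed

lemma holomorphic_resol:
  assumes f: "f absint" and \<psi>: "sup_functional \<psi>"
  shows "(\<lambda>z. \<psi> (resol z f)) holomorphic_on UNIV" unfolding resol_def
proof (rule holomorphic_sol[OF f _ holomorphic_\<Delta> \<psi>])
  show "(\<lambda>z. cramer z f $ i) holomorphic_on UNIV" for i unfolding cramer_def using exhaust_2[of i]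
    by (auto intro!: holomorphic_intros holomorphic_M holomorphic_w[OF f sup_functional_boundary])
qed

lemma homogeneous_solution_zero:
  assumes "dsol z (\<lambda>_. 0) y" "homogeneous_bc y" "\<Delta> z \<noteq> 0" "x \<in> {0..1}"
  shows "y x = 0"
proof -
  have w0: "sol z 0 (\<lambda>_. 0) x = 0" if "x \<in> {0..1}" for x
    using dsol_unique[OF sol(1)[OF absint_0] dsol_zero _ that, of z 0] sol(2)[OF absint_0, of z 0] by simp
  have b0: "boundary_form a l (sol z 0 (\<lambda>_. 0)) = 0" for l using w0[of 0] w0[of 1] by (simp add: boundary_form_def)
  have e: "M z 1 1 * y 0 $ 1 + M z 1 2 * y 0 $ 2 = 0" "M z 2 1 * y 0 $ 1 + M z 2 2 * y 0 $ 2 = 0"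
    using assms(2) unfolding homogeneous_bc_def boundary_decompose[OF assms(1)] b0 by auto
  have "\<Delta> z * y 0 $ 1 = M z 2 2 * (M z 1 1 * y 0 $ 1 + M z 1 2 * y 0 $ 2) - M z 1 2 * (M z 2 1 * y 0 $ 1 + M z 2 2 * y 0 $ 2)"
    "\<Delta> z * y 0 $ 2 = M z 1 1 * (M z 2 1 * y 0 $ 1 + M z 2 2 * y 0 $ 2) - M z 2 1 * (M z 1 1 * y 0 $ 1 + M z 1 2 * y 0 $ 2)"
    by (simp_all add: \<Delta>_def algebra_simps)
  then have "y 0 $ 1 = 0" "y 0 $ 2 = 0" using e assms(3) by auto
  then show ?thesis using dsol_decompose[OF assms(1,4)] w0[OF assms(4)] by simp
qed

lemma bvp_unique:
  assumes "dsol z f y" "homogeneous_bc y" "dsol z f w" "homogeneous_bc w" "\<Delta> z \<noteq> 0" "x \<in> {0..1}"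
  shows "y x = w x"
proof -
  have "homogeneous_bc (\<lambda>x. y x - w x)" using assms(2,4) by (simp add: homogeneous_bc_def boundary_form_diff)
  then show ?thesis using homogeneous_solution_zero[of z "\<lambda>x. y x - w x"] dsol_diff[OF assms(1,3)] assms(5,6) by simp
qed

lemma dsol_imp_square_integrable: "dsol z f y \<Longrightarrow> square_integrable y" by (intro continuous_imp_square_integrable dsol_continuous)

lemma dirac_pointwise:
  "(- \<i>) *s (matrix_inv (B_matrix b1 b2) *v g) + Q x *v v = f \<longleftrightarrow> g = (D 0 + V x) *v v + D 1 *v f"
proof -
  have scalar: "(- \<i> * (p / c) + q = r) \<longleftrightarrow> (p = \<i> * c * r - \<i> * c * q)" if "c \<noteq> 0" for p q r c :: complex
  proof -
    have "(- \<i> * (p / c) + q = r) \<longleftrightarrow> (\<i> * c * (- \<i> * (p / c) + q) = \<i> * c * r)" using that by simp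
    also have "\<i> * c * (- \<i> * (p / c) + q) = p + \<i> * c * q" using that by (simp add: field_simps)
    finally show ?thesis by (auto simp: algebra_simps)
  qed
  have n: "coef b1 b2 i \<noteq> 0" for i using b1 b2 by (simp add: coef_def)
  have "((- \<i>) *s (matrix_inv (B_matrix b1 b2) *v g) + Q x *v v) $ i = - \<i> * (g $ i / of_real (coef b1 b2 i)) + (Q x *v v) $ i"
    "((D 0 + V x) *v v + D 1 *v f) $ i = \<i> * of_real (coef b1 b2 i) * f $ i - \<i> * of_real (coef b1 b2 i) * (Q x *v v) $ i" for i
    using b1 b2 by (simp_all add: matrix_inv_B matrix_vector_mult_add_rdistrib)
  then show ?thesis unfolding vec_eq_iff using n by (simp only: scalar of_real_eq_0_iff not_False_eq_True)
qed

lemma dirac_expr_eq_AE: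
  assumes y: "dsol 0 f y"
  shows "AE x in unit_leb. dirac_expr b1 b2 Q y x = f x"
proof -
  have "AE x in unit_leb. (y has_vector_derivative (D 0 + V x) *v y x + D 1 *v f x) (at x within {0..1})"
    using y unfolding dsol_def linear_ode_def by (intro antiderivative_AE) auto
  moreover have "AE x in unit_leb. x \<in> {0..1::real}" by (rule AE_I2) simp
  ultimately show ?thesis
  proof eventually_elim
    case (elim x)
    have "vector_derivative y (at x within {0..1}) = (D 0 + V x) *v y x + D 1 *v f x"
      by (rule vector_derivative_within_cbox[of 0 1, unfolded cbox_interval, OF _ elim(2,1)]) simp
    then show ?case unfolding dirac_expr_def by (subst dirac_pointwise) simp
  qed
qed

text \<open>In one direction absolute continuity provides a density that equals
  \<open>vector_derivative\<close> wherever the derivative exists, that is, almost everywhere. In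
  the other direction the differential expression equals \<open>f\<close> only almost everywhere,
  which is enough for the class in \<open>L2\<close>.\<close>

lemma dirac_op_iff:
  "(u, v) \<in> dirac_op b1 b2 Q a \<longleftrightarrow> (\<exists>y f. u = abs_L2 y \<and> v = abs_L2 f \<and> square_integrable f \<and> dsol 0 f y \<and> homogeneous_bc y)"
proof
  assume "(u, v) \<in> dirac_op b1 b2 Q a"
  then obtain y where y: "u = abs_L2 y" "v = abs_L2 (dirac_expr b1 b2 Q y)" "absolutely_continuous_on 0 1 y"
    "square_integrable (dirac_expr b1 b2 Q y)" "homogeneous_bc y" unfolding dirac_op_def homogeneous_bc_def by auto
  define f where "f = dirac_expr b1 b2 Q y"
  obtain g where g: "g absint" "\<And>x. x \<in> {0..1} \<Longrightarrow> y x = y 0 + integral {0..x} g" using absolutely_continuous_imp_integral[OF y(3)] by blast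
  then have "antiderivative g y" by (intro antiderivativeI2)
  have "dsol 0 f y" unfolding dsol_def linear_ode_def
  proof
    show "f absint" unfolding f_def by (rule square_integrable_imp_absint[OF y(4)])
    show "antiderivative (\<lambda>t. (D 0 + V t) *v y t + D 1 *v f t) y"
    proof (rule antiderivativeI[OF y(3)])
      have "AE x in unit_leb. x \<in> {0..1::real}" by (rule AE_I2) simp
      with antiderivative_AE[OF \<open>antiderivative g y\<close>]
      show "AE x in unit_leb. (y has_vector_derivative (D 0 + V x) *v y x + D 1 *v f x) (at x within {0..1})"
      proof eventually_elim
        case (elim x)
        have "vector_derivative y (at x within {0..1}) = g x"
          by (rule vector_derivative_within_cbox[of 0 1, unfolded cbox_interval, OF _ elim(2,1)]) simp
        then have "g x = (D 0 + V x) *v y x + D 1 *v f x" unfolding f_def dirac_expr_def by (subst dirac_pointwise[symmetric]) simp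
        then show ?case using elim(1) by simp
      qed
    qed
  qed
  then show "\<exists>y f. u = abs_L2 y \<and> v = abs_L2 f \<and> square_integrable f \<and> dsol 0 f y \<and> homogeneous_bc y" using y unfolding f_def by blast
next
  assume "\<exists>y f. u = abs_L2 y \<and> v = abs_L2 f \<and> square_integrable f \<and> dsol 0 f y \<and> homogeneous_bc y"
  then obtain y f where y: "u = abs_L2 y" "v = abs_L2 f" "square_integrable f" "dsol 0 f y" "homogeneous_bc y" by blast
  have ae: "AE x in unit_leb. f x = dirac_expr b1 b2 Q y x" using dirac_expr_eq_AE[OF y(4)] by eventually_elim simp
  have "square_integrable (dirac_expr b1 b2 Q y)" unfolding square_integrable_def integrable_unit_leb_iff
  proof
    show "dirac_expr b1 b2 Q y \<in> borel_measurable unit_leb"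
      by (rule absolutely_integrable_imp_borel_measurable[OF absolutely_integrable_AE_cong(1)[OF square_integrable_imp_absint[OF y(3)] ae]]) simp
    have "AE x in unit_leb. (norm (f x))\<^sup>2 = (norm (dirac_expr b1 b2 Q y x))\<^sup>2" using ae by eventually_elim simp
    from absolutely_integrable_AE_cong(1)[OF square_integrable_norm2[OF y(3)] this]
    show "(\<lambda>x. (norm (dirac_expr b1 b2 Q y x))\<^sup>2) absint" .
  qed
  moreover from this have "abs_L2 f = abs_L2 (dirac_expr b1 b2 Q y)" using abs_L2_eq_iff[OF y(3)] ae by blast
  moreover have "absolutely_continuous_on 0 1 y" using y(4) unfolding dsol_def linear_ode_def by (intro antiderivative_absolutely_continuous) auto
  ultimately show "(u, v) \<in> dirac_op b1 b2 Q a" using y unfolding dirac_op_def homogeneous_bc_def by auto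
qed

lemma shifted_op_iff:
  "(u, v) \<in> shifted_op (dirac_op b1 b2 Q a) z \<longleftrightarrow> (\<exists>y f. u = abs_L2 y \<and> v = abs_L2 f \<and> square_integrable f \<and> dsol z f y \<and> homogeneous_bc y)"
proof
  assume "(u, v) \<in> shifted_op (dirac_op b1 b2 Q a) z"
  then obtain v' where v': "(u, v') \<in> dirac_op b1 b2 Q a" "v = v' - cscale z u" unfolding shifted_op_def by auto
  then obtain y f where y: "u = abs_L2 y" "v' = abs_L2 f" "square_integrable f" "dsol 0 f y" "homogeneous_bc y" unfolding dirac_op_iff by blast
  have sy: "square_integrable (\<lambda>x. z *s y x)" by (rule square_integrable_cscale[OF dsol_imp_square_integrable[OF y(4)]])
  have e: "(\<lambda>x. f x + (0 - z) *s y x) = (\<lambda>x. f x - z *s y x)" by (simp add: fun_eq_iff vec_eq_iff)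
  have "v = abs_L2 (\<lambda>x. f x - z *s y x)" unfolding v'(2) y(1,2) abs_L2_scale[OF dsol_imp_square_integrable[OF y(4)]] by (rule abs_L2_diff[OF y(3) sy])
  then show "\<exists>y f. u = abs_L2 y \<and> v = abs_L2 f \<and> square_integrable f \<and> dsol z f y \<and> homogeneous_bc y"
    using y(1,5) dsol_shift[OF y(4), of z] square_integrable_diff[OF y(3) sy] unfolding e by blast
next
  assume "\<exists>y f. u = abs_L2 y \<and> v = abs_L2 f \<and> square_integrable f \<and> dsol z f y \<and> homogeneous_bc y"
  then obtain y f where y: "u = abs_L2 y" "v = abs_L2 f" "square_integrable f" "dsol z f y" "homogeneous_bc y" by blast
  have sy: "square_integrable (\<lambda>x. z *s y x)" by (rule square_integrable_cscale[OF dsol_imp_square_integrable[OF y(4)]])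
  have "(u, abs_L2 (\<lambda>x. f x + z *s y x)) \<in> dirac_op b1 b2 Q a"
    unfolding dirac_op_iff using y(1,5) dsol_shift[OF y(4), of 0] square_integrable_add[OF y(3) sy] by auto
  moreover have "v = abs_L2 (\<lambda>x. f x + z *s y x) - cscale z u"
    unfolding y(1,2) abs_L2_scale[OF dsol_imp_square_integrable[OF y(4)]] abs_L2_diff[OF square_integrable_add[OF y(3) sy] sy] by simp
  ultimately show "(u, v) \<in> shifted_op (dirac_op b1 b2 Q a) z" unfolding shifted_op_def by auto
qed

lemma dsol_AE_cong:
  assumes y: "dsol z f y" and fg: "AE x in unit_leb. f x = g x"
  shows "dsol z g y" unfolding dsol_def linear_ode_def
proof
  show "g absint" using y by (intro absolutely_integrable_AE_cong(1)[OF _ fg]) (simp add: dsol_def)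
  note A = y[unfolded dsol_def linear_ode_def, THEN conjunct2]
  have ae: "AE x in unit_leb. (D z + V x) *v y x + D 1 *v f x = (D z + V x) *v y x + D 1 *v g x" using fg by eventually_elim simp
  show "antiderivative (\<lambda>t. (D z + V t) *v y t + D 1 *v g t) y"
  proof (rule antiderivativeI2)
    show "(\<lambda>t. (D z + V t) *v y t + D 1 *v g t) absint" by (rule absolutely_integrable_AE_cong(1)[OF antiderivativeD(1)[OF A] ae])
    fix x :: real assume x: "x \<in> {0..1}"
    have "integral {0..x} (\<lambda>t. (D z + V t) *v y t + D 1 *v g t) = integral {0..x} (\<lambda>t. (D z + V t) *v y t + D 1 *v f t)"
      by (rule absolutely_integrable_AE_cong(2)[OF antiderivativeD(1)[OF A] ae]) (use x in simp)
    then show "y x = y 0 + integral {0..x} (\<lambda>t. (D z + V t) *v y t + D 1 *v g t)" using antiderivativeD(2)[OF A x] by (simp only:)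
  qed
qed

lemma eigenvalue_\<Delta>:
  assumes "z \<in> eigenvalues (dirac_op b1 b2 Q a)"
  shows "\<Delta> z = 0"
proof (rule ccontr)
  assume nz: "\<Delta> z \<noteq> 0"
  obtain u where u: "u \<noteq> 0" "(u, cscale z u) \<in> dirac_op b1 b2 Q a" using assms unfolding eigenvalues_def by auto
  then have "(u, 0) \<in> shifted_op (dirac_op b1 b2 Q a) z" unfolding shifted_op_def by force
  then obtain y f where y: "u = abs_L2 y" "0 = abs_L2 f" "square_integrable f" "dsol z f y" "homogeneous_bc y" unfolding shifted_op_iff by blast
  have "AE x in unit_leb. f x = 0" using y(2,3) abs_L2_eq_iff[OF y(3) square_integrable_zero] abs_L2_zero by simp
  with y(4) have "dsol z (\<lambda>_. 0) y" by (rule dsol_AE_cong)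
  from homogeneous_solution_zero[OF this y(5) nz] have y0: "\<And>x. x \<in> {0..1} \<Longrightarrow> y x = 0" .
  have "abs_L2 y = abs_L2 (\<lambda>_. 0)" by (rule abs_L2_eqI(2)[OF dsol_imp_square_integrable[OF y(4)] y0])
  then show False using u(1) y(1) abs_L2_zero by simp
qed

end

text \<open>Normal families. If every \<open>\<delta>'\<close> failed, there would be windows
  \<open>{\<tau> n..\<tau> n + \<epsilon>}\<close> in which each vertical segment carries a value
  below \<open>1 / (n + 1)\<close>. The translates of \<open>F\<close> by \<open>\<tau> n\<close>
  are uniformly bounded in a wider strip, so a subsequence converges locally uniformly. The lower
  bound on \<open>Im z = h\<close> survives in the limit, which therefore has only finitely many
  zeros in the rectangle; some vertical segment avoids them, and on it the translates are eventually
  bounded away from 0.\<close>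

lemma vertical_lines_bounded_below:
  fixes F :: "complex \<Rightarrow> complex"
  assumes hol: "F holomorphic_on UNIV" and h: "0 < h" and eps: "0 < \<epsilon>"
    and bound: "\<And>z. \<bar>Im z\<bar> \<le> h + 1 \<Longrightarrow> norm (F z) \<le> B"
    and lower: "\<And>x. \<delta> \<le> norm (F (Complex x h))" and d: "0 < \<delta>"
  obtains \<delta>' where "0 < \<delta>'" "\<And>\<tau>. \<exists>s\<in>{\<tau>..\<tau> + \<epsilon>}. \<forall>t\<in>{-h..h}. \<delta>' \<le> norm (F (Complex s t))"
proof (rule ccontr)
  assume "\<not> thesis"
  then have "\<forall>n::nat. \<exists>\<tau>. \<forall>s\<in>{\<tau>..\<tau> + \<epsilon>}. \<exists>t\<in>{-h..h}. norm (F (Complex s t)) < 1 / (real n + 1)"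
    using that by (metis (no_types, opaque_lifting) not_le add_pos_pos divide_pos_pos of_nat_0_le_iff zero_less_one add_nonneg_pos)
  then obtain \<tau> where \<tau>: "\<And>n s. s \<in> {\<tau> n..\<tau> n + \<epsilon>} \<Longrightarrow> \<exists>t\<in>{-h..h}. norm (F (Complex s t)) < 1 / (real n + 1)" by metis
  \<comment> \<open>One unit wider than the strip of interest, so that the rectangle
    \<open>?K\<close>, with its sides on \<open>Im z = h\<close> and \<open>Im z = - h\<close>, is a
    compact subset of an open set.\<close>
  define S where "S = {z. Im z < h + 1} \<inter> {z. - (h + 1) < Im z}"
  have S: "open S" "convex S" unfolding S_def by (auto intro: open_Int open_halfspace_Im_lt open_halfspace_Im_gt convex_Int convex_halfspace_Im_lt convex_halfspace_Im_gt)
  define \<F> where "\<F> n z = F (z + of_real (\<tau> n))" for n :: nat and z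
  define \<H> where "\<H> = {g. g holomorphic_on S \<and> (\<forall>z\<in>S. norm (g z) \<le> B)}"
  have \<F>\<H>: "range \<F> \<subseteq> \<H>"
  proof clarify
    fix n
    have "\<F> n holomorphic_on S" unfolding \<F>_def using holomorphic_on_compose_gen[of "\<lambda>z. z + of_real (\<tau> n)" S F UNIV, OF _ hol]
      by (simp add: o_def holomorphic_on_add holomorphic_on_ident)
    moreover have "norm (\<F> n z) \<le> B" if "z \<in> S" for z unfolding \<F>_def by (rule bound) (use that in \<open>auto simp: S_def\<close>)
    ultimately show "\<F> n \<in> \<H>" by (simp add: \<H>_def)
  qed
  obtain g r where g: "g holomorphic_on S" and r: "strict_mono (r :: nat \<Rightarrow> nat)"
    and pw: "\<And>x. x \<in> S \<Longrightarrow> ((\<lambda>n. \<F> (r n) x) \<longlongrightarrow> g x) sequentially"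
    and ul: "\<And>K. \<lbrakk>compact K; K \<subseteq> S\<rbrakk> \<Longrightarrow> uniform_limit K (\<F> \<circ> r) g sequentially"
  proof (rule Montel[OF S(1) _ _ \<F>\<H>])
    show "h holomorphic_on S" if "h \<in> \<H>" for h using that by (simp add: \<H>_def)
    show "\<exists>B. \<forall>h\<in>\<H>. \<forall>z\<in>K. norm (h z) \<le> B" if "compact K" "K \<subseteq> S" for K using that by (intro exI[of _ B]) (auto simp: \<H>_def)
  qed blast
  have gl: "\<delta> \<le> norm (g (Complex x h))" for x
  proof -
    have "Complex x h \<in> S" using h by (simp add: S_def)
    then have "(\<lambda>n. norm (\<F> (r n) (Complex x h))) \<longlonglongrightarrow> norm (g (Complex x h))" by (intro tendsto_norm pw)
    moreover have "\<delta> \<le> norm (\<F> (r n) (Complex x h))" for n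
    proof -
      have "Complex x h + of_real (\<tau> (r n)) = Complex (x + \<tau> (r n)) h" by (simp add: complex_eq_iff)
      then show ?thesis unfolding \<F>_def using lower by simp
    qed
    ultimately show ?thesis by (intro LIMSEQ_le_const) auto
  qed
  let ?K = "cbox (Complex 0 (-h)) (Complex \<epsilon> h)"
  have KS: "?K \<subseteq> S" by (auto simp: S_def in_cbox_complex_iff)
  have fin: "finite {z \<in> ?K. g z = 0}"
  proof (cases "g constant_on S")
    case True
    then obtain c where c: "\<And>z. z \<in> S \<Longrightarrow> g z = c" unfolding constant_on_def by auto
    have "Complex 0 h \<in> S" using h by (simp add: S_def)
    then have "c \<noteq> 0" using gl[of 0] d c[of "Complex 0 h"] by auto
    then have "{z \<in> ?K. g z = 0} = {}" using c KS by auto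
    then show ?thesis by (simp only: finite.emptyI)
  next
    case False
    then show ?thesis by (intro holomorphic_compact_finite_zeros[OF g S(1) convex_connected[OF S(2)] _ KS]) auto
  qed
  have "infinite ({0..\<epsilon>} - Re ` {z \<in> ?K. g z = 0})" using fin eps by (intro Diff_infinite_finite) (auto simp: infinite_Icc)
  then obtain s where s: "s \<in> {0..\<epsilon>}" "s \<notin> Re ` {z \<in> ?K. g z = 0}" using infinite_imp_nonempty by blast
  define L where "L = (\<lambda>t. Complex s t) ` {-h..h}"
  have cL: "compact L" unfolding L_def by (intro compact_continuous_image continuous_intros) auto
  have LK: "L \<subseteq> ?K" using s h by (auto simp: L_def in_cbox_complex_iff)
  have LS: "L \<subseteq> S" using LK KS by blast
  have Lne: "L \<noteq> {}" using h by (auto simp: L_def)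
  have gn: "g z \<noteq> 0" if "z \<in> L" for z
  proof
    assume "g z = 0"
    then have "Re z \<in> Re ` {z \<in> ?K. g z = 0}" using that LK by (intro imageI) auto
    moreover have "Re z = s" using that by (auto simp: L_def)
    ultimately show False using s by simp
  qed
  have "continuous_on L (\<lambda>z. norm (g z))" by (intro continuous_intros continuous_on_subset[OF holomorphic_on_imp_continuous_on[OF g] LS])
  then obtain z0 where z0: "z0 \<in> L" "\<And>z. z \<in> L \<Longrightarrow> norm (g z0) \<le> norm (g z)" using continuous_attains_inf[OF cL Lne] by blast
  define m where "m = norm (g z0)"
  have m: "m > 0" using gn[OF z0(1)] by (simp add: m_def)
  obtain N where N: "\<And>n z. n \<ge> N \<Longrightarrow> z \<in> L \<Longrightarrow> dist (\<F> (r n) z) (g z) < m/2"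
    using ul[OF cL LS] m unfolding uniform_limit_sequentially_iff by (metis half_gt_zero o_apply)
  obtain k :: nat where k: "2 / m < real k" using reals_Archimedean2 by blast
  define n where "n = max N k"
  have "s + \<tau> (r n) \<in> {\<tau> (r n)..\<tau> (r n) + \<epsilon>}" using s by auto
  from \<tau>[OF this] obtain t where t: "t \<in> {-h..h}" "norm (F (Complex (s + \<tau> (r n)) t)) < 1 / (real (r n) + 1)" by blast
  have "Complex s t + of_real (\<tau> (r n)) = Complex (s + \<tau> (r n)) t" by (simp add: complex_eq_iff)
  then have 1: "norm (\<F> (r n) (Complex s t)) < 1 / (real (r n) + 1)" unfolding \<F>_def using t by simp
  have tL: "Complex s t \<in> L" using t by (auto simp: L_def)
  have "m \<le> norm (g (Complex s t))" unfolding m_def by (rule z0(2)[OF tL])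
  moreover have "dist (\<F> (r n) (Complex s t)) (g (Complex s t)) < m/2" by (rule N[OF _ tL]) (simp add: n_def)
  ultimately have 2: "m/2 < norm (\<F> (r n) (Complex s t))"
    unfolding dist_norm by (smt (verit) norm_minus_commute norm_triangle_ineq2 field_sum_of_halves)
  have "real k \<le> real (r n)" using seq_suble[OF r, of n] by (simp add: n_def)
  then have "1 / (real (r n) + 1) \<le> 1 / real k"
  proof -
    have "0 < real k" using k m by (smt (verit) divide_pos_pos)
    then show ?thesis using \<open>real k \<le> real (r n)\<close> by (intro divide_left_mono) auto
  qed
  also have "1 / real k < m/2"
  proof -
    have "0 < real k" using k m by (smt (verit) divide_pos_pos)
    then show ?thesis using k m by (simp add: field_simps)
  qed
  finally show False using 1 2 by linarith
qed

section \<open>Transposition, conjugation and reflection for the dual system\<close>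

definition transpose2 :: "complex^2^2 \<Rightarrow> complex^2^2" where "transpose2 A = (\<chi> i j. A $ j $ i)"

text \<open>Bilinear instead of sesquilinear, so that passing to the transposed system leaves the
  spectral parameter unconjugated.\<close>

definition bdot :: "complex^2 \<Rightarrow> complex^2 \<Rightarrow> complex" where "bdot v w = v $ 1 * w $ 1 + v $ 2 * w $ 2"

lemma bounded_bilinear_bdot: "bounded_bilinear bdot"
proof
  fix u v w :: "complex^2" and r :: real
  show "bdot (u + v) w = bdot u w + bdot v w" by (simp add: bdot_def algebra_simps)
  show "bdot u (v + w) = bdot u v + bdot u w" by (simp add: bdot_def algebra_simps)
  show "bdot (r *\<^sub>R u) v = r *\<^sub>R bdot u v" by (simp add: bdot_def algebra_simps)
  show "bdot u (r *\<^sub>R v) = r *\<^sub>R bdot u v" by (simp add: bdot_def algebra_simps)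
  have "norm (bdot u v) \<le> norm u * norm v * 2" for u v
  proof -
    have "norm (bdot u v) \<le> norm (u $ 1) * norm (v $ 1) + norm (u $ 2) * norm (v $ 2)"
      unfolding bdot_def by (rule order_trans[OF norm_triangle_ineq]) (simp add: norm_mult)
    also have "\<dots> \<le> norm u * norm v + norm u * norm v" by (intro add_mono mult_mono norm_entry_le) auto
    finally show ?thesis by simp
  qed
  then show "\<exists>K. \<forall>u v. norm (bdot u v) \<le> norm u * norm v * K" by blast
qed

lemma bdot_transpose: "bdot (transpose2 A *v u) v = bdot u (A *v v)" by (simp add: bdot_def transpose2_def matrix_vector_mult_def sum_2 algebra_simps)

lemma transpose2_add: "transpose2 (A + B) = transpose2 A + transpose2 B" by (simp add: transpose2_def vec_eq_iff)

lemma transpose2_diagA: "transpose2 (diagA b1 b2 z) = diagA b1 b2 z" by (simp add: transpose2_def diagA_def vec_eq_iff)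

lemma bounded_linear_transpose2: "bounded_linear transpose2"
proof -
  have "linear transpose2" by (rule linearI) (simp_all add: transpose2_def vec_eq_iff)
  then show ?thesis by (simp add: linear_conv_bounded_linear)
qed

definition cnj2 :: "complex^2 \<Rightarrow> complex^2" where "cnj2 v = (\<chi> i. cnj (v $ i))"

lemma norm_cnj2: "norm (cnj2 v) = norm v" by (simp add: cnj2_def norm_vec_def)

lemma cdot_bdot: "cdot v w = bdot (cnj2 w) v" by (simp add: cdot_def bdot_def cnj2_def sum_2 mult.commute)

lemma bounded_linear_cnj2: "bounded_linear cnj2"
proof -
  have "linear cnj2" by (rule linearI) (simp_all add: cnj2_def vec_eq_iff)
  then show ?thesis by (simp add: linear_conv_bounded_linear)
qed

lemma square_integrable_norm_le:
  assumes f: "square_integrable f" and g: "g \<in> borel_measurable unit_leb" and le: "\<And>x. norm (g x) \<le> c * norm (f x)"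
  shows "square_integrable g" "norm_sq g \<le> c\<^sup>2 * norm_sq f"
proof -
  have f2: "(\<lambda>x. (norm (f x))\<^sup>2) integrable_on {0..1}" using square_integrable_norm2[OF f] absint_integrable by blast
  have le2: "(norm (g x))\<^sup>2 \<le> c\<^sup>2 * (norm (f x))\<^sup>2" for x using power_mono[OF le[of x] norm_ge_zero, of 2] by (simp add: power_mult_distrib)
  have g2: "(\<lambda>x. (norm (g x))\<^sup>2) absint"
    by (rule measurable_bounded_by_integrable_imp_absolutely_integrable[OF _ _ integrable_on_mult_right[OF f2, of "c\<^sup>2"]]) (use g le2 in auto)
  then show "square_integrable g" unfolding square_integrable_def integrable_unit_leb_iff using g by blast
  have "norm_sq g \<le> integral {0..1} (\<lambda>x. c\<^sup>2 * (norm (f x))\<^sup>2)"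
    by (rule integral_le) (use g2 absint_integrable f2 le2 in \<open>auto intro!: integrable_on_mult_right\<close>)
  then show "norm_sq g \<le> c\<^sup>2 * norm_sq f" by simp
qed

lemma square_integrable_cnj_reverse:
  assumes g: "square_integrable g"
  shows "square_integrable (\<lambda>t. cnj2 (g (1 - t)))"
    "integral {0..1} (\<lambda>t. (norm (cnj2 (g (1 - t))))\<^sup>2) = norm_sq g"
proof -
  have "(\<lambda>t. cnj2 (g (1 - t))) absint"
    using absolutely_integrable_linear[OF reverse_integral(1)[OF square_integrable_imp_absint[OF g]] bounded_linear_cnj2] by (simp add: o_def)
  then have m: "(\<lambda>t. cnj2 (g (1 - t))) \<in> borel_measurable unit_leb" by (rule absolutely_integrable_imp_borel_measurable) simp
  show "square_integrable (\<lambda>t. cnj2 (g (1 - t)))" unfolding square_integrable_def integrable_unit_leb_iff norm_cnj2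
    using m reverse_integral(1)[OF square_integrable_norm2[OF g]] by blast
  show "integral {0..1} (\<lambda>t. (norm (cnj2 (g (1 - t))))\<^sup>2) = norm_sq g"
    unfolding norm_cnj2 by (rule reverse_integral(2)[OF square_integrable_norm2[OF g]])
qed

definition L2sq :: "curve \<Rightarrow> real" where "L2sq f = norm_sq f"

lemma L2sq_nonneg: "0 \<le> L2sq f" unfolding L2sq_def by (cases "(\<lambda>x. (norm (f x))\<^sup>2) integrable_on {0..1}")
    (auto intro: hk_integral_nonneg simp: not_integrable_integral)

lemma norm_abs_L2_L2sq: "square_integrable f \<Longrightarrow> (norm (abs_L2 f))\<^sup>2 = L2sq f" unfolding L2sq_def by (rule norm_abs_L2)

section \<open>Bessel inequalities for the system and bounds for its determinant\<close>

context dirac_problem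
begin

lemma nz: "b1 \<noteq> 0" "b2 \<noteq> 0" using b1 b2 by auto

text \<open>\<open>c\<close> will be the spacing of the cells. It has to be so small that the
  exponentials with frequencies \<open>b1 * c * k\<close>, and likewise those with
  \<open>b2 * c * k\<close>, have a common period of length at least 1.\<close>

lemma coef_c_bounds:
  obtains c where "c > 0" "\<bar>b1\<bar> * c \<le> 2 * pi" "\<bar>b2\<bar> * c \<le> 2 * pi"
proof (rule that[of "2 * pi / \<beta>"])
  show "2 * pi / \<beta> > 0" using \<beta>(1) by simp
  show "\<bar>b1\<bar> * (2 * pi / \<beta>) \<le> 2 * pi" "\<bar>b2\<bar> * (2 * pi / \<beta>) \<le> 2 * pi" using \<beta>(1) by (auto simp: field_simps \<beta>_def)
qed

theorem bessel_w:
  assumes c: "c > 0" "\<bar>b1\<bar> * c \<le> 2 * pi" "\<bar>b2\<bar> * c \<le> 2 * pi" and R: "0 \<le> R"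
  obtains C where "0 < C" "\<And>f K z. square_integrable f \<Longrightarrow> finite (K :: int set) \<Longrightarrow> (\<And>k. k \<in> K \<Longrightarrow> norm (z k - of_real (c * of_int k)) \<le> R) \<Longrightarrow>
    (\<Sum>k\<in>K. (norm (sol (z k) 0 f 1))\<^sup>2) \<le> C * L2sq f"
proof -
  obtain C where C: "0 \<le> C" "\<And>F K z w x. square_integrable F \<Longrightarrow> finite (K :: int set) \<Longrightarrow> (\<And>k. k \<in> K \<Longrightarrow> norm (z k - of_real (c * of_int k)) \<le> R) \<Longrightarrow>
    (\<And>k. k \<in> K \<Longrightarrow> linear_ode (\<lambda>t. diagA b1 b2 (z k) + V t) F (w k)) \<Longrightarrow> (\<And>k. k \<in> K \<Longrightarrow> w k 0 = 0) \<Longrightarrow> x \<in> {0..1} \<Longrightarrow> (\<Sum>k\<in>K. (norm (w k x))\<^sup>2) \<le> C * norm_sq F"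
    by (rule bessel_gronwall[OF nz c V_absint R]) blast
  show ?thesis
  proof (rule that[of "C * (norm (D 1))\<^sup>2 + 1"])
    show "0 < C * (norm (D 1))\<^sup>2 + 1" using C(1) by (simp add: add_nonneg_pos)
    fix f and K :: "int set" and z :: "int \<Rightarrow> complex" assume f: "square_integrable f" and K: "finite K"
      and z: "\<And>k. k \<in> K \<Longrightarrow> norm (z k - of_real (c * of_int k)) \<le> R"
    have fi: "f absint" by (rule square_integrable_imp_absint[OF f])
    have m: "(\<lambda>t. D 1 *v f t) \<in> borel_measurable unit_leb" by (rule absolutely_integrable_imp_borel_measurable[OF D1_absint[OF fi]]) simp
    note sq = square_integrable_norm_le[OF f m norm_matrix_vector_le]
    have "(\<Sum>k\<in>K. (norm (sol (z k) 0 f 1))\<^sup>2) \<le> C * integral {0..1} (\<lambda>t. (norm (D 1 *v f t))\<^sup>2)"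
      by (rule C(2)[OF sq(1) K z]) (use sol[OF fi] in \<open>auto simp: dsol_def\<close>)
    also have "\<dots> \<le> C * ((norm (D 1))\<^sup>2 * L2sq f)" unfolding L2sq_def by (rule mult_left_mono[OF sq(2) C(1)])
    also have "\<dots> \<le> (C * (norm (D 1))\<^sup>2 + 1) * L2sq f" using L2sq_nonneg[of f] by (simp add: algebra_simps)
    finally show "(\<Sum>k\<in>K. (norm (sol (z k) 0 f 1))\<^sup>2) \<le> (C * (norm (D 1))\<^sup>2 + 1) * L2sq f" .
  qed
qed

text \<open>The pairing of \<open>g\<close> with solutions of the homogeneous system is computed by solving the transposed system
  backwards from \<open>x = 1\<close>, which makes the same Bessel inequality available for it.\<close>

theorem bessel_pairing:
  assumes c: "c > 0" "\<bar>b1\<bar> * c \<le> 2 * pi" "\<bar>b2\<bar> * c \<le> 2 * pi" and R: "0 \<le> R"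
  obtains C where "0 < C" "\<And>g K z. square_integrable g \<Longrightarrow> finite (K :: int set) \<Longrightarrow> (\<And>k. k \<in> K \<Longrightarrow> norm (z k - of_real (c * of_int k)) \<le> R) \<Longrightarrow>
    (\<Sum>k\<in>K. (norm (pairing g (U (z k) 1)) + norm (pairing g (U (z k) 2)))\<^sup>2) \<le> C * L2sq g"
proof -
  define W where "W t = transpose2 (V (1 - t))" for t
  have W: "W absint"
    using absolutely_integrable_linear[OF reverse_integral(1)[OF V_absint] bounded_linear_transpose2] by (simp add: o_def W_def[abs_def])
  obtain C where C: "0 \<le> C" "\<And>F K z w x. square_integrable F \<Longrightarrow> finite (K :: int set) \<Longrightarrow> (\<And>k. k \<in> K \<Longrightarrow> norm (z k - of_real (c * of_int k)) \<le> R) \<Longrightarrow>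
    (\<And>k. k \<in> K \<Longrightarrow> linear_ode (\<lambda>t. diagA b1 b2 (z k) + W t) F (w k)) \<Longrightarrow> (\<And>k. k \<in> K \<Longrightarrow> w k 0 = 0) \<Longrightarrow> x \<in> {0..1} \<Longrightarrow> (\<Sum>k\<in>K. (norm (w k x))\<^sup>2) \<le> C * norm_sq F"
    by (rule bessel_gronwall[OF nz c W R]) blast
  show ?thesis
  proof (rule that[of "4 * C + 1"])
    show "0 < 4 * C + 1" using C(1) by simp
    fix g and K :: "int set" and z :: "int \<Rightarrow> complex" assume g: "square_integrable g" and K: "finite K"
      and z: "\<And>k. k \<in> K \<Longrightarrow> norm (z k - of_real (c * of_int k)) \<le> R"
    define G where "G t = cnj2 (g (1 - t))" for t
    note G = square_integrable_cnj_reverse[OF g, folded G_def]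
    have Wz: "(\<lambda>t. diagA b1 b2 z + W t) absint" for z by (intro set_integral_add W) simp
    have "\<exists>\<zeta>. linear_ode (\<lambda>t. diagA b1 b2 z + W t) G \<zeta> \<and> \<zeta> 0 = 0" for z using linear_ode_exists[OF Wz square_integrable_imp_absint[OF G(1)]] by metis
    then obtain \<zeta> where \<zeta>: "\<And>z. linear_ode (\<lambda>t. diagA b1 b2 z + W t) G (\<zeta> z)" "\<And>z. \<zeta> z 0 = 0" by metis
    \<comment> \<open>For \<open>q t = \<zeta> z (1 - t)\<close> the derivative of
      \<open>bdot q U\<close> is \<open>- cdot U g\<close>. At 1 the factor \<open>q\<close>
      vanishes, and at 0 the factor \<open>U\<close> is a unit vector.\<close>
    have key: "pairing g (U z i) = \<zeta> z 1 $ i" for z i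
    proof -
      let ?q = "\<lambda>t. \<zeta> z (1 - t)"
      have q: "antiderivative (\<lambda>t. - ((diagA b1 b2 z + W (1 - t)) *v ?q t + G (1 - t))) ?q"
        using antiderivative_reverse[OF \<zeta>(1)[of z, unfolded linear_ode_def]] .
      have y: "antiderivative (\<lambda>t. (D z + V t) *v U z i t + D 1 *v 0) (U z i)" using U_dsol(1)[of z i] unfolding dsol_def linear_ode_def by blast
      have "antiderivative (\<lambda>t. - cdot (U z i t) (g t)) (\<lambda>t. bdot (?q t) (U z i t))"
      proof (rule antiderivative_cong[OF antiderivative_bilinear[OF bounded_bilinear_bdot q y]])
        fix t
        have T: "diagA b1 b2 z + W (1 - t) = transpose2 (D z + V t)" by (simp add: W_def transpose2_add transpose2_diagA)
        interpret bd: bounded_bilinear bdot by (rule bounded_bilinear_bdot)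
        show "bdot (?q t) ((D z + V t) *v U z i t + D 1 *v 0) + bdot (- ((diagA b1 b2 z + W (1 - t)) *v ?q t + G (1 - t))) (U z i t)
          = - cdot (U z i t) (g t)"
          unfolding T cdot_bdot by (simp only: minus_add_distrib bd.add_left bd.minus_left bdot_transpose G_def matrix_vector_mult_0_right, simp)
      qed simp
      from antiderivativeD(2)[OF this, of 1]
      have "bdot (\<zeta> z 0) (U z i 1) = bdot (\<zeta> z 1) (U z i 0) - pairing g (U z i)" by (simp add: pairing_def)
      then have "pairing g (U z i) = bdot (\<zeta> z 1) (axis i 1)" by (simp add: \<zeta>(2) U_dsol(2) bdot_def)
      then show ?thesis using exhaust_2[of i] by (auto simp: bdot_def axis_def)
    qed
    have "(\<Sum>k\<in>K. (norm (pairing g (U (z k) 1)) + norm (pairing g (U (z k) 2)))\<^sup>2) \<le> (\<Sum>k\<in>K. 4 * (norm (\<zeta> (z k) 1))\<^sup>2)"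
    proof (rule sum_mono)
      fix k
      have "norm (\<zeta> (z k) 1 $ 1) + norm (\<zeta> (z k) 1 $ 2) \<le> 2 * norm (\<zeta> (z k) 1)"
        using norm_entry_le[of "\<zeta> (z k) 1" 1] norm_entry_le[of "\<zeta> (z k) 1" 2] by linarith
      then have "(norm (\<zeta> (z k) 1 $ 1) + norm (\<zeta> (z k) 1 $ 2))\<^sup>2 \<le> (2 * norm (\<zeta> (z k) 1))\<^sup>2" by (intro power_mono) auto
      then show "(norm (pairing g (U (z k) 1)) + norm (pairing g (U (z k) 2)))\<^sup>2 \<le> 4 * (norm (\<zeta> (z k) 1))\<^sup>2"
        unfolding key by (simp add: power_mult_distrib)
    qed
    also have "\<dots> = 4 * (\<Sum>k\<in>K. (norm (\<zeta> (z k) 1))\<^sup>2)" by (simp add: sum_distrib_left)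
    also have "(\<Sum>k\<in>K. (norm (\<zeta> (z k) 1))\<^sup>2) \<le> C * norm_sq G" by (rule C(2)[OF G(1) K z]) (use \<zeta> in auto)
    also have "\<dots> = C * L2sq g" unfolding G(2) L2sq_def ..
    finally show "(\<Sum>k\<in>K. (norm (pairing g (U (z k) 1)) + norm (pairing g (U (z k) 2)))\<^sup>2) \<le> (4 * C + 1) * L2sq g"
      using L2sq_nonneg[of g] by (simp add: algebra_simps)
  qed
qed

lemma strip_sol_bound:
  assumes "0 \<le> h"
  obtains C where "0 < C" "\<And>f z y x. \<bar>Im z\<bar> \<le> h \<Longrightarrow> dsol z f y \<Longrightarrow> x \<in> {0..1} \<Longrightarrow>
    norm (y x) \<le> C * (norm (y 0) + norm_L1 f)"
proof -
  obtain C where C: "0 \<le> C" "\<And>F z w x. F absint \<Longrightarrow> \<bar>Im z\<bar> \<le> h \<Longrightarrow>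
    linear_ode (\<lambda>t. diagA b1 b2 z + V t) F w \<Longrightarrow> x \<in> {0..1} \<Longrightarrow>
    norm (w x) \<le> C * (norm (w 0) + norm_L1 F)" by (rule strip_bound[OF V_absint assms]) blast
  show ?thesis
  proof (rule that[of "C * (1 + norm (D 1)) + 1"])
    show "0 < C * (1 + norm (D 1)) + 1" using C(1) by (simp add: add_nonneg_pos)
    fix f z y x assume z: "\<bar>Im z\<bar> \<le> h" and y: "dsol z f y" and x: "x \<in> {0..1::real}"
    have f: "f absint" using y by (simp add: dsol_def)
    let ?I = "norm_L1 f"
    have I0: "0 \<le> ?I" by (rule hk_integral_nonneg) (use absint_sub(3)[OF f] in auto)
    have "integral {0..1} (\<lambda>t. norm (D 1 *v f t)) \<le> integral {0..1} (\<lambda>t. norm (D 1) * norm (f t))"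
      by (rule integral_le) (auto intro!: absint_sub(3)[OF D1_absint[OF f]] integrable_on_mult_right absint_sub(3)[OF f] norm_matrix_vector_le)
    then have I: "integral {0..1} (\<lambda>t. norm (D 1 *v f t)) \<le> norm (D 1) * ?I" by simp
    have "norm (y x) \<le> C * (norm (y 0) + integral {0..1} (\<lambda>t. norm (D 1 *v f t)))"
      using y by (intro C(2)[OF D1_absint[OF f] z _ x]) (simp add: dsol_def)
    also have "\<dots> \<le> C * (norm (y 0) + norm (D 1) * ?I)" using I by (intro mult_left_mono add_left_mono C)
    also have "\<dots> \<le> C * ((1 + norm (D 1)) * (norm (y 0) + ?I))"
    proof (rule mult_left_mono[OF _ C(1)])
      have "0 \<le> norm (D 1) * norm (y 0)" by simp
      moreover have "(1 + norm (D 1)) * (norm (y 0) + ?I) = norm (y 0) + ?I + norm (D 1) * norm (y 0) + norm (D 1) * ?I" by (simp add: algebra_simps)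
      ultimately show "norm (y 0) + norm (D 1) * ?I \<le> (1 + norm (D 1)) * (norm (y 0) + ?I)" using I0 by linarith
    qed
    also have "\<dots> \<le> (C * (1 + norm (D 1)) + 1) * (norm (y 0) + ?I)" using I0 by (simp add: algebra_simps)
    finally show "norm (y x) \<le> (C * (1 + norm (D 1)) + 1) * (norm (y 0) + ?I)" .
  qed
qed

lemma norm_boundary_form_le:
  assumes "norm (y 0) \<le> s" "norm (y 1) \<le> s"
  shows "norm (boundary_form a l y) \<le> (\<Sum>j\<in>UNIV. \<Sum>k\<in>UNIV. norm (a $ j $ k)) * s"
proof -
  have s: "norm (y 0 $ i) \<le> s" "norm (y 1 $ i) \<le> s" for i using assms by (auto intro: order_trans[OF norm_entry_le])
  have s0: "0 \<le> s" using assms(1) norm_ge_zero order_trans by blast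
  have "norm (boundary_form a l y) \<le> (norm (a $ l $ 1) + norm (a $ l $ 2) + norm (a $ l $ 3) + norm (a $ l $ 4)) * s"
    unfolding boundary_form_def distrib_right by (intro norm_triangle_le add_mono) (auto simp: norm_mult intro!: mult_left_mono s)
  also have "norm (a $ l $ 1) + norm (a $ l $ 2) + norm (a $ l $ 3) + norm (a $ l $ 4) = (\<Sum>k\<in>UNIV. norm (a $ l $ k))" by (simp add: sum_4)
  also have "(\<Sum>k\<in>UNIV. norm (a $ l $ k)) * s \<le> (\<Sum>j\<in>UNIV. \<Sum>k\<in>UNIV. norm (a $ j $ k)) * s"
    by (rule mult_right_mono[OF member_le_sum s0]) (auto intro: sum_nonneg)
  finally show ?thesis .
qed

lemma M_bound:
  assumes "0 \<le> h"
  obtains C where "0 < C" "\<And>z l i. \<bar>Im z\<bar> \<le> h \<Longrightarrow> norm (M z l i) \<le> C"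
proof -
  obtain C where C: "0 < C" "\<And>f z y x. \<bar>Im z\<bar> \<le> h \<Longrightarrow> dsol z f y \<Longrightarrow> x \<in> {0..1} \<Longrightarrow>
    norm (y x) \<le> C * (norm (y 0) + norm_L1 f)" using strip_sol_bound[OF assms] by blast
  have "norm (U z i x) \<le> C" if "\<bar>Im z\<bar> \<le> h" "x \<in> {0..1}" for z i x using C(2)[OF that(1) U_dsol(1) that(2), of i] by (simp add: U_dsol(2))
  then have le: "norm (M z l i) \<le> (\<Sum>j\<in>UNIV. \<Sum>k\<in>UNIV. norm (a $ j $ k)) * C" if "\<bar>Im z\<bar> \<le> h" for z l i
    unfolding M_def using that by (intro norm_boundary_form_le) auto
  show ?thesis
  proof (rule that)
    have "0 \<le> (\<Sum>j\<in>UNIV. \<Sum>k\<in>UNIV. norm (a $ j $ k)) * C" using C(1) by (intro mult_nonneg_nonneg sum_nonneg) auto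
    then show "0 < (\<Sum>j\<in>UNIV. \<Sum>k\<in>UNIV. norm (a $ j $ k)) * C + 1" by linarith
    show "norm (M z l i) \<le> (\<Sum>j\<in>UNIV. \<Sum>k\<in>UNIV. norm (a $ j $ k)) * C + 1" if "\<bar>Im z\<bar> \<le> h" for z l i using le[OF that, of l i] by linarith
  qed
qed

text \<open>The hypothesis bounds the matrix \<open>M z\<close> from below by \<open>1 / C\<close>.
  Applied to the columns of its adjugate, whose images are \<open>\<Delta> z\<close> times unit
  vectors up to sign, it bounds entries of \<open>M z\<close> by
  \<open>C * norm (\<Delta> z)\<close>; applied to the first unit vector, it shows that the first
  column of \<open>M z\<close> is not small.\<close>

lemma \<Delta>_lower:
  assumes ap: "\<And>y x. dsol z (\<lambda>_. 0) y \<Longrightarrow> x \<in> {0..1} \<Longrightarrow>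
    norm (y x) \<le> C * (norm (boundary_form a 1 y) + norm (boundary_form a 2 y))" and C: "0 < C"
  shows "1 / (2 * C\<^sup>2) \<le> norm (\<Delta> z)"
proof -
  have b: "norm c \<le> C * (norm (M z 1 1 * c $ 1 + M z 1 2 * c $ 2) + norm (M z 2 1 * c $ 1 + M z 2 2 * c $ 2))" for c :: "complex^2"
  proof -
    have d: "dsol z (\<lambda>_. 0) (sol z c (\<lambda>_. 0))" and c: "sol z c (\<lambda>_. 0) 0 = c" by (rule sol[OF absint_0])+
    have w0: "sol z 0 (\<lambda>_. 0) x = 0" if "x \<in> {0..1}" for x
      using dsol_unique[OF sol(1)[OF absint_0] dsol_zero _ that, of z 0] sol(2)[OF absint_0, of z 0] by simp
    have b0: "boundary_form a l (sol z 0 (\<lambda>_. 0)) = 0" for l using w0[of 0] w0[of 1] by (simp add: boundary_form_def)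
    show ?thesis using ap[OF d, of 0] unfolding boundary_decompose[OF d] c b0 by simp
  qed
  have c1: "norm (M z 2 2) \<le> C * norm (\<Delta> z)" "norm (M z 2 1) \<le> C * norm (\<Delta> z)"
    "norm (M z 1 1) \<le> C * norm (\<Delta> z)"
  proof -
    let ?c = "(\<chi> i. if i = 1 then M z 2 2 else - M z 2 1) :: complex^2"
    have "norm ?c \<le> C * norm (\<Delta> z)" using b[of ?c] by (simp add: \<Delta>_def algebra_simps)
    moreover have "norm (?c $ 1) \<le> norm ?c" "norm (?c $ 2) \<le> norm ?c" by (rule norm_entry_le)+
    ultimately show "norm (M z 2 2) \<le> C * norm (\<Delta> z)" "norm (M z 2 1) \<le> C * norm (\<Delta> z)" by auto
    let ?d = "(\<chi> i. if i = 1 then - M z 1 2 else M z 1 1) :: complex^2"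
    have "norm ?d \<le> C * norm (\<Delta> z)" using b[of ?d] by (simp add: \<Delta>_def algebra_simps)
    moreover have "norm (?d $ 2) \<le> norm ?d" by (rule norm_entry_le)
    ultimately show "norm (M z 1 1) \<le> C * norm (\<Delta> z)" by auto
  qed
  have "1 \<le> C * (norm (M z 1 1) + norm (M z 2 1))"     using order_trans[OF norm_entry_le[of "axis 1 1 :: complex^2" 1] b[of "axis 1 1"]] by (simp add: axis_def)
  also have "\<dots> \<le> C * (C * norm (\<Delta> z) + C * norm (\<Delta> z))" using c1 C by (intro mult_left_mono add_mono) auto
  also have "\<dots> = 2 * C\<^sup>2 * norm (\<Delta> z)" by (simp add: power2_eq_square algebra_simps)
  finally show ?thesis using C by (simp add: field_simps)
qed

text \<open>The initial value is obtained from the boundary forms of \<open>- sol z 0 f\<close> by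
  inverting \<open>M z\<close>. As \<open>sol z 0 f\<close> vanishes at 0, only its value at 1
  enters these forms, and this is the quantity that \<open>bessel_w\<close> sums.\<close>

lemma initial_value_bound:
  assumes "0 \<le> h" "0 < \<delta>"
  obtains C where "0 < C" "\<And>f z y. \<bar>Im z\<bar> \<le> h \<Longrightarrow> \<delta> \<le> norm (\<Delta> z) \<Longrightarrow> dsol z f y \<Longrightarrow> homogeneous_bc y \<Longrightarrow>
    norm (y 0) \<le> C * norm (sol z 0 f 1)"
proof -
  obtain B where B: "0 < B" "\<And>z l i. \<bar>Im z\<bar> \<le> h \<Longrightarrow> norm (M z l i) \<le> B" using M_bound[OF assms(1)] by blast
  define A where "A = (\<Sum>j\<in>UNIV. \<Sum>k\<in>UNIV. norm (a $ j $ k))"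
  have A0: "0 \<le> A" unfolding A_def by (intro sum_nonneg norm_ge_zero)
  show ?thesis
  proof (rule that[of "8 * B * A / \<delta> + 1"])
    show "0 < 8 * B * A / \<delta> + 1" using B(1) A0 assms(2) by (simp add: add_nonneg_pos)
    fix f z y assume z: "\<bar>Im z\<bar> \<le> h" and \<Delta>: "\<delta> \<le> norm (\<Delta> z)" and y: "dsol z f y" and bc: "homogeneous_bc y"
    have f: "f absint" using y by (simp add: dsol_def)
    let ?w = "sol z 0 f"
    have bw: "norm (boundary_form a l ?w) \<le> A * norm (?w 1)" for l unfolding A_def by (rule norm_boundary_form_le) (simp_all add: sol(2)[OF f])
    have e: "M z l 1 * y 0 $ 1 + M z l 2 * y 0 $ 2 = - boundary_form a l ?w" for l
      using bc exhaust_2[of l] boundary_decompose[OF y, of l] unfolding homogeneous_bc_def by (auto simp: eq_neg_iff_add_eq_0 add.commute)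
    have nz: "M z 1 1 * M z 2 2 - M z 2 1 * M z 1 2 \<noteq> 0" using \<Delta> assms(2) by (auto simp: \<Delta>_def algebra_simps)
    have "norm (y 0) \<le> norm (y 0 $ 1) + norm (y 0 $ 2)" by (rule norm_C2_le)
    also have "\<dots> \<le> (norm (M z 1 1) + norm (M z 2 1) + norm (M z 1 2) + norm (M z 2 2)) / norm (M z 1 1 * M z 2 2 - M z 2 1 * M z 1 2)
      * (norm (M z 1 1 * y 0 $ 1 + M z 1 2 * y 0 $ 2) + norm (M z 2 1 * y 0 $ 1 + M z 2 2 * y 0 $ 2))" by (rule solve_2x2_bound[OF nz])
    also have "\<dots> \<le> (B + B + B + B) / \<delta> * (A * norm (?w 1) + A * norm (?w 1))"
    proof (rule mult_mono)
      show "(norm (M z 1 1) + norm (M z 2 1) + norm (M z 1 2) + norm (M z 2 2)) / norm (M z 1 1 * M z 2 2 - M z 2 1 * M z 1 2) \<le> (B + B + B + B) / \<delta>"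
        using \<Delta> assms(2) B(1) by (intro frac_le add_mono B(2) z) (auto simp: \<Delta>_def mult.commute)
      show "norm (M z 1 1 * y 0 $ 1 + M z 1 2 * y 0 $ 2) + norm (M z 2 1 * y 0 $ 1 + M z 2 2 * y 0 $ 2) \<le> A * norm (?w 1) + A * norm (?w 1)"
        unfolding e norm_minus_cancel by (intro add_mono bw)
    qed (use B(1) assms(2) in auto)
    also have "\<dots> \<le> (8 * B * A / \<delta> + 1) * norm (?w 1)" by (simp add: field_simps)
    finally show "norm (y 0) \<le> (8 * B * A / \<delta> + 1) * norm (?w 1)" .
  qed
qed

end

section \<open>Root functions and Riesz projections\<close>

text \<open>The point of maximal modulus is kept because the Bessel inequalities sum over one sample
  point for each cell; a bound by separate suprema of the factors would not fit them.\<close>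

lemma rectpath_mean_value:
  assumes cont: "continuous_on (path_image (rectpath a b)) F" and le: "Re a \<le> Re b" "Im a \<le> Im b"
  obtains z where "z \<in> path_image (rectpath a b)"
    "norm (contour_integral (rectpath a b) F) \<le> 2 * ((Re b - Re a) + (Im b - Im a)) * norm (F z)"
proof -
  let ?P = "path_image (rectpath a b)"
  have 1: "compact ?P" by (intro compact_path_image) simp
  have 2: "?P \<noteq> {}" by simp
  have 3: "continuous_on ?P (\<lambda>z. norm (F z))" by (intro continuous_intros cont)
  obtain z where z: "z \<in> ?P" "\<And>w. w \<in> ?P \<Longrightarrow> norm (F w) \<le> norm (F z)" using continuous_attains_sup[OF 1 2 3] by blast
  define c d where "c = Complex (Re b) (Im a)" and "d = Complex (Re a) (Im b)"
  have r: "rectpath a b = linepath a c +++ linepath c b +++ linepath b d +++ linepath d a" by (simp add: rectpath_def Let_def c_def d_def)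
  have P: "?P = closed_segment a c \<union> closed_segment c b \<union> closed_segment b d \<union> closed_segment d a" unfolding r by (simp add: path_image_join Un_assoc)
  have ci: "F contour_integrable_on linepath p q" "norm (contour_integral (linepath p q) F) \<le> norm (F z) * norm (q - p)"
    if "closed_segment p q \<subseteq> ?P" for p q
  proof -
    show i: "F contour_integrable_on linepath p q" by (intro contour_integrable_continuous_linepath continuous_on_subset[OF cont that])
    show "norm (contour_integral (linepath p q) F) \<le> norm (F z) * norm (q - p)"
      by (rule contour_integral_bound_linepath[OF i]) (use z(2) that in auto)
  qed
  note ci1 = ci[of a c] and ci2 = ci[of c b] and ci3 = ci[of b d] and ci4 = ci[of d a]
  have s: "closed_segment a c \<subseteq> ?P" "closed_segment c b \<subseteq> ?P" "closed_segment b d \<subseteq> ?P" "closed_segment d a \<subseteq> ?P" unfolding P by auto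
  have n: "norm (c - a) = Re b - Re a" "norm (b - c) = Im b - Im a" "norm (d - b) = Re b - Re a" "norm (a - d) = Im b - Im a"
    using le by (simp_all add: c_def d_def cmod_def)
  have eq: "contour_integral (rectpath a b) F = contour_integral (linepath a c) F + (contour_integral (linepath c b) F
      + (contour_integral (linepath b d) F + contour_integral (linepath d a) F))"
    unfolding r using ci1(1)[OF s(1)] ci2(1)[OF s(2)] ci3(1)[OF s(3)] ci4(1)[OF s(4)] by (simp add: contour_integral_join contour_integrable_joinI)
  have "norm (contour_integral (rectpath a b) F) \<le> norm (contour_integral (linepath a c) F) + (norm (contour_integral (linepath c b) F)
      + (norm (contour_integral (linepath b d) F) + norm (contour_integral (linepath d a) F)))"
    unfolding eq by (intro norm_triangle_le add_mono order_refl)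
  also have "\<dots> \<le> norm (F z) * norm (c - a) + (norm (F z) * norm (b - c) + (norm (F z) * norm (d - b) + norm (F z) * norm (a - d)))"
    by (intro add_mono ci1(2) ci2(2) ci3(2) ci4(2) s)
  finally show ?thesis unfolding n by (intro that[OF z(1)]) (simp add: algebra_simps)
qed

lemma contour_integral_inverse_power:
  assumes g: "valid_path g" "pathfinish g = pathstart g" and z: "z \<notin> path_image g"
  shows "((\<lambda>w. 1 / (w - z) ^ Suc j) has_contour_integral (if j = 0 then 2 * of_real pi * \<i> * winding_number g z else 0)) g"
proof (cases "j = 0")
  case True
  have i: "(\<lambda>w. 1 / (w - z)) contour_integrable_on g" by (rule contour_integrable_inversediff[OF g(1) z])
  have "contour_integral g (\<lambda>w. 1 / (w - z)) = 2 * of_real pi * \<i> * winding_number g z" using winding_number_valid_path[OF g(1) z] by simp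
  then show ?thesis using True has_contour_integral_integral[OF i] by simp
next
  case False
  have "((\<lambda>w. 1 / (w - z) ^ Suc j) has_contour_integral (- 1 / (of_nat j * (pathfinish g - z) ^ j) - (- 1 / (of_nat j * (pathstart g - z) ^ j)))) g"
  proof (rule contour_integral_primitive[of "- {z}" "\<lambda>w. - 1 / (of_nat j * (w - z) ^ j)"])
    fix w assume "w \<in> - {z}"
    then have wz: "w - z \<noteq> 0" by simp
    obtain m where m: "j = Suc m" using False by (cases j) auto
    have "((\<lambda>w. - 1 / (of_nat j * (w - z) ^ j)) has_field_derivative
      - (0 * (of_nat j * (w - z) ^ j) - (- 1) * 0) + (of_nat j * (of_nat j * (w - z) ^ (j - 1))) / (of_nat j * (w - z) ^ j) ^ 2) (at w)"
      using wz False by (auto intro!: derivative_eq_intros simp: power2_eq_square divide_simps)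
    moreover have "(of_nat j * (of_nat j * (w - z) ^ (j - 1))) / (of_nat j * (w - z) ^ j) ^ 2 = 1 / (w - z) ^ Suc j"
    proof -
      have alg: "(c * (c * X)) / (c * (d * X)) ^ 2 = 1 / (d * (d * X))" if "c \<noteq> 0" "d \<noteq> 0" "X \<noteq> 0" for c d X :: complex
        using that by (simp add: power2_eq_square field_simps)
      show ?thesis using alg[of "of_nat j" "w - z" "(w - z) ^ m"] wz False unfolding m by (simp del: of_nat_Suc)
    qed
    ultimately have "((\<lambda>w. - 1 / (of_nat j * (w - z) ^ j)) has_field_derivative 1 / (w - z) ^ Suc j) (at w)" by simp
    then show "((\<lambda>w. - 1 / (of_nat j * (w - z) ^ j)) has_field_derivative 1 / (w - z) ^ Suc j) (at w within - {z})"
      by (rule has_field_derivative_at_within)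
  qed (use g z in auto)
  then show ?thesis using False g(2) by simp
qed

section \<open>Chains of root functions and their resolvents\<close>

context dirac_problem
begin

abbreviation L :: "(L2 \<times> L2) set" where "L \<equiv> dirac_op b1 b2 Q a"

text \<open>Here \<open>v 0\<close> is the root function, and \<open>v (Suc j)\<close> is the image
  of \<open>v j\<close> under the operator minus \<open>z\<close>, until 0 is reached. The members
  are functions and not classes, which gives continuous representatives throughout the
  chain.\<close>

definition chain :: "complex \<Rightarrow> nat \<Rightarrow> (nat \<Rightarrow> curve) \<Rightarrow> bool"
  where "chain z n v \<longleftrightarrow> (\<forall>j<n. dsol z (v (Suc j)) (v j) \<and> homogeneous_bc (v j)) \<and> v n = (\<lambda>_. 0)"

text \<open>In a relational power, consecutive pairs share only a class in \<open>L2\<close>. A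
  right-hand side may be changed on a null set, so the representative found for the remaining steps
  can be inserted into the current one.\<close>

lemma root_subspace_chain:
  assumes "u \<in> root_subspace L z"
  obtains n v where "chain z n v" "abs_L2 (v 0) = u"
proof -
  obtain n where "(u, 0) \<in> shifted_op L z ^^ n" using assms unfolding root_subspace_def by blast
  then have "\<exists>v. chain z n v \<and> abs_L2 (v 0) = u"
  proof (induction n arbitrary: u)
    case 0
    then show ?case by (intro exI[of _ "\<lambda>_ _. 0"]) (auto simp: chain_def abs_L2_zero)
  next
    case (Suc n)
    then obtain u' where u': "(u, u') \<in> shifted_op L z" "(u', 0) \<in> shifted_op L z ^^ n" by (meson relpow_Suc_D2)
    obtain v where v: "chain z n v" "abs_L2 (v 0) = u'" using Suc.IH[OF u'(2)] by blast
    obtain y f where y: "u = abs_L2 y" "u' = abs_L2 f" "square_integrable f" "dsol z f y" "homogeneous_bc y"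
      using u'(1) unfolding shifted_op_iff by blast
    have sv: "square_integrable (v 0)"
    proof (cases n)
      case 0 then show ?thesis using v(1) by (simp add: chain_def square_integrable_zero)
    next
      case (Suc m) then show ?thesis using v(1) dsol_imp_square_integrable unfolding chain_def by blast
    qed
    have "AE x in unit_leb. f x = v 0 x" using y(2) v(2) abs_L2_eq_iff[OF y(3) sv] by simp
    then have "dsol z (v 0) y" by (rule dsol_AE_cong[OF y(4)])
    then show ?case using v(1) y(1,5) by (intro exI[of _ "\<lambda>j. if j = 0 then y else v (j - 1)"]) (auto simp: chain_def less_Suc_eq_0_disj)
  qed
  then show ?thesis using that by blast
qed

lemma chain_continuous:
  assumes "chain z n v" "j \<le> n" shows "continuous_on {0..1} (v j)"
  using assms dsol_continuous unfolding chain_def by (cases "j = n") (auto simp: le_less)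

lemma chain_root_subspace:
  assumes "chain z n v" "j \<le> n"
  shows "(abs_L2 (v j), 0) \<in> shifted_op L z ^^ (n - j)" using assms(2)
proof (induction "n - j" arbitrary: j)
  case 0
  then have "j = n" by simp
  then show ?case using assms(1) by (simp add: chain_def abs_L2_zero)
next
  case (Suc k)
  then have j: "j < n" "k = n - Suc j" by auto
  have "square_integrable (v (Suc j))" using chain_continuous[OF assms(1), of "Suc j"] j by (intro continuous_imp_square_integrable) auto
  then have "(abs_L2 (v j), abs_L2 (v (Suc j))) \<in> shifted_op L z" using assms(1) j(1) unfolding shifted_op_iff chain_def by blast
  moreover have "(abs_L2 (v (Suc j)), 0) \<in> shifted_op L z ^^ k" using Suc.hyps(1)[OF j(2)] j by simp
  ultimately show ?case using Suc.hyps(2) by (metis relpow_Suc_I2)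
qed

lemma root_subspace_nonzero_eigenvalue:
  assumes "u \<in> root_subspace L z" "u \<noteq> 0"
  shows "z \<in> eigenvalues L"
proof -
  obtain n where "(u, 0) \<in> shifted_op L z ^^ n" using assms unfolding root_subspace_def by blast
  then show ?thesis using assms(2)
  proof (induction n arbitrary: u)
    case (Suc n)
    then obtain u' where u': "(u, u') \<in> shifted_op L z" "(u', 0) \<in> shifted_op L z ^^ n" by (meson relpow_Suc_D2)
    show ?case
    proof (cases "u' = 0")
      case True
      then obtain v where "(u, v) \<in> L" "0 = v - cscale z u" using u'(1) unfolding shifted_op_def by auto
      then show ?thesis using Suc.prems(2) unfolding eigenvalues_def by auto
    qed (use Suc.IH[OF u'(2)] in blast)
  qed simp
qed

text \<open>The finite Laurent sum at \<open>z\<close> for the resolvent at \<open>w\<close> applied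
  to \<open>v 0\<close>. The minus signs come from writing the operator minus \<open>w\<close> as
  the operator minus \<open>z\<close>, minus \<open>w - z\<close>.\<close>

definition chain_resolvent :: "complex \<Rightarrow> nat \<Rightarrow> (nat \<Rightarrow> curve) \<Rightarrow> complex \<Rightarrow> curve"
  where "chain_resolvent z n v w x = (\<Sum>j<n. (- 1 / (w - z) ^ Suc j) *s v j x)"

text \<open>Moving the spectral parameter from \<open>z\<close> to \<open>w\<close> turns the
  right-hand sides into a telescoping sum from \<open>v 0\<close> to \<open>v n = 0\<close>.\<close>

lemma chain_resolvent:
  assumes c: "chain z n v" and wz: "w \<noteq> z"
  shows "dsol w (v 0) (chain_resolvent z n v w)" "homogeneous_bc (chain_resolvent z n v w)"
proof -
  have cj: "dsol z (v (Suc j)) (v j)" "homogeneous_bc (v j)" "continuous_on {0..1} (v j)" if "j < n" for j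
    using c that chain_continuous[OF c, of j] unfolding chain_def by auto
  have "dsol w (\<lambda>x. \<Sum>j<n. (- 1 / (w - z) ^ Suc j) *s (v (Suc j) x + (z - w) *s v j x)) (\<lambda>x. \<Sum>j<n. (- 1 / (w - z) ^ Suc j) *s v j x)"
    by (intro dsol_sum dsol_shift cj) auto
  then show "dsol w (v 0) (chain_resolvent z n v w)"
  proof (rule dsol_cong)
    fix x
    have "(- 1 / (w - z) ^ Suc j) *s (v (Suc j) x + (z - w) *s v j x) = (1 / (w - z) ^ j) *s v j x - (1 / (w - z) ^ Suc j) *s v (Suc j) x" for j
    proof -
      have e: "- 1 / (w - z) ^ Suc j * (z - w) = 1 / (w - z) ^ j" using wz by (simp add: field_simps)
      have "(- 1 / (w - z) ^ Suc j) *s (v (Suc j) x + (z - w) *s v j x) =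
          (- 1 / (w - z) ^ Suc j) *s v (Suc j) x + (- 1 / (w - z) ^ Suc j * (z - w)) *s v j x" by (simp only: vector_add_ldistrib vector_smult_assoc)
      also have "\<dots> = (1 / (w - z) ^ j) *s v j x - (1 / (w - z) ^ Suc j) *s v (Suc j) x" unfolding e by (simp add: vec_eq_iff)
      finally show ?thesis .
    qed
    then have "(\<Sum>j<n. (- 1 / (w - z) ^ Suc j) *s (v (Suc j) x + (z - w) *s v j x))
      = (\<Sum>j<n. (1 / (w - z) ^ j) *s v j x - (1 / (w - z) ^ Suc j) *s v (Suc j) x)" by simp
    also have "\<dots> = v 0 x - (1 / (w - z) ^ n) *s v n x" by (subst sum_lessThan_telescope') simp
    also have "v n x = 0" using c by (simp add: chain_def)
    finally show "(\<Sum>j<n. (- 1 / (w - z) ^ Suc j) *s (v (Suc j) x + (z - w) *s v j x)) = v 0 x" by simp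
  qed (simp add: chain_resolvent_def)
  have "boundary_form a l (chain_resolvent z n v w) = (\<Sum>j<n. (- 1 / (w - z) ^ Suc j) * boundary_form a l (v j))" for l
    unfolding chain_resolvent_def[abs_def] by (rule sup_functional_sum[OF sup_functional_boundary]) (use cj in auto)
  then show "homogeneous_bc (chain_resolvent z n v w)" using cj(2) by (auto simp: homogeneous_bc_def)
qed

lemma chain_functional:
  assumes c: "chain z n v" and \<psi>: "sup_functional \<psi>"
  shows "\<psi> (chain_resolvent z n v w) = (\<Sum>j<n. - \<psi> (v j) * (1 / (w - z) ^ Suc j))"
proof -
  have "\<psi> (chain_resolvent z n v w) = (\<Sum>j<n. (- 1 / (w - z) ^ Suc j) * \<psi> (v j))" unfolding chain_resolvent_def[abs_def]
    by (rule sup_functional_sum[OF \<psi>]) (use chain_continuous[OF c] in auto)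
  then show ?thesis by (simp add: mult.commute)
qed

text \<open>Of the Laurent sum only the simple pole contributes; its residue is
  \<open>- \<psi> (v 0)\<close>.\<close>

lemma chain_contour_integral:
  assumes c: "chain z n v" and \<psi>: "sup_functional \<psi>"
    and g: "valid_path g" "pathfinish g = pathstart g" and z: "z \<notin> path_image g"
  shows "((\<lambda>w. \<psi> (chain_resolvent z n v w)) has_contour_integral (- (2 * of_real pi * \<i>) * winding_number g z * \<psi> (v 0))) g"
proof (cases "n = 0")
  case True
  then have "\<psi> (v 0) = 0" using c sup_functional_zero[OF \<psi>] by (simp add: chain_def)
  then show ?thesis unfolding chain_functional[OF c \<psi>] using True by (simp add: has_contour_integral_0)
next
  case False
  have "((\<lambda>w. \<Sum>j<n. - \<psi> (v j) * (1 / (w - z) ^ Suc j)) has_contour_integral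
    (\<Sum>j<n. - \<psi> (v j) * (if j = 0 then 2 * of_real pi * \<i> * winding_number g z else 0))) g"
    by (intro has_contour_integral_sum has_contour_integral_lmul contour_integral_inverse_power g z) auto
  moreover have "(\<Sum>j<n. - \<psi> (v j) * (if j = 0 then 2 * of_real pi * \<i> * winding_number g z else 0))
    = - (2 * of_real pi * \<i>) * winding_number g z * \<psi> (v 0)"
  proof -
    have "(\<Sum>j<n. - \<psi> (v j) * (if j = 0 then 2 * of_real pi * \<i> * winding_number g z else 0))
      = (\<Sum>j<n. if j = 0 then - \<psi> (v 0) * (2 * of_real pi * \<i> * winding_number g z) else 0)" by (rule sum.cong) auto
    also have "\<dots> = - \<psi> (v 0) * (2 * of_real pi * \<i> * winding_number g z)" using False by simp
    finally show ?thesis by (simp add: mult_ac)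
  qed
  ultimately show ?thesis unfolding chain_functional[OF c \<psi>] by simp
qed

text \<open>The part \<open>sol w 0 f\<close> of the resolvent is entire and drops out of the contour integral, so that only the
  initial value, controlled by \<open>sol w 0 f 1\<close>, and the solutions \<open>U w i\<close> remain.\<close>

lemma rectangle_projection:
  assumes h: "0 \<le> h" and \<delta>: "0 < \<delta>"
    and C: "\<And>f z y. \<bar>Im z\<bar> \<le> h \<Longrightarrow> \<delta> \<le> norm (\<Delta> z) \<Longrightarrow> dsol z f y \<Longrightarrow> homogeneous_bc y \<Longrightarrow>
      norm (y 0) \<le> C * norm (sol z 0 f 1)" "0 < C"
    and p: "Re p < Re q" "Im p < Im q" and l: "2 * ((Re q - Re p) + (Im q - Im p)) \<le> l"
    and path: "\<And>w. w \<in> path_image (rectpath p q) \<Longrightarrow> \<bar>Im w\<bar> \<le> h \<and> \<delta> \<le> norm (\<Delta> w)"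
    and F: "finite F" "\<And>z. z \<in> F \<Longrightarrow> \<Delta> z = 0" "\<And>z. z \<in> F \<Longrightarrow> chain z (n z) (v z)"
    and \<psi>: "sup_functional \<psi>"
  obtains w where "w \<in> path_image (rectpath p q)"
    "norm (\<Sum>z\<in>F \<inter> box p q. \<psi> (v z 0)) \<le> l * C * norm (sol w 0 (\<lambda>x. \<Sum>z\<in>F. v z 0 x) 1) * (norm (\<psi> (U w 1)) + norm (\<psi> (U w 2)))"
proof -
  let ?g = "rectpath p q" and ?S = "\<Sum>z\<in>F \<inter> box p q. \<psi> (v z 0)" and ?R = "\<lambda>w. \<Sum>z\<in>F. \<psi> (chain_resolvent z (n z) (v z) w)" and ?c = "2 * of_real pi * \<i>"
  define f where "f x = (\<Sum>z\<in>F. v z 0 x)" for x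
  define r where "r w x = (\<Sum>z\<in>F. chain_resolvent z (n z) (v z) w x)" for w x
  have out: "z \<notin> path_image ?g" if "z \<in> F" for z using path[of z] F(2)[OF that] \<delta> by auto
  have cF: "continuous_on {0..1} (v z 0)" if "z \<in> F" for z using chain_continuous[OF F(3)[OF that], of 0] by simp
  have f: "f absint" unfolding f_def by (intro absolutely_integrable_continuous_real continuous_intros cF)
  have r: "dsol w f (r w)" "homogeneous_bc (r w)" "\<psi> (r w) = (\<Sum>z\<in>F. \<psi> (chain_resolvent z (n z) (v z) w))" if w: "w \<notin> F" for w
  proof -
    have wz: "w \<noteq> z" if "z \<in> F" for z using that w by blast
    note cr = chain_resolvent[OF F(3) wz]
    have "dsol w (\<lambda>x. \<Sum>z\<in>F. 1 *s v z 0 x) (\<lambda>x. \<Sum>z\<in>F. 1 *s chain_resolvent z (n z) (v z) w x)" by (rule dsol_sum) (rule cr(1))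
    then show "dsol w f (r w)" by (simp add: f_def[abs_def] r_def[abs_def])
    have s: "\<psi> (r w) = (\<Sum>z\<in>F. \<psi> (chain_resolvent z (n z) (v z) w))" if \<psi>: "sup_functional \<psi>" for \<psi>
      using sup_functional_sum[OF \<psi>, of F "\<lambda>z. chain_resolvent z (n z) (v z) w" "\<lambda>_. 1"] dsol_continuous[OF cr(1)] by (simp add: r_def[abs_def])
    show "\<psi> (r w) = (\<Sum>z\<in>F. \<psi> (chain_resolvent z (n z) (v z) w))" by (rule s[OF \<psi>])
    show "homogeneous_bc (r w)" using cr(2) by (simp add: homogeneous_bc_def s[OF sup_functional_boundary])
  qed
  have pF: "w \<notin> F" if "w \<in> path_image ?g" for w using out that by blast
  have ci: "(?R has_contour_integral (\<Sum>z\<in>F. - ?c * winding_number ?g z * \<psi> (v z 0))) ?g"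
    by (intro has_contour_integral_sum F(1) chain_contour_integral[OF F(3) \<psi>] out) simp_all
  have wn: "(\<Sum>z\<in>F. - ?c * winding_number ?g z * \<psi> (v z 0)) = - ?c * ?S"
  proof -
    have "winding_number ?g z = (if z \<in> box p q then 1 else 0)" if "z \<in> F" for z
    proof (cases "z \<in> box p q")
      case False
      then have "z \<notin> cbox p q" using out[OF that] p by (auto simp: path_image_rectpath_cbox_minus_box)
      then show ?thesis using winding_number_rectpath_outside[of p q z] p False by simp
    qed (simp add: winding_number_rectpath)
    then have "(\<Sum>z\<in>F. - ?c * winding_number ?g z * \<psi> (v z 0)) = (\<Sum>z\<in>F. if z \<in> box p q then - ?c * \<psi> (v z 0) else 0)" by (intro sum.cong) auto
    also have "\<dots> = (\<Sum>z\<in>F \<inter> box p q. - ?c * \<psi> (v z 0))" by (rule sum.inter_restrict[OF F(1), symmetric])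
    finally show ?thesis by (simp add: sum_distrib_left)
  qed
  have hw: "(\<lambda>w. \<psi> (sol w 0 f)) holomorphic_on UNIV" by (rule holomorphic_w[OF f \<psi>])
  have cw: "((\<lambda>w. \<psi> (sol w 0 f)) has_contour_integral 0) ?g" by (rule Cauchy_theorem_convex_simple[OF hw]) auto
  define G where "G w = r w 0 $ 1 * \<psi> (U w 1) + r w 0 $ 2 * \<psi> (U w 2)" for w
  have dec: "?R w - \<psi> (sol w 0 f) = G w" if "w \<in> path_image ?g" for w
    using functional_decompose[OF \<psi> r(1)[OF pF[OF that]]] unfolding G_def r(3)[OF pF[OF that]] by (simp only: add_diff_cancel_left')
  have "((\<lambda>w. ?R w - \<psi> (sol w 0 f)) has_contour_integral (- ?c * ?S - 0)) ?g" using has_contour_integral_diff[OF ci cw] unfolding wn .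
  then have iG: "(G has_contour_integral (- ?c * ?S)) ?g" using has_contour_integral_eq[OF _ dec] by simp
  have cG: "continuous_on (path_image ?g) G"
  proof (rule continuous_on_eq[OF _ dec])
    show "continuous_on (path_image ?g) (\<lambda>w. ?R w - \<psi> (sol w 0 f))" unfolding chain_functional[OF F(3) \<psi>]
    proof (intro continuous_on_diff)
      show "continuous_on (path_image ?g) (\<lambda>w. \<psi> (sol w 0 f))" using holomorphic_on_imp_continuous_on[OF hw] by (rule continuous_on_subset) simp
      have "continuous_on (path_image ?g) (\<lambda>w. \<Sum>z\<in>F. \<Sum>j<n z. - \<psi> (v z j) * (1 / (w - z) ^ Suc j))" by (intro continuous_intros) (use out in auto)
      then show "continuous_on (path_image ?g) ?R" by (rule continuous_on_eq) (simp add: chain_functional[OF F(3) \<psi>])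
    qed
  qed
  obtain w where w: "w \<in> path_image ?g"
    "norm (contour_integral ?g G) \<le> 2 * ((Re q - Re p) + (Im q - Im p)) * norm (G w)" using rectpath_mean_value[OF cG] p by auto
  have nG: "norm (G w) \<le> C * norm (sol w 0 f 1) * (norm (\<psi> (U w 1)) + norm (\<psi> (U w 2)))"
  proof -
    have "norm (r w 0) \<le> C * norm (sol w 0 f 1)" using path[OF w(1)] r(1,2)[OF pF[OF w(1)]] by (intro C) auto
    then have n: "norm (r w 0 $ i) \<le> C * norm (sol w 0 f 1)" for i by (rule order_trans[OF norm_entry_le])
    have "norm (G w) \<le> norm (r w 0 $ 1) * norm (\<psi> (U w 1)) + norm (r w 0 $ 2) * norm (\<psi> (U w 2))"
      unfolding G_def by (intro norm_triangle_le) (simp add: norm_mult)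
    also have "\<dots> \<le> C * norm (sol w 0 f 1) * norm (\<psi> (U w 1)) + C * norm (sol w 0 f 1) * norm (\<psi> (U w 2))" by (intro add_mono mult_right_mono n) auto
    finally show ?thesis by (simp add: algebra_simps)
  qed
  have "norm ?S \<le> 2 * pi * norm ?S" using pi_gt3 by (simp add: mult_right_mono[of 1 "2 * pi", simplified])
  also have "\<dots> = norm (contour_integral ?g G)" unfolding contour_integral_unique[OF iG] by (simp add: norm_mult)
  also have "\<dots> \<le> l * norm (G w)" using w(2) mult_right_mono[OF l norm_ge_zero[of "G w"]] by linarith
  also have "\<dots> \<le> l * (C * norm (sol w 0 f 1) * (norm (\<psi> (U w 1)) + norm (\<psi> (U w 2))))" by (rule mult_left_mono[OF nG]) (use l p in argo)
  finally show ?thesis by (intro that[OF w(1)]) (simp add: f_def[abs_def] mult.assoc)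
qed

end

section \<open>Completeness\<close>

text \<open>Division by \<open>x ^ m\<close> shifts the series. Applied to numerator and
  denominator, this gives the limit of a quotient at a common zero.\<close>

lemma powser_order_limit:
  fixes F :: "complex \<Rightarrow> complex"
  assumes r: "0 < r" and F: "\<And>x. norm x < r \<Longrightarrow> (\<lambda>n. a n * x ^ n) sums F x" and a: "\<And>n. n < m \<Longrightarrow> a n = 0"
  shows "((\<lambda>x. F x / x ^ m) \<longlongrightarrow> a m) (at 0)"
proof -
  have "((\<lambda>x. F x / x ^ m) \<longlongrightarrow> a (0 + m)) (at 0)"
  proof (rule powser_limit_0_strong[OF r, of "\<lambda>n. a (n + m)"])
    fix x :: complex assume x: "x \<noteq> 0" "norm x < r"
    have "(\<lambda>n. a (n + m) * x ^ (n + m)) sums (F x - (\<Sum>n<m. a n * x ^ n))" using sums_split_initial_segment[OF F[OF x(2)]] .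
    then have "(\<lambda>n. a (n + m) * x ^ (n + m)) sums F x" using a by simp
    from sums_divide[OF this, of "x ^ m"] show "(\<lambda>n. a (n + m) * x ^ n) sums (F x / x ^ m)" using x(1) by (simp add: power_add)
  qed
  then show ?thesis by simp
qed

lemma powser_zero_coeffs:
  assumes r: "0 < r" and F: "\<And>x :: complex. norm x < r \<Longrightarrow> (\<lambda>n. a n * x ^ n) sums 0"
  shows "a n = 0"
proof (induction n rule: less_induct)
  case (less n)
  have "((\<lambda>x. 0 / x ^ n) \<longlongrightarrow> a n) (at (0 :: complex))" by (rule powser_order_limit[OF r F less])
  then have "((\<lambda>x. 0) \<longlongrightarrow> a n) (at (0 :: complex))" by (simp only: div_0)
  from tendsto_unique[OF at_neq_bot this tendsto_const] show ?case .
qed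

text \<open>The argument of du Bois-Reymond. Let \<open>\<phi>\<close> be the antiderivative
  \<open>\<Gamma>\<close> of \<open>g\<close> minus its mean \<open>m\<close>. Then the primitive
  \<open>y\<close> of \<open>\<phi>\<close> vanishes at both ends, and integration by parts turns
  orthogonality to this \<open>y\<close> into the vanishing of the square integral of
  \<open>\<phi>\<close>. Hence \<open>\<Gamma>\<close> is constant.\<close>

lemma pairing_zero_imp_AE:
  assumes g: "g absint"
    and orth: "\<And>\<phi> y. antiderivative \<phi> y \<Longrightarrow> y 0 = 0 \<Longrightarrow> y 1 = 0 \<Longrightarrow> pairing g y = 0"
  shows "AE x in unit_leb. g x = 0"
proof -
  define \<Gamma> where "\<Gamma> x = 0 + integral {0..x} g" for x
  define m where "m = integral {0..1} \<Gamma>"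
  define \<phi> where "\<phi> x = \<Gamma> x + (- m)" for x
  define y where "y x = 0 + integral {0..x} \<phi>" for x
  have \<Gamma>: "antiderivative g \<Gamma>" unfolding \<Gamma>_def[abs_def] by (rule antiderivative_integral[OF g])
  have c: "antiderivative (\<lambda>x. 0) (\<lambda>x. - m)" by (rule antiderivativeI2) auto
  have \<phi>: "antiderivative g \<phi>" using antiderivative_add[OF \<Gamma> c] unfolding \<phi>_def[abs_def] by simp
  note c\<phi> = antiderivative_continuous[OF \<phi>]
  have y: "antiderivative \<phi> y" unfolding y_def[abs_def] by (rule antiderivative_integral) (intro absolutely_integrable_continuous_real c\<phi>)
  have i\<Gamma>: "\<Gamma> integrable_on {0..1}" by (intro integrable_continuous_interval antiderivative_continuous[OF \<Gamma>])
  have y0: "y 0 = 0" by (simp add: y_def)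
  have "y 1 = integral {0..1} \<Gamma> - integral {0..1::real} (\<lambda>x. m)" unfolding y_def \<phi>_def add_0_left diff_conv_add_uminus[symmetric]
    by (rule hk_integral_diff[OF i\<Gamma>]) (rule integrable_const_ivl)
  then have y1: "y 1 = 0" by (simp add: m_def)
  have A: "antiderivative (\<lambda>x. cdot (y x) (g x) + cdot (\<phi> x) (\<phi> x)) (\<lambda>x. cdot (y x) (\<phi> x))"
    by (rule antiderivative_bilinear[OF bounded_bilinear_cdot y \<phi>])
  have i1: "(\<lambda>x. cdot (y x) (g x)) integrable_on {0..1}" using absint_cdot[OF g antiderivative_continuous[OF y]] absint_integrable by blast
  have cn: "continuous_on {0..1} (\<lambda>x. (norm (\<phi> x))\<^sup>2)" by (intro continuous_intros c\<phi>)
  have i2: "(\<lambda>x. cdot (\<phi> x) (\<phi> x)) integrable_on {0..1}" unfolding cdot_self by (intro integrable_continuous_interval continuous_intros c\<phi>)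
  have "cdot (y 1) (\<phi> 1) = cdot (y 0) (\<phi> 0) + integral {0..1} (\<lambda>x. cdot (y x) (g x) + cdot (\<phi> x) (\<phi> x))" by (rule antiderivativeD(2)[OF A]) simp
  moreover have "cdot 0 w = 0" for w by (simp add: cdot_def)
  ultimately have "integral {0..1} (\<lambda>x. cdot (y x) (g x) + cdot (\<phi> x) (\<phi> x)) = 0" unfolding y0 y1 by simp
  then have "pairing g y + integral {0..1} (\<lambda>x. cdot (\<phi> x) (\<phi> x)) = 0" unfolding pairing_def hk_integral_add[OF i1 i2] .
  then have "integral {0..1} (\<lambda>x. cdot (\<phi> x) (\<phi> x)) = 0" using orth[OF y y0 y1] by simp
  moreover have "integral {0..1} (\<lambda>x. Re (cdot (\<phi> x) (\<phi> x))) = Re (integral {0..1} (\<lambda>x. cdot (\<phi> x) (\<phi> x)))"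
    using integral_linear[OF i2 bounded_linear_Re] by (simp add: o_def)
  ultimately have "integral {0..1} (\<lambda>x. (norm (\<phi> x))\<^sup>2) = 0" by (simp add: cdot_self)
  then have z: "(norm (\<phi> x))\<^sup>2 = 0" if "x \<in> {0..1}" for x using integral_eq_0_iff[OF cn] that by auto
  have "AE x in unit_leb. x \<in> {0..1::real}" by (rule AE_I2) simp
  with antiderivative_AE[OF \<phi>] show ?thesis
  proof eventually_elim
    case (elim x)
    have "((\<lambda>_. 0) has_vector_derivative g x) (at x within {0..1})" using has_vector_derivative_transform[OF elim(2) _ elim(1), of "\<lambda>_. 0"] z by simp
    from vector_derivative_within_cbox[of 0 1, unfolded cbox_interval, OF _ elim(2) this]
      vector_derivative_within_cbox[of 0 1, unfolded cbox_interval, OF _ elim(2) has_vector_derivative_const[of "0::complex^2"]]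
    show ?case by simp
  qed
qed

text \<open>\<open>h\<close> and \<open>C\<close> come from the a priori estimate, and the
  \<open>s k\<close> are the abscissas of vertical segments on which \<open>\<Delta>\<close> stays
  away from 0. Choosing \<open>s k\<close> in a window of length \<open>c / 2\<close> keeps
  consecutive segments at distances between \<open>c / 2\<close> and
  \<open>3 * c / 2\<close>.\<close>

locale dirac_contours = dirac_problem +
  fixes c h \<delta> C :: real and s :: "int \<Rightarrow> real"
  assumes c: "0 < c" "\<bar>b1\<bar> * c \<le> 2 * pi" "\<bar>b2\<bar> * c \<le> 2 * pi"
    and h: "0 < h" and \<delta>: "0 < \<delta>" and C: "0 < C"
    and outer_bound: "\<And>z f y x. h \<le> \<bar>Im z\<bar> \<Longrightarrow> dsol z f y \<Longrightarrow> homogeneous_bc y \<Longrightarrow> x \<in> {0..1} \<Longrightarrow>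
      norm (y x) \<le> C * norm_L1 f"
    and decay: "\<And>f e. f absint \<Longrightarrow> 0 < e \<Longrightarrow>
      \<exists>\<tau>. \<forall>z y x. \<tau> \<le> \<bar>Im z\<bar> \<longrightarrow> dsol z f y \<longrightarrow> homogeneous_bc y \<longrightarrow> x \<in> {0..1} \<longrightarrow> norm (y x) \<le> e"
    and \<Delta>_outer: "\<And>z. h \<le> \<bar>Im z\<bar> \<Longrightarrow> \<delta> \<le> norm (\<Delta> z)"
    and s: "\<And>k. c * of_int k \<le> s k" "\<And>k. s k \<le> c * of_int k + c / 2"
    and \<Delta>_vertical: "\<And>k t. \<bar>t\<bar> \<le> h \<Longrightarrow> \<delta> \<le> norm (\<Delta> (Complex (s k) t))"

lemma (in dirac_problem) contours_exist: "\<exists>c h \<delta> C s. dirac_contours b1 b2 Q a c h \<delta> C s"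
proof -
  obtain c where c: "c > 0" "\<bar>b1\<bar> * c \<le> 2 * pi" "\<bar>b2\<bar> * c \<le> 2 * pi" by (rule coef_c_bounds)
  obtain h C where h: "h > 0" and C: "C > 0" and ap: "\<And>z f y x. h \<le> \<bar>Im z\<bar> \<Longrightarrow> dsol z f y \<Longrightarrow> x \<in> {0..1} \<Longrightarrow>
    norm (y x) \<le> C * (norm (boundary_form a 1 y) + norm (boundary_form a 2 y) + norm_L1 f)"
    and dec: "\<And>f e. f absint \<Longrightarrow> 0 < e \<Longrightarrow> \<exists>\<tau>. \<forall>z y x. \<tau> \<le> \<bar>Im z\<bar> \<longrightarrow> dsol z f y \<longrightarrow>
      boundary_form a 1 y = 0 \<longrightarrow> boundary_form a 2 y = 0 \<longrightarrow> x \<in> {0..1} \<longrightarrow> norm (y x) \<le> e" by (rule a_priori) blast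
  define \<delta>1 where "\<delta>1 = 1 / (2 * C\<^sup>2)"
  have \<delta>1: "\<delta>1 \<le> norm (\<Delta> z)" if "h \<le> \<bar>Im z\<bar>" for z unfolding \<delta>1_def using ap[OF that, of "\<lambda>_. 0"] C by (intro \<Delta>_lower) auto
  have p1: "0 < \<delta>1" using C by (simp add: \<delta>1_def)
  have h1: "0 \<le> h + 1" using h by simp
  obtain CM where CM: "0 < CM" "\<And>z l i. \<bar>Im z\<bar> \<le> h + 1 \<Longrightarrow> norm (M z l i) \<le> CM" by (rule M_bound[OF h1]) blast
  have "norm (\<Delta> z) \<le> CM * CM + CM * CM" if "\<bar>Im z\<bar> \<le> h + 1" for z
    unfolding \<Delta>_def using CM that by (intro norm_triangle_le_diff add_mono) (auto simp: norm_mult intro!: mult_mono)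
  note bd = this
  have "0 < c / 2" using c by simp
  from vertical_lines_bounded_below[OF holomorphic_\<Delta> h this bd \<delta>1[of "Complex x h" for x] p1] h
  obtain \<delta>2 where \<delta>2: "0 < \<delta>2" "\<And>\<tau>. \<exists>s\<in>{\<tau>..\<tau> + c / 2}. \<forall>t\<in>{-h..h}. \<delta>2 \<le> norm (\<Delta> (Complex s t))"
    by (metis (no_types, lifting) abs_of_pos complex.sel(2) order_refl)
  from \<delta>2(2) have "\<forall>k :: int. \<exists>s. s \<in> {c * of_int k..c * of_int k + c / 2} \<and> (\<forall>t\<in>{-h..h}. \<delta>2 \<le> norm (\<Delta> (Complex s t)))" by blast
  then obtain s where s: "\<And>k. s k \<in> {c * of_int k..c * of_int k + c / 2}" "\<And>k t. t \<in> {-h..h} \<Longrightarrow> \<delta>2 \<le> norm (\<Delta> (Complex (s k) t))"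
    unfolding choice_iff by blast
  have "dirac_contours b1 b2 Q a c h (min \<delta>1 \<delta>2) C s"
  proof (unfold_locales)
    show "norm (y x) \<le> C * norm_L1 f" if "h \<le> \<bar>Im z\<bar>" "dsol z f y" "homogeneous_bc y" "x \<in> {0..1}" for z f y x
      using ap[OF that(1,2,4)] that(3) by (simp add: homogeneous_bc_def)
    show "\<exists>\<tau>. \<forall>z y x. \<tau> \<le> \<bar>Im z\<bar> \<longrightarrow> dsol z f y \<longrightarrow> homogeneous_bc y \<longrightarrow> x \<in> {0..1} \<longrightarrow> norm (y x) \<le> e" if "f absint" "0 < e" for f e
      using dec[OF that] unfolding homogeneous_bc_def by blast
    show "min \<delta>1 \<delta>2 \<le> norm (\<Delta> z)" if "h \<le> \<bar>Im z\<bar>" for z using \<delta>1[OF that] by simp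
    show "min \<delta>1 \<delta>2 \<le> norm (\<Delta> (Complex (s k) t))" if "\<bar>t\<bar> \<le> h" for k t using s(2)[of t k] that by (simp add: abs_le_iff)
    show "c * of_int k \<le> s k" "s k \<le> c * of_int k + c / 2" for k using s(1)[of k] by auto
  qed (use c h C p1 \<delta>2(1) in auto)
  then show ?thesis by blast
qed

context dirac_contours
begin

definition box_lo :: "int \<Rightarrow> complex" where "box_lo k = Complex (s k) (- h)"
definition box_hi :: "int \<Rightarrow> complex" where "box_hi k = Complex (s (k + 1)) h"

lemma s_less: "s k < s (k + 1)" "s (k + 1) - s k \<le> 3 * c / 2"
  using s(2)[of k] s(1)[of k] s(1)[of "k + 1"] s(2)[of "k + 1"] c(1) by (simp_all add: algebra_simps)

lemma s_strict_mono: "j < k \<Longrightarrow> s j < s k"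
proof -
  assume "j < k"
  then have "c * (of_int j + 1) \<le> c * of_int k" using c(1) by (intro mult_left_mono) auto
  then show ?thesis using s(2)[of j] s(1)[of k] c(1) by (simp add: algebra_simps)
qed

lemma box_bounds: "Re (box_lo k) < Re (box_hi k)" "Im (box_lo k) < Im (box_hi k)" using s_less h by (simp_all add: box_lo_def box_hi_def)

text \<open>The abscissa \<open>s j\<close> may lie on either side of \<open>x\<close>, so the right
  index is \<open>j\<close> or \<open>j - 1\<close>.\<close>

lemma interval_cover: obtains k where "s k \<le> x" "x < s (k + 1)"
proof -
  define j where "j = \<lfloor>x / c\<rfloor>"
  have "of_int j \<le> x / c" "x / c < of_int j + 1" unfolding j_def by linarith+
  then have j: "c * of_int j \<le> x" "x < c * (of_int j + 1)" using c(1) by (simp_all add: field_simps)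
  show ?thesis
  proof (cases "s j \<le> x")
    case True
    then show ?thesis using that[of j] j(2) s(1)[of "j + 1"] by simp
  next
    case False
    have "s (j - 1) \<le> c * of_int (j - 1) + c / 2" by (rule s)
    also have "\<dots> \<le> x" using j(1) c(1) by (simp add: algebra_simps)
    finally show ?thesis using that[of "j - 1"] False by simp
  qed
qed

lemma contour_bound:
  assumes "z \<in> path_image (rectpath (box_lo k) (box_hi k))"
  shows "\<bar>Im z\<bar> \<le> h" "\<delta> \<le> norm (\<Delta> z)"
proof -
  have z: "(Re z = s k \<or> Re z = s (k + 1)) \<and> Im z \<in> {-h..h} \<or> (Im z = - h \<or> Im z = h)" "Im z \<in> {-h..h}"
    using assms box_bounds[of k] by (auto simp: path_image_rectpath box_lo_def box_hi_def)
  then show i: "\<bar>Im z\<bar> \<le> h" by auto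
  from z(1) show "\<delta> \<le> norm (\<Delta> z)"
  proof
    assume "(Re z = s k \<or> Re z = s (k + 1)) \<and> Im z \<in> {-h..h}"
    then show ?thesis using \<Delta>_vertical[OF i, of k] \<Delta>_vertical[OF i, of "k + 1"] by (metis complex.collapse)
  next
    assume "Im z = - h \<or> Im z = h"
    then show ?thesis by (intro \<Delta>_outer) auto
  qed
qed

lemma \<Delta>_nonzero: "\<Delta> (Complex 0 h) \<noteq> 0" using \<Delta>_outer[of "Complex 0 h"] \<delta> h by auto

lemma \<Delta>_isolated: obtains r where "0 < r" "\<And>w. w \<in> ball z r - {z} \<Longrightarrow> \<Delta> w \<noteq> 0"
proof (cases "\<Delta> z = 0")
  case True
  obtain r where "0 < r" "ball z r \<subseteq> UNIV" "\<And>w. w \<in> ball z r - {z} \<Longrightarrow> \<Delta> w \<noteq> 0"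
    by (rule isolated_zeros[OF holomorphic_\<Delta> open_UNIV connected_UNIV UNIV_I True UNIV_I \<Delta>_nonzero]) blast
  then show ?thesis using that by blast
next
  case False
  have "continuous_on UNIV \<Delta>" by (intro holomorphic_on_imp_continuous_on holomorphic_\<Delta>)
  then have "open (\<Delta> -` (- {0}))" by (intro open_vimage) auto
  then obtain r where "0 < r" "ball z r \<subseteq> \<Delta> -` (- {0})" using False by (meson openE vimageI ComplI singletonD)
  then show ?thesis using that by blast
qed


text \<open>Since \<open>resol z f\<close> belongs to the right-hand side
  \<open>\<Delta> z *s f\<close>, this is the pairing of \<open>g\<close> with the resolvent applied
  to \<open>f\<close>. At the zeros of \<open>\<Delta>\<close> the quotient has the default value 0,
  which is why \<open>remove_sings\<close> is applied to it later.\<close>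

definition resolvent_quotient :: "curve \<Rightarrow> curve \<Rightarrow> complex \<Rightarrow> complex"
  where "resolvent_quotient g f z = pairing g (resol z f) / \<Delta> z"

text \<open>The Taylor coefficients of \<open>resol\<close> below the order of the zero of \<open>\<Delta>\<close> form a chain of root functions.
  They are annihilated by \<open>g\<close>, so the numerator vanishes at least to the order of the denominator.\<close>

lemma resolvent_quotient_limit:
  assumes g: "square_integrable g" and f: "f absint"
    and orth: "\<And>z u. u \<in> root_subspace L z \<Longrightarrow> cinner u (abs_L2 g) = 0"
  obtains l where "resolvent_quotient g f \<midarrow>z0\<rightarrow> l"
proof -
  have gi: "g absint" by (rule square_integrable_imp_absint[OF g])
  define cn where "cn n = (\<chi> i. (deriv ^^ n) (\<lambda>z. cramer z f $ i) z0 / fact n)" for n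
  define dn where "dn n = (deriv ^^ n) \<Delta> z0 / fact n" for n
  have hc: "(\<lambda>z. cramer z f $ i) holomorphic_on UNIV" for i unfolding cramer_def using exhaust_2[of i]
    by (auto intro!: holomorphic_intros holomorphic_M holomorphic_w[OF f sup_functional_boundary])
  have cs: "(\<lambda>n. cn n $ i * (z - z0) ^ n) sums (cramer z f $ i)" for i z
    using holomorphic_power_series[OF holomorphic_on_subset[OF hc], of z0 "norm (z - z0) + 1" z i] by (simp add: cn_def dist_norm norm_minus_commute)
  have ds: "(\<lambda>n. dn n * (z - z0) ^ n) sums \<Delta> z" for z
    using holomorphic_power_series[OF holomorphic_on_subset[OF holomorphic_\<Delta>], of z0 "norm (z - z0) + 1" z]
    by (simp add: dn_def dist_norm norm_minus_commute)
  define T where "T = taylor_sol z0 cn dn f"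
  obtain r where r: "r > 0" "\<And>z c d C D' \<psi>. norm (z - z0) < r \<Longrightarrow> (\<And>i. (\<lambda>n. c n $ i * (z - z0) ^ n) sums (C $ i)) \<Longrightarrow>
    (\<lambda>n. d n * (z - z0) ^ n) sums D' \<Longrightarrow> sup_functional \<psi> \<Longrightarrow> (\<lambda>n. \<psi> (taylor_sol z0 c d f n) * (z - z0) ^ n) sums \<psi> (sol z C (\<lambda>x. D' *s f x))"
    using taylor_sol_sums[OF f, of z0] by blast
  have T: "(\<lambda>n. \<psi> (T n) * x ^ n) sums \<psi> (resol (z0 + x) f)" if "norm x < r" "sup_functional \<psi>" for \<psi> x
    unfolding T_def resol_def using r(2)[OF _ cs ds that(2), of "z0 + x"] that(1) by simp
  have bc: "boundary_form a l (T n) = 0" if "l = 1 \<or> l = 2" for l n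
  proof (rule powser_zero_coeffs[OF r(1)])
    fix x :: complex assume "norm x < r"
    from T[OF this sup_functional_boundary, of a l]
    show "(\<lambda>n. boundary_form a l (T n) * x ^ n) sums 0" using resol(2)[OF f, of "z0 + x"] that by (auto simp: homogeneous_bc_def)
  qed
  have "\<exists>n. dn n \<noteq> 0"
  proof (rule ccontr)
    assume "\<nexists>n. dn n \<noteq> 0"
    then have "(\<lambda>n. 0) sums \<Delta> (Complex 0 h)" using ds[of "Complex 0 h"] by simp
    from sums_unique2[OF this sums_zero] show False using \<Delta>_nonzero by simp
  qed
  \<comment> \<open>The order of the zero of \<open>\<Delta>\<close> at \<open>z0\<close>, possibly
    0.\<close>
  define m where "m = (LEAST n. dn n \<noteq> 0)"
  have dm: "dn m \<noteq> 0" unfolding m_def by (rule LeastI_ex) fact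
  have dl: "dn n = 0" if "n < m" for n using not_less_Least[of n "\<lambda>n. dn n \<noteq> 0"] that unfolding m_def by blast
  have Tm: "pairing g (T n) = 0" if n: "n < m" for n
  proof -
    \<comment> \<open>The chain runs through the coefficients backwards. For \<open>k < m\<close>
      the coefficient \<open>dn k\<close> vanishes, so \<open>f\<close> drops out of the recursion
      and only the preceding coefficient is left on the right.\<close>
    define v where "v j = (if j \<le> n then T (n - j) else (\<lambda>_. 0))" for j
    have d: "dsol z0 (if k = 0 then (\<lambda>_. 0) else T (k - 1)) (T k)" if "k \<le> n" for k
    proof -
      have "dsol z0 (\<lambda>x. dn k *s f x + (if k = 0 then 0 else T (k - 1) x)) (T k)" unfolding T_def using taylor_sol_dsol[OF f, of z0 dn k cn] by blast
      then show ?thesis by (rule dsol_cong) (use dl[of k] that n in auto)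
    qed
    have "chain z0 (Suc n) v" unfolding chain_def
    proof (intro conjI allI impI)
      fix j assume "j < Suc n"
      then have j: "j \<le> n" by simp
      have "v (Suc j) = (if n - j = 0 then (\<lambda>_. 0) else T (n - j - 1))" using j by (auto simp: v_def)
      then show "dsol z0 (v (Suc j)) (v j)" using d[of "n - j"] j by (simp add: v_def)
      show "homogeneous_bc (v j)" using bc j by (simp add: v_def homogeneous_bc_def)
    qed (simp add: v_def)
    from chain_root_subspace[OF this, of 0] have "abs_L2 (T n) \<in> root_subspace L z0"
      unfolding root_subspace_def by (intro CollectI exI[of _ "Suc n"]) (simp add: v_def)
    from orth[OF this] show ?thesis using cinner_abs_L2[OF dsol_imp_square_integrable[OF d[OF order_refl]] g] by simp
  qed
  have 1: "((\<lambda>x. pairing g (resol (z0 + x) f) / x ^ m) \<longlongrightarrow> pairing g (T m)) (at 0)"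
    by (rule powser_order_limit[OF r(1) T[OF _ sup_functional_pairing[OF gi]] Tm])
  have 2: "((\<lambda>x. \<Delta> (z0 + x) / x ^ m) \<longlongrightarrow> dn m) (at 0)" by (rule powser_order_limit[OF r(1) _ dl]) (use ds[of "z0 + x" for x] in simp)
  have 3: "((\<lambda>x. (pairing g (resol (z0 + x) f) / x ^ m) / (\<Delta> (z0 + x) / x ^ m)) \<longlongrightarrow> pairing g (T m) / dn m) (at 0)" by (rule tendsto_divide[OF 1 2 dm])
  have ev: "eventually (\<lambda>x. x \<noteq> 0) (at (0 :: complex))" by (rule eventually_neq_at_within)
  have "((\<lambda>x. resolvent_quotient g f (z0 + x)) \<longlongrightarrow> pairing g (T m) / dn m) (at 0)"
    by (rule Lim_transform_eventually[OF 3]) (use ev in eventually_elim, simp add: resolvent_quotient_def)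
  then show ?thesis by (intro that) (simp add: LIM_offset_zero_iff add.commute)
qed

text \<open>Above and below the strip this is the a priori estimate. On a contour the lower bound
  for \<open>\<Delta>\<close> controls the initial value by the Cauchy solution at 1, and the strip
  estimate controls both this value and the solution itself.\<close>

lemma resolvent_bounds:
  obtains C' where "0 < C'" "\<And>z f y x. dsol z f y \<Longrightarrow> homogeneous_bc y \<Longrightarrow> x \<in> {0..1} \<Longrightarrow>
    h \<le> \<bar>Im z\<bar> \<or> (\<exists>k. z \<in> path_image (rectpath (box_lo k) (box_hi k))) \<Longrightarrow>
    norm (y x) \<le> C' * norm_L1 f"
proof -
  have h0: "0 \<le> h" using h by simp
  obtain C1 where C1: "0 < C1" "\<And>f z y x. \<bar>Im z\<bar> \<le> h \<Longrightarrow> dsol z f y \<Longrightarrow> x \<in> {0..1} \<Longrightarrow>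
    norm (y x) \<le> C1 * (norm (y 0) + norm_L1 f)" by (rule strip_sol_bound[OF h0]) blast
  obtain C2 where C2: "0 < C2" "\<And>f z y. \<bar>Im z\<bar> \<le> h \<Longrightarrow> \<delta> \<le> norm (\<Delta> z) \<Longrightarrow> dsol z f y \<Longrightarrow> homogeneous_bc y \<Longrightarrow>
    norm (y 0) \<le> C2 * norm (sol z 0 f 1)" by (rule initial_value_bound[OF h0 \<delta>]) blast
  show ?thesis
  proof (rule that[of "C + C1 * (C2 * C1 + 1)"])
    show "0 < C + C1 * (C2 * C1 + 1)" using C C1(1) C2(1) by (simp add: add_pos_pos)
    fix z f y and x :: real
    assume y: "dsol z f y" "homogeneous_bc y" and x: "x \<in> {0..1}"
      and z: "h \<le> \<bar>Im z\<bar> \<or> (\<exists>k. z \<in> path_image (rectpath (box_lo k) (box_hi k)))"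
    have f: "f absint" using y by (simp add: dsol_def)
    define I where "I = norm_L1 f"
    have I: "0 \<le> I" unfolding I_def using absint_norm[OF f] absint_integrable by (intro hk_integral_nonneg) auto
    have p: "0 \<le> C * I" "0 \<le> C1 * (C2 * C1 + 1) * I" using C C1(1) C2(1) I by auto
    have "norm (y x) \<le> C * I \<or> norm (y x) \<le> C1 * (C2 * C1 + 1) * I" using z
    proof
      assume "h \<le> \<bar>Im z\<bar>"
      then show ?thesis using outer_bound[OF _ y x] unfolding I_def by blast
    next
      assume "\<exists>k. z \<in> path_image (rectpath (box_lo k) (box_hi k))"
      then obtain k where k: "z \<in> path_image (rectpath (box_lo k) (box_hi k))" ..
      note b = contour_bound[OF k]
      have "norm (sol z 0 f 1) \<le> C1 * I" using C1(2)[OF b(1) sol(1)[OF f, of z 0], of 1] by (simp add: sol(2)[OF f] I_def)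
      then have "norm (y 0) \<le> C2 * (C1 * I)" using C2(2)[OF b y] C2(1) by (meson mult_left_mono less_imp_le order_trans)
      then have "C1 * (norm (y 0) + I) \<le> C1 * (C2 * (C1 * I) + I)" using C1(1) by (intro mult_left_mono add_right_mono) auto
      then show ?thesis using C1(2)[OF b(1) y(1) x] unfolding I_def[symmetric] by (simp add: algebra_simps)
    qed
    then show "norm (y x) \<le> (C + C1 * (C2 * C1 + 1)) * norm_L1 f" using p unfolding I_def[symmetric] distrib_right by linarith
  qed
qed

lemma normalized_resol:
  assumes f: "f absint" and z: "\<Delta> z \<noteq> 0"
  shows "dsol z f (\<lambda>x. (1 / \<Delta> z) *s resol z f x)" "homogeneous_bc (\<lambda>x. (1 / \<Delta> z) *s resol z f x)"
    "g absint \<Longrightarrow> resolvent_quotient g f z = pairing g (\<lambda>x. (1 / \<Delta> z) *s resol z f x)"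
proof -
  note cr = dsol_continuous[OF resol(1)[OF f]]
  show "dsol z f (\<lambda>x. (1 / \<Delta> z) *s resol z f x)" by (rule dsol_cong[OF dsol_scale[OF resol(1)[OF f], of _ "1 / \<Delta> z"]]) (use z in auto)
  show "homogeneous_bc (\<lambda>x. (1 / \<Delta> z) *s resol z f x)"
    using resol(2)[OF f, of z] sup_functional_scale[OF sup_functional_boundary cr] by (simp add: homogeneous_bc_def)
  show "resolvent_quotient g f z = pairing g (\<lambda>x. (1 / \<Delta> z) *s resol z f x)" if "g absint"
    using sup_functional_scale[OF sup_functional_pairing[OF that] cr] by (simp add: resolvent_quotient_def)
qed

text \<open>The singularities are removable by \<open>resolvent_quotient_limit\<close>. The
  resulting entire function is bounded outside the strip and on all cell boundaries by one constant,
  and the maximum principle carries the bound into the cells, so the function is constant. The decay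
  of solutions for growing \<open>\<bar>Im z\<bar>\<close> identifies the constant as 0.\<close>

lemma resolvent_quotient_zero:
  assumes g: "square_integrable g" and f: "f absint"
    and orth: "\<And>z u. u \<in> root_subspace L z \<Longrightarrow> cinner u (abs_L2 g) = 0" and z: "\<Delta> z \<noteq> 0"
  shows "resolvent_quotient g f z = 0"
proof -
  have gi: "g absint" by (rule square_integrable_imp_absint[OF g])
  define G where "G = norm_L1 g"
  have G: "0 \<le> G" unfolding G_def using absint_norm[OF gi] absint_integrable by (intro hk_integral_nonneg) auto
  define F where "F = norm_L1 f"
  define \<Psi> where "\<Psi> = remove_sings (resolvent_quotient g f)"
  have hq: "(\<lambda>z. pairing g (resol z f)) holomorphic_on UNIV" by (rule holomorphic_resol[OF f sup_functional_pairing[OF gi]])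
  have an: "resolvent_quotient g f holomorphic_on A" if "\<And>w. w \<in> A \<Longrightarrow> \<Delta> w \<noteq> 0" for A unfolding resolvent_quotient_def[abs_def]
    by (intro holomorphic_on_divide that holomorphic_on_subset[OF hq] holomorphic_on_subset[OF holomorphic_\<Delta>]) auto
  have an_at: "resolvent_quotient g f analytic_on {w}" if "\<Delta> w \<noteq> 0" for w
  proof -
    obtain r where r: "0 < r" "\<And>v. v \<in> ball w r - {w} \<Longrightarrow> \<Delta> v \<noteq> 0" using \<Delta>_isolated[of w] by blast
    have "resolvent_quotient g f holomorphic_on ball w r" by (rule an) (use r that in blast)
    then show ?thesis using r(1) by (meson analytic_at centre_in_ball open_ball)
  qed
  have eq: "\<Psi> w = resolvent_quotient g f w" if "\<Delta> w \<noteq> 0" for w unfolding \<Psi>_def by (rule remove_sings_at_analytic[OF an_at[OF that]])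
  have "\<Psi> analytic_on {w}" for w
  proof -
    obtain l where l: "resolvent_quotient g f \<midarrow>w\<rightarrow> l" by (rule resolvent_quotient_limit[OF g f orth]) auto
    obtain r where r: "0 < r" "\<And>v. v \<in> ball w r - {w} \<Longrightarrow> \<Delta> v \<noteq> 0" using \<Delta>_isolated[of w] by blast
    have "resolvent_quotient g f holomorphic_on (ball w r - {w})" by (rule an[OF r(2)])
    then have "isolated_singularity_at (resolvent_quotient g f) w"
      unfolding isolated_singularity_at_def using r(1) by (intro exI[of _ r]) (simp add: analytic_on_open open_delete)
    from remove_sings_analytic_at[OF this l] show ?thesis unfolding \<Psi>_def .
  qed
  then have hol: "\<Psi> holomorphic_on UNIV" by (meson UNIV_I analytic_imp_holomorphic analytic_on_analytic_at)
  have val: "norm (\<Psi> w) \<le> G * e" if nz: "\<Delta> w \<noteq> 0"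
    and b: "\<And>x y. dsol w f y \<Longrightarrow> homogeneous_bc y \<Longrightarrow> x \<in> {0..1} \<Longrightarrow> norm (y x) \<le> e" for w e unfolding eq[OF nz] normalized_resol(3)[OF f nz gi] G_def
    by (rule norm_pairing_le[OF gi]) (use normalized_resol(1,2)[OF f nz] dsol_continuous b in blast)+
  obtain C' where C': "0 < C'" "\<And>z f y x. dsol z f y \<Longrightarrow> homogeneous_bc y \<Longrightarrow> x \<in> {0..1} \<Longrightarrow>
    h \<le> \<bar>Im z\<bar> \<or> (\<exists>k. z \<in> path_image (rectpath (box_lo k) (box_hi k))) \<Longrightarrow>
    norm (y x) \<le> C' * norm_L1 f" by (rule resolvent_bounds) blast
  have outer: "norm (\<Psi> w) \<le> G * (C' * F)" if w: "h \<le> \<bar>Im w\<bar> \<or> (\<exists>k. w \<in> path_image (rectpath (box_lo k) (box_hi k)))" for w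
  proof (rule val)
    show "\<Delta> w \<noteq> 0" using w \<Delta>_outer[of w] contour_bound(2)[of w] \<delta> by auto
  qed (use C'(2)[OF _ _ _ w] in \<open>auto simp: F_def\<close>)
  have "norm (\<Psi> w) \<le> G * (C' * F)" for w
  proof (cases "h \<le> \<bar>Im w\<bar>")
    case True
    then show ?thesis using outer by blast
  next
    case False
    obtain k where k: "s k \<le> Re w" "Re w < s (k + 1)" by (rule interval_cover)
    show ?thesis
    proof (rule maximum_modulus_frontier[of \<Psi> "cbox (box_lo k) (box_hi k)"])
      show "norm (\<Psi> z) \<le> G * (C' * F)" if "z \<in> frontier (cbox (box_lo k) (box_hi k))" for z
      proof -
        have "z \<in> path_image (rectpath (box_lo k) (box_hi k))"
          using that box_bounds[of k] by (simp add: frontier_cbox path_image_rectpath_cbox_minus_box)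
        then show ?thesis by (intro outer) blast
      qed
      show "w \<in> cbox (box_lo k) (box_hi k)" using k False by (auto simp: in_cbox_complex_iff box_lo_def box_hi_def)
      show "continuous_on (closure (cbox (box_lo k) (box_hi k))) \<Psi>" by (intro holomorphic_on_imp_continuous_on holomorphic_on_subset[OF hol]) simp
    qed (auto intro: holomorphic_on_subset[OF hol])
  qed
  then have "bounded (range \<Psi>)" by (intro boundedI[of _ "G * (C' * F)"]) auto
  then obtain l where l: "\<And>w. \<Psi> w = l" using Liouville_theorem[OF hol] unfolding constant_on_def by auto
  have "norm l \<le> e * G" if e: "0 < e" for e
  proof -
    obtain \<tau> where \<tau>: "\<And>z y x. \<tau> \<le> \<bar>Im z\<bar> \<Longrightarrow> dsol z f y \<Longrightarrow> homogeneous_bc y \<Longrightarrow> x \<in> {0..1} \<Longrightarrow> norm (y x) \<le> e" using decay[OF f e] by blast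
    define w where "w = Complex 0 (max h \<tau>)"
    have "norm (\<Psi> w) \<le> G * e"
    proof (rule val)
      show "\<Delta> w \<noteq> 0" using \<Delta>_outer[of w] \<delta> h by (auto simp: w_def)
    qed (use \<tau>[of w] in \<open>auto simp: w_def\<close>)
    then show ?thesis by (simp add: l mult.commute)
  qed
  note * = this
  have "norm l \<le> 0 + e" if "0 < e" for e
  proof -
    have "norm l \<le> e / (G + 1) * G" using that G by (intro *) auto
    also have "\<dots> \<le> e" using that G by (simp add: field_simps)
    finally show ?thesis by simp
  qed
  then have "norm l \<le> 0" by (rule field_le_epsilon)
  then show ?thesis using eq[OF z] l[of z] by simp
qed

text \<open>A function that vanishes at both ends satisfies every boundary condition of this form. A
  primitive \<open>y\<close> of this kind is therefore the resolvent applied to a suitable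
  integrable \<open>f\<close>, and the vanishing of the quotient makes \<open>g\<close> orthogonal
  to \<open>y\<close>.\<close>

theorem root_subspaces_complete:
  assumes orth: "\<And>z u. u \<in> root_subspace L z \<Longrightarrow> cinner u v = 0"
  shows "v = 0"
proof -
  obtain g where g: "square_integrable g" "v = abs_L2 g" by (rule L2_rep)
  have gi: "g absint" by (rule square_integrable_imp_absint[OF g(1)])
  define z where "z = Complex 0 h"
  have z: "\<Delta> z \<noteq> 0" unfolding z_def by (rule \<Delta>_nonzero)
  have "AE x in unit_leb. g x = 0"
  proof (rule pairing_zero_imp_AE[OF gi])
    fix \<phi> y :: curve assume y: "antiderivative \<phi> y" "y 0 = 0" "y 1 = 0"
    \<comment> \<open>The inverse of \<open>D 1\<close>: its diagonal entries are
      \<open>- i / b1\<close> and \<open>- i / b2\<close>.\<close>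
    define A where "A = diagA (1 / b1) (1 / b2) (- 1)"
    have DA: "D 1 *v (A *v w) = w" for w
    proof -
      have "(D 1 *v (A *v w)) $ i = w $ i" for i unfolding A_def diagA_nth using nz exhaust_2[of i] by (auto simp: coef_def)
      then show ?thesis by (simp add: vec_eq_iff)
    qed
    define f where "f x = A *v (\<phi> x - (D z + V x) *v y x)" for x
    have "(\<lambda>x. \<phi> x - (D z + V x) *v y x) absint"
      by (intro set_integral_diff antiderivativeD(1)[OF y(1)] absint_matrix_vector DV_absint antiderivative_continuous[OF y(1)])
    from absolutely_integrable_linear[OF this bounded_bilinear.bounded_linear_right[OF bounded_bilinear_matrix_vector, of A]]
    have f: "f absint" unfolding f_def[abs_def] by (simp add: o_def)
    have d: "dsol z f y" unfolding dsol_def linear_ode_def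
    proof (intro conjI f antiderivative_cong[OF y(1)])
      show "\<phi> x = (D z + V x) *v y x + D 1 *v f x" for x unfolding f_def DA by simp
    qed auto
    have h: "homogeneous_bc y" using y by (simp add: homogeneous_bc_def boundary_form_def)
    have "pairing g y = pairing g (\<lambda>x. (1 / \<Delta> z) *s resol z f x)"
      by (rule sup_functional_cong[OF sup_functional_pairing[OF gi] dsol_continuous[OF d]]) (rule bvp_unique[OF d h normalized_resol(1,2)[OF f z] z])
    also have "\<dots> = 0" using resolvent_quotient_zero[OF g(1) f orth[unfolded g(2)] z] unfolding normalized_resol(3)[OF f z gi] .
    finally show "pairing g y = 0" .
  qed
  then show ?thesis unfolding g(2) abs_L2_zero[symmetric] abs_L2_eq_iff[OF g(1) square_integrable_zero] .
qed

end

section \<open>Estimates for the spectral cells\<close>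

lemma square_integrable_sum:
  "(\<And>i. i \<in> I \<Longrightarrow> square_integrable (f i)) \<Longrightarrow> square_integrable (\<lambda>x. \<Sum>i\<in>I. f i x)"
  by (induction I rule: infinite_finite_induct) (simp_all add: square_integrable_zero square_integrable_add)

lemma abs_L2_sum:
  "(\<And>i. i \<in> I \<Longrightarrow> square_integrable (f i)) \<Longrightarrow> (\<Sum>i\<in>I. abs_L2 (f i)) = abs_L2 (\<lambda>x. \<Sum>i\<in>I. f i x)"
proof (induction I rule: infinite_finite_induct)
  case (insert i I)
  then show ?case by (simp add: abs_L2_add square_integrable_sum)
qed (simp_all add: abs_L2_zero)

lemma cinner_commute: "cinner u v = cnj (cinner v u)"
proof -
  obtain f g where fg: "square_integrable f" "u = abs_L2 f" "square_integrable g" "v = abs_L2 g" using L2_rep by metis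
  have "(\<lambda>x. cdot (g x) (f x)) integrable_on {0..1}" using square_integrable_cdot_absint[OF fg(3,1)] absint_integrable by blast
  from integral_linear[OF this bounded_linear_cnj] show ?thesis unfolding fg cinner_abs_L2[OF fg(1,3)] cinner_abs_L2[OF fg(3,1)] pairing_def
    by (simp add: o_def cdot_def mult.commute)
qed

lemma cinner_add_left: "cinner (u + v) w = cinner u w + cinner v w" by transfer (simp add: L2_rel_def cdot_add_left integrable_cdot)

lemma cinner_scale_left: "cinner (cscale r u) w = r * cinner u w" by transfer (simp add: cdot_scale_left)

lemma cinner_scale_right: "cinner v (cscale r u) = cnj r * cinner v u" by (metis cinner_commute cinner_scale_left complex_cnj_mult)

lemma cinner_self: "cinner u u = of_real ((norm u)\<^sup>2)"
proof -
  have "Im (cinner u u) = 0" using cinner_commute[of u u] by (simp add: complex_eq_iff)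
  then show ?thesis by (simp add: complex_eq_iff power2_norm_eq_inner inner_L2_def)
qed

lemma norm_cscale: "norm (cscale r u) = norm r * norm u"
proof -
  have "cinner (cscale r u) (cscale r u) = r * cnj r * cinner u u" by (simp only: cinner_scale_left cinner_scale_right mult_ac)
  then have "of_real ((norm (cscale r u))\<^sup>2) = (of_real ((norm r)\<^sup>2 * (norm u)\<^sup>2) :: complex)"
    unfolding cinner_self of_real_mult complex_norm_square[of r] .
  then have "(norm (cscale r u))\<^sup>2 = (norm r * norm u)\<^sup>2" unfolding of_real_eq_iff power_mult_distrib .
  then show ?thesis by simp
qed

text \<open>A unimodular factor makes the inner product real and nonnegative, and then the real
  Cauchy-Schwarz inequality applies.\<close>

lemma norm_cinner_le: "norm (cinner u v) \<le> norm u * norm v"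
proof -
  obtain r where r: "norm r = 1" "r * cinner u v = of_real (norm (cinner u v))"
  proof (cases "cinner u v = 0")
    case True then show ?thesis using that[of 1] by simp
  next
    case False
    show ?thesis
    proof (rule that[of "cnj (cinner u v) / of_real (norm (cinner u v))"])
      show "norm (cnj (cinner u v) / of_real (norm (cinner u v))) = 1" using False by (simp add: norm_divide)
      have "cnj (cinner u v) * cinner u v = of_real (norm (cinner u v)) * of_real (norm (cinner u v))"
        by (metis complex_norm_square mult.commute of_real_mult power2_eq_square)
      then show "cnj (cinner u v) / of_real (norm (cinner u v)) * cinner u v = of_real (norm (cinner u v))" using False by simp
    qed
  qed
  have "norm (cinner u v) = cscale r u \<bullet> v" unfolding inner_L2_def cinner_scale_left r(2) by simp
  also have "\<dots> \<le> norm (cscale r u) * norm v" by (rule norm_cauchy_schwarz)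
  finally show ?thesis by (simp add: norm_cscale r(1))
qed

lemma bounded_linear_cinner_left: "bounded_linear (\<lambda>u. cinner u v)" by (rule bounded_linear_intro[of _ "norm v"])
    (simp_all add: cinner_add_left scaleR_L2_eq cinner_scale_left scaleR_conv_of_real norm_cinner_le)

lemma bounded_linear_cscale_L2: "bounded_linear (cscale r)" by (rule bounded_linear_intro[of _ "norm r"])
    (simp_all add: L2.scale_right_distrib scaleR_L2_eq L2.scale_left_commute norm_cscale mult.commute)

lemma bounded_linear_cscale_left: "bounded_linear (\<lambda>r. cscale r u)" by (rule bounded_linear_intro[of _ "norm u"])
    (simp_all add: L2.scale_left_distrib scaleR_L2_eq scaleR_conv_of_real norm_cscale)

lemma cinner_sum_left: "cinner (\<Sum>i\<in>A. f i) v = (\<Sum>i\<in>A. cinner (f i) v)" using bounded_linear.linear[OF bounded_linear_cinner_left] by (rule linear_sum)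

lemma cinner_diff_left: "cinner (u - w) v = cinner u v - cinner w v" using bounded_linear.linear[OF bounded_linear_cinner_left] by (rule linear_diff)

lemma cinner_zero [simp]: "cinner 0 v = 0" "cinner v 0 = 0" using cinner_scale_left[of 0 0 v] cinner_commute[of v 0] by simp_all

lemma norm_sum_orthonormal:
  assumes "finite A" "\<And>i j. i \<in> A \<Longrightarrow> j \<in> A \<Longrightarrow> cinner (e i) (e j) = (if i = j then 1 else 0)"
  shows "cinner (\<Sum>i\<in>A. cscale (r i) (e i)) v = (\<Sum>i\<in>A. r i * cinner (e i) v)"
    "j \<in> A \<Longrightarrow> cinner (\<Sum>i\<in>A. cscale (r i) (e i)) (e j) = r j"
    "(norm (\<Sum>i\<in>A. cscale (r i) (e i)))\<^sup>2 = (\<Sum>i\<in>A. (norm (r i))\<^sup>2)"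
proof -
  show 1: "cinner (\<Sum>i\<in>A. cscale (r i) (e i)) v = (\<Sum>i\<in>A. r i * cinner (e i) v)" for v by (simp add: cinner_sum_left cinner_scale_left)
  show 2: "cinner (\<Sum>i\<in>A. cscale (r i) (e i)) (e j) = r j" if "j \<in> A" for j
  proof -
    have "(\<Sum>i\<in>A. r i * cinner (e i) (e j)) = (\<Sum>i\<in>A. if i = j then r j else 0)" by (rule sum.cong) (use assms(2) that in auto)
    then show ?thesis unfolding 1 using assms(1) that by simp
  qed
  let ?s = "\<Sum>i\<in>A. cscale (r i) (e i)"
  have "of_real ((norm ?s)\<^sup>2) = cinner ?s ?s" by (rule cinner_self[symmetric])
  also have "\<dots> = (\<Sum>i\<in>A. r i * cnj (r i))" unfolding 1 by (rule sum.cong) (simp_all add: cinner_commute[of "e i" for i] 2)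
  also have "\<dots> = of_real (\<Sum>i\<in>A. (norm (r i))\<^sup>2)" by (simp add: complex_norm_square del: of_real_power)
  finally show "(norm ?s)\<^sup>2 = (\<Sum>i\<in>A. (norm (r i))\<^sup>2)" by (simp only: of_real_eq_iff)
qed

text \<open>A nonnegative continuous function with integral 0 vanishes identically.\<close>

lemma continuous_abs_L2_eqD:
  assumes f: "continuous_on {0..1} f" and g: "continuous_on {0..1} g" and eq: "abs_L2 f = abs_L2 g" and x: "x \<in> {0..1}"
  shows "f x = g x"
proof -
  note s = continuous_imp_square_integrable[OF f] continuous_imp_square_integrable[OF g]
  have "abs_L2 (\<lambda>x. f x - g x) = 0" using abs_L2_diff[OF s] eq by simp
  then have "integral {0..1} (\<lambda>x. (norm (f x - g x))\<^sup>2) = 0" using norm_abs_L2[OF square_integrable_diff[OF s]] by simp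
  moreover have "continuous_on {0..1} (\<lambda>x. (norm (f x - g x))\<^sup>2)" by (intro continuous_intros f g)
  ultimately have "(norm (f x - g x))\<^sup>2 = 0" using integral_eq_0_iff[of 0 1 "\<lambda>x. (norm (f x - g x))\<^sup>2"] x by auto
  then show ?thesis by simp
qed

lemma pairing_self: "square_integrable f \<Longrightarrow> pairing f f = of_real (L2sq f)"
proof -
  assume f: "square_integrable f"
  have "(\<lambda>x. (norm (f x))\<^sup>2) integrable_on {0..1}" using square_integrable_norm2[OF f] absint_integrable by blast
  from integral_linear[OF this bounded_linear_of_real[where 'a=complex]]
  show ?thesis by (simp add: pairing_def cdot_self L2sq_def o_def)
qed

text \<open>Closes the estimates below in which the square norm to be bounded reappears under a root
  on the right.\<close>

lemma le_sqrt_self: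
  fixes x A :: real
  assumes "x \<le> A * sqrt x" "0 \<le> x" "0 \<le> A"
  shows "x \<le> A\<^sup>2"
proof (cases "x = 0")
  case False
  then have "0 < sqrt x" using assms(2) by simp
  moreover have "sqrt x * sqrt x \<le> A * sqrt x" using assms by simp
  ultimately have "sqrt x \<le> A" by (simp only: mult_le_cancel_right_pos)
  then have "(sqrt x)\<^sup>2 \<le> A\<^sup>2" using assms(2) by (intro power_mono) auto
  then show ?thesis using assms(2) by simp
qed simp

section \<open>Cells of the spectrum and the projection estimate\<close>

context dirac_contours
begin

abbreviation cell :: "int \<Rightarrow> complex set" where "cell k \<equiv> box (box_lo k) (box_hi k)"

lemma cell_cover: assumes "\<Delta> z = 0" obtains k where "z \<in> cell k"
proof -
  have i: "\<bar>Im z\<bar> < h" using \<Delta>_outer[of z] assms \<delta> by (cases "h \<le> \<bar>Im z\<bar>") auto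
  obtain k where k: "s k \<le> Re z" "Re z < s (k + 1)" by (rule interval_cover)
  have "Re z \<noteq> s k"
  proof
    assume e: "Re z = s k"
    have "\<delta> \<le> norm (\<Delta> (Complex (s k) (Im z)))" using i by (intro \<Delta>_vertical) simp
    moreover have "Complex (s k) (Im z) = z" using e by (simp add: complex_eq_iff)
    ultimately show False using assms \<delta> by simp
  qed
  then show ?thesis using i k by (intro that[of k]) (auto simp: in_box_complex_iff box_lo_def box_hi_def)
qed

lemma cell_disjoint: assumes "z \<in> cell j" "z \<in> cell k" shows "j = k"
proof (rule ccontr)
  assume "j \<noteq> k"
  then have "j + 1 \<le> k \<or> k + 1 \<le> j" by auto
  then have "s (j + 1) \<le> s k \<or> s (k + 1) \<le> s j" using s_strict_mono by (metis order_le_less order_refl)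
  then show False using assms by (auto simp: in_box_complex_iff box_lo_def box_hi_def)
qed

text \<open>Bounds the distance of \<open>c * k\<close> from the contour around cell
  \<open>k\<close>, whose points have real parts between \<open>c * k\<close> and
  \<open>c * k + 3 * c / 2\<close>.\<close>

definition radius :: real where "radius = 3 * c / 2 + h"

lemma contour_radius:
  assumes "w \<in> path_image (rectpath (box_lo k) (box_hi k))"
  shows "norm (w - of_real (c * of_int k)) \<le> radius"
proof -
  have "s k \<le> s (k + 1)" "- h \<le> h" using s_less(1)[of k] h by auto
  then have "s k \<le> Re w" "Re w \<le> s (k + 1)" using assms by (auto simp: path_image_rectpath box_lo_def box_hi_def)
  then have "\<bar>Re w - c * of_int k\<bar> \<le> 3 * c / 2" using s(1)[of k] s(2)[of "k + 1"] c(1) by (simp add: algebra_simps abs_le_iff)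
  moreover have "\<bar>Im w\<bar> \<le> h" by (rule contour_bound(1)[OF assms])
  moreover have "norm (w - of_real (c * of_int k)) \<le> \<bar>Re w - c * of_int k\<bar> + \<bar>Im w\<bar>" using cmod_le[of "w - of_real (c * of_int k)"] by simp
  ultimately show ?thesis unfolding radius_def by linarith
qed

text \<open>\<open>y z\<close> is the representative of \<open>u z\<close> that begins a chain.
  Fixing it makes point evaluations and boundary forms of root vectors meaningful.\<close>

definition root_data :: "complex set \<Rightarrow> (complex \<Rightarrow> L2) \<Rightarrow> (complex \<Rightarrow> curve) \<Rightarrow> bool"
  where "root_data F u y \<longleftrightarrow> finite F \<and> (\<forall>z\<in>F. \<Delta> z = 0 \<and> u z = abs_L2 (y z) \<and> (\<exists>n v. chain z n v \<and> y z = v 0))"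

lemma root_data_exists:
  assumes "finite F" "\<And>z. z \<in> F \<Longrightarrow> \<Delta> z = 0" "\<And>z. z \<in> F \<Longrightarrow> u z \<in> root_subspace L z"
  obtains y where "root_data F u y"
proof -
  have "\<forall>z\<in>F. \<exists>y n v. chain z n v \<and> y = v 0 \<and> u z = abs_L2 y" using root_subspace_chain[OF assms(3)] by metis
  from bchoice[OF this] obtain y where "\<forall>z\<in>F. \<exists>n v. chain z n v \<and> y z = v 0 \<and> u z = abs_L2 (y z)" ..
  then show ?thesis using assms(1,2) by (intro that[of y]) (simp add: root_data_def, blast)
qed

lemma root_data_subset: "root_data F u y \<Longrightarrow> G \<subseteq> F \<Longrightarrow> root_data G u y" unfolding root_data_def by (auto intro: finite_subset)

lemma root_data_continuous: "root_data F u y \<Longrightarrow> z \<in> F \<Longrightarrow> continuous_on {0..1} (y z)" unfolding root_data_def using chain_continuous[of z _ _ 0] by auto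

lemma root_data_sum:
  assumes "root_data F u y"
  shows "continuous_on {0..1} (\<lambda>x. \<Sum>z\<in>F. y z x)" "square_integrable (\<lambda>x. \<Sum>z\<in>F. y z x)"
    "(\<Sum>z\<in>F. u z) = abs_L2 (\<lambda>x. \<Sum>z\<in>F. y z x)" "(norm (\<Sum>z\<in>F. u z))\<^sup>2 = L2sq (\<lambda>x. \<Sum>z\<in>F. y z x)"
proof -
  show "continuous_on {0..1} (\<lambda>x. \<Sum>z\<in>F. y z x)" by (intro continuous_intros root_data_continuous[OF assms])
  then show si: "square_integrable (\<lambda>x. \<Sum>z\<in>F. y z x)" by (rule continuous_imp_square_integrable)
  have "(\<Sum>z\<in>F. u z) = (\<Sum>z\<in>F. abs_L2 (y z))" using assms by (intro sum.cong) (auto simp: root_data_def)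
  also have "\<dots> = abs_L2 (\<lambda>x. \<Sum>z\<in>F. y z x)" by (intro abs_L2_sum continuous_imp_square_integrable root_data_continuous[OF assms])
  finally show e: "(\<Sum>z\<in>F. u z) = abs_L2 (\<lambda>x. \<Sum>z\<in>F. y z x)" .
  show "(norm (\<Sum>z\<in>F. u z))\<^sup>2 = L2sq (\<lambda>x. \<Sum>z\<in>F. y z x)" unfolding e by (rule norm_abs_L2_L2sq[OF si])
qed

lemma root_data_functional:
  assumes "root_data F u y" "sup_functional \<psi>"
  shows "\<psi> (\<lambda>x. \<Sum>z\<in>F. y z x) = (\<Sum>z\<in>F. \<psi> (y z))" using sup_functional_sum[OF assms(2), of F y "\<lambda>_. 1"] root_data_continuous[OF assms(1)] by simp

text \<open>\<open>rectangle_projection\<close> with one constant for all cells: the lengths of the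
  contours and the bound for initial values do not depend on \<open>k\<close>. The sample point
  \<open>w\<close> depends on all the data, which the Bessel inequalities permit.\<close>

lemma cell_projection:
  obtains K where "0 < K" "\<And>F u y \<psi> k. root_data F u y \<Longrightarrow> sup_functional \<psi> \<Longrightarrow>
    \<exists>w. \<bar>Im w\<bar> \<le> h \<and> norm (w - of_real (c * of_int k)) \<le> radius \<and>
      norm (\<psi> (\<lambda>x. \<Sum>z\<in>F \<inter> cell k. y z x)) \<le>
        K * (norm (sol w 0 (\<lambda>x. \<Sum>z\<in>F. y z x) 1) * (norm (\<psi> (U w 1)) + norm (\<psi> (U w 2))))"
proof -
  have h0: "0 \<le> h" using h by simp
  obtain C2 where C2: "0 < C2" "\<And>f z y. \<bar>Im z\<bar> \<le> h \<Longrightarrow> \<delta> \<le> norm (\<Delta> z) \<Longrightarrow> dsol z f y \<Longrightarrow> homogeneous_bc y \<Longrightarrow>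
    norm (y 0) \<le> C2 * norm (sol z 0 f 1)" by (rule initial_value_bound[OF h0 \<delta>]) blast
  define l where "l = 2 * (3 * c / 2 + 2 * h)"
  have l: "2 * ((Re (box_hi k) - Re (box_lo k)) + (Im (box_hi k) - Im (box_lo k))) \<le> l" for k
    using s_less(2)[of k] by (simp add: l_def box_lo_def box_hi_def)
  have lp: "0 < l" using c h by (simp add: l_def add_pos_pos)
  show ?thesis
  proof (rule that[of "l * C2"])
    show "0 < l * C2" using lp C2(1) by simp
    fix F u y \<psi> and k :: int assume d: "root_data F u y" and \<psi>: "sup_functional \<psi>"
    have "\<forall>z\<in>F. \<exists>n v. chain z n v \<and> y z = v 0" using d by (auto simp: root_data_def)
    then obtain n v where nv: "\<And>z. z \<in> F \<Longrightarrow> chain z (n z) (v z)" "\<And>z. z \<in> F \<Longrightarrow> y z = v z 0" by metis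
    obtain w where w: "w \<in> path_image (rectpath (box_lo k) (box_hi k))"
      "norm (\<Sum>z\<in>F \<inter> cell k. \<psi> (v z 0)) \<le> l * C2 * norm (sol w 0 (\<lambda>x. \<Sum>z\<in>F. v z 0 x) 1) * (norm (\<psi> (U w 1)) + norm (\<psi> (U w 2)))"
    proof (rule rectangle_projection[OF h0 \<delta> _ C2(1) box_bounds[of k] l[of k], where F=F and n=n and v=v and \<psi>=\<psi>] , rule C2(2))
      show "\<bar>Im w\<bar> \<le> h \<and> \<delta> \<le> norm (\<Delta> w)" if "w \<in> path_image (rectpath (box_lo k) (box_hi k))" for w using contour_bound[OF that] by blast
    qed (use d nv(1) \<psi> in \<open>auto simp: root_data_def\<close>)
    have e1: "(\<lambda>x. \<Sum>z\<in>F. v z 0 x) = (\<lambda>x. \<Sum>z\<in>F. y z x)" using nv(2) by (intro ext sum.cong) auto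
    have e2: "(\<Sum>z\<in>F \<inter> cell k. \<psi> (v z 0)) = \<psi> (\<lambda>x. \<Sum>z\<in>F \<inter> cell k. y z x)"
      unfolding root_data_functional[OF root_data_subset[OF d Int_lower1[of F "cell k"]] \<psi>] by (rule sum.cong) (use nv(2) in auto)
    show "\<exists>w. \<bar>Im w\<bar> \<le> h \<and> norm (w - of_real (c * of_int k)) \<le> radius \<and>
      norm (\<psi> (\<lambda>x. \<Sum>z\<in>F \<inter> cell k. y z x)) \<le>
        l * C2 * (norm (sol w 0 (\<lambda>x. \<Sum>z\<in>F. y z x) 1) * (norm (\<psi> (U w 1)) + norm (\<psi> (U w 2))))"
      using w contour_bound(1)[OF w(1)] contour_radius[OF w(1)] unfolding e1 e2 by (auto simp: mult.assoc)
  qed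
qed

text \<open>Both estimates pair the cell components with a square-integrable function: with the component itself for
  the first one, with the whole sum for the second one. The two factors in \<open>cell_projection\<close> are then
  square-summable over the cells by the Bessel inequalities.\<close>

theorem cell_inequalities:
  obtains K where "0 < K"
    "\<And>F u J. finite F \<Longrightarrow> finite J \<Longrightarrow> (\<And>z. z \<in> F \<Longrightarrow> \<Delta> z = 0) \<Longrightarrow> (\<And>z. z \<in> F \<Longrightarrow> u z \<in> root_subspace L z) \<Longrightarrow>
      (\<Sum>k\<in>J. (norm (\<Sum>z\<in>F \<inter> cell k. u z))\<^sup>2) \<le> K * (norm (\<Sum>z\<in>F. u z))\<^sup>2"
    "\<And>F u J. finite F \<Longrightarrow> finite J \<Longrightarrow> (\<And>z. z \<in> F \<Longrightarrow> \<Delta> z = 0) \<Longrightarrow> (\<And>z. z \<in> F \<Longrightarrow> u z \<in> root_subspace L z) \<Longrightarrow>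
      F \<subseteq> (\<Union>k\<in>J. cell k) \<Longrightarrow> (norm (\<Sum>z\<in>F. u z))\<^sup>2 \<le> K * (\<Sum>k\<in>J. (norm (\<Sum>z\<in>F \<inter> cell k. u z))\<^sup>2)"
proof -
  have r0: "0 \<le> radius" using c h by (simp add: radius_def)
  obtain K where K: "0 < K" "\<And>F u y \<psi> k. root_data F u y \<Longrightarrow> sup_functional \<psi> \<Longrightarrow>
    \<exists>w. \<bar>Im w\<bar> \<le> h \<and> norm (w - of_real (c * of_int k)) \<le> radius \<and>
      norm (\<psi> (\<lambda>x. \<Sum>z\<in>F \<inter> cell k. y z x)) \<le>
        K * (norm (sol w 0 (\<lambda>x. \<Sum>z\<in>F. y z x) 1) * (norm (\<psi> (U w 1)) + norm (\<psi> (U w 2))))" by (rule cell_projection) blast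
  obtain A where A: "0 < A" "\<And>f K z. square_integrable f \<Longrightarrow> finite (K :: int set) \<Longrightarrow> (\<And>k. k \<in> K \<Longrightarrow> norm (z k - of_real (c * of_int k)) \<le> radius) \<Longrightarrow>
    (\<Sum>k\<in>K. (norm (sol (z k) 0 f 1))\<^sup>2) \<le> A * L2sq f" by (rule bessel_w[OF c r0]) blast
  obtain B where B: "0 < B" "\<And>g K z. square_integrable g \<Longrightarrow> finite (K :: int set) \<Longrightarrow> (\<And>k. k \<in> K \<Longrightarrow> norm (z k - of_real (c * of_int k)) \<le> radius) \<Longrightarrow>
    (\<Sum>k\<in>K. (norm (pairing g (U (z k) 1)) + norm (pairing g (U (z k) 2)))\<^sup>2) \<le> B * L2sq g" by (rule bessel_pairing[OF c r0]) blast
  \<comment> \<open>This and \<open>B1\<close> are the one-point cases of the two Bessel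
    inequalities; they bound the factor that is not summed over the cells.\<close>
  have A1: "norm (sol w 0 f 1) \<le> sqrt A * sqrt (L2sq f)" if "square_integrable f" "norm (w - of_real (c * of_int k)) \<le> radius" for f w and k :: int
  proof -
    have "(norm (sol w 0 f 1))\<^sup>2 \<le> A * L2sq f" using A(2)[OF that(1), of "{k}" "\<lambda>_. w"] that(2) by simp
    then show ?thesis by (simp add: real_le_rsqrt flip: real_sqrt_mult)
  qed
  have B1: "norm (pairing g (U w 1)) + norm (pairing g (U w 2)) \<le> sqrt B * sqrt (L2sq g)"
    if "square_integrable g" "norm (w - of_real (c * of_int k)) \<le> radius" for g w and k :: int
  proof -
    have "(norm (pairing g (U w 1)) + norm (pairing g (U w 2)))\<^sup>2 \<le> B * L2sq g" using B(2)[OF that(1), of "{k}" "\<lambda>_. w"] that(2) by simp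
    then show ?thesis by (simp add: real_le_rsqrt flip: real_sqrt_mult)
  qed
  show ?thesis
  proof (rule that[of "K\<^sup>2 * B * A"])
    show "0 < K\<^sup>2 * B * A" using K(1) A(1) B(1) by simp
    fix F u and J :: "int set"
    assume F: "finite F" "finite J" "\<And>z. z \<in> F \<Longrightarrow> \<Delta> z = 0" "\<And>z. z \<in> F \<Longrightarrow> u z \<in> root_subspace L z"
    obtain y where d: "root_data F u y" by (rule root_data_exists[OF F(1,3,4)])
    define f where "f x = (\<Sum>z\<in>F. y z x)" for x
    define g where "g k x = (\<Sum>z\<in>F \<inter> cell k. y z x)" for k x
    note sf = root_data_sum[OF d, folded f_def]
    note dk = root_data_subset[OF d Int_lower1[of F "cell _"]]
    note sg = root_data_sum[OF dk, folded g_def]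
    have gi: "g k absint" for k by (rule square_integrable_imp_absint[OF sg(2)])
    have fi: "f absint" by (rule square_integrable_imp_absint[OF sf(2)])
    \<comment> \<open>The functional is the pairing with \<open>g k\<close> itself, so
      \<open>L2sq (g k)\<close> stands on the left while its root appears on the right and can be
      cancelled.\<close>
    have "\<forall>k. \<exists>w. norm (w - of_real (c * of_int k)) \<le> radius \<and> L2sq (g k) \<le> K\<^sup>2 * B * (norm (sol w 0 f 1))\<^sup>2"
    proof
      fix k
      obtain w where w: "norm (w - of_real (c * of_int k)) \<le> radius"
        "norm (pairing (g k) (g k)) \<le> K * (norm (sol w 0 f 1) * (norm (pairing (g k) (U w 1)) + norm (pairing (g k) (U w 2))))"
        using K(2)[OF d sup_functional_pairing[OF gi[of k]], of k] unfolding f_def[symmetric] g_def[symmetric] by blast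
      have "K * (norm (sol w 0 f 1) * (norm (pairing (g k) (U w 1)) + norm (pairing (g k) (U w 2))))
        \<le> K * (norm (sol w 0 f 1) * (sqrt B * sqrt (L2sq (g k))))" using K(1) B1[OF sg(2) w(1)] by (intro mult_left_mono) auto
      with w(2) have "L2sq (g k) \<le> (K * norm (sol w 0 f 1) * sqrt B) * sqrt (L2sq (g k))" by (simp add: pairing_self[OF sg(2)] L2sq_nonneg mult.assoc)
      then have "L2sq (g k) \<le> (K * norm (sol w 0 f 1) * sqrt B)\<^sup>2" using K(1) B(1) by (intro le_sqrt_self L2sq_nonneg) auto
      also have "\<dots> = K\<^sup>2 * B * (norm (sol w 0 f 1))\<^sup>2" using B(1) by (simp add: power_mult_distrib)
      finally show "\<exists>w. norm (w - of_real (c * of_int k)) \<le> radius \<and> L2sq (g k) \<le> K\<^sup>2 * B * (norm (sol w 0 f 1))\<^sup>2" using w(1) by blast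
    qed
    then obtain w where w: "\<And>k. norm (w k - of_real (c * of_int k)) \<le> radius"
      "\<And>k. L2sq (g k) \<le> K\<^sup>2 * B * (norm (sol (w k) 0 f 1))\<^sup>2" by metis
    have "(\<Sum>k\<in>J. (norm (\<Sum>z\<in>F \<inter> cell k. u z))\<^sup>2) \<le> (\<Sum>k\<in>J. K\<^sup>2 * B * (norm (sol (w k) 0 f 1))\<^sup>2)" unfolding sg(4) by (intro sum_mono w(2))
    also have "\<dots> = K\<^sup>2 * B * (\<Sum>k\<in>J. (norm (sol (w k) 0 f 1))\<^sup>2)" by (rule sum_distrib_left[symmetric])
    also have "\<dots> \<le> K\<^sup>2 * B * (A * L2sq f)" using K(1) B(1) by (intro mult_left_mono A(2) F w(1) sf(2)) auto
    finally show "(\<Sum>k\<in>J. (norm (\<Sum>z\<in>F \<inter> cell k. u z))\<^sup>2) \<le> K\<^sup>2 * B * A * (norm (\<Sum>z\<in>F. u z))\<^sup>2" unfolding sf(4) by (simp add: mult.assoc)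
    assume cover: "F \<subseteq> (\<Union>k\<in>J. cell k)"
    have "\<forall>k. \<exists>w. norm (w - of_real (c * of_int k)) \<le> radius \<and> norm (pairing f (g k)) \<le>
        K * (sqrt A * sqrt (L2sq (g k)) * (norm (pairing f (U w 1)) + norm (pairing f (U w 2))))"
    proof
      fix k
      \<comment> \<open>\<open>cell_projection\<close> is applied to the part of \<open>F\<close> in
        the cell in place of \<open>F\<close>: the component is its own cell component, and the
        Cauchy solution is then bounded by the norm of \<open>g k\<close>.\<close>
      have id: "F \<inter> cell k \<inter> cell k = F \<inter> cell k" by blast
      obtain w where w: "norm (w - of_real (c * of_int k)) \<le> radius"
        "norm (pairing f (g k)) \<le> K * (norm (sol w 0 (g k) 1) * (norm (pairing f (U w 1)) + norm (pairing f (U w 2))))"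
        using K(2)[OF dk[of k] sup_functional_pairing[OF fi], of k] unfolding id g_def[symmetric] by blast
      have "K * (norm (sol w 0 (g k) 1) * (norm (pairing f (U w 1)) + norm (pairing f (U w 2))))
        \<le> K * (sqrt A * sqrt (L2sq (g k)) * (norm (pairing f (U w 1)) + norm (pairing f (U w 2))))"
        using K(1) A1[OF sg(2) w(1)] by (intro mult_left_mono mult_right_mono) auto
      then show "\<exists>w. norm (w - of_real (c * of_int k)) \<le> radius \<and> norm (pairing f (g k)) \<le>
        K * (sqrt A * sqrt (L2sq (g k)) * (norm (pairing f (U w 1)) + norm (pairing f (U w 2))))" using w order_trans by blast
    qed
    then obtain w where w: "\<And>k. norm (w k - of_real (c * of_int k)) \<le> radius"
      "\<And>k. norm (pairing f (g k)) \<le>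
        K * (sqrt A * sqrt (L2sq (g k)) * (norm (pairing f (U (w k) 1)) + norm (pairing f (U (w k) 2))))" by metis
    define p where "p k = norm (pairing f (U (w k) 1)) + norm (pairing f (U (w k) 2))" for k
    define q where "q k = sqrt (L2sq (g k))" for k
    have fsum: "f = (\<lambda>x. \<Sum>k\<in>J. 1 *s g k x)"
    proof
      fix x
      have "f x = (\<Sum>z\<in>(\<Union>k\<in>J. F \<inter> cell k). y z x)" unfolding f_def using cover by (intro sum.cong) auto
      also have "\<dots> = (\<Sum>k\<in>J. g k x)" unfolding g_def using F(1,2) cell_disjoint by (intro sum.UNION_disjoint) auto
      finally show "f x = (\<Sum>k\<in>J. 1 *s g k x)" by simp
    qed
    have "pairing f f = (\<Sum>k\<in>J. 1 * pairing f (g k))" by (subst (2) fsum) (rule sup_functional_sum[OF sup_functional_pairing[OF fi] sg(1)])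
    then have "L2sq f \<le> norm (\<Sum>k\<in>J. pairing f (g k))" unfolding mult_1_left pairing_self[OF sf(2)] by (metis abs_ge_self norm_of_real)
    also have "\<dots> \<le> (\<Sum>k\<in>J. norm (pairing f (g k)))" by (rule norm_sum)
    also have "\<dots> \<le> (\<Sum>k\<in>J. K * sqrt A * (\<bar>q k\<bar> * \<bar>p k\<bar>))" using w(2) L2sq_nonneg by (intro sum_mono) (simp add: p_def q_def mult.assoc)
    also have "\<dots> \<le> K * sqrt A * (L2_set q J * L2_set p J)"
      unfolding sum_distrib_left[symmetric] using K(1) A(1) by (intro mult_left_mono L2_set_mult_ineq) auto
    also have "\<dots> \<le> K * sqrt A * (L2_set q J * (sqrt B * sqrt (L2sq f)))"
    proof -
      have "(\<Sum>k\<in>J. (p k)\<^sup>2) \<le> B * L2sq f" unfolding p_def by (intro B(2) sf(2) F(2) w(1))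
      then have "L2_set p J \<le> sqrt B * sqrt (L2sq f)" unfolding L2_set_def by (simp flip: real_sqrt_mult)
      then show ?thesis using K(1) A(1) by (intro mult_left_mono) auto
    qed
    finally have "L2sq f \<le> (K * sqrt A * L2_set q J * sqrt B) * sqrt (L2sq f)" by (simp add: mult_ac)
    then have "L2sq f \<le> (K * sqrt A * L2_set q J * sqrt B)\<^sup>2" using K(1) A(1) B(1) by (intro le_sqrt_self L2sq_nonneg) auto
    also have "\<dots> = K\<^sup>2 * B * A * (L2_set q J)\<^sup>2" using A(1) B(1) by (simp add: power_mult_distrib mult_ac)
    also have "(L2_set q J)\<^sup>2 = (\<Sum>k\<in>J. (norm (\<Sum>z\<in>F \<inter> cell k. u z))\<^sup>2)" unfolding sg(4) L2_set_def q_def by (simp add: L2sq_nonneg sum_nonneg)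
    finally show "(norm (\<Sum>z\<in>F. u z))\<^sup>2 \<le> K\<^sup>2 * B * A * (\<Sum>k\<in>J. (norm (\<Sum>z\<in>F \<inter> cell k. u z))\<^sup>2)" unfolding sf(4) .
  qed
qed


text \<open>Root functions of a cell are bounded pointwise by their mean-square norm, uniformly in the cell. The
  trace of an orthonormal system of such functions bounds its cardinality.\<close>

theorem cell_dimension_bound:
  obtains K where "\<And>k N F u. finite F \<Longrightarrow> F \<subseteq> cell k \<Longrightarrow> (\<And>z. z \<in> F \<Longrightarrow> \<Delta> z = 0) \<Longrightarrow> (\<And>i z. i < N \<Longrightarrow> z \<in> F \<Longrightarrow> u i z \<in> root_subspace L z) \<Longrightarrow>
    (\<And>z. z \<in> F \<Longrightarrow> L2.subspace (root_subspace L z)) \<Longrightarrow>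
    (\<And>i j. i < N \<Longrightarrow> j < N \<Longrightarrow> cinner (\<Sum>z\<in>F. u i z) (\<Sum>z\<in>F. u j z) = (if i = j then 1 else 0)) \<Longrightarrow> real N \<le> K"
proof -
  have h0: "0 \<le> h" and r0: "0 \<le> radius" using c h by (simp_all add: radius_def)
  obtain K where K: "0 < K" "\<And>F u y \<psi> k. root_data F u y \<Longrightarrow> sup_functional \<psi> \<Longrightarrow>
    \<exists>w. \<bar>Im w\<bar> \<le> h \<and> norm (w - of_real (c * of_int k)) \<le> radius \<and>
      norm (\<psi> (\<lambda>x. \<Sum>z\<in>F \<inter> cell k. y z x)) \<le>
        K * (norm (sol w 0 (\<lambda>x. \<Sum>z\<in>F. y z x) 1) * (norm (\<psi> (U w 1)) + norm (\<psi> (U w 2))))" by (rule cell_projection) blast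
  obtain A where A: "0 < A" "\<And>f K z. square_integrable f \<Longrightarrow> finite (K :: int set) \<Longrightarrow> (\<And>k. k \<in> K \<Longrightarrow> norm (z k - of_real (c * of_int k)) \<le> radius) \<Longrightarrow>
    (\<Sum>k\<in>K. (norm (sol (z k) 0 f 1))\<^sup>2) \<le> A * L2sq f" by (rule bessel_w[OF c r0]) blast
  obtain C1 where C1: "0 < C1" "\<And>f z y x. \<bar>Im z\<bar> \<le> h \<Longrightarrow> dsol z f y \<Longrightarrow> x \<in> {0..1} \<Longrightarrow>
    norm (y x) \<le> C1 * (norm (y 0) + norm_L1 f)" by (rule strip_sol_bound[OF h0]) blast
  define K1 where "K1 = K * (sqrt A * (2 * C1))"
  have K1: "0 \<le> K1" using K(1) A(1) C1(1) by (simp add: K1_def)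
  have Ub: "norm (U w i x $ l) \<le> C1" if "\<bar>Im w\<bar> \<le> h" "x \<in> {0..1}" for w i x l
  proof -
    have "norm (U w i x) \<le> C1" using C1(2)[OF that(1) U_dsol(1) that(2), of i] by (simp add: U_dsol(2))
    then show ?thesis by (rule order_trans[OF norm_entry_le])
  qed
  have point: "norm ((\<Sum>z\<in>F. y z x) $ l) \<le> K1 * sqrt (L2sq (\<lambda>x. \<Sum>z\<in>F. y z x))"
    if d: "root_data F u y" and F: "F \<subseteq> cell k" and x: "x \<in> {0..1}" for F u y k x l
  proof -
    have id: "F \<inter> cell k = F" using F by blast
    define g where "g x = (\<Sum>z\<in>F. y z x)" for x
    note sg = root_data_sum(2)[OF d, folded g_def]
    obtain w where w: "\<bar>Im w\<bar> \<le> h" "norm (w - of_real (c * of_int k)) \<le> radius"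
      "norm (g x $ l) \<le> K * (norm (sol w 0 g 1) * (norm (U w 1 x $ l) + norm (U w 2 x $ l)))"
      using K(2)[OF d sup_functional_eval[OF x], of k l] unfolding id g_def[symmetric] by blast
    have "(norm (sol w 0 g 1))\<^sup>2 \<le> A * L2sq g" using A(2)[OF sg, of "{k}" "\<lambda>_. w"] w(2) by simp
    then have n: "norm (sol w 0 g 1) \<le> sqrt A * sqrt (L2sq g)" by (simp add: real_le_rsqrt flip: real_sqrt_mult)
    have "norm (sol w 0 g 1) * (norm (U w 1 x $ l) + norm (U w 2 x $ l)) \<le> sqrt A * sqrt (L2sq g) * (C1 + C1)"
      using Ub[OF w(1) x] A(1) L2sq_nonneg[of g] by (intro mult_mono add_mono n) auto
    with w(3) have "norm (g x $ l) \<le> K * (sqrt A * sqrt (L2sq g) * (C1 + C1))" using K(1) by (meson mult_left_mono less_imp_le order_trans)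
    then show ?thesis unfolding K1_def g_def[abs_def] mult_2[symmetric] by (simp only: mult_ac)
  qed
  show ?thesis
  proof (rule that[of "2 * K1\<^sup>2"])
    fix k N F and u :: "nat \<Rightarrow> complex \<Rightarrow> L2"
    assume F: "finite F" "F \<subseteq> cell k" "\<And>z. z \<in> F \<Longrightarrow> \<Delta> z = 0" and u: "\<And>i z. i < N \<Longrightarrow> z \<in> F \<Longrightarrow> u i z \<in> root_subspace L z"
      and sub: "\<And>z. z \<in> F \<Longrightarrow> L2.subspace (root_subspace L z)"
      and orth: "\<And>i j. i < N \<Longrightarrow> j < N \<Longrightarrow> cinner (\<Sum>z\<in>F. u i z) (\<Sum>z\<in>F. u j z) = (if i = j then 1 else 0)"
    have "\<forall>i. \<exists>y. i < N \<longrightarrow> root_data F (u i) y"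
    proof
      fix i
      show "\<exists>y. i < N \<longrightarrow> root_data F (u i) y"
      proof (cases "i < N")
        case True
        then obtain y where "root_data F (u i) y" using root_data_exists[OF F(1,3) u[OF True]] by blast
        then show ?thesis by blast
      qed simp
    qed
    then obtain y where d: "\<And>i. i < N \<Longrightarrow> root_data F (u i) (y i)" by metis
    define e where "e i x = (\<Sum>z\<in>F. y i z x)" for i x
    note se = root_data_sum[OF d, folded e_def]
    have trace: "(\<Sum>i<N. (norm (e i x $ l))\<^sup>2) \<le> K1\<^sup>2" if x: "x \<in> {0..1}" for x l
    proof -
      \<comment> \<open>With these coefficients the combination of the \<open>e i\<close> has value
        \<open>T\<close> at \<open>x\<close> in component \<open>l\<close>, and its squared norm is
        also \<open>T\<close>. The pointwise bound becomes
        \<open>T \<le> K1 * sqrt T\<close>.\<close>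
      define q where "q i = cnj (e i x $ l)" for i
      define w where "w z = (\<Sum>i<N. cscale (q i) (u i z))" for z
      have wr: "w z \<in> root_subspace L z" if "z \<in> F" for z unfolding w_def using u that by (intro L2.subspace_sum L2.subspace_scale sub) auto
      obtain v where v: "root_data F w v" by (rule root_data_exists[OF F(1,3) wr])
      define T where "T = (\<Sum>i<N. (norm (e i x $ l))\<^sup>2)"
      have T0: "0 \<le> T" by (simp add: T_def sum_nonneg)
      have sw: "(\<Sum>z\<in>F. w z) = (\<Sum>i<N. cscale (q i) (\<Sum>z\<in>F. u i z))" unfolding w_def by (subst sum.swap) (simp add: L2.scale_sum_right)
      have "(norm (\<Sum>z\<in>F. w z))\<^sup>2 = (\<Sum>i<N. (norm (q i))\<^sup>2)" unfolding sw by (rule norm_sum_orthonormal(3)) (use orth in auto)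
      then have nT: "L2sq (\<lambda>x. \<Sum>z\<in>F. v z x) = T" using root_data_sum(4)[OF v] by (simp add: q_def T_def)
      have ce: "continuous_on {0..1} (\<lambda>x. \<Sum>i<N. q i *s e i x)" using se(1) by (intro continuous_intros) auto
      have "(\<Sum>i<N. cscale (q i) (\<Sum>z\<in>F. u i z)) = (\<Sum>i<N. abs_L2 (\<lambda>x. q i *s e i x))" by (rule sum.cong) (use se(2,3) abs_L2_scale in auto)
      also have "\<dots> = abs_L2 (\<lambda>x. \<Sum>i<N. q i *s e i x)" by (intro abs_L2_sum square_integrable_cscale se(2)) auto
      finally have "abs_L2 (\<lambda>x. \<Sum>z\<in>F. v z x) = abs_L2 (\<lambda>x. \<Sum>i<N. q i *s e i x)" unfolding sw[symmetric] root_data_sum(3)[OF v] .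
      \<comment> \<open>The representatives \<open>v\<close> were chosen independently of the
        \<open>y i\<close>; continuity identifies the two sums at the point
        \<open>x\<close>.\<close>
      from continuous_abs_L2_eqD[OF root_data_sum(1)[OF v] ce this x]
      have "(\<Sum>z\<in>F. v z x) $ l = (\<Sum>i<N. q i * e i x $ l)" by simp
      also have "\<dots> = of_real T" unfolding T_def q_def by (simp add: complex_norm_square mult.commute del: of_real_power)
      finally have "T \<le> K1 * sqrt T" using point[OF v F(2) x, of l] T0 unfolding nT by simp
      then show ?thesis unfolding T_def[symmetric] by (rule le_sqrt_self[OF _ T0 K1])
    qed
    have "real N = (\<Sum>i<N. L2sq (e i))"
    proof -
      have "L2sq (e i) = 1" if "i < N" for i using se(4)[OF that] orth[OF that that] unfolding cinner_self by (metis of_real_eq_1_iff)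
      then show ?thesis by simp
    qed
    also have "\<dots> = integral {0..1} (\<lambda>x. \<Sum>i<N. (norm (e i x))\<^sup>2)" unfolding L2sq_def using se(1)
      by (intro hk_integral_sum[symmetric] integrable_continuous_interval continuous_intros) auto
    also have "\<dots> \<le> integral {0..1::real} (\<lambda>x. 2 * K1\<^sup>2)"
    proof (rule integral_le)
      show "(\<lambda>x. \<Sum>i<N. (norm (e i x))\<^sup>2) integrable_on {0..1}" using se(1) by (intro integrable_continuous_interval continuous_intros) auto
      fix x :: real assume x: "x \<in> {0..1}"
      have "(norm (v :: complex^2))\<^sup>2 = (norm (v $ 1))\<^sup>2 + (norm (v $ 2))\<^sup>2" for v by (simp add: norm_vec_def L2_set_def sum_2)
      then have "(\<Sum>i<N. (norm (e i x))\<^sup>2) = (\<Sum>i<N. (norm (e i x $ 1))\<^sup>2) + (\<Sum>i<N. (norm (e i x $ 2))\<^sup>2)" by (simp add: sum.distrib)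
      then show "(\<Sum>i<N. (norm (e i x))\<^sup>2) \<le> 2 * K1\<^sup>2" using trace[OF x, of 1] trace[OF x, of 2] by simp
    qed auto
    finally show "real N \<le> 2 * K1\<^sup>2" by simp
  qed
qed

text \<open>The projection estimate on a small square around \<open>z0\<close> bounds the component
  at \<open>z0\<close> by the Cauchy solution whose right-hand side is the whole sum. The sum is
  zero in \<open>L2\<close>, so this solution vanishes at 1.\<close>

theorem root_subspaces_independent:
  assumes F: "finite F" "\<And>z. z \<in> F \<Longrightarrow> \<Delta> z = 0" "\<And>z. z \<in> F \<Longrightarrow> u z \<in> root_subspace L z"
    and zero: "(\<Sum>z\<in>F. u z) = 0" and z0: "z0 \<in> F"
  shows "u z0 = 0"
proof -
  obtain y where d: "root_data F u y" by (rule root_data_exists[OF F])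
  obtain r where r: "0 < r" "\<And>w. w \<in> ball z0 r - {z0} \<Longrightarrow> \<Delta> w \<noteq> 0" using \<Delta>_isolated[of z0] by blast
  \<comment> \<open>All points of the square have distance at most \<open>2 * t < r\<close> from
    \<open>z0\<close>, so it contains no zero of \<open>\<Delta>\<close> other than possibly
    \<open>z0\<close>.\<close>
  define t where "t = r / 4"
  define p q where "p = z0 - Complex t t" and "q = z0 + Complex t t"
  have t: "0 < t" using r(1) by (simp add: t_def)
  have pq: "Re p < Re q" "Im p < Im q" using t by (simp_all add: p_def q_def)
  have near: "w \<in> ball z0 r" if "w \<in> cbox p q" for w
  proof -
    have "\<bar>Re (w - z0)\<bar> \<le> t" "\<bar>Im (w - z0)\<bar> \<le> t" using that by (auto simp: in_cbox_complex_iff p_def q_def)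
    then have "norm (w - z0) \<le> 2 * t" using cmod_le[of "w - z0"] by linarith
    also have "\<dots> < r" using r(1) by (simp add: t_def)
    finally show ?thesis by (simp add: dist_norm norm_minus_commute)
  qed
  let ?P = "path_image (rectpath p q)"
  have P: "?P = cbox p q - box p q" using pq by (intro path_image_rectpath_cbox_minus_box) auto
  have z0b: "z0 \<in> box p q" using t by (simp add: in_box_complex_iff p_def q_def)
  have nzP: "\<Delta> w \<noteq> 0" if "w \<in> ?P" for w using that z0b near unfolding P by (intro r(2)) auto
  have "continuous_on ?P (\<lambda>w. norm (\<Delta> w))" by (intro continuous_intros holomorphic_on_imp_continuous_on holomorphic_on_subset[OF holomorphic_\<Delta>]) auto
  moreover have "compact ?P" "?P \<noteq> {}" by (simp_all add: compact_path_image)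
  ultimately obtain w0 where w0: "w0 \<in> ?P" "\<And>w. w \<in> ?P \<Longrightarrow> norm (\<Delta> w0) \<le> norm (\<Delta> w)" using continuous_attains_inf by metis
  define \<delta>' where "\<delta>' = norm (\<Delta> w0)"
  have \<delta>': "0 < \<delta>'" using nzP[OF w0(1)] by (simp add: \<delta>'_def)
  define h' where "h' = \<bar>Im z0\<bar> + t"
  have h': "0 \<le> h'" using t by (simp add: h'_def)
  obtain C2 where C2: "0 < C2" "\<And>f z y. \<bar>Im z\<bar> \<le> h' \<Longrightarrow> \<delta>' \<le> norm (\<Delta> z) \<Longrightarrow> dsol z f y \<Longrightarrow> homogeneous_bc y \<Longrightarrow>
    norm (y 0) \<le> C2 * norm (sol z 0 f 1)" by (rule initial_value_bound[OF h' \<delta>']) blast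
  have "\<forall>z\<in>F. \<exists>n v. chain z n v \<and> y z = v 0" using d by (auto simp: root_data_def)
  then obtain n v where nv: "\<And>z. z \<in> F \<Longrightarrow> chain z (n z) (v z)" "\<And>z. z \<in> F \<Longrightarrow> y z = v z 0" by metis
  have sy: "square_integrable (y z0)" by (rule continuous_imp_square_integrable[OF root_data_continuous[OF d z0]])
  have gi: "y z0 absint" by (rule square_integrable_imp_absint[OF sy])
  obtain w where w: "w \<in> ?P"
    "norm (\<Sum>z\<in>F \<inter> box p q. pairing (y z0) (v z 0)) \<le> 2 * ((Re q - Re p) + (Im q - Im p)) * C2 * norm (sol w 0 (\<lambda>x. \<Sum>z\<in>F. v z 0 x) 1) *
      (norm (pairing (y z0) (U w 1)) + norm (pairing (y z0) (U w 2)))"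
  proof (rule rectangle_projection[OF h' \<delta>' _ C2(1) pq order_refl, where F=F and n=n and v=v and \<psi>="pairing (y z0)"], rule C2(2))
    show "\<bar>Im w\<bar> \<le> h' \<and> \<delta>' \<le> norm (\<Delta> w)" if "w \<in> ?P" for w
    proof
      have "\<bar>Im (w - z0)\<bar> \<le> t" using that unfolding P by (auto simp: in_cbox_complex_iff p_def q_def)
      then show "\<bar>Im w\<bar> \<le> h'" by (simp add: h'_def)
      show "\<delta>' \<le> norm (\<Delta> w)" unfolding \<delta>'_def by (rule w0(2)[OF that])
    qed
  qed (use F(1,2) nv(1) sup_functional_pairing[OF gi] in auto)
  have Fb: "F \<inter> box p q = {z0}" using z0 z0b r(2) F(2) near box_subset_cbox[of p q] by blast
  define f where "f x = (\<Sum>z\<in>F. y z x)" for x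
  have fe: "(\<lambda>x. \<Sum>z\<in>F. v z 0 x) = f" unfolding f_def using nv(2) by (intro ext sum.cong) auto
  \<comment> \<open>With the single index 0 and the radius \<open>norm w\<close>, the Bessel
    inequality becomes a bound for one Cauchy solution at 1 by the norm of \<open>f\<close>.\<close>
  obtain A where A: "0 < A" "\<And>f K z. square_integrable f \<Longrightarrow> finite (K :: int set) \<Longrightarrow> (\<And>k. k \<in> K \<Longrightarrow> norm (z k - of_real (c * of_int k)) \<le> norm w) \<Longrightarrow>
    (\<Sum>k\<in>K. (norm (sol (z k) 0 f 1))\<^sup>2) \<le> A * L2sq f" by (rule bessel_w[OF c norm_ge_zero]) blast
  have "L2sq f = 0" using root_data_sum(4)[OF d] zero by (simp add: f_def[abs_def])
  then have "(norm (sol w 0 f 1))\<^sup>2 \<le> 0" using A(2)[of f "{0}" "\<lambda>_. w"] root_data_sum(2)[OF d] by (simp add: f_def[abs_def])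
  then have "sol w 0 f 1 = 0" by simp
  then have "pairing (y z0) (y z0) = 0" using w(2) unfolding Fb fe by (simp add: nv(2)[OF z0])
  then have "L2sq (y z0) = 0" by (simp add: pairing_self[OF sy])
  then have "(norm (u z0))\<^sup>2 = 0" using d z0 norm_abs_L2_L2sq[OF sy] by (simp add: root_data_def)
  then show ?thesis by simp
qed

end

section \<open>Riesz bases in L2\<close>

lemma integral_norm_le_L2_norm:
  assumes f: "square_integrable f"
  shows "norm_L1 f \<le> norm (abs_L2 f)"
proof -
  have 1: "(\<lambda>x. norm (f x)) integrable_on {0..1}" using absint_norm[OF square_integrable_imp_absint[OF f]] absint_integrable by blast
  have 2: "(\<lambda>x. (norm (f x))\<^sup>2) integrable_on {0..1}" using square_integrable_norm2[OF f] absint_integrable by blast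
  have "(integral {0..1} (\<lambda>x. 1 * norm (f x)))\<^sup>2 \<le> integral {0..1::real} (\<lambda>_. 1) * integral {0..1} (\<lambda>x. 1 * (norm (f x))\<^sup>2)"
    by (rule Cauchy_Schwarz_weighted) (use 1 2 in auto)
  then have "(norm_L1 f)\<^sup>2 \<le> (norm (abs_L2 f))\<^sup>2" unfolding norm_abs_L2[OF f] by simp
  then show ?thesis by (rule power2_le_imp_le) simp
qed

text \<open>Riesz-Fischer. Along a subsequence with steps at most \<open>(1/2) ^ n\<close>, the sum
  of the norms of the differences has a finite integral, which gives convergence almost everywhere.
  Fatou's lemma shows that the pointwise limit is also the limit in norm.\<close>

theorem L2_complete:
  fixes X :: "nat \<Rightarrow> L2"
  assumes X: "Cauchy X"
  obtains l where "X \<longlonglongrightarrow> l"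
proof -
  have "\<forall>n. \<exists>M. \<forall>i\<ge>M. \<forall>j\<ge>M. norm (X i - X j) < (1/2) ^ n" using X unfolding Cauchy_iff by simp
  then obtain M where M: "\<And>n i j. M n \<le> i \<Longrightarrow> M n \<le> j \<Longrightarrow> norm (X i - X j) < (1/2) ^ n" by metis
  \<comment> \<open>The partial sums make the indices increasing and at least
    \<open>M n\<close>.\<close>
  define r where "r n = (\<Sum>i\<le>n. M i) + n" for n
  have Mr: "M n \<le> r n" for n using member_le_sum[of n "{..n}" M] by (simp add: r_def)
  have "incseq r" by (rule incseq_SucI) (simp add: r_def)
  then have rmono: "m \<le> n \<Longrightarrow> r m \<le> r n" for m n by (rule incseqD)
  have d: "norm (X i - X (r n)) < (1/2) ^ n" if "r n \<le> i" for i n using M[of n i "r n"] Mr[of n] that by simp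
  have "\<forall>n. \<exists>f. square_integrable f \<and> X n = abs_L2 f" using L2_rep by metis
  then obtain f where f: "\<And>n. square_integrable (f n)" "\<And>n. X n = abs_L2 (f n)" by metis
  have fd: "square_integrable (\<lambda>x. f i x - f j x)" "X i - X j = abs_L2 (\<lambda>x. f i x - f j x)" for i j
    using f by (simp_all add: square_integrable_diff abs_L2_diff)
  have fm [measurable]: "f n \<in> borel_measurable unit_leb" for n using f(1) by (simp add: square_integrable_def)
  define g where "g n x = f (r (Suc n)) x - f (r n) x" for n x
  have gm [measurable]: "g n \<in> borel_measurable unit_leb" for n unfolding g_def by simp
  have gi: "integrable unit_leb (\<lambda>x. norm (g n x))" for n using fd(1)[of "r (Suc n)" "r n"] unfolding integrable_unit_leb_iff g_def[symmetric]
    by (intro absint_norm square_integrable_imp_absint)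
  have g1: "integral\<^sup>L unit_leb (\<lambda>x. norm (g n x)) \<le> (1/2) ^ n" for n
  proof -
    have "integral\<^sup>L unit_leb (\<lambda>x. norm (g n x)) = integral {0..1} (\<lambda>x. norm (g n x))"
      by (rule integral_unit_leb) (use gi integrable_unit_leb_iff in blast)
    also have "\<dots> \<le> norm (X (r (Suc n)) - X (r n))" unfolding fd(2) g_def by (rule integral_norm_le_L2_norm[OF fd(1)])
    also have "\<dots> \<le> (1/2) ^ n" using d[OF rmono, of n "Suc n"] by simp
    finally show ?thesis .
  qed
  have "(\<integral>\<^sup>+x. (\<Sum>n. ennreal (norm (g n x))) \<partial>unit_leb) = (\<Sum>n. \<integral>\<^sup>+x. ennreal (norm (g n x)) \<partial>unit_leb)" by (rule nn_integral_suminf) simp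
  also have "\<dots> \<le> (\<Sum>n. ennreal ((1/2) ^ n))"
  proof (rule suminf_le)
    fix n
    have "(\<integral>\<^sup>+x. ennreal (norm (g n x)) \<partial>unit_leb) = ennreal (integral\<^sup>L unit_leb (\<lambda>x. norm (g n x)))" by (rule nn_integral_eq_integral[OF gi]) simp
    then show "(\<integral>\<^sup>+x. ennreal (norm (g n x)) \<partial>unit_leb) \<le> ennreal ((1/2) ^ n)" using g1 by (simp add: ennreal_leI)
  qed auto
  also have "\<dots> = ennreal (\<Sum>n. (1/2) ^ n)" by (rule suminf_ennreal2) (auto intro: summable_geometric)
  also have "\<dots> < top" by simp
  finally have "(\<integral>\<^sup>+x. (\<Sum>n. ennreal (norm (g n x))) \<partial>unit_leb) \<noteq> \<infinity>" by simp
  then have "AE x in unit_leb. (\<Sum>n. ennreal (norm (g n x))) \<noteq> \<infinity>" by (intro nn_integral_PInf_AE) auto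
  then have conv: "AE x in unit_leb. convergent (\<lambda>n. f (r n) x)"
  proof eventually_elim
    case (elim x)
    then have "summable (\<lambda>n. norm (g n x))" by (intro summable_suminf_not_top) auto
    then have "summable (\<lambda>n. g n x)" by (rule summable_norm_cancel)
    then have "convergent (\<lambda>n. f (r 0) x + (\<Sum>i<n. g i x))" unfolding summable_iff_convergent by (intro convergent_add convergent_const)
    moreover have "f (r 0) x + (\<Sum>i<n. g i x) = f (r n) x" for n unfolding g_def by (subst sum_lessThan_telescope) simp
    ultimately show ?case by simp
  qed
  define F where "F x = lim (\<lambda>n. f (r n) x)" for x
  have Fm [measurable]: "F \<in> borel_measurable unit_leb" unfolding F_def by (rule borel_measurable_lim_metric) simp
  let ?d = "\<lambda>n N x. (norm (f (r n) x - f (r N) x))\<^sup>2" and ?D = "\<lambda>N x. (norm (F x - f (r N) x))\<^sup>2"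
  have fatou: "(\<integral>\<^sup>+x. ennreal (?D N x) \<partial>unit_leb) \<le> ennreal (((1/2) ^ N)\<^sup>2)" for N
  proof -
    have "AE x in unit_leb. ennreal (?D N x) = liminf (\<lambda>n. ennreal (?d n N x))" using conv
    proof eventually_elim
      case (elim x)
      then have "(\<lambda>n. f (r n) x) \<longlonglongrightarrow> F x" unfolding F_def by (simp add: convergent_LIMSEQ_iff)
      then have "(\<lambda>n. ennreal (?d n N x)) \<longlonglongrightarrow> ennreal (?D N x)" by (intro tendsto_ennrealI tendsto_intros)
      then show ?case by (intro lim_imp_Liminf[symmetric]) simp_all
    qed
    then have "(\<integral>\<^sup>+x. ennreal (?D N x) \<partial>unit_leb) = (\<integral>\<^sup>+x. liminf (\<lambda>n. ennreal (?d n N x)) \<partial>unit_leb)" by (rule nn_integral_cong_AE)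
    also have "\<dots> \<le> liminf (\<lambda>n. \<integral>\<^sup>+x. ennreal (?d n N x) \<partial>unit_leb)" by (rule nn_integral_liminf) simp
    also have "\<dots> \<le> ennreal (((1/2) ^ N)\<^sup>2)"
    proof (rule Liminf_le)
      have "(\<integral>\<^sup>+x. ennreal (?d n N x) \<partial>unit_leb) \<le> ennreal (((1/2) ^ N)\<^sup>2)" if n: "N \<le> n" for n
      proof -
        have i: "integrable unit_leb (\<lambda>x. ?d n N x)" using fd(1) by (simp add: square_integrable_def)
        have "(\<integral>\<^sup>+x. ennreal (?d n N x) \<partial>unit_leb) = ennreal (integral\<^sup>L unit_leb (\<lambda>x. ?d n N x))" by (rule nn_integral_eq_integral[OF i]) simp
        also have "integral\<^sup>L unit_leb (\<lambda>x. ?d n N x) = (norm (X (r n) - X (r N)))\<^sup>2"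
          unfolding fd(2) norm_abs_L2[OF fd(1)] by (rule integral_unit_leb) (use i integrable_unit_leb_iff in blast)
        also have "ennreal ((norm (X (r n) - X (r N)))\<^sup>2) \<le> ennreal (((1/2) ^ N)\<^sup>2)" using d[OF rmono[OF n]] by (intro ennreal_leI power_mono) auto
        finally show ?thesis .
      qed
      then show "\<forall>\<^sub>F n in sequentially. (\<integral>\<^sup>+x. ennreal (?d n N x) \<partial>unit_leb) \<le> ennreal (((1/2) ^ N)\<^sup>2)" by (rule eventually_sequentiallyI)
    qed simp
    finally show ?thesis .
  qed
  have sd: "square_integrable (\<lambda>x. F x - f (r N) x)" for N unfolding square_integrable_def
  proof
    show "integrable unit_leb (\<lambda>x. ?D N x)"
      by (rule integrableI_bounded) (use fatou[of N] in \<open>auto simp: top_unique less_top[symmetric] intro: le_less_trans\<close>)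
  qed simp
  have sF: "square_integrable F" using square_integrable_add[OF sd[of 0] f(1)[of "r 0"]] by simp
  have lim: "norm (X (r N) - abs_L2 F) \<le> (1/2) ^ N" for N
  proof -
    have i: "integrable unit_leb (\<lambda>x. ?D N x)" using sd by (simp add: square_integrable_def)
    have "(norm (abs_L2 F - X (r N)))\<^sup>2 = integral\<^sup>L unit_leb (\<lambda>x. ?D N x)" unfolding f(2) abs_L2_diff[OF sF f(1)] norm_abs_L2[OF sd]
      by (rule integral_unit_leb[symmetric]) (use i integrable_unit_leb_iff in blast)
    moreover have "ennreal (integral\<^sup>L unit_leb (\<lambda>x. ?D N x)) \<le> ennreal (((1/2) ^ N)\<^sup>2)" using fatou[of N] nn_integral_eq_integral[OF i] by simp
    ultimately have "(norm (abs_L2 F - X (r N)))\<^sup>2 \<le> ((1/2) ^ N)\<^sup>2" by (simp add: ennreal_le_iff)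
    then have "norm (abs_L2 F - X (r N)) \<le> (1/2) ^ N" by (rule power2_le_imp_le) simp
    then show ?thesis by (simp add: norm_minus_commute)
  qed
  have "X \<longlonglongrightarrow> abs_L2 F"
  proof (rule LIMSEQ_I)
    fix \<epsilon> :: real assume "0 < \<epsilon>"
    then obtain N where N: "(1/2) ^ N < \<epsilon> / 2" using real_arch_pow_inv[of "\<epsilon> / 2" "1/2"] by auto
    have "norm (X i - abs_L2 F) < \<epsilon>" if "r N \<le> i" for i
    proof -
      have "norm (X i - abs_L2 F) \<le> norm (X i - X (r N)) + norm (X (r N) - abs_L2 F)" by (rule norm_le_of_eq_add) simp
      then show ?thesis using d[OF that] lim[of N] N by linarith
    qed
    then show "\<exists>no. \<forall>n\<ge>no. norm (X n - abs_L2 F) < \<epsilon>" by blast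
  qed
  then show ?thesis by (rule that)
qed

text \<open>The coefficients are kept apart from the vectors, so that the same combination can be
  formed of two sequences and the norms compared.\<close>

definition lincomb :: "(nat \<Rightarrow> complex) \<Rightarrow> nat \<Rightarrow> (nat \<Rightarrow> L2) \<Rightarrow> L2"
  where "lincomb r n x = (\<Sum>i<n. cscale (r i) (x i))"

lemma lincomb_extend: "n \<le> m \<Longrightarrow> lincomb r n x = lincomb (\<lambda>i. if i < n then r i else 0) m x"
  unfolding lincomb_def by (rule sum.mono_neutral_cong_left) auto

lemma lincomb_add:
  "\<exists>q. \<forall>x. lincomb r n x + lincomb r' n' x = lincomb q (max n n') x"
proof (intro exI allI)
  fix x
  show "lincomb r n x + lincomb r' n' x = lincomb (\<lambda>i. (if i < n then r i else 0) + (if i < n' then r' i else 0)) (max n n') x"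
    unfolding lincomb_extend[of n "max n n'", simplified] lincomb_extend[of n' "max n n'", simplified]
    by (simp add: lincomb_def L2.scale_left_distrib sum.distrib)
qed

lemma lincomb_scale: "cscale c (lincomb r n x) = lincomb (\<lambda>i. c * r i) n x" by (simp add: lincomb_def L2.scale_sum_right)

lemma lincomb_unit: "lincomb (\<lambda>j. if j = i then 1 else 0) (Suc i) x = x i"
proof -
  have "lincomb (\<lambda>j. if j = i then 1 else 0) (Suc i) x = (\<Sum>j<Suc i. if j = i then x i else 0)" unfolding lincomb_def by (rule sum.cong) auto
  then show ?thesis by simp
qed

lemma span_range_lincomb:
  assumes "u \<in> L2.span (range x)"
  obtains r n where "u = lincomb r n x"
proof -
  have "\<exists>r n. u = lincomb r n x" using assms
  proof (induction rule: L2.span_induct_alt)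
    case base
    show ?case by (intro exI[of _ "\<lambda>_. 0"] exI[of _ 0]) (simp add: lincomb_def)
  next
    case (step c v w)
    then obtain i r n where i: "v = x i" "w = lincomb r n x" by blast
    have "cscale c v + w = lincomb (\<lambda>j. c * (if j = i then 1 else 0)) (Suc i) x + lincomb r n x" unfolding lincomb_scale[symmetric] lincomb_unit i ..
    then show ?case using lincomb_add by metis
  qed
  then show ?thesis using that by blast
qed

lemma closure_span_lincomb:
  assumes "closure (L2.span (range x)) = UNIV"
  obtains r n where "(\<lambda>m. lincomb (r m) (n m) x) \<longlonglongrightarrow> v"
proof -
  obtain w where w: "\<And>m. w m \<in> L2.span (range x)" "w \<longlonglongrightarrow> v" using assms closure_sequential[of v "L2.span (range x)"] by auto
  have "\<forall>m. \<exists>r n. w m = lincomb r n x" using span_range_lincomb[OF w(1)] by metis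
  then obtain r n where "\<And>m. w m = lincomb (r m) (n m) x" by metis
  then have "w = (\<lambda>m. lincomb (r m) (n m) x)" by blast
  then show ?thesis using that w(2) by blast
qed

text \<open>\<open>P v w\<close> says that one sequence of coefficients approximates
  \<open>v\<close> by the \<open>y i\<close> and \<open>w\<close> by the \<open>x i\<close>. The
  bound makes the second approximation a Cauchy sequence and its limit independent of the
  coefficients, so \<open>P\<close> is the graph of a bounded linear operator.\<close>

theorem bounded_extension:
  assumes dense: "closure (L2.span (range y)) = UNIV"
    and bound: "\<And>r n. norm (lincomb r n x) \<le> C * norm (lincomb r n y)"
  obtains T where "bounded_operator T" "\<And>i. T (y i) = x i"
proof -
  let ?l = "\<lambda>r n x m. lincomb (r m) (n m) x"
  define P where "P v w \<longleftrightarrow> (\<exists>r n. ?l r n y \<longlonglongrightarrow> v \<and> ?l r n x \<longlonglongrightarrow> w)" for v w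
  have ex: "\<exists>w. P v w" for v
  proof -
    obtain r n where rn: "?l r n y \<longlonglongrightarrow> v" by (rule closure_span_lincomb[OF dense])
    have "Cauchy (?l r n x)"
    proof (rule CauchyI)
      fix e :: real assume e: "0 < e"
      have e': "0 < e / (\<bar>C\<bar> + 1)" using e by simp
      have "Cauchy (?l r n y)" using rn by (simp add: LIMSEQ_imp_Cauchy)
      then obtain M where M: "\<And>i j. M \<le> i \<Longrightarrow> M \<le> j \<Longrightarrow> norm (lincomb (r i) (n i) y - lincomb (r j) (n j) y) < e / (\<bar>C\<bar> + 1)"
        unfolding Cauchy_iff using e' by blast
      have "norm (lincomb (r i) (n i) x - lincomb (r j) (n j) x) < e" if "M \<le> i" "M \<le> j" for i j
      proof -
        obtain q where q: "\<And>x. lincomb (r i) (n i) x + lincomb (\<lambda>k. - 1 * r j k) (n j) x = lincomb q (max (n i) (n j)) x" using lincomb_add by metis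
        have q': "lincomb (r i) (n i) x - lincomb (r j) (n j) x = lincomb q (max (n i) (n j)) x" for x
          unfolding q[symmetric] lincomb_scale[symmetric] by (simp add: L2.scale_minus_left)
        have "norm (lincomb (r i) (n i) x - lincomb (r j) (n j) x) \<le> C * norm (lincomb (r i) (n i) y - lincomb (r j) (n j) y)"
          unfolding q' by (rule bound)
        also have "\<dots> \<le> (\<bar>C\<bar> + 1) * norm (lincomb (r i) (n i) y - lincomb (r j) (n j) y)" by (intro mult_right_mono) auto
        also have "\<dots> < e" using M[OF that] by (simp add: field_simps)
        finally show ?thesis .
      qed
      then show "\<exists>M. \<forall>i\<ge>M. \<forall>j\<ge>M. norm (lincomb (r i) (n i) x - lincomb (r j) (n j) x) < e" by blast
    qed
    then obtain w where "?l r n x \<longlonglongrightarrow> w" by (rule L2_complete)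
    then show ?thesis using rn unfolding P_def by (intro exI[of _ w] exI[of _ r] exI[of _ n] conjI)
  qed
  have add: "P (v + v') (w + w')" if "P v w" "P v' w'" for v w v' w'
  proof -
    obtain r n where "?l r n y \<longlonglongrightarrow> v \<and> ?l r n x \<longlonglongrightarrow> w" using \<open>P v w\<close> unfolding P_def by (elim exE)
    moreover obtain r' n' where "?l r' n' y \<longlonglongrightarrow> v' \<and> ?l r' n' x \<longlonglongrightarrow> w'" using \<open>P v' w'\<close> unfolding P_def by (elim exE)
    ultimately have rn: "?l r n y \<longlonglongrightarrow> v" "?l r n x \<longlonglongrightarrow> w"
      "?l r' n' y \<longlonglongrightarrow> v'" "?l r' n' x \<longlonglongrightarrow> w'" by auto
    have "\<forall>m. \<exists>q. \<forall>x. lincomb (r m) (n m) x + lincomb (r' m) (n' m) x = lincomb q (max (n m) (n' m)) x" using lincomb_add by blast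
    then obtain q where q: "\<And>m x. lincomb (r m) (n m) x + lincomb (r' m) (n' m) x = lincomb (q m) (max (n m) (n' m)) x" by metis
    show ?thesis unfolding P_def using tendsto_add[OF rn(1,3)] tendsto_add[OF rn(2,4)] unfolding q
      by (intro exI[of _ q] exI[of _ "\<lambda>m. max (n m) (n' m)"] conjI)
  qed
  have scale: "P (cscale c v) (cscale c w)" if vw: "P v w" for c v w
  proof -
    obtain r n where "?l r n y \<longlonglongrightarrow> v \<and> ?l r n x \<longlonglongrightarrow> w" using vw unfolding P_def by (elim exE)
    then have rn: "?l r n y \<longlonglongrightarrow> v" "?l r n x \<longlonglongrightarrow> w" by auto
    show ?thesis unfolding P_def
      using bounded_linear.tendsto[OF bounded_linear_cscale_L2 rn(1), of c] bounded_linear.tendsto[OF bounded_linear_cscale_L2 rn(2), of c]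
      unfolding lincomb_scale by (intro exI[of _ "\<lambda>m i. c * r m i"] exI[of _ n] conjI)
  qed
  have bd: "norm w \<le> C * norm v" if "P v w" for v w
  proof -
    obtain r n where "?l r n y \<longlonglongrightarrow> v \<and> ?l r n x \<longlonglongrightarrow> w" using \<open>P v w\<close> unfolding P_def by (elim exE)
    then have rn: "?l r n y \<longlonglongrightarrow> v" "?l r n x \<longlonglongrightarrow> w" by auto
    have l: "(\<lambda>m. norm (lincomb (r m) (n m) x)) \<longlonglongrightarrow> norm w" by (intro tendsto_intros rn)
    have r: "(\<lambda>m. C * norm (lincomb (r m) (n m) y)) \<longlonglongrightarrow> C * norm v" by (intro tendsto_intros rn)
    show ?thesis by (rule LIMSEQ_le[OF l r]) (use bound in blast)
  qed
  have uniq: "w = w'" if "P v w" "P v w'" for v w w'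
  proof -
    have "P (v + cscale (- 1) v) (w + cscale (- 1) w')" by (intro add scale that)
    from bd[OF this] show ?thesis by (simp add: L2.scale_minus_left)
  qed
  define T where "T v = (SOME w. P v w)" for v
  have T: "P v (T v)" for v unfolding T_def by (rule someI_ex[OF ex])
  have Tadd: "T (v + w) = T v + T w" for v w by (rule uniq[OF T add[OF T T]])
  have Tscale: "T (cscale c v) = cscale c (T v)" for c v by (rule uniq[OF T scale[OF T]])
  have "bounded_operator T" unfolding bounded_operator_def
  proof
    show "Vector_Spaces.linear cscale cscale T" unfolding Vector_Spaces.linear_iff using Tadd Tscale L2.vector_space_axioms by blast
    show "bounded_linear T" by (rule bounded_linear_intro[of _ C]) (use bd[OF T] in \<open>simp_all add: Tadd Tscale scaleR_L2_eq mult.commute\<close>)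
  qed
  moreover have "T (y i) = x i" for i
  proof (rule uniq[OF T])
    show "P (y i) (x i)" unfolding P_def by (intro exI[of _ "\<lambda>_ j. if j = i then 1 else 0"] exI[of _ "\<lambda>_. Suc i"]) (simp add: lincomb_unit)
  qed
  ultimately show ?thesis by (rule that)
qed

section \<open>Orthonormal systems\<close>

definition orthonormal_on :: "nat set \<Rightarrow> (nat \<Rightarrow> L2) \<Rightarrow> bool"
  where "orthonormal_on A e \<longleftrightarrow> (\<forall>i\<in>A. \<forall>j\<in>A. cinner (e i) (e j) = (if i = j then 1 else 0))"

lemma orthonormal_sum:
  assumes "finite A" "orthonormal_on A e"
  shows "j \<in> A \<Longrightarrow> cinner (\<Sum>i\<in>A. cscale (r i) (e i)) (e j) = r j"
    "(norm (\<Sum>i\<in>A. cscale (r i) (e i)))\<^sup>2 = (\<Sum>i\<in>A. (norm (r i))\<^sup>2)"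
  using norm_sum_orthonormal(2,3)[OF assms(1), of e] assms(2) unfolding orthonormal_on_def by auto

fun gram_schmidt :: "(nat \<Rightarrow> L2) \<Rightarrow> nat \<Rightarrow> L2"
  where "gram_schmidt f n = (let g = f n - (\<Sum>i<n. cscale (cinner (f n) (gram_schmidt f i)) (gram_schmidt f i))
    in cscale (1 / of_real (norm g)) g)"

declare gram_schmidt.simps [simp del]

lemma gram_schmidt:
  assumes inj: "inj_on f {..<N}" and ind: "L2.independent (f ` {..<N})" and "m \<le> N"
  shows "orthonormal_on {..<m} (gram_schmidt f) \<and> L2.span (gram_schmidt f ` {..<m}) = L2.span (f ` {..<m})" using assms(3)
proof (induction m)
  case 0
  then show ?case by (simp add: orthonormal_on_def)
next
  case (Suc m)
  let ?e = "gram_schmidt f"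
  have on: "orthonormal_on {..<m} ?e" and sp: "L2.span (?e ` {..<m}) = L2.span (f ` {..<m})" using Suc by auto
  define p where "p = (\<Sum>i<m. cscale (cinner (f m) (?e i)) (?e i))"
  define g where "g = f m - p"
  have e: "?e m = cscale (1 / of_real (norm g)) g" by (subst gram_schmidt.simps) (simp add: Let_def g_def p_def)
  have ps: "p \<in> L2.span (?e ` {..<m})" unfolding p_def by (intro L2.span_sum L2.span_scale L2.span_base) auto
  have fm: "f m \<notin> L2.span (f ` {..<m})"
  proof -
    have "f ` {..<m} \<subseteq> f ` {..<N} - {f m}"
    proof clarify
      fix i assume i: "i < m"
      have "f i = f m \<Longrightarrow> i = m" using inj_onD[OF inj, of i m] i Suc.prems by simp
      then show "f i \<in> f ` {..<N} - {f m}" using i Suc.prems by auto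
    qed
    moreover have "f m \<notin> L2.span (f ` {..<N} - {f m})" using ind Suc.prems unfolding L2.dependent_def by auto
    ultimately show ?thesis using L2.span_mono by blast
  qed
  have "g \<noteq> 0" using ps fm unfolding g_def sp by auto
  then have ng: "norm g \<noteq> 0" by simp
  have go: "cinner g (?e j) = 0" if "j < m" for j unfolding g_def cinner_diff_left p_def using orthonormal_sum(1)[OF _ on, of j] that by simp
  have eo: "cinner (?e m) (?e j) = 0" if "j < m" for j unfolding e cinner_scale_left go[OF that] by simp
  have ee: "cinner (?e m) (?e m) = 1"
  proof -
    have "norm (?e m) = 1" unfolding e norm_cscale using ng by (simp add: norm_divide)
    then show ?thesis by (simp add: cinner_self)
  qed
  have "orthonormal_on {..<Suc m} ?e" unfolding orthonormal_on_def
  proof (intro ballI)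
    fix i j assume "i \<in> {..<Suc m}" "j \<in> {..<Suc m}"
    then consider "i < m" "j < m" | "i = m" "j = m" | "i = m" "j < m" | "i < m" "j = m" by fastforce
    then show "cinner (?e i) (?e j) = (if i = j then 1 else 0)"
    proof cases
      case 1 then show ?thesis using on by (simp add: orthonormal_on_def)
    next
      case 2 then show ?thesis using ee by simp
    next
      case 3 then show ?thesis using eo by simp
    next
      case 4 then show ?thesis using eo[of i] cinner_commute[of "?e i" "?e j"] by simp
    qed
  qed
  moreover have "L2.span (?e ` {..<Suc m}) = L2.span (f ` {..<Suc m})" unfolding lessThan_Suc image_insert
  proof (rule L2.span_eq[THEN iffD2], intro conjI insert_subsetI)
    have sub: "L2.span (f ` {..<m}) \<subseteq> L2.span (insert (f m) (f ` {..<m}))" "L2.span (?e ` {..<m}) \<subseteq> L2.span (insert (?e m) (?e ` {..<m}))"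
      by (auto intro!: L2.span_mono)
    have "g \<in> L2.span (insert (f m) (f ` {..<m}))" unfolding g_def
    proof (rule L2.span_diff)
      show "f m \<in> L2.span (insert (f m) (f ` {..<m}))" by (rule L2.span_base) simp
      show "p \<in> L2.span (insert (f m) (f ` {..<m}))" using ps sub(1) unfolding sp by blast
    qed
    then show "?e m \<in> L2.span (insert (f m) (f ` {..<m}))" unfolding e by (rule L2.span_scale)
    show "?e ` {..<m} \<subseteq> L2.span (insert (f m) (f ` {..<m}))"      by (rule order_trans[OF L2.span_superset[of "?e ` {..<m}", unfolded sp] sub(1)])
    show "f ` {..<m} \<subseteq> L2.span (insert (?e m) (?e ` {..<m}))"      by (rule order_trans[OF L2.span_superset[of "f ` {..<m}", folded sp] sub(2)])
    have "cscale (of_real (norm g)) (?e m) = g" unfolding e using ng by simp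
    then have "f m = cscale (of_real (norm g)) (?e m) + p" by (simp add: g_def)
    then show "f m \<in> L2.span (insert (?e m) (?e ` {..<m}))" using subsetD[OF sub(2) ps] by (simp add: L2.span_add L2.span_base L2.span_scale)
  qed
  ultimately show ?case by blast
qed

lemma finite_orthonormal_basis:
  assumes T: "finite T" "L2.independent T"
  obtains e where "orthonormal_on {..<card T} e" "L2.span (e ` {..<card T}) = L2.span T"
proof -
  obtain b where "bij_betw b {0..<card T} T" using ex_bij_betw_nat_finite[OF T(1)] by blast
  then have b: "inj_on b {..<card T}" "b ` {..<card T} = T" by (simp_all add: bij_betw_def atLeast0LessThan)
  show ?thesis using gram_schmidt[OF b(1) _ order_refl] T(2) unfolding b(2) by (intro that[of "gram_schmidt b"]) auto
qed

text \<open>By Bessel's inequality the Fourier partial sums of \<open>v\<close> form a Cauchy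
  sequence; its limit differs from \<open>v\<close> by a vector orthogonal to all
  \<open>e i\<close>.\<close>

lemma orthonormal_total_dense:
  assumes on: "orthonormal_on UNIV e" and total: "\<And>v. (\<And>i. cinner v (e i) = 0) \<Longrightarrow> v = 0"
  shows "closure (L2.span (range e)) = UNIV"
proof -
  have fin: "orthonormal_on A e" for A using on by (simp add: orthonormal_on_def)
  have "v \<in> closure (L2.span (range e))" for v
  proof -
    define r where "r i = cinner v (e i)" for i
    define S where "S A = (\<Sum>i\<in>A. cscale (r i) (e i))" for A
    have nS: "(norm (S A))\<^sup>2 = (\<Sum>i\<in>A. (norm (r i))\<^sup>2)" if "finite A" for A unfolding S_def by (rule orthonormal_sum(2)[OF that fin])
    have bessel: "(\<Sum>i\<in>A. (norm (r i))\<^sup>2) \<le> (norm v)\<^sup>2" if A: "finite A" for A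
    proof -
      have "cinner v (S A) = cnj (cinner (S A) v)" by (rule cinner_commute)
      also have "\<dots> = (\<Sum>i\<in>A. of_real ((norm (r i))\<^sup>2))"
        unfolding S_def cinner_sum_left cinner_scale_left cinner_commute[of "e i" v for i] r_def[symmetric]
        by (simp add: complex_norm_square mult.commute del: of_real_power)
      also have "\<dots> = of_real ((norm (S A))\<^sup>2)" unfolding nS[OF A] by simp
      finally have "(norm (S A))\<^sup>2 = norm (cinner v (S A))" by (simp only: norm_of_real abs_power2)
      also have "\<dots> \<le> norm v * norm (S A)" by (rule norm_cinner_le)
      finally have "norm (S A) \<le> norm v" by (cases "norm (S A) = 0") (simp_all add: power2_eq_square)
      then show ?thesis unfolding nS[OF A, symmetric] by (intro power_mono) auto
    qed
    have "summable (\<lambda>i. (norm (r i))\<^sup>2)" by (rule summableI_nonneg_bounded[of _ "(norm v)\<^sup>2"]) (use bessel in auto)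
    have "Cauchy (\<lambda>n. S {..<n})"
    proof (rule metric_CauchyI)
      fix \<epsilon> :: real assume "0 < \<epsilon>"
      then have "0 < \<epsilon>\<^sup>2" by simp
      then obtain N where N: "\<And>m n. N \<le> m \<Longrightarrow> norm (\<Sum>i\<in>{m..<n}. (norm (r i))\<^sup>2) < \<epsilon>\<^sup>2"
        using \<open>summable (\<lambda>i. (norm (r i))\<^sup>2)\<close> unfolding summable_Cauchy by blast
      have lt: "norm (S {..<n} - S {..<m}) < \<epsilon>" if "N \<le> m" "m \<le> n" for m n
      proof -
        have "S {..<n} = S {..<m} + S {m..<n}" unfolding S_def using that(2) by (metis atLeast0LessThan le0 sum.atLeastLessThan_concat)
        then have "(norm (S {..<n} - S {..<m}))\<^sup>2 < \<epsilon>\<^sup>2" using N[OF that(1), of n] nS[of "{m..<n}"] by (simp add: sum_nonneg)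
        then show ?thesis using \<open>0 < \<epsilon>\<close> by (simp add: power_less_imp_less_base)
      qed
      have "dist (S {..<m}) (S {..<n}) < \<epsilon>" if "N \<le> m" "N \<le> n" for m n
        using lt[of m n] lt[of n m] that by (cases "m \<le> n") (auto simp: dist_norm norm_minus_commute)
      then show "\<exists>M. \<forall>m\<ge>M. \<forall>n\<ge>M. dist (S {..<m}) (S {..<n}) < \<epsilon>" by blast
    qed
    then obtain l where l: "(\<lambda>n. S {..<n}) \<longlonglongrightarrow> l" by (rule L2_complete)
    have "v - l = 0"
    proof (rule total)
      fix i
      have "(\<lambda>n. cinner (v - S {..<n}) (e i)) \<longlonglongrightarrow> cinner (v - l) (e i)"
        by (intro bounded_linear.tendsto[OF bounded_linear_cinner_left] tendsto_intros l)
      moreover have "\<forall>\<^sub>F n in sequentially. cinner (v - S {..<n}) (e i) = 0"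
      proof (rule eventually_sequentiallyI)
        fix n assume "Suc i \<le> n"
        then have "cinner (S {..<n}) (e i) = r i" unfolding S_def by (intro orthonormal_sum(1) fin) auto
        then show "cinner (v - S {..<n}) (e i) = 0" by (simp add: cinner_diff_left r_def)
      qed
      ultimately have "(\<lambda>n. 0) \<longlonglongrightarrow> cinner (v - l) (e i)" by (rule Lim_transform_eventually)
      then show "cinner (v - l) (e i) = 0" by (simp add: LIMSEQ_const_iff)
    qed
    then have "(\<lambda>n. S {..<n}) \<longlonglongrightarrow> v" using l by simp
    moreover have "S {..<n} \<in> L2.span (range e)" for n unfolding S_def by (intro L2.span_sum L2.span_scale L2.span_base) auto
    ultimately show ?thesis unfolding closure_sequential by (intro exI[of _ "\<lambda>n. S {..<n}"]) blast
  qed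
  then show ?thesis by blast
qed

lemma span_image_sum:
  assumes "finite A" "u \<in> L2.span (e ` A)"
  obtains r where "u = (\<Sum>i\<in>A. cscale (r i) (e i))"
proof -
  have "\<exists>r. u = (\<Sum>i\<in>A. cscale (r i) (e i))" using assms(2)
  proof (induction rule: L2.span_induct_alt)
    case base
    then show ?case by (intro exI[of _ "\<lambda>_. 0"]) simp
  next
    case (step c v w)
    then obtain i r where i: "i \<in> A" "v = e i" "w = (\<Sum>i\<in>A. cscale (r i) (e i))" by blast
    have "cscale c v = (\<Sum>j\<in>A. if j = i then cscale c (e i) else 0)" using i assms(1) by simp
    also have "\<dots> = (\<Sum>j\<in>A. cscale (if j = i then c else 0) (e j))" by (rule sum.cong) auto
    finally have "cscale c v + w = (\<Sum>j\<in>A. cscale ((if j = i then c else 0) + r j) (e j))"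
      unfolding i(3) by (simp add: L2.scale_left_distrib sum.distrib)
    then show ?case by (intro exI)
  qed
  then show ?thesis using that by blast
qed

text \<open>The span is the set of fixed points of the orthogonal projection, which is
  continuous.\<close>

lemma closed_span_orthonormal:
  assumes A: "finite A" and on: "orthonormal_on A e"
  shows "closed_subspace (L2.span (e ` A))" unfolding closed_subspace_def
proof
  let ?V = "{v. (\<Sum>i\<in>A. cscale (cinner v (e i)) (e i)) = v}"
  have "L2.span (e ` A) = ?V"
  proof
    show "L2.span (e ` A) \<subseteq> ?V"
    proof
      fix v assume "v \<in> L2.span (e ` A)"
      then obtain r where r: "v = (\<Sum>i\<in>A. cscale (r i) (e i))" by (rule span_image_sum[OF A])
      show "v \<in> ?V" unfolding r by (simp add: orthonormal_sum(1)[OF A on])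
    qed
    show "?V \<subseteq> L2.span (e ` A)"
    proof
      fix v assume "v \<in> ?V"
      then have "v = (\<Sum>i\<in>A. cscale (cinner v (e i)) (e i))" by simp
      also have "\<dots> \<in> L2.span (e ` A)" by (intro L2.span_sum L2.span_scale L2.span_base) auto
      finally show "v \<in> L2.span (e ` A)" .
    qed
  qed
  moreover have "closed ?V" by (intro closed_Collect_eq continuous_intros bounded_linear.continuous_on[OF bounded_linear_cscale_left]
        bounded_linear.continuous_on[OF bounded_linear_cinner_left])
  ultimately show "closed (L2.span (e ` A))" by simp
qed simp

section \<open>Sequences divided into blocks, and the criterion for a Riesz basis with
  parentheses\<close>

lemma block_exists:
  fixes n :: "nat \<Rightarrow> nat"
  assumes "strict_mono n" "n 0 = 0"
  obtains k where "n k \<le> i" "i < n (Suc k)"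
proof -
  have "i < n (Suc i)" using strict_mono_imp_increasing[OF assms(1), of "Suc i"] by simp
  then have ex: "\<exists>k. i < n (Suc k)" by blast
  define k where "k = (LEAST k. i < n (Suc k))"
  have "i < n (Suc k)" unfolding k_def by (rule LeastI_ex[OF ex])
  moreover have "n k \<le> i"
  proof (cases k)
    case 0 then show ?thesis using assms(2) by simp
  next
    case (Suc j)
    then have "\<not> i < n (Suc j)" using not_less_Least[of j "\<lambda>k. i < n (Suc k)"] unfolding k_def by simp
    then show ?thesis using Suc by simp
  qed
  ultimately show ?thesis using that by blast
qed

lemma block_unique:
  fixes n :: "nat \<Rightarrow> nat"
  assumes n: "strict_mono n" and "n j \<le> i" "i < n (Suc j)" "n k \<le> i" "i < n (Suc k)"
  shows "j = k"
proof (rule ccontr)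
  assume "j \<noteq> k"
  then have "Suc j \<le> k \<or> Suc k \<le> j" by auto
  then have "n (Suc j) \<le> n k \<or> n (Suc k) \<le> n j" using strict_mono_mono[OF n] by (auto dest: monoD)
  then show False using assms by auto
qed

text \<open>The finite blocks are listed one after another; that they are nonempty is what makes
  \<open>n\<close> strictly increasing.\<close>

lemma enumerate_blocks:
  fixes B :: "nat \<Rightarrow> 'a set"
  assumes fin: "\<And>k. finite (B k)" and ne: "\<And>k. B k \<noteq> {}" and disj: "\<And>j k. j \<noteq> k \<Longrightarrow> B j \<inter> B k = {}"
  obtains f :: "nat \<Rightarrow> 'a" and n :: "nat \<Rightarrow> nat" where "bij_betw f UNIV (\<Union>k. B k)" "n 0 = 0" "strict_mono n" "\<And>k. f ` {n k..<n (Suc k)} = B k"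
proof -
  have "\<forall>k. \<exists>b. bij_betw b {0..<card (B k)} (B k)" using ex_bij_betw_nat_finite[OF fin] by blast
  then obtain b where b: "\<And>k. bij_betw (b k) {0..<card (B k)} (B k)" by metis
  define n where "n k = (\<Sum>j<k. card (B j))" for k
  have nS: "n (Suc k) = n k + card (B k)" for k by (simp add: n_def)
  have n: "strict_mono n" "n 0 = 0" using fin ne by (auto simp: strict_mono_Suc_iff nS card_gt_0_iff, simp add: n_def)
  have "\<forall>i. \<exists>k. n k \<le> i \<and> i < n (Suc k)" using block_exists[OF n] by metis
  then obtain q where q: "\<And>i. n (q i) \<le> i" "\<And>i. i < n (Suc (q i))" by metis
  have qe: "q i = k" if "n k \<le> i" "i < n (Suc k)" for i k by (rule block_unique[OF n(1) q that])
  define f where "f i = b (q i) (i - n (q i))" for i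
  have fB: "f i \<in> B (q i)" for i unfolding f_def by (rule bij_betwE[OF b, rule_format]) (use q[of i] nS in auto)
  have im: "f ` {n k..<n (Suc k)} = B k" for k
  proof
    show "f ` {n k..<n (Suc k)} \<subseteq> B k" using fB qe by fastforce
    show "B k \<subseteq> f ` {n k..<n (Suc k)}"
    proof
      fix x assume "x \<in> B k"
      then obtain j where j: "j < card (B k)" "x = b k j" using bij_betw_imp_surj_on[OF b[of k]] by (metis atLeastLessThan_iff imageE)
      have "q (n k + j) = k" by (rule qe) (use j nS in auto)
      then have "f (n k + j) = x" using j by (simp add: f_def)
      then show "x \<in> f ` {n k..<n (Suc k)}" using j nS by (intro image_eqI[of _ _ "n k + j"]) auto
    qed
  qed
  have "inj f"
  proof (rule injI)
    fix i j assume e: "f i = f j"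
    have qq: "q i = q j"
    proof (rule ccontr)
      assume "q i \<noteq> q j"
      then show False using disj fB[of i] fB[of j] e by (metis disjoint_iff)
    qed
    have "b (q i) (i - n (q i)) = b (q i) (j - n (q i))" using e unfolding f_def qq .
    then have "i - n (q i) = j - n (q i)" by (rule inj_onD[OF bij_betw_imp_inj_on[OF b]]) (use q[of i] q[of j] qq nS in auto)
    then show "i = j" using q[of i] q[of j] qq by simp
  qed
  moreover have "range f = (\<Union>k. B k)"
  proof
    show "range f \<subseteq> (\<Union>k. B k)" using fB by blast
    show "(\<Union>k. B k) \<subseteq> range f" using im by blast
  qed
  ultimately have "bij_betw f UNIV (\<Union>k. B k)" by (simp add: bij_betw_def)
  then show ?thesis by (rule that[of f n, OF _ n(2,1) im])
qed

lemma sum_blocks: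
  fixes n :: "nat \<Rightarrow> nat" and g :: "nat \<Rightarrow> 'a::comm_monoid_add"
  assumes "strict_mono n" "n 0 = 0"
  shows "(\<Sum>i<n m. g i) = (\<Sum>k<m. \<Sum>i\<in>{n k..<n (Suc k)}. g i)"
proof (induction m)
  case (Suc m)
  have "(\<Sum>i<n (Suc m). g i) = (\<Sum>i\<in>{0..<n m}. g i) + (\<Sum>i\<in>{n m..<n (Suc m)}. g i)"
    using strict_monoD[OF assms(1), of m "Suc m"] by (subst sum.atLeastLessThan_concat) (auto simp: atLeast0LessThan)
  then show ?case using Suc by (simp add: atLeast0LessThan)
qed (simp add: assms)

text \<open>A Gram--Schmidt basis \<open>e\<close> of the whole system is compared with a blockwise Gram--Schmidt basis \<open>u\<close>:
  \<open>e i \<mapsto> u i\<close> is bounded in both directions exactly because the blocks satisfy the two-sided estimate.\<close>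

theorem Riesz_basis_with_parentheses_of_blocks:
  assumes inj: "inj f" and ind: "L2.independent (range f)" and n: "strict_mono n" "n 0 = 0"
    and total: "\<And>v. (\<And>i. cinner (f i) v = 0) \<Longrightarrow> v = 0"
    and lower: "\<And>J U. finite J \<Longrightarrow> (\<And>k. k \<in> J \<Longrightarrow> U k \<in> L2.span (f ` {n k..<n (Suc k)})) \<Longrightarrow> (\<Sum>k\<in>J. (norm (U k))\<^sup>2) \<le> K * (norm (\<Sum>k\<in>J. U k))\<^sup>2"
    and upper: "\<And>J U. finite J \<Longrightarrow> (\<And>k. k \<in> J \<Longrightarrow> U k \<in> L2.span (f ` {n k..<n (Suc k)})) \<Longrightarrow> (norm (\<Sum>k\<in>J. U k))\<^sup>2 \<le> K * (\<Sum>k\<in>J. (norm (U k))\<^sup>2)"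
    and K: "0 \<le> K"
  shows "Riesz_basis_with_parentheses f"
proof -
  define A where "A k = {n k..<n (Suc k)}" for k
  have finA: "finite (A k)" for k by (simp add: A_def)
  define e where "e = gram_schmidt f"
  have gs: "orthonormal_on {..<m} e \<and> L2.span (e ` {..<m}) = L2.span (f ` {..<m})" for m
    unfolding e_def by (rule gram_schmidt[OF inj_on_subset[OF inj subset_UNIV] L2.independent_mono[OF ind image_mono[OF subset_UNIV]] order_refl])
  have on: "orthonormal_on S e" for S unfolding orthonormal_on_def
  proof (intro ballI)
    fix i j
    show "cinner (e i) (e j) = (if i = j then 1 else 0)" using gs[of "Suc (max i j)"] unfolding orthonormal_on_def by auto
  qed
  have fspan: "f i \<in> L2.span (range e)" for i
  proof -
    have "f i \<in> L2.span (f ` {..<Suc i})" by (rule L2.span_base) simp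
    also have "\<dots> = L2.span (e ` {..<Suc i})" using gs by simp
    also have "\<dots> \<subseteq> L2.span (range e)" by (rule L2.span_mono) auto
    finally show ?thesis .
  qed
  have espan: "e i \<in> L2.span (range f)" for i
  proof -
    have "e i \<in> L2.span (e ` {..<Suc i})" by (rule L2.span_base) simp
    also have "\<dots> = L2.span (f ` {..<Suc i})" using gs by simp
    also have "\<dots> \<subseteq> L2.span (range f)" by (rule L2.span_mono) auto
    finally show ?thesis .
  qed
  have se: "L2.span (range e) = L2.span (range f)" using fspan espan by (intro L2.span_eq[THEN iffD2]) auto
  have dense_e: "closure (L2.span (range e)) = UNIV"
  proof (rule orthonormal_total_dense[OF on])
    fix v assume v: "\<And>i. cinner v (e i) = 0"
    show "v = 0"
    proof (rule total)
      fix i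
      obtain r m where "f i = lincomb r m e" by (rule span_range_lincomb[OF fspan])
      then show "cinner (f i) v = 0" using v by (simp add: lincomb_def cinner_sum_left cinner_scale_left cinner_commute[of "e j" v for j])
    qed
  qed
  have "\<forall>i. \<exists>k. n k \<le> i \<and> i < n (Suc k)" using block_exists[OF n] by metis
  then obtain q where q: "\<And>i. n (q i) \<le> i" "\<And>i. i < n (Suc (q i))" by metis
  \<comment> \<open>Gram-Schmidt restarted at the first index of the block that contains
    \<open>i\<close>; the result is orthonormal within each block only.\<close>
  define u where "u i = gram_schmidt (\<lambda>j. f (n (q i) + j)) (i - n (q i))" for i
  have uA: "orthonormal_on (A k) u \<and> L2.span (u ` A k) = L2.span (f ` A k)" for k
  proof -
    let ?g = "\<lambda>j. f (n k + j)" and ?N = "n (Suc k) - n k"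
    have nk: "n k < n (Suc k)" using strict_monoD[OF n(1)] by simp
    have sh: "A k = (+) (n k) ` {..<?N}" using nk unfolding A_def by (simp add: lessThan_atLeast0)
    have qk: "q i = k" if "i \<in> A k" for i using block_unique[OF n(1) q(1,2)[of i], of k] that by (simp add: A_def)
    have ue: "u (n k + j) = gram_schmidt ?g j" if "j < ?N" for j using qk[of "n k + j"] that unfolding u_def A_def by simp
    have g: "orthonormal_on {..<?N} (gram_schmidt ?g) \<and> L2.span (gram_schmidt ?g ` {..<?N}) = L2.span (?g ` {..<?N})"
    proof (rule gram_schmidt)
      show "inj_on ?g {..<?N}" using injD[OF inj] by (fastforce intro: inj_onI)
      show "L2.independent (?g ` {..<?N})" by (rule L2.independent_mono[OF ind]) auto
    qed simp
    have "u ` A k = gram_schmidt ?g ` {..<?N}" unfolding sh image_image by (rule image_cong) (use ue in auto)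
    moreover have "f ` A k = ?g ` {..<?N}" unfolding sh image_image ..
    moreover have "orthonormal_on (A k) u" using g ue unfolding sh orthonormal_on_def by auto
    ultimately show ?thesis using g by simp
  qed
  \<comment> \<open>Each block of \<open>u\<close> is orthonormal, so the squared norm of the
    combination of the \<open>e i\<close> is the sum of the squared block norms of the combination
    of the \<open>u i\<close>.\<close>
  have key: "(norm (lincomb r N u))\<^sup>2 \<le> K * (norm (lincomb r N e))\<^sup>2 \<and> (norm (lincomb r N e))\<^sup>2 \<le> K * (norm (lincomb r N u))\<^sup>2" for r N
  proof -
    \<comment> \<open>Extension by zero to the length \<open>n N\<close>, which is at least
      \<open>N\<close>, makes the sum split into whole blocks.\<close>
    define r' where "r' i = (if i < N then r i else 0)" for i
    have Nn: "N \<le> n N" by (rule strict_mono_imp_increasing[OF n(1)])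
    define U where "U k = (\<Sum>i\<in>A k. cscale (r' i) (u i))" for k
    have lc: "lincomb r N x = (\<Sum>k<N. \<Sum>i\<in>A k. cscale (r' i) (x i))" for x
      unfolding lincomb_extend[OF Nn] unfolding lincomb_def sum_blocks[OF n] A_def r'_def ..
    have Us: "U k \<in> L2.span (f ` {n k..<n (Suc k)})" for k
    proof -
      have "U k \<in> L2.span (u ` A k)" unfolding U_def by (intro L2.span_sum L2.span_scale L2.span_base) auto
      then show ?thesis using uA[of k] by (simp add: A_def)
    qed
    have Un: "(norm (U k))\<^sup>2 = (\<Sum>i\<in>A k. (norm (r' i))\<^sup>2)" for k unfolding U_def using uA[of k] by (intro orthonormal_sum(2) finA) simp
    have "(norm (lincomb r N e))\<^sup>2 = (\<Sum>i<n N. (norm (r' i))\<^sup>2)"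
      unfolding lincomb_extend[OF Nn] unfolding lincomb_def r'_def[symmetric] by (rule orthonormal_sum(2)[OF _ on]) simp
    also have "\<dots> = (\<Sum>k<N. (norm (U k))\<^sup>2)" unfolding sum_blocks[OF n] Un A_def ..
    finally have ne: "(norm (lincomb r N e))\<^sup>2 = (\<Sum>k<N. (norm (U k))\<^sup>2)" .
    have nu: "lincomb r N u = (\<Sum>k<N. U k)" unfolding lc U_def ..
    show ?thesis unfolding ne nu using upper[of "{..<N}" U] lower[of "{..<N}" U] Us by simp
  qed
  have sq: "x \<le> sqrt K * y" if "x\<^sup>2 \<le> K * y\<^sup>2" "0 \<le> y" for x y :: real using real_le_rsqrt[OF that(1)] that(2) by (simp add: real_sqrt_mult)
  have su: "L2.span (range u) = L2.span (range f)"
  proof (rule L2.span_eq[THEN iffD2], intro conjI subsetI)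
    fix v assume "v \<in> range u"
    then obtain i where i: "v = u i" by blast
    have "u i \<in> L2.span (u ` A (q i))" by (rule L2.span_base) (use q[of i] in \<open>auto simp: A_def\<close>)
    also have "\<dots> = L2.span (f ` A (q i))" using uA by simp
    also have "\<dots> \<subseteq> L2.span (range f)" by (rule L2.span_mono) auto
    finally show "v \<in> L2.span (range f)" unfolding i .
  next
    fix v assume "v \<in> range f"
    then obtain i where i: "v = f i" by blast
    have "f i \<in> L2.span (f ` A (q i))" by (rule L2.span_base) (use q[of i] in \<open>auto simp: A_def\<close>)
    also have "\<dots> = L2.span (u ` A (q i))" using uA by simp
    also have "\<dots> \<subseteq> L2.span (range u)" by (rule L2.span_mono) auto
    finally show "v \<in> L2.span (range u)" unfolding i .
  qed
  have dense_u: "closure (L2.span (range u)) = UNIV" using dense_e unfolding se su .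
  obtain T where T: "bounded_operator T" "\<And>i. T (e i) = u i" by (rule bounded_extension[OF dense_e, of u "sqrt K"]) (use key sq in auto)
  obtain S where S: "bounded_operator S" "\<And>i. S (u i) = e i" by (rule bounded_extension[OF dense_u, of e "sqrt K"]) (use key sq in auto)
  \<comment> \<open>Two continuous linear maps that agree on a sequence with dense span are equal;
    here one of them is the identity.\<close>
  have ident: "P (P' v) = v" if P: "bounded_operator P" and P': "bounded_operator P'" and PP: "\<And>i. P (P' (x i)) = x i"
    and dense: "closure (L2.span (range x)) = UNIV" for P P' x v
  proof -
    have lin: "Vector_Spaces.linear cscale cscale P" "Vector_Spaces.linear cscale cscale P'"
      and bl: "bounded_linear P" "bounded_linear P'" using P P' by (simp_all add: bounded_operator_def)
    have "L2.span (range x) \<subseteq> {v. P (P' v) = v}"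
    proof (rule L2.span_minimal)
      show "range x \<subseteq> {v. P (P' v) = v}" using PP by auto
      show "L2.subspace {v. P (P' v) = v}" using lin unfolding L2.subspace_def Vector_Spaces.linear_iff
        by (simp add: bounded_linear.linear[OF bl(1), THEN linear_0] bounded_linear.linear[OF bl(2), THEN linear_0])
    qed
    moreover have "closed {v. P (P' v) = v}"
      by (intro closed_Collect_eq continuous_intros bounded_linear.continuous_on[OF bl(1)] bounded_linear.continuous_on[OF bl(2)])
    ultimately have "closure (L2.span (range x)) \<subseteq> {v. P (P' v) = v}" by (rule closure_minimal)
    then show ?thesis using dense by blast
  qed
  have "Riesz_basis_of_subspaces (\<lambda>k. L2.span (f ` {n k..<n (Suc k)}))" unfolding Riesz_basis_of_subspaces_def
  proof (rule exI[of _ "\<lambda>k. L2.span (e ` A k)"], rule exI[of _ T], rule exI[of _ S], intro conjI allI impI ballI)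
    show "closed_subspace (L2.span (e ` A k))" for k by (rule closed_span_orthonormal[OF finA on])
    show "cinner v w = 0" if jk: "j \<noteq> k" and v: "v \<in> L2.span (e ` A j)" and w: "w \<in> L2.span (e ` A k)" for j k v w
    proof -
      have ij: "cinner (e i) (e i') = 0" if "i \<in> A j" "i' \<in> A k" for i i'
      proof -
        have "i \<noteq> i'" using that block_unique[OF n(1), of j i k] jk by (auto simp: A_def)
        then show ?thesis using on[of UNIV] by (simp add: orthonormal_on_def)
      qed
      obtain r where r: "v = (\<Sum>i\<in>A j. cscale (r i) (e i))" by (rule span_image_sum[OF finA v])
      obtain p where p: "w = (\<Sum>i\<in>A k. cscale (p i) (e i))" by (rule span_image_sum[OF finA w])
      have "cinner (e i) w = 0" if i: "i \<in> A j" for i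
      proof -
        have "cinner (e i') (e i) = 0" if "i' \<in> A k" for i' using ij[OF i that] cinner_commute[of "e i'" "e i"] by simp
        then have "cinner w (e i) = 0" unfolding p by (simp add: cinner_sum_left cinner_scale_left)
        then show ?thesis using cinner_commute[of "e i" w] by simp
      qed
      then show ?thesis unfolding r by (simp add: cinner_sum_left cinner_scale_left)
    qed
    have "L2.span (range e) \<subseteq> L2.span (\<Union>k. L2.span (e ` A k))"
    proof (rule L2.span_minimal)
      show "range e \<subseteq> L2.span (\<Union>k. L2.span (e ` A k))"
      proof clarify
        fix i
        have "e i \<in> L2.span (e ` A (q i))" by (rule L2.span_base) (use q[of i] in \<open>auto simp: A_def\<close>)
        then show "e i \<in> L2.span (\<Union>k. L2.span (e ` A k))" by (intro L2.span_base) blast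
      qed
    qed simp
    then show "closure (L2.span (\<Union>k. L2.span (e ` A k))) = UNIV" using dense_e closure_mono by blast
    show "S \<circ> T = id" using ident[OF S(1) T(1) _ dense_e] T(2) S(2) by (simp add: fun_eq_iff)
    show "T \<circ> S = id" using ident[OF T(1) S(1) _ dense_u] T(2) S(2) by (simp add: fun_eq_iff)
    show "L2.span (f ` {n k..<n (Suc k)}) = T ` L2.span (e ` A k)" for k
    proof -
      have "T ` L2.span (e ` A k) = L2.span (T ` e ` A k)"
        using T(1) Vector_Spaces.linear.axioms(3)[THEN module_hom.span_image, of cscale cscale T "e ` A k"] by (simp add: bounded_operator_def)
      also have "T ` e ` A k = u ` A k" unfolding image_image T(2) ..
      finally show ?thesis using uA[of k] by (simp add: A_def)
    qed
  qed (use T(1) S(1) in auto)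
  then show ?thesis unfolding Riesz_basis_with_parentheses_def using inj ind n by blast
qed

section \<open>Root vectors\<close>

context dirac_contours
begin

context
  fixes E :: "complex \<Rightarrow> L2 set" and R :: "L2 set"
  assumes E: "\<And>z. z \<in> eigenvalues L \<Longrightarrow> basis_of (root_subspace L z) (E z)" and R: "R = (\<Union>z\<in>eigenvalues L. E z)"
begin

lemma root_subspace_span: "z \<in> eigenvalues L \<Longrightarrow> L2.span (E z) = root_subspace L z"
  and E_independent: "z \<in> eigenvalues L \<Longrightarrow> L2.independent (E z)" using E by (auto simp: basis_of_def)

lemma root_subspace_subspace: "z \<in> eigenvalues L \<Longrightarrow> L2.subspace (root_subspace L z)" using root_subspace_span by (metis L2.subspace_span)

lemma eigenspaces_independent:
  assumes "finite F" "F \<subseteq> eigenvalues L" "\<And>z. z \<in> F \<Longrightarrow> u z \<in> root_subspace L z" "(\<Sum>z\<in>F. u z) = 0" "z \<in> F"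
  shows "u z = 0" using root_subspaces_independent[OF assms(1) _ assms(3-5)] assms(2) eigenvalue_\<Delta> by blast

definition eig :: "L2 \<Rightarrow> complex" where "eig r = (SOME z. z \<in> eigenvalues L \<and> r \<in> E z)"

lemma eig: "r \<in> R \<Longrightarrow> eig r \<in> eigenvalues L \<and> r \<in> E (eig r)" unfolding eig_def R by (rule someI_ex) blast

lemma root_sum:
  assumes T: "finite T" "T \<subseteq> R"
  shows "(\<Sum>r\<in>T. cscale (q r) r) = (\<Sum>z\<in>eig ` T. \<Sum>r\<in>{r\<in>T. eig r = z}. cscale (q r) r)"
    "z \<in> eig ` T \<Longrightarrow> (\<Sum>r\<in>{r\<in>T. eig r = z}. cscale (q r) r) \<in> root_subspace L z"
proof -
  show "(\<Sum>r\<in>T. cscale (q r) r) = (\<Sum>z\<in>eig ` T. \<Sum>r\<in>{r\<in>T. eig r = z}. cscale (q r) r)" by (rule sum.image_gen[OF T(1)])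
  assume "z \<in> eig ` T"
  then have z: "z \<in> eigenvalues L" using eig T(2) by blast
  show "(\<Sum>r\<in>{r\<in>T. eig r = z}. cscale (q r) r) \<in> root_subspace L z" unfolding root_subspace_span[OF z, symmetric]
    by (intro L2.span_sum L2.span_scale L2.span_base) (use eig T(2) in auto)
qed

lemma span_root_vectors:
  assumes T: "finite T" "T \<subseteq> R" and v: "v \<in> L2.span T"
  obtains u where "\<And>z. z \<in> eig ` T \<Longrightarrow> u z \<in> root_subspace L z" "v = (\<Sum>z\<in>eig ` T. u z)"
proof -
  obtain q where "v = (\<Sum>r\<in>T. cscale (q r) r)" using v unfolding L2.span_finite[OF T(1)] by blast
  then show ?thesis using root_sum[OF T, where q = q] by (intro that[of "\<lambda>z. \<Sum>r\<in>{r\<in>T. eig r = z}. cscale (q r) r"]) auto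
qed

text \<open>A vanishing combination is grouped by eigenvalues. The groups lie in different root
  subspaces and hence vanish separately, and within one root subspace \<open>E z\<close> is
  independent.\<close>

lemma root_vectors_independent: "L2.independent R" unfolding L2.dependent_explicit
proof clarify
  fix T q v assume T: "finite T" "T \<subseteq> R" and s: "(\<Sum>r\<in>T. cscale (q r) r) = 0" and v: "v \<in> T" "q v \<noteq> 0"
  have z: "eig v \<in> eigenvalues L" using eig v(1) T(2) by blast
  have "(\<Sum>r\<in>{r\<in>T. eig r = eig v}. cscale (q r) r) = 0"
  proof (rule eigenspaces_independent[where F = "eig ` T" and u = "\<lambda>z. \<Sum>r\<in>{r\<in>T. eig r = z}. cscale (q r) r"])
    show "eig ` T \<subseteq> eigenvalues L" using eig T(2) by blast
    show "(\<Sum>z\<in>eig ` T. \<Sum>r\<in>{r\<in>T. eig r = z}. cscale (q r) r) = 0" using s root_sum(1)[OF T, where q = q] by simp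
  qed (use T v(1) root_sum(2)[OF T, where q = q] in auto)
  moreover have "{r\<in>T. eig r = eig v} \<subseteq> E (eig v)"
  proof
    fix r assume "r \<in> {r\<in>T. eig r = eig v}"
    then show "r \<in> E (eig v)" using eig[of r] T(2) by auto
  qed
  moreover have "finite {r\<in>T. eig r = eig v}" using T(1) by simp
  ultimately have "q v = 0" using L2.independentD[OF E_independent[OF z], of "{r\<in>T. eig r = eig v}" q v] v(1) by blast
  then show False using v(2) by simp
qed

lemma root_vectors_total:
  assumes "\<And>r. r \<in> R \<Longrightarrow> cinner r v = 0"
  shows "v = 0"
proof (rule root_subspaces_complete)
  fix z u assume u: "u \<in> root_subspace L z"
  show "cinner u v = 0"
  proof (cases "u = 0")
    case False
    then have z: "z \<in> eigenvalues L" using root_subspace_nonzero_eigenvalue[OF u] by blast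
    have "u \<in> L2.span (E z)" using u root_subspace_span[OF z] by simp
    then show ?thesis
    proof (induction rule: L2.span_induct_alt)
      case (step c x y)
      then show ?case using assms[of x] z by (auto simp: R cinner_add_left cinner_scale_left)
    qed simp
  qed simp
qed

text \<open>If \<open>R\<close> were finite, totality would make its span the whole space. The
  continuous function \<open>(1 - x) *s axis 1 1\<close> would then be a finite sum of root
  functions and satisfy the boundary conditions. But its boundary forms are the entries of the first
  column of \<open>a\<close>, which cannot both vanish because J14 is not 0.\<close>

lemma infinite_root_vectors: "infinite R"
proof
  assume fin: "finite R"
  obtain e where e: "orthonormal_on {..<card R} e" "L2.span (e ` {..<card R}) = L2.span R"
    by (rule finite_orthonormal_basis[OF fin root_vectors_independent])
  define g where "g x = of_real (1 - x) *s (axis 1 1 :: complex^2)" for x :: real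
  have g: "continuous_on {0..1} g" unfolding g_def vector_scalar_mult_def by (intro continuous_intros)
  define v where "v = abs_L2 g"
  define p where "p = (\<Sum>i<card R. cscale (cinner v (e i)) (e i))"
  have "v - p = 0"
  proof (rule root_vectors_total)
    fix r assume "r \<in> R"
    then have "r \<in> L2.span (e ` {..<card R})" unfolding e(2) by (rule L2.span_base)
    then obtain q where q: "r = (\<Sum>i<card R. cscale (q i) (e i))" by (rule span_image_sum[OF finite_lessThan])
    have "cinner (e i) (v - p) = 0" if "i < card R" for i
    proof -
      have "cinner p (e i) = cinner v (e i)" unfolding p_def by (rule orthonormal_sum(1)[OF _ e(1)]) (use that in auto)
      then have "cinner (v - p) (e i) = 0" by (simp add: cinner_diff_left)
      then show ?thesis using cinner_commute[of "e i" "v - p"] by simp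
    qed
    then show "cinner r (v - p) = 0" unfolding q by (simp add: cinner_sum_left cinner_scale_left)
  qed
  then have vp: "v = (\<Sum>i<card R. cscale (cinner v (e i)) (e i))" by (simp add: p_def)
  have "v \<in> L2.span (e ` {..<card R})" by (subst vp) (intro L2.span_sum L2.span_scale L2.span_base imageI)
  then obtain u where u: "\<And>z. z \<in> eig ` R \<Longrightarrow> u z \<in> root_subspace L z" "v = (\<Sum>z\<in>eig ` R. u z)"
    unfolding e(2) by (rule span_root_vectors[OF fin order_refl]) blast
  have "\<Delta> z = 0" if "z \<in> eig ` R" for z using that eig eigenvalue_\<Delta> by blast
  then obtain y where y: "root_data (eig ` R) u y" by (rule root_data_exists[OF finite_imageI[OF fin] _ u(1)])
  \<comment> \<open>Equality of classes is upgraded to equality of continuous functions, since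
    boundary forms are evaluated at points.\<close>
  have "g x = (\<Sum>z\<in>eig ` R. y z x)" if "x \<in> {0..1}" for x
    using continuous_abs_L2_eqD[OF g root_data_sum(1)[OF y] _ that] root_data_sum(3)[OF y] u(2) by (simp add: v_def)
  then have "boundary_form a l g = boundary_form a l (\<lambda>x. \<Sum>z\<in>eig ` R. y z x)" for l by (rule sup_functional_cong[OF sup_functional_boundary g])
  moreover have "boundary_form a l (\<lambda>x. \<Sum>z\<in>eig ` R. y z x) = 0" if "l = 1 \<or> l = 2" for l unfolding root_data_functional[OF y sup_functional_boundary]
  proof (rule sum.neutral, rule ballI)
    fix z assume "z \<in> eig ` R"
    then obtain n w where "chain z n w" "y z = w 0" using y by (auto simp: root_data_def)
    then show "boundary_form a l (y z) = 0" using that by (cases "n = 0") (auto simp: chain_def homogeneous_bc_def boundary_form_def)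
  qed
  moreover have "boundary_form a l g = a $ l $ 1" for l by (simp add: boundary_form_def g_def axis_def)
  ultimately have "a $ 1 $ 1 = 0" "a $ 2 $ 1 = 0" by metis+
  then show False using regular by (simp add: regular_bc_def boundary_minor_def det_2)
qed

definition cell_index :: "L2 \<Rightarrow> int" where "cell_index r = (SOME k. eig r \<in> cell k)"

lemma cell_index: "r \<in> R \<Longrightarrow> eig r \<in> cell (cell_index r)" unfolding cell_index_def by (rule someI_ex) (use eig eigenvalue_\<Delta> cell_cover in metis)

text \<open>Gram-Schmidt turns a finite subset into an orthonormal system of the same size
  consisting of sums of root vectors of the cell, and \<open>cell_dimension_bound\<close> limits
  this size.\<close>

lemma finite_cell: "finite {r \<in> R. cell_index r = k}"
proof -
  obtain K where K: "\<And>k N F u. finite F \<Longrightarrow> F \<subseteq> cell k \<Longrightarrow> (\<And>z. z \<in> F \<Longrightarrow> \<Delta> z = 0) \<Longrightarrow> (\<And>i z. i < N \<Longrightarrow> z \<in> F \<Longrightarrow> u i z \<in> root_subspace L z) \<Longrightarrow>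
    (\<And>z. z \<in> F \<Longrightarrow> L2.subspace (root_subspace L z)) \<Longrightarrow>
    (\<And>i j. i < N \<Longrightarrow> j < N \<Longrightarrow> cinner (\<Sum>z\<in>F. u i z) (\<Sum>z\<in>F. u j z) = (if i = j then 1 else 0)) \<Longrightarrow> real N \<le> K" by (rule cell_dimension_bound) blast
  have "card T \<le> nat \<lceil>K\<rceil>" if T: "T \<subseteq> {r \<in> R. cell_index r = k}" "finite T" for T
  proof -
    have TR: "T \<subseteq> R" using T by blast
    obtain e where e: "orthonormal_on {..<card T} e" "L2.span (e ` {..<card T}) = L2.span T"
      by (rule finite_orthonormal_basis[OF T(2) L2.independent_mono[OF root_vectors_independent TR]])
    have "\<forall>i. \<exists>u. i < card T \<longrightarrow> (\<forall>z\<in>eig ` T. u z \<in> root_subspace L z) \<and> e i = (\<Sum>z\<in>eig ` T. u z)"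
    proof
      fix i
      show "\<exists>u. i < card T \<longrightarrow> (\<forall>z\<in>eig ` T. u z \<in> root_subspace L z) \<and> e i = (\<Sum>z\<in>eig ` T. u z)"
      proof (cases "i < card T")
        case True
        then have "e i \<in> L2.span T" unfolding e(2)[symmetric] by (intro L2.span_base) auto
        then obtain u where "\<And>z. z \<in> eig ` T \<Longrightarrow> u z \<in> root_subspace L z" "e i = (\<Sum>z\<in>eig ` T. u z)" by (rule span_root_vectors[OF T(2) TR]) blast
        then show ?thesis by blast
      qed simp
    qed
    then obtain u where u: "\<And>i z. i < card T \<Longrightarrow> z \<in> eig ` T \<Longrightarrow> u i z \<in> root_subspace L z"
      "\<And>i. i < card T \<Longrightarrow> e i = (\<Sum>z\<in>eig ` T. u i z)" unfolding choice_iff by blast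
    have "real (card T) \<le> K"
    proof (rule K[of "eig ` T" k _ u])
      show "eig ` T \<subseteq> cell k" using cell_index T(1) by auto
      show "\<Delta> z = 0" if "z \<in> eig ` T" for z using that eig eigenvalue_\<Delta> TR by blast
      show "cinner (\<Sum>z\<in>eig ` T. u i z) (\<Sum>z\<in>eig ` T. u j z) = (if i = j then 1 else 0)" if "i < card T" "j < card T" for i j
        using e(1) that unfolding u(2)[OF that(1), symmetric] u(2)[OF that(2), symmetric] by (simp add: orthonormal_on_def)
      show "L2.subspace (root_subspace L z)" if "z \<in> eig ` T" for z using that eig root_subspace_subspace TR by blast
    qed (use T(2) u(1) in auto)
    then show ?thesis by linarith
  qed
  then show ?thesis using finite_if_finite_subsets_card_bdd by blast
qed

text \<open>The blocks are the cells that contain root vectors, numbered by \<open>\<phi>\<close> in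
  an arbitrary order. There are infinitely many of them, because each is finite and \<open>R\<close>
  is infinite.\<close>

theorem root_vectors_Riesz_basis: "\<exists>f :: nat \<Rightarrow> L2. bij_betw f UNIV R \<and> Riesz_basis_with_parentheses f"
proof -
  have "infinite (cell_index ` R)"
  proof
    assume "finite (cell_index ` R)"
    then have "finite (\<Union>k\<in>cell_index ` R. {r \<in> R. cell_index r = k})" by (intro finite_UN_I finite_cell)
    moreover have "R \<subseteq> (\<Union>k\<in>cell_index ` R. {r \<in> R. cell_index r = k})" by blast
    ultimately show False using infinite_root_vectors finite_subset by blast
  qed
  then obtain \<phi> where \<phi>: "bij_betw \<phi> (UNIV :: nat set) (cell_index ` R)" using bij_betw_from_nat_into[of "cell_index ` R"] by blast
  define B where "B k = {r \<in> R. cell_index r = \<phi> k}" for k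
  have inj\<phi>: "\<phi> j = \<phi> k \<longleftrightarrow> j = k" for j k using bij_betw_imp_inj_on[OF \<phi>] by (auto simp: inj_def)
  have "\<phi> k \<in> cell_index ` R" for k using bij_betwE[OF \<phi>] by blast
  then have ne: "B k \<noteq> {}" for k unfolding B_def by (simp add: image_iff) metis
  have finB: "finite (B k)" for k unfolding B_def by (rule finite_cell)
  have BR: "B k \<subseteq> R" for k by (auto simp: B_def)
  have BU: "(\<Union>k. B k) = R" using bij_betw_imp_surj_on[OF \<phi>] by (fastforce simp: B_def)
  obtain f :: "nat \<Rightarrow> L2" and n where f: "bij_betw f UNIV (\<Union>k. B k)" and n: "n 0 = 0" "strict_mono n" "\<And>k. f ` {n k..<n (Suc k)} = B k"
  proof (rule enumerate_blocks[of B])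
    show "B j \<inter> B k = {}" if "j \<noteq> k" for j k using that by (auto simp: B_def inj\<phi>)
  qed (use finB ne in auto)
  have fR: "inj f" "range f = R" using f unfolding BU bij_betw_def by auto
  obtain K where K: "0 < K"
    "\<And>F u J. finite F \<Longrightarrow> finite J \<Longrightarrow> (\<And>z. z \<in> F \<Longrightarrow> \<Delta> z = 0) \<Longrightarrow> (\<And>z. z \<in> F \<Longrightarrow> u z \<in> root_subspace L z) \<Longrightarrow>
      (\<Sum>k\<in>J. (norm (\<Sum>z\<in>F \<inter> cell k. u z))\<^sup>2) \<le> K * (norm (\<Sum>z\<in>F. u z))\<^sup>2"
    "\<And>F u J. finite F \<Longrightarrow> finite J \<Longrightarrow> (\<And>z. z \<in> F \<Longrightarrow> \<Delta> z = 0) \<Longrightarrow> (\<And>z. z \<in> F \<Longrightarrow> u z \<in> root_subspace L z) \<Longrightarrow>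
      F \<subseteq> (\<Union>k\<in>J. cell k) \<Longrightarrow> (norm (\<Sum>z\<in>F. u z))\<^sup>2 \<le> K * (\<Sum>k\<in>J. (norm (\<Sum>z\<in>F \<inter> cell k. u z))\<^sup>2)" by (rule cell_inequalities) blast
  have both: "(\<Sum>k\<in>J. (norm (U k))\<^sup>2) \<le> K * (norm (\<Sum>k\<in>J. U k))\<^sup>2 \<and> (norm (\<Sum>k\<in>J. U k))\<^sup>2 \<le> K * (\<Sum>k\<in>J. (norm (U k))\<^sup>2)"
    if J: "finite J" and U: "\<And>k. k \<in> J \<Longrightarrow> U k \<in> L2.span (B k)" for J U
  proof -
    have "\<forall>k. \<exists>w. k \<in> J \<longrightarrow> (\<forall>z\<in>eig ` B k. w z \<in> root_subspace L z) \<and> U k = (\<Sum>z\<in>eig ` B k. w z)"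
    proof
      fix k
      show "\<exists>w. k \<in> J \<longrightarrow> (\<forall>z\<in>eig ` B k. w z \<in> root_subspace L z) \<and> U k = (\<Sum>z\<in>eig ` B k. w z)"
      proof (cases "k \<in> J")
        case True
        obtain w where "\<And>z. z \<in> eig ` B k \<Longrightarrow> w z \<in> root_subspace L z" "U k = (\<Sum>z\<in>eig ` B k. w z)"
          by (rule span_root_vectors[OF finB BR U[OF True]]) blast
        then show ?thesis by blast
      qed simp
    qed
    then obtain w where w: "\<And>k z. k \<in> J \<Longrightarrow> z \<in> eig ` B k \<Longrightarrow> w k z \<in> root_subspace L z"
      "\<And>k. k \<in> J \<Longrightarrow> U k = (\<Sum>z\<in>eig ` B k. w k z)" unfolding choice_iff by blast
    have cB: "z \<in> cell (\<phi> k)" if "z \<in> eig ` B k" for z k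
    proof -
      obtain r where r: "r \<in> R" "cell_index r = \<phi> k" "z = eig r" using \<open>z \<in> eig ` B k\<close> by (auto simp: B_def)
      then show ?thesis using cell_index[OF r(1)] by simp
    qed
    \<comment> \<open>Disjointness of the cells allows the families \<open>w k\<close>, one for each
      block, to be glued into a single function of the eigenvalue, as
      \<open>cell_inequalities\<close> expects.\<close>
    define u where "u z = w (THE k. z \<in> cell (\<phi> k)) z" for z
    have uw: "u z = w k z" if "z \<in> eig ` B k" for z k
    proof -
      have "(THE k. z \<in> cell (\<phi> k)) = k"
      proof (rule the_equality)
        show "z \<in> cell (\<phi> k)" by (rule cB[OF that])
        show "j = k" if "z \<in> cell (\<phi> j)" for j using cell_disjoint[OF that \<open>z \<in> cell (\<phi> k)\<close>] inj\<phi> by simp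
      qed
      then show ?thesis by (simp add: u_def)
    qed
    define F where "F = (\<Union>k\<in>J. eig ` B k)"
    have F: "finite F" "\<And>z. z \<in> F \<Longrightarrow> \<Delta> z = 0" "\<And>z. z \<in> F \<Longrightarrow> u z \<in> root_subspace L z" "F \<subseteq> (\<Union>k\<in>\<phi> ` J. cell k)"
    proof -
      show "finite F" unfolding F_def using J finB by auto
      show "\<Delta> z = 0" if "z \<in> F" for z using that eig BR eigenvalue_\<Delta> unfolding F_def by blast
      show "u z \<in> root_subspace L z" if z: "z \<in> F" for z
      proof -
        obtain k where "k \<in> J" "z \<in> eig ` B k" using z unfolding F_def by blast
        then show ?thesis using w(1) uw by simp
      qed
      show "F \<subseteq> (\<Union>k\<in>\<phi> ` J. cell k)" using cB unfolding F_def by blast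
    qed
    have Fk: "F \<inter> cell (\<phi> k) = eig ` B k" if k: "k \<in> J" for k
    proof
      show "eig ` B k \<subseteq> F \<inter> cell (\<phi> k)" using k cB unfolding F_def by blast
      show "F \<inter> cell (\<phi> k) \<subseteq> eig ` B k"
      proof
        fix z assume z: "z \<in> F \<inter> cell (\<phi> k)"
        then obtain j where j: "j \<in> J" "z \<in> eig ` B j" unfolding F_def by blast
        then have "j = k" using cell_disjoint[OF cB[OF j(2)], of "\<phi> k"] z inj\<phi> by blast
        then show "z \<in> eig ` B k" using j by blast
      qed
    qed
    have Uk: "(\<Sum>z\<in>F \<inter> cell (\<phi> k). u z) = U k" if k: "k \<in> J" for k unfolding Fk[OF k] w(2)[OF k] by (rule sum.cong) (use uw in auto)
    have "(\<Sum>z\<in>F. u z) = (\<Sum>k\<in>J. \<Sum>z\<in>eig ` B k. u z)" unfolding F_def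
    proof (rule sum.UNION_disjoint)
      show "\<forall>i\<in>J. \<forall>j\<in>J. i \<noteq> j \<longrightarrow> eig ` B i \<inter> eig ` B j = {}" using cB cell_disjoint inj\<phi> by (metis disjoint_iff)
    qed (use J finB in auto)
    also have "\<dots> = (\<Sum>k\<in>J. U k)" using Uk Fk by (intro sum.cong) auto
    finally have sU: "(\<Sum>z\<in>F. u z) = (\<Sum>k\<in>J. U k)" .
    have re: "(\<Sum>k\<in>\<phi> ` J. (norm (\<Sum>z\<in>F \<inter> cell k. u z))\<^sup>2) = (\<Sum>k\<in>J. (norm (U k))\<^sup>2)"
    proof -
      have "(\<Sum>k\<in>\<phi> ` J. (norm (\<Sum>z\<in>F \<inter> cell k. u z))\<^sup>2) = (\<Sum>k\<in>J. (norm (\<Sum>z\<in>F \<inter> cell (\<phi> k). u z))\<^sup>2)"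
        by (rule sum.reindex[unfolded o_def]) (auto simp: inj_on_def inj\<phi>)
      then show ?thesis using Uk by simp
    qed
    show ?thesis using K(2)[OF F(1) finite_imageI[OF J, of \<phi>] F(2,3)] K(3)[OF F(1) finite_imageI[OF J, of \<phi>] F(2,3,4)] unfolding re sU by blast
  qed
  have "Riesz_basis_with_parentheses f"
  proof (rule Riesz_basis_with_parentheses_of_blocks[OF fR(1) _ n(2,1), of K])
    show "L2.independent (range f)" unfolding fR(2) by (rule root_vectors_independent)
    show "v = 0" if "\<And>i. cinner (f i) v = 0" for v by (rule root_vectors_total) (use that fR(2) in auto)
    show "0 \<le> K" using K(1) by simp
  qed (use both n(3) in auto)
  then show ?thesis using f unfolding BU by blast
qed

end

end

theorem proposition6p9:
  fixes b1 b2 :: real and Q :: "real \<Rightarrow> complex^2^2" and a :: "complex^4^2" and R :: "L2 set"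
  assumes "b1 < 0" and "0 < b2"
    and "integrable (lebesgue_on {0..1}) Q"
    and "regular_bc a"
    and "root_vectors_system (dirac_op b1 b2 Q a) R"
  shows "\<exists>f :: nat \<Rightarrow> L2. bij_betw f UNIV R \<and> Riesz_basis_with_parentheses f"
proof -
  interpret dirac_problem b1 b2 Q a using assms by unfold_locales (simp_all add: integrable_unit_leb_iff)
  obtain c h \<delta> C s where "dirac_contours b1 b2 Q a c h \<delta> C s" using contours_exist by blast
  then interpret dirac_contours b1 b2 Q a c h \<delta> C s .
  obtain E where "\<And>z. z \<in> eigenvalues L \<Longrightarrow> basis_of (root_subspace L z) (E z)" "R = (\<Union>z\<in>eigenvalues L. E z)"
    using assms(5) unfolding root_vectors_system_def by blast
  then show ?thesis by (rule root_vectors_Riesz_basis)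
qed

end
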